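(* Let $N\geq 1$ be an integer and let \[S=\left\{\prod_{k=1}^{\lfloor N/2\rfloor} h_{(k/N,0)}^{e(k)} \;:\; e(k)\in\mathbf{Z}\text{ for all }k,\ \sum_k e(k)\in 12\mathbf{Z},\ \sum_k k^2e(k)\in \gcd(N,2)N\mathbf{Z}\right\}.\] Then $S$ is a free abelian group of rank $\lfloor N/2\rfloor$ and $\mathbf{Q}^*\times S=\mathcal{O}(Y^1(N))^*$.
   Context: $\mathbf{H}$ is the upper half plane, $q=\exp(2\pi i\tau)$, $\Lambda_\tau=\tau\mathbf{Z}+\mathbf{Z}$, and $\Gamma^1(N)=\{\left(\begin{smallmatrix}a&b\\c&d\end{smallmatrix}\right)\in\mathrm{SL}_2(\mathbf{Z}): b\equiv 0,\ a\equiv d\equiv 1 \bmod N\}$. $Y^1(N)$ is the modular curve over $\mathbf{Q}$ parametrising elliptic curves with a point of exact order $N$, with complex uniformisation $\Gamma^1(N)\backslash\mathbf{H}\to Y^1(N)(\mathbf{C})$, $\tau\mapsto(\mathbf{C}/\Lambda_\tau,\tau/N \bmod \Lambda_\tau)$. Via this uniformisation, $\mathcal{O}(Y^1(N))^*$ (the unit group of the ring of regular functions over $\mathbf{Q}$ on $Y^1(N)$) is the group of meromorphic functions on $\Gamma^1(N)\backslash(\mathbf{H}\cup\mathbf{P}^1(\mathbf{Q}))$ whose divisor is supported on the cusps $\mathbf{P}^1(\mathbf{Q})$ and whose $q$-expansion lies in $\mathbf{Q}((q^{1/N}))$. Siegel functions: for a lattice $\Lambda=\omega_1\mathbf{Z}+\omega_2\mathbf{Z}$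 with $\omega_1/\omega_2\in\mathbf{H}$, let $\sigma(z,\Lambda)=z\prod_{0\neq w\in\Lambda}(1-z/w)\exp(z/w+\tfrac12(z/w)^2)$ be the Weierstrass sigma function, $\zeta=\sigma'/\sigma$, and $\eta_1,\eta_2$ the quasi-periods defined by $\zeta(z+\omega_i,\Lambda)=\zeta(z,\Lambda)+\eta_i$. For $a=(a_1,a_2)\in\mathbf{Q}^2\setminus\mathbf{Z}^2$ the Klein form is $\mathfrak{t}_a(\omega_1,\omega_2)=\exp(-\tfrac12(a_1\eta_1+a_2\eta_2)(a_1\omega_1+a_2\omega_2))\,\sigma(a_1\omega_1+a_2\omega_2,\Lambda)$, and $\mathfrak{t}_a(\tau)=\omega_2^{-1}\mathfrak{t}_a(\omega_1,\omega_2)$ depends only on $\tau=\omega_1/\omega_2$. With $\eta(\tau)=q^{1/24}\prod_{n\geq1}(1-q^n)$ the Dedekind eta function, the Siegel function is $h_a=2\pi\eta^2\mathfrak{t}_a$. (For $0\le a_1\le\frac12$ one has $h_{(a_1,0)}=i\,q^{\frac12(a_1^2-a_1+\frac16)}(1-q^{a_1})\prod_{n\geq1}(1-q^{n+a_1})(1-q^{n-a_1})$.) *)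

theory Defs
  imports
    "HOL-Complex_Analysis.Complex_Analysis"
    "HOL-Algebra.Free_Abelian_Groups"
    "HOL-Number_Theory.Cong"
begin

abbreviation upper_half_plane :: "complex set" where
  "upper_half_plane \<equiv> {\<tau>. Im \<tau> > 0}"

section \<open>Siegel functions\<close>

definition period_lattice :: "complex \<Rightarrow> complex \<Rightarrow> complex set" where
  "period_lattice \<omega>\<^sub>1 \<omega>\<^sub>2 = {of_int m * \<omega>\<^sub>1 + of_int n * \<omega>\<^sub>2 | m n. True}"

text \<open>The product over the nonzero lattice points is the unordered one, i.e.\ the limit of
  the finite subproducts along the net of finite subsets.\<close>

definition weierstrass_sigma :: "complex set \<Rightarrow> complex \<Rightarrow> complex" where
  "weierstrass_sigma \<Lambda> z =
     z * Lim (finite_subsets_at_top (\<Lambda> - {0}))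
           (\<lambda>F. \<Prod>w\<in>F. (1 - z / w) * exp (z / w + (z / w)\<^sup>2 / 2))"

definition weierstrass_zeta :: "complex set \<Rightarrow> complex \<Rightarrow> complex" where
  "weierstrass_zeta \<Lambda> z = deriv (weierstrass_sigma \<Lambda>) z / weierstrass_sigma \<Lambda> z"

text \<open>The poles of zeta, which are exactly the lattice points, have to be excluded because
  of the convention \<open>x / 0 = 0\<close>.\<close>

definition quasi_period :: "complex set \<Rightarrow> complex \<Rightarrow> complex" where
  "quasi_period \<Lambda> \<omega> =
     (THE \<eta>. \<forall>z. z \<notin> \<Lambda> \<longrightarrow> weierstrass_zeta \<Lambda> (z + \<omega>) = weierstrass_zeta \<Lambda> z + \<eta>)"

definition klein_form :: "rat \<times> rat \<Rightarrow> complex \<Rightarrow> complex \<Rightarrow> complex" where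
  "klein_form a \<omega>\<^sub>1 \<omega>\<^sub>2 =
     (let \<Lambda> = period_lattice \<omega>\<^sub>1 \<omega>\<^sub>2;
          a\<^sub>1 = of_rat (fst a); a\<^sub>2 = of_rat (snd a);
          \<eta>\<^sub>1 = quasi_period \<Lambda> \<omega>\<^sub>1; \<eta>\<^sub>2 = quasi_period \<Lambda> \<omega>\<^sub>2
      in exp (- (a\<^sub>1 * \<eta>\<^sub>1 + a\<^sub>2 * \<eta>\<^sub>2) * (a\<^sub>1 * \<omega>\<^sub>1 + a\<^sub>2 * \<omega>\<^sub>2) / 2)
           * weierstrass_sigma \<Lambda> (a\<^sub>1 * \<omega>\<^sub>1 + a\<^sub>2 * \<omega>\<^sub>2))"

definition dedekind_eta :: "complex \<Rightarrow> complex" where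
  "dedekind_eta \<tau> =
     exp (2 * of_real pi * \<i> * \<tau> / 24) * prodinf (\<lambda>n. 1 - exp (2 * of_real pi * \<i> * \<tau>) ^ Suc n)"

text \<open>The Klein form, as a function of \<open>\<tau> = \<omega>\<^sub>1 / \<omega>\<^sub>2\<close>, is
  \<open>klein_form a \<omega>\<^sub>1 \<omega>\<^sub>2 / \<omega>\<^sub>2\<close>, which by homogeneity depends on \<open>\<tau>\<close> only;
  here it is evaluated at \<open>\<omega>\<^sub>1 = \<tau>\<close>, \<open>\<omega>\<^sub>2 = 1\<close>.\<close>

definition siegel_function :: "rat \<times> rat \<Rightarrow> complex \<Rightarrow> complex" where
  "siegel_function a \<tau> = 2 * of_real pi * (dedekind_eta \<tau>)\<^sup>2 * klein_form a \<tau> 1"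

section \<open>Modular units on the modular curve\<close>

definition SL2Z :: "(int ^ 2 ^ 2) set" where
  "SL2Z = {A. det A = 1}"

definition Gamma_up_1 :: "nat \<Rightarrow> (int ^ 2 ^ 2) set" where
  "Gamma_up_1 N = {A \<in> SL2Z. [A $ 1 $ 2 = 0] (mod int N) \<and>
                     [A $ 1 $ 1 = 1] (mod int N) \<and> [A $ 2 $ 2 = 1] (mod int N)}"

definition SL2_act :: "int ^ 2 ^ 2 \<Rightarrow> complex \<Rightarrow> complex" where
  "SL2_act A = moebius (of_int (A $ 1 $ 1)) (of_int (A $ 1 $ 2))
                       (of_int (A $ 2 $ 1)) (of_int (A $ 2 $ 2))"

text \<open>\<open>f\<close> is given, for \<open>Im \<tau>\<close> sufficiently large, by a convergent Laurent series with
  finite principal part in \<open>q\<close> to the power \<open>1 / N\<close>.\<close>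

definition has_q_expansion :: "nat \<Rightarrow> (complex \<Rightarrow> complex) \<Rightarrow> complex fls \<Rightarrow> bool" where
  "has_q_expansion N f F \<longleftrightarrow>
     fls_conv_radius F > 0 \<and>
     (\<forall>\<^sub>F \<tau> in filtercomap Im at_top. f \<tau> = eval_fls F (exp (2 * of_real pi * \<i> * \<tau> / of_nat N)))"

text \<open>A meromorphic function on the compactified quotient by \<open>Gamma_up_1 N\<close> is represented
  by its pull-back to the upper half plane. To have a unique representative, we take value 0
  at the poles (this is part of \<open>nicely_meromorphic_on\<close>) and \<open>undefined\<close> outside the
  upper half plane. Every cusp is \<open>\<gamma>\<infinity>\<close> for some \<open>\<gamma> \<in> SL2Z\<close>; as the principal congruence
  subgroup of level \<open>N\<close> is normal in \<open>SL2Z\<close> and contained in \<open>Gamma_up_1 N\<close>, the function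
  \<open>f \<circ> \<gamma>\<close> is invariant under \<open>\<tau> \<mapsto> \<tau> + N\<close>, so meromorphy at the cusp can be tested in the
  parameter \<open>exp (2\<pi>i\<tau>/N)\<close> even if the cusp is narrower.\<close>

definition modular_functions :: "nat \<Rightarrow> (complex \<Rightarrow> complex) set" where
  "modular_functions N =
     {f \<in> extensional upper_half_plane.
        f nicely_meromorphic_on upper_half_plane \<and>
        (\<forall>\<gamma>\<in>Gamma_up_1 N. \<forall>\<tau>\<in>upper_half_plane. f (SL2_act \<gamma> \<tau>) = f \<tau>) \<and>
        (\<forall>\<gamma>\<in>SL2Z. \<exists>F. has_q_expansion N (\<lambda>\<tau>. f (SL2_act \<gamma> \<tau>)) F)}"

text \<open>The group \<open>\<O>(Y\<^sup>1(N))\<^sup>*\<close>. The condition \<open>f \<tau> \<noteq> 0\<close> for some \<open>\<tau>\<close> excludes the zero function,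
  which has no divisor and for which \<open>zorder\<close> is meaningless.\<close>

definition modular_units :: "nat \<Rightarrow> (complex \<Rightarrow> complex) monoid" where
  "modular_units N =
     \<lparr>carrier = {f \<in> modular_functions N.
        (\<exists>\<tau>\<in>upper_half_plane. f \<tau> \<noteq> 0) \<and>
        (\<forall>\<tau>\<in>upper_half_plane. zorder f \<tau> = 0) \<and>
        (\<exists>F. has_q_expansion N f F \<and> (\<forall>n. fls_nth F n \<in> \<rat>))},
      monoid.mult = (\<lambda>f g. \<lambda>\<tau>\<in>upper_half_plane. f \<tau> * g \<tau>),
      one = (\<lambda>\<tau>\<in>upper_half_plane. 1)\<rparr>"

definition siegel_products :: "nat \<Rightarrow> (complex \<Rightarrow> complex) set" where
  "siegel_products N =
     {\<lambda>\<tau>\<in>upper_half_plane. \<Prod>k=1..N div 2. siegel_function (of_nat k / of_nat N, 0) \<tau> powi e k | e.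
        12 dvd (\<Sum>k=1..N div 2. e k) \<and>
        int (gcd N 2 * N) dvd (\<Sum>k=1..N div 2. int k ^ 2 * e k)}"

definition rat_units :: "rat monoid" where
  "rat_units = \<lparr>carrier = {c. c \<noteq> 0}, monoid.mult = (*), one = 1\<rparr>"

end

theory Submission
  imports Defs "HOL-Number_Theory.Residues"
begin

text \<open>The product formula for the sigma function turns Siegel functions into infinite products;
  \<open>SL\<^sub>2(\<int>)\<close> permutes them up to twelfth roots of unity, and their orders at the cusps are explicit.
  Let \<open>f\<close> be a modular unit. Lagrange interpolation over the \<open>SL\<^sub>2(\<int>)\<close>-translates of
  \<open>\<phi> = h\<^bsub>(1/N,0)\<^esub>\<^sup>2\<^sup>4\<^sup>N\<close> writes \<open>f\<close> as a quotient of polynomials in a Hauptmodul \<open>J\<close> and in \<open>\<phi>\<close>, with integral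
  coefficients because the expansion of \<open>f\<close> at \<open>\<infinity>\<close> is rational. So the expansions of \<open>f \<circ> \<gamma>\<close>, for
  \<open>\<gamma>\<close> with upper left entry \<open>\<plusminus>a\<close> modulo \<open>N\<close>, are Galois conjugate, and \<open>f\<close> has at most \<open>\<lfloor>N/2\<rfloor> + 1\<close>
  different orders at the cusps. Linear algebra then makes all orders of some product of \<open>f\<close> and the \<open>h\<^bsub>(k/N,0)\<^esub>\<close>,
  with exponents not all zero, equal, so that it is constant by the maximum principle. Hence a power \<open>f\<^sup>d\<close> is a
  product of Siegel functions. The normalised expansion of \<open>f\<close> is integral, since \<open>\<int>[[x]]\<close> is completely
  integrally closed, and comparing it with \<open>h\<^bsub>(k/N,0)\<^esub> \<sim> 1 - x\<^sup>k\<close> shows that \<open>d\<close> divides the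
  exponents, up to a factor 2 when \<open>2k = N\<close>. The congruences on the exponents, which also remove that factor,
  are the invariance under \<open>\<tau> \<mapsto> \<tau> + N\<close> and \<open>\<tau> \<mapsto> \<tau>/(\<tau> + 1)\<close>.\<close>

text \<open>All arithmetic information on the functions \<open>f \<circ> \<gamma>\<close> has to
  come from one rational expansion; the others are a priori arbitrary complex Laurent series.
  Interpolation bridges this gap because the translates of \<phi> have explicit expansions, with
  coefficients that are integer polynomials in an N-th root of unity w. The exponent 24N removes at
  once the twelfth roots of unity of the transformation law, the dependence on the characteristic
  beyond its class modulo N, and the constants that are not powers of w. Galois conjugation enters
  only in this form: an integer polynomial vanishing at w vanishes at \<open>w ^ s\<close> for s
  prime to N. At w = 1 the same quotient supplies the denominator that complete integral closure
  asks for. The linear algebra has one more unknown than equations: the exponents of f and of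
  \<lfloor>N/2\<rfloor> Siegel functions and the common order, against \<lfloor>N/2\<rfloor> + 1
  orders. The product formula for \<sigma> and the law under \<tau> \<mapsto> -1/\<tau> are two
  cases of one uniqueness statement: entire functions with simple zeros exactly at the lattice and
  odd, quasi-periodic logarithmic derivative agree up to a Gaussian factor.\<close>

lemma prodinf_uniform_limit:
  fixes f :: "nat \<Rightarrow> complex \<Rightarrow> complex"
  assumes "compact K" "\<And>n. continuous_on K (f n)"
    and "summable M" "\<And>n z. z \<in> K \<Longrightarrow> norm (f n z - 1) \<le> M n"
  shows "uniform_limit K (\<lambda>N z. \<Prod>n<N. f n z) (\<lambda>z. prodinf (\<lambda>n. f n z)) sequentially"
proof -
  have "uniformly_convergent_on K (\<lambda>N z. \<Prod>n<N. f n z)"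
    using assms by (intro uniformly_convergent_on_prod' Weierstrass_m_test'[of _ _ M]) auto
  then obtain g where g: "uniform_limit K (\<lambda>N z. \<Prod>n<N. f n z) g sequentially"
    by (auto simp: uniformly_convergent_on_def)
  have "g z = prodinf (\<lambda>n. f n z)" if "z \<in> K" for z
  proof -
    have "summable (\<lambda>n. norm (f n z - 1))"
      by (rule summable_comparison_test'[of M 0]) (use assms(3) assms(4)[OF that] in simp_all)
    hence "convergent_prod (\<lambda>n. f n z)"
      by (intro abs_convergent_prod_imp_convergent_prod) (simp add: abs_convergent_prod_conv_summable)
    hence "(\<lambda>n. \<Prod>i<n. f i z) \<longlonglongrightarrow> prodinf (\<lambda>n. f n z)"
      by (intro has_prod_imp_tendsto' convergent_prod_has_prod)
    moreover have "(\<lambda>n. \<Prod>i<n. f i z) \<longlonglongrightarrow> g z"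
      using tendsto_uniform_limitI[OF g that] .
    ultimately show ?thesis using LIMSEQ_unique by blast
  qed
  moreover have "uniform_limit K (\<lambda>N z. \<Prod>n<N. f n z) (\<lambda>z. prodinf (\<lambda>n. f n z)) sequentially \<longleftrightarrow> uniform_limit K (\<lambda>N z. \<Prod>n<N. f n z) g sequentially"
    by (rule uniform_limit_cong') (use calculation in auto)
  ultimately show ?thesis using g by blast
qed

lemma prodinf_holomorphic:
  fixes f :: "nat \<Rightarrow> complex \<Rightarrow> complex"
  assumes "open A" "\<And>n. f n holomorphic_on A"
    and "\<And>z. z \<in> A \<Longrightarrow> \<exists>d>0. cball z d \<subseteq> A \<and>
           (\<exists>M. summable M \<and> (\<forall>n. \<forall>w\<in>cball z d. norm (f n w - 1) \<le> M n))"
  shows "(\<lambda>z. prodinf (\<lambda>n. f n z)) holomorphic_on A"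
proof (rule holomorphic_uniform_sequence[of A "\<lambda>N z. \<Prod>n<N. f n z"])
  fix z assume "z \<in> A"
  from assms(3)[OF this] obtain d M where d: "d > 0" "cball z d \<subseteq> A" "summable M"
      and M: "\<forall>n. \<forall>w\<in>cball z d. norm (f n w - 1) \<le> M n"
    by (elim exE conjE)
  have "continuous_on (cball z d) (f n)" for n
    using assms(2)[of n] d(2) by (meson holomorphic_on_imp_continuous_on holomorphic_on_subset)
  hence "uniform_limit (cball z d) (\<lambda>N z. \<Prod>n<N. f n z) (\<lambda>z. prodinf (\<lambda>n. f n z)) sequentially"
    using d M by (intro prodinf_uniform_limit[where M = M]) simp_all
  thus "\<exists>d>0. cball z d \<subseteq> A \<and> uniform_limit (cball z d) (\<lambda>N z. \<Prod>n<N. f n z) (\<lambda>z. prodinf (\<lambda>n. f n z)) sequentially"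
    using d by metis
qed (use assms in \<open>auto intro!: holomorphic_intros\<close>)

lemma convergent_prodI_bound:
  fixes f :: "nat \<Rightarrow> complex"
  assumes "summable M" "\<And>n. norm (f n - 1) \<le> M n"
  shows "convergent_prod f"
proof (intro abs_convergent_prod_imp_convergent_prod)
  show "abs_convergent_prod f"
    unfolding abs_convergent_prod_conv_summable
    by (rule summable_comparison_test'[of M 0]) (use assms in simp_all)
qed

section \<open>The product $\prod_n (1 - x q^n)$\<close>

text \<open>The q-Pochhammer symbol (x; q) of infinite length.\<close>

definition qpoch :: "complex \<Rightarrow> complex \<Rightarrow> complex" where
  "qpoch x q = prodinf (\<lambda>n. 1 - x * q ^ n)"

lemma convergent_qpoch: "norm (q::complex) < 1 \<Longrightarrow> convergent_prod (\<lambda>n. 1 - x * q ^ n)"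
  by (rule convergent_prodI_bound[of "\<lambda>n. norm x * norm q ^ n"])
     (auto intro!: summable_mult summable_geometric simp: norm_mult norm_power)

lemma qpoch_rec: "norm q < 1 \<Longrightarrow> qpoch x q = (1 - x) * qpoch (x * q) q"
  unfolding qpoch_def
proof (cases "x = 1")
  case True
  assume "norm q < 1"
  hence "qpoch x q = 0" using True has_prod_eq_0_iff[OF convergent_prod_has_prod[OF convergent_qpoch], of q x]
    by (auto simp: qpoch_def image_iff intro!: exI[of _ 0])
  thus "prodinf (\<lambda>n. 1 - x * q ^ n) = (1 - x) * prodinf (\<lambda>n. 1 - x * q * q ^ n)"
    using True by (simp add: qpoch_def)
next
  case False
  assume "norm q < 1"
  from prodinf_split_head[OF convergent_qpoch[OF this], of x] False
  show "prodinf (\<lambda>n. 1 - x * q ^ n) = (1 - x) * prodinf (\<lambda>n. 1 - x * q * q ^ n)"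
    by (simp add: field_simps)
qed

lemma qpoch_eq_0_iff: "norm q < 1 \<Longrightarrow> qpoch x q = 0 \<longleftrightarrow> (\<exists>n. x * q ^ n = 1)"
  unfolding qpoch_def
  using has_prod_eq_0_iff[OF convergent_prod_has_prod[OF convergent_qpoch], of q x] by auto

lemma qpoch_holomorphic: "norm q < 1 \<Longrightarrow> (\<lambda>x. qpoch x q) holomorphic_on UNIV"
  unfolding qpoch_def
proof (rule prodinf_holomorphic)
  fix z :: complex assume q: "norm q < 1"
  have "norm (w * q ^ n) \<le> (norm z + 1) * norm q ^ n" if "w \<in> cball z 1" for w n
    unfolding norm_mult norm_power using norm_triangle_sub[of w z] that
    by (intro mult_right_mono) (auto simp: dist_norm norm_minus_commute)
  thus "\<exists>d>0. cball z d \<subseteq> UNIV \<and> (\<exists>M. summable M \<and> (\<forall>n. \<forall>w\<in>cball z d. norm ((1 - w * q ^ n) - 1) \<le> M n))"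
    using q by (intro exI[of _ 1] exI[of _ "\<lambda>n. (norm z + 1) * norm q ^ n"] conjI)
      (simp_all add: summable_mult summable_geometric)
qed (auto intro!: holomorphic_intros)

lemma qpoch_square:
  assumes "norm q < 1"
  shows "qpoch x (q^2) * qpoch (x * q) (q^2) = qpoch x q"
proof -
  have q2: "norm (q^2) < 1" using assms by (simp add: norm_power power_less_one_iff)
  have 1: "(\<lambda>n. \<Prod>i<n. (1 - x * (q^2)^i) * (1 - x * q * (q^2)^i)) \<longlonglongrightarrow> qpoch x (q^2) * qpoch (x * q) (q^2)"
    unfolding qpoch_def prod.distrib
    using has_prod_imp_tendsto'[OF convergent_prod_has_prod[OF convergent_qpoch[OF q2]]]
    by (intro tendsto_mult) auto
  have 2: "(\<Prod>i<n. (1 - x * (q^2)^i) * (1 - x * q * (q^2)^i)) = (\<Prod>i<2*n. 1 - x * q ^ i)" for n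
    by (induction n) (auto simp: power_mult[symmetric] mult_ac)
  have "(\<lambda>n. \<Prod>i<n. 1 - x * q ^ i) \<longlonglongrightarrow> qpoch x q"
    unfolding qpoch_def by (rule has_prod_imp_tendsto'[OF convergent_prod_has_prod[OF convergent_qpoch[OF assms]]])
  from LIMSEQ_subseq_LIMSEQ[OF this, of "\<lambda>n. 2 * n"]
  have "(\<lambda>n. \<Prod>i<2*n. 1 - x * q ^ i) \<longlonglongrightarrow> qpoch x q" by (simp add: strict_mono_def o_def)
  with 1 2 show ?thesis using LIMSEQ_unique by simp
qed

lemma qpoch_uminus:
  assumes "norm q < 1"
  shows "qpoch x q * qpoch (- x) q = qpoch (x^2) (q^2)"
proof -
  have q2: "norm (q^2) < 1" using assms by (simp add: norm_power power_less_one_iff)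
  have "qpoch x q * qpoch (- x) q = prodinf (\<lambda>n. (1 - x * q ^ n) * (1 - (- x) * q ^ n))"
    unfolding qpoch_def by (rule prodinf_mult[OF convergent_qpoch convergent_qpoch]) (use assms in auto)
  also have "\<dots> = qpoch (x^2) (q^2)" unfolding qpoch_def
    by (rule prodinf_cong) (auto simp: algebra_simps power2_eq_square power_mult_distrib)
  finally show ?thesis .
qed

text \<open>Euler's identity between partitions into odd and into distinct parts. Splitting
  \<open>qpoch q q\<close> into even and odd factors, and multiplying it by
  \<open>qpoch (- q) q\<close>, both lead to \<open>qpoch (q^2) (q^2)\<close>, which is nonzero and
  cancels.\<close>

lemma qpoch_euler: assumes "norm q < 1" "q \<noteq> 0" shows "qpoch q (q^2) * qpoch (- q) q = 1"
proof -
  have q2: "norm (q^2) < 1" using assms by (simp add: norm_power power_less_one_iff)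
  have "qpoch (q^2) (q^2) \<noteq> 0"
  proof
    assume "qpoch (q^2) (q^2) = 0"
    then obtain n where "q^2 * (q^2)^n = 1" using qpoch_eq_0_iff[OF q2] by auto
    hence "norm (q^2) ^ Suc n = 1" by (metis norm_one norm_power power_Suc)
    thus False using power_Suc_less_one[of "norm (q^2)" n] q2 assms(2) by simp
  qed
  moreover have "qpoch q (q^2) * qpoch (q^2) (q^2) = qpoch q q"
    using qpoch_square[OF assms(1), of q] by (simp add: power2_eq_square)
  moreover have "qpoch q q * qpoch (- q) q = qpoch (q^2) (q^2)"
    by (rule qpoch_uminus[OF assms(1)])
  ultimately show ?thesis by (metis (no_types, lifting) mult.assoc mult.commute mult_cancel_right1)
qed

section \<open>Lattice sums and products\<close>

text \<open>The exponent is half of 3: the product of two such sums will dominate the sum of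
  \<open>1 / norm w ^ 3\<close> over a lattice of rank 2. The \<open>max 1\<close> regularises the
  term at 0.\<close>

lemma summable_on_int_powr: "(\<lambda>m::int. max 1 \<bar>of_int m\<bar> powr (-3/2) :: real) summable_on UNIV"
proof -
  have s: "(\<lambda>n::nat. max 1 (real n) powr (-3/2)) summable_on UNIV"
  proof (subst summable_on_UNIV_nonneg_real_iff)
    have "summable (\<lambda>n. real n powr (-3/2))" by (simp add: summable_real_powr_iff)
    moreover have "\<forall>\<^sub>F n in sequentially. max 1 (real n) powr (-3/2) = real n powr (-3/2)"
      using eventually_ge_at_top[of 1] by eventually_elim (simp add: max_def)
    ultimately show "summable (\<lambda>n. max 1 (real n) powr (-3/2))"
      using summable_cong by fastforce
  qed auto
  have 1: "(\<lambda>m::int. max 1 \<bar>of_int m\<bar> powr (-3/2) :: real) summable_on range int"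
    using s by (subst summable_on_reindex) (auto simp: o_def)
  have 2: "(\<lambda>m::int. max 1 \<bar>of_int m\<bar> powr (-3/2) :: real) summable_on range (\<lambda>n. - int n)"
    using s by (subst summable_on_reindex) (auto simp: o_def inj_def)
  have "m \<in> range int \<union> range (\<lambda>n. - int n)" for m
    by (cases m rule: int_cases2) (simp_all add: image_iff)
  hence "UNIV = range int \<union> range (\<lambda>n. - int n)" by blast
  thus ?thesis using summable_on_union[OF 1 2] by simp
qed

text \<open>The bound involves only the tail after \<open>n\<close> and not \<open>I\<close>, so it
  turns convergence of the ordered partial products into convergence along all finite sets. Both
  factors come from 1 + x \<le> exp x.\<close>

lemma prod_norm_diff_le:
  fixes g :: "nat \<Rightarrow> complex"
  assumes "finite I" "{..<n} \<subseteq> I" "summable (\<lambda>n. norm (g n - 1))"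
  shows "norm (prod g I - prod g {..<n}) \<le>
           exp (suminf (\<lambda>k. norm (g k - 1))) * (exp (suminf (\<lambda>k. norm (g (k + n) - 1))) - 1)"
proof -
  have *: "prod (\<lambda>k. 1 + norm (g k - 1)) A \<le> exp (\<Sum>k\<in>A. norm (g k - 1))" if "finite A" for A
    using that by (simp add: exp_sum) (intro prod_mono, auto simp: exp_ge_add_one_self)
  have "prod g I = prod g {..<n} * prod g (I - {..<n})"
    using assms by (metis prod.subset_diff mult.commute)
  hence "prod g I - prod g {..<n} = prod g {..<n} * (prod g (I - {..<n}) - 1)" by (simp add: algebra_simps)
  also have "norm \<dots> = norm (prod g {..<n}) * norm (prod g (I - {..<n}) - 1)" by (rule norm_mult)
  also have "\<dots> \<le> exp (suminf (\<lambda>k. norm (g k - 1))) * (exp (suminf (\<lambda>k. norm (g (k + n) - 1))) - 1)"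
  proof (intro mult_mono)
    have "norm (prod g {..<n}) = prod (\<lambda>k. norm (1 + (g k - 1))) {..<n}" by (simp add: prod_norm)
    also have "\<dots> \<le> prod (\<lambda>k. 1 + norm (g k - 1)) {..<n}"
      by (intro prod_mono conjI norm_ge_zero) (metis norm_one norm_triangle_ineq)
    also have "\<dots> \<le> exp (\<Sum>k<n. norm (g k - 1))" by (rule *) auto
    also have "\<dots> \<le> exp (suminf (\<lambda>k. norm (g k - 1)))" using assms by (simp add: sum_le_suminf)
    finally show "norm (prod g {..<n}) \<le> exp (suminf (\<lambda>k. norm (g k - 1)))" .
    have "norm (prod g (I - {..<n}) - 1) = norm (prod (\<lambda>k. 1 + (g k - 1)) (I - {..<n}) - 1)" by simp
    also have "\<dots> \<le> prod (\<lambda>k. 1 + norm (g k - 1)) (I - {..<n}) - 1"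
      by (rule norm_prod_minus1_le_prod_minus1)
    also have "\<dots> \<le> exp (\<Sum>k\<in>I - {..<n}. norm (g k - 1)) - 1" using *[of "I - {..<n}"] assms by simp
    also have "(\<Sum>k\<in>I - {..<n}. norm (g k - 1)) = (\<Sum>k\<in>(\<lambda>k. k - n) ` (I - {..<n}). norm (g (k + n) - 1))"
      by (rule sum.reindex_cong[of "\<lambda>k. k + n"]) (auto simp: image_iff inj_on_def)
    also have "\<dots> \<le> (suminf (\<lambda>k. norm (g (k + n) - 1)))"
      using assms by (intro sum_le_suminf) (auto simp: summable_iff_shift[of "\<lambda>k. norm (g k - 1)"])
    finally show "norm (prod g (I - {..<n}) - 1) \<le> exp (suminf (\<lambda>k. norm (g (k + n) - 1))) - 1" by simp
  qed auto
  finally show ?thesis .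
qed

lemma tendsto_prod_finite_subsets:
  fixes g :: "nat \<Rightarrow> complex"
  assumes "summable (\<lambda>n. norm (g n - 1))"
  shows "(prod g \<longlongrightarrow> prodinf g) (finite_subsets_at_top UNIV)"
proof -
  have "convergent_prod g"
    by (rule convergent_prodI_bound[OF assms]) simp
  hence lim: "(\<lambda>n. prod g {..<n}) \<longlonglongrightarrow> prodinf g"
    by (intro has_prod_imp_tendsto' convergent_prod_has_prod)
  define C where "C = exp (suminf (\<lambda>k. norm (g k - 1)))"
  have "(\<lambda>n. suminf (\<lambda>k. norm (g (k + n) - 1))) \<longlonglongrightarrow> 0"
    using suminf_exist_split2[OF assms] .
  hence "(\<lambda>n. C * (exp (suminf (\<lambda>k. norm (g (k + n) - 1))) - 1)) \<longlonglongrightarrow> C * (exp 0 - 1)"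
    by (intro tendsto_intros)
  hence lim2: "(\<lambda>n. C * (exp (suminf (\<lambda>k. norm (g (k + n) - 1))) - 1)) \<longlonglongrightarrow> 0" by simp
  show ?thesis
  proof (rule tendstoI)
    fix e :: real assume "e > 0"
    hence "\<forall>\<^sub>F n in sequentially. dist (prod g {..<n}) (prodinf g) < e / 2"
      "\<forall>\<^sub>F n in sequentially. C * (exp (suminf (\<lambda>k. norm (g (k + n) - 1))) - 1) < e / 2"
      using tendstoD[OF lim, of "e/2"] order_tendstoD(2)[OF lim2, of "e/2"] by auto
    hence "\<forall>\<^sub>F n in sequentially. dist (prod g {..<n}) (prodinf g) < e / 2 \<and>
        C * (exp (suminf (\<lambda>k. norm (g (k + n) - 1))) - 1) < e / 2" by (rule eventually_conj)
    then obtain n where n: "dist (prod g {..<n}) (prodinf g) < e / 2"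
      "C * (exp (suminf (\<lambda>k. norm (g (k + n) - 1))) - 1) < e / 2"
      using eventually_happens[of _ sequentially] by fastforce
    have dist_less: "dist (prod g I) (prodinf g) < e" if "finite I" "{..<n} \<subseteq> I" for I
    proof -
      have "dist (prod g I) (prod g {..<n}) < e / 2"
        using prod_norm_diff_le[OF that assms] n(2) unfolding C_def dist_norm by linarith
      with n(1) show ?thesis using dist_triangle[of "prod g I" "prodinf g" "prod g {..<n}"] by linarith
    qed
    thus "\<forall>\<^sub>F F in finite_subsets_at_top UNIV. dist (prod g F) (prodinf g) < e"
      unfolding eventually_finite_subsets_at_top by (intro exI[of _ "{..<n}"] conjI allI impI dist_less) auto
  qed
qed

section \<open>The lattice spanned by \<tau> and 1\<close>

locale upper_lattice =
  fixes \<tau> :: complex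
  assumes Im_tau: "Im \<tau> > 0"
begin

abbreviation "L \<equiv> period_lattice \<tau> 1"

lemma lattice_iff: "z \<in> L \<longleftrightarrow> (\<exists>m n. z = of_int m * \<tau> + of_int n)"
  by (auto simp: period_lattice_def)

lemma lattice_0 [simp]: "0 \<in> L" by (auto simp: lattice_iff intro!: exI[of _ 0])
lemma lattice_tau [simp]: "\<tau> \<in> L"
  unfolding lattice_iff by (intro exI[of _ 1] exI[of _ 0]) simp
lemma lattice_1 [simp]: "1 \<in> L"
  unfolding lattice_iff by (intro exI[of _ 0] exI[of _ 1]) simp

lemma lattice_add: "z \<in> L \<Longrightarrow> w \<in> L \<Longrightarrow> z + w \<in> L"
  unfolding lattice_iff
proof (elim exE)
  fix m n m' n' assume "z = of_int m * \<tau> + of_int n" "w = of_int m' * \<tau> + of_int n'"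
  thus "\<exists>m n. z + w = of_int m * \<tau> + of_int n"
    by (intro exI[of _ "m + m'"] exI[of _ "n + n'"]) (simp add: algebra_simps)
qed

lemma lattice_uminus: "z \<in> L \<Longrightarrow> - z \<in> L"
  unfolding lattice_iff
proof (elim exE)
  fix m n assume "z = of_int m * \<tau> + of_int n"
  thus "\<exists>m n. - z = of_int m * \<tau> + of_int n"
    by (intro exI[of _ "- m"] exI[of _ "- n"]) (simp add: algebra_simps)
qed

lemma lattice_uminus_iff [simp]: "- z \<in> L \<longleftrightarrow> z \<in> L"
  using lattice_uminus[of z] lattice_uminus[of "- z"] by auto

lemma lattice_add_iff: "w \<in> L \<Longrightarrow> z + w \<in> L \<longleftrightarrow> z \<in> L"
  using lattice_add[of z w] lattice_add[of "z + w" "- w"] by (auto simp: algebra_simps)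

lemma lattice_inj: "inj (\<lambda>(m, n). of_int m * \<tau> + of_int n :: complex)"
proof (rule injI, clarify)
  fix m n m' n' :: int assume eq: "of_int m * \<tau> + of_int n = of_int m' * \<tau> + of_int n'"
  from arg_cong[OF eq, of Im] have "m = m'" using Im_tau by simp
  with eq show "m = m' \<and> n = n'" by simp
qed

lemma lattice_eq: "L = range (\<lambda>(m, n). of_int m * \<tau> + of_int n)"
  by (force simp: lattice_iff)

lemma countable_lattice: "countable L" unfolding lattice_eq by simp

lemma lattice_norm_bound:
  obtains K where "K > 0" "\<And>m n. \<bar>of_int m\<bar> + \<bar>of_int n\<bar> \<le> K * norm (of_int m * \<tau> + of_int n)"
proof -
  define y where "y = Im \<tau>"
  have y: "y > 0" using Im_tau by (simp add: y_def)
  have "\<bar>of_int m\<bar> + \<bar>of_int n\<bar> \<le> (1 / y + norm \<tau> / y + 1) * norm (of_int m * \<tau> + of_int n)" for m n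
  proof -
    define w where "w = of_int m * \<tau> + of_int n"
    have 1: "\<bar>of_int m\<bar> * y \<le> norm w" using abs_Im_le_cmod[of w] y by (simp add: w_def y_def abs_mult)
    hence m: "\<bar>of_int m\<bar> \<le> norm w / y" using y by (simp add: field_simps)
    have "\<bar>of_int n\<bar> = norm (w - of_int m * \<tau>)" by (simp add: w_def)
    also have "\<dots> \<le> norm w + \<bar>of_int m\<bar> * norm \<tau>" using norm_triangle_ineq4[of w "of_int m * \<tau>"] by (simp add: norm_mult)
    also have "\<dots> \<le> norm w + norm w / y * norm \<tau>" using m by (intro add_left_mono mult_right_mono) auto
    finally show ?thesis using m by (simp add: w_def algebra_simps)
  qed
  moreover have "1 / y + norm \<tau> / y + 1 > 0" using y by (intro add_nonneg_pos add_nonneg_nonneg) auto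
  ultimately show ?thesis using that by blast
qed

lemma summable_on_lattice: "(\<lambda>w. 1 / norm w ^ 3) summable_on (L - {0})"
proof -
  define M where "M = (\<lambda>m::int. max 1 \<bar>of_int m\<bar> :: real)"
  obtain K where K: "K > 0" "\<And>m n. \<bar>of_int m\<bar> + \<bar>of_int n\<bar> \<le> K * norm (of_int m * \<tau> + of_int n)"
    using lattice_norm_bound by blast
  define h where "h = (\<lambda>(m, n). of_int m * \<tau> + of_int n :: complex)"
  have nn: "M m powr (-3/2) \<ge> 0" for m by simp
  define c where "c = (\<lambda>(m, n). M m powr (-3/2) * M n powr (-3/2))"
  have "(\<lambda>p. norm (c p)) summable_on UNIV \<times> UNIV"
    unfolding Infinite_Sum.abs_summable_on_Sigma_iff using summable_on_int_powr
    by (auto simp: c_def M_def abs_mult infsum_cmult_right' intro!: summable_on_cmult_right summable_on_cmult_left)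
  hence "(\<lambda>p. norm (K ^ 3 * c p)) summable_on UNIV"
    by (simp add: abs_mult summable_on_cmult_right)
  hence "(\<lambda>p. norm (K ^ 3 * c p)) summable_on (UNIV - {(0,0)})"
    by (rule summable_on_subset) auto
  hence "(\<lambda>p. norm (1 / norm (h p) ^ 3)) summable_on (UNIV - {(0,0)})"
  proof (rule Infinite_Sum.abs_summable_on_comparison_test)
    fix p :: "int \<times> int" assume p: "p \<in> UNIV - {(0, 0)}"
    obtain m n where mn': "p = (m, n)" by (cases p)
    with p have mn: "(m, n) \<noteq> (0, 0)" by simp
    define s :: real where "s = \<bar>of_int m\<bar> + \<bar>of_int n\<bar>"
    define r where "r = norm (of_int m * \<tau> + of_int n)"
    have "\<bar>m\<bar> \<ge> 1 \<or> \<bar>n\<bar> \<ge> 1" using mn by auto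
    hence "s \<ge> 1" unfolding s_def by linarith
    hence s: "s \<ge> M m" "s \<ge> M n" by (auto simp: s_def M_def)
    have "M m * M n \<ge> 1" unfolding M_def using mult_mono[of 1 "max 1 \<bar>of_int m\<bar>" 1 "max 1 \<bar>of_int n\<bar> :: real"] by simp
    have "s \<le> K * r" using K(2) by (simp add: s_def r_def)
    with \<open>s \<ge> 1\<close> have "K * r > 0" by linarith
    hence r: "r > 0" using K(1) by (simp add: zero_less_mult_iff)
    \<comment> \<open>Both \<open>M m\<close> and \<open>M n\<close> are at most the 1-norm
      \<open>s\<close>, so this power is at most the cube of \<open>s\<close>, which
      \<open>K\<close> compares with the cube of the norm.\<close>
    have "(M m * M n) powr (3/2) \<le> (s * s) powr (3/2)"
      using s \<open>s \<ge> 1\<close> by (intro powr_mono2 mult_mono) (auto simp: M_def)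
    also have "\<dots> = s ^ 3"
      using \<open>s \<ge> 1\<close> powr_realpow[of s 3] by (simp add: powr_mult flip: powr_add)
    also have "\<dots> \<le> (K * r) ^ 3" using \<open>s \<le> K * r\<close> \<open>s \<ge> 1\<close> by (intro power_mono) auto
    finally have *: "(M m * M n) powr (3/2) \<le> K ^ 3 * r ^ 3" by (simp add: power_mult_distrib)
    have "1 / r ^ 3 \<le> K ^ 3 * (1 / (M m * M n) powr (3/2))"
    proof -
      have "0 < (M m * M n) powr (3/2)" using \<open>M m * M n \<ge> 1\<close> unfolding powr_gt_zero by linarith
      thus ?thesis using * r by (simp add: divide_simps mult_ac)
    qed
    also have "1 / (M m * M n) powr (3/2) = M m powr (-3/2) * M n powr (-3/2)"
      by (simp add: powr_mult powr_minus field_simps M_def)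
    finally show "norm (1 / norm (h p) ^ 3) \<le> norm (K ^ 3 * c p)"
      using K(1) r mn' by (simp add: h_def r_def abs_mult c_def)
  qed
  hence "((\<lambda>w. 1 / norm w ^ 3) \<circ> h) summable_on (UNIV - {(0,0)})" by (simp add: o_def)
  moreover have "h ` (UNIV - {(0,0)}) = L - {0}"
  proof -
    have "h ` (UNIV - {(0,0)}) = h ` UNIV - h ` {(0,0)}"
      by (rule image_set_diff) (use lattice_inj h_def in simp)
    thus ?thesis by (simp add: lattice_eq h_def)
  qed
  moreover have "inj_on h (UNIV - {(0,0)})" using lattice_inj h_def inj_on_subset by blast
  ultimately show ?thesis using summable_on_reindex[of h "UNIV - {(0,0)}"] by metis
qed

end

section \<open>The Weierstrass sigma function\<close>

context upper_lattice
begin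

lemma lattice_discrete: obtains e where "e > 0" "\<And>w. w \<in> L \<Longrightarrow> w \<noteq> 0 \<Longrightarrow> norm w \<ge> e"
proof -
  obtain K where K: "K > 0" "\<And>m n. \<bar>of_int m\<bar> + \<bar>of_int n\<bar> \<le> K * norm (of_int m * \<tau> + of_int n)"
    using lattice_norm_bound by blast
  have "norm w \<ge> 1 / K" if w: "w \<in> L" "w \<noteq> 0" for w
  proof -
    from w obtain m n where mn: "w = of_int m * \<tau> + of_int n" by (auto simp: lattice_iff)
    have "\<not> (m = 0 \<and> n = 0)" using mn w by auto
    hence "\<bar>m\<bar> + \<bar>n\<bar> \<ge> 1" by linarith
    hence "real_of_int (\<bar>m\<bar> + \<bar>n\<bar>) \<ge> 1" by linarith
    with K(2)[of m n] have "1 \<le> K * norm w" by (simp add: mn)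
    with K(1) show ?thesis by (simp add: field_simps)
  qed
  thus ?thesis using that[of "1 / K"] K(1) by simp
qed

lemma lattice_diff: "z \<in> L \<Longrightarrow> w \<in> L \<Longrightarrow> z - w \<in> L"
  using lattice_add[of z "- w"] by simp

lemma closed_lattice: "closed L"
proof -
  obtain e where e: "e > 0" "\<And>w. w \<in> L \<Longrightarrow> w \<noteq> 0 \<Longrightarrow> norm w \<ge> e" using lattice_discrete by blast
  show ?thesis
    by (rule discrete_imp_closed[OF e(1)])
      (use e(2)[OF lattice_diff] in \<open>force simp: dist_norm not_le[symmetric]\<close>)
qed

lemma open_complement_lattice: "open (- L)" using closed_lattice by blast

lemma connected_complement_lattice: "connected (- L)"
  using connected_open_diff_countable[of "UNIV :: complex set" L] countable_lattice
    convex_connected[OF convex_UNIV]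
  by (simp add: Compl_eq_Diff_UNIV)

lemma eventually_not_lattice: "eventually (\<lambda>z. z \<notin> L) (at w)"
proof -
  have "open (- (L - {w}))"
  proof -
    obtain e where e: "e > 0" "\<And>w. w \<in> L \<Longrightarrow> w \<noteq> 0 \<Longrightarrow> norm w \<ge> e" using lattice_discrete by blast
    have "closed (L - {w})"
      by (rule discrete_imp_closed[OF e(1)])
        (use e(2)[OF lattice_diff] in \<open>force simp: dist_norm not_le[symmetric]\<close>)
    thus ?thesis by blast
  qed
  hence "eventually (\<lambda>z. z \<in> - (L - {w})) (nhds w)" by (rule eventually_nhds_in_open) auto
  thus ?thesis unfolding eventually_at_filter by (rule eventually_mono) auto
qed

text \<open>The Weierstrass products of the library run over sequences; by absolute convergence any
  enumeration of the nonzero lattice points will do.\<close>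

definition enum :: "nat \<Rightarrow> complex" where "enum = from_nat_into (L - {0})"

lemma bij_enum: "bij_betw enum UNIV (L - {0})"
  unfolding enum_def
proof (rule bij_betw_from_nat_into)
  have "infinite L" unfolding lattice_eq
  proof
    assume "finite (range (\<lambda>(m, n). of_int m * \<tau> + of_int n))"
    hence "finite (UNIV :: (int \<times> int) set)" using finite_imageD lattice_inj by blast
    hence "finite (range (fst :: int \<times> int \<Rightarrow> int))" by blast
    thus False by simp
  qed
  thus "infinite (L - {0})" by simp
qed (use countable_lattice in auto)

lemma enum_in: "enum n \<in> L" "enum n \<noteq> 0" and range_enum: "range enum = L - {0}"
  using bij_enum by (auto simp: bij_betw_def)

lemma summable_enum: "summable (\<lambda>n. 1 / norm (enum n) ^ 3)"
  using summable_on_lattice summable_on_reindex_bij_betw[OF bij_enum, of "\<lambda>w. 1 / norm w ^ 3"]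
  by (simp add: summable_on_imp_summable)

lemma filterlim_enum: "filterlim enum at_infinity sequentially"
proof -
  have "(\<lambda>n. (1 / norm (enum n)) ^ 3) \<longlonglongrightarrow> 0"
    using summable_LIMSEQ_zero[OF summable_enum] by (simp add: power_divide)
  from tendsto_real_root[OF this, of 3] have "(\<lambda>n. inverse (norm (enum n))) \<longlonglongrightarrow> 0"
    by (simp add: real_root_power_cancel inverse_eq_divide)
  hence "filterlim (\<lambda>n. norm (enum n)) at_infinity sequentially"
    using filterlim_inverse_at_iff[of "\<lambda>n. norm (enum n)" sequentially] enum_in
    by (auto simp: filterlim_at)
  thus ?thesis
    using filterlim_at_infinity_imp_norm_at_top filterlim_norm_at_top_imp_at_infinity by fastforce
qed

sublocale W: weierstrass_product enum "\<lambda>_. 2"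
proof
  fix r :: real
  show "summable (\<lambda>n. (r / norm (enum n)) ^ Suc 2)"
    using summable_mult[OF summable_enum, of "r ^ 3"] by (simp add: power_divide eval_nat_numeral)
qed (use enum_in filterlim_enum in auto)

abbreviation "wsigma \<equiv> weierstrass_sigma L"
abbreviation "wzeta \<equiv> weierstrass_zeta L"

lemma weierstrass_factor_2: "weierstrass_factor 2 x = (1 - x) * exp (x + x\<^sup>2 / 2)"
  by (simp add: weierstrass_factor_def eval_nat_numeral)

text \<open>The definition takes an unordered limit over finite sets of lattice points; absolute
  convergence identifies it with the product along \<open>enum\<close>.\<close>

lemma sigma_eq: "wsigma z = z * W.f z"
proof -
  let ?g = "\<lambda>w. (1 - z / w) * exp (z / w + (z / w)\<^sup>2 / 2)"
  have "summable (\<lambda>n. norm (?g (enum n) - 1))"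
    using W.abs_convergent[of z] by (simp add: abs_convergent_prod_conv_summable weierstrass_factor_2)
  hence "(prod (\<lambda>n. ?g (enum n)) \<longlongrightarrow> prodinf (\<lambda>n. ?g (enum n))) (finite_subsets_at_top UNIV)"
    by (rule tendsto_prod_finite_subsets)
  also have "prodinf (\<lambda>n. ?g (enum n)) = W.f z"
    by (simp add: W.f_def weierstrass_factor_2)
  also have "(prod (\<lambda>n. ?g (enum n)) \<longlongrightarrow> W.f z) (finite_subsets_at_top UNIV) \<longleftrightarrow>
      ((\<lambda>F. prod ?g (enum ` F)) \<longlongrightarrow> W.f z) (finite_subsets_at_top UNIV)"
    using bij_enum by (intro tendsto_cong always_eventually allI)
       (simp add: prod.reindex inj_on_subset[of enum UNIV] bij_betw_def)
  also have "\<dots> \<longleftrightarrow> (prod ?g \<longlongrightarrow> W.f z) (finite_subsets_at_top (L - {0}))"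
    using filtermap_image_finite_subsets_at_top[of enum UNIV] bij_enum
    by (simp add: bij_betw_def filterlim_filtermap[symmetric] flip: filterlim_filtermap)
  finally have "Lim (finite_subsets_at_top (L - {0})) (prod ?g) = W.f z"
    by (intro tendsto_Lim) auto
  thus ?thesis by (simp add: weierstrass_sigma_def)
qed

lemma sigma_fun_eq: "wsigma = (\<lambda>z. z * W.f z)" using sigma_eq by blast

lemma sigma_holomorphic: "wsigma holomorphic_on A"
  unfolding sigma_fun_eq by (intro holomorphic_intros)

lemma sigma_eq_0_iff: "wsigma z = 0 \<longleftrightarrow> z \<in> L"
  using range_enum by (auto simp: sigma_eq W.zero)

lemma Wf_0: "W.f 0 = 1" by (simp add: W.f_def)

lemma deriv_sigma: "deriv wsigma z = W.f z + z * deriv W.f z"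
proof -
  have "(W.f has_field_derivative deriv W.f z) (at z)"
    by (rule holomorphic_derivI[OF W.holomorphic[of UNIV]]) auto
  thus ?thesis unfolding sigma_fun_eq
    by (auto intro!: DERIV_imp_deriv derivative_eq_intros)
qed

text \<open>At a nonzero lattice point the order of \<open>W.f\<close> is the number of indices that
  hit it, namely 1, so its derivative has order 0 there; at 0 the simple zero is the factor z of
  \<sigma>.\<close>

lemma deriv_sigma_nonzero: assumes "w \<in> L" shows "deriv wsigma w \<noteq> 0"
proof (cases "w = 0")
  case False
  hence w: "w \<in> range enum" using assms range_enum by auto
  then obtain n where n: "w = enum n" by auto
  have "enum -` {w} = {n}" using bij_enum by (auto simp: n bij_betw_def inj_def)
  hence z: "zorder W.f w = 1" using W.zorder[of w] by simp
  have iso: "isolated_zero W.f w" by (rule W.isolated_zero[OF w])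
  have hol: "W.f analytic_on {w}" by (rule W.analytic)
  have "zorder (deriv W.f) w = zorder W.f w - 1"
  proof (rule zorder_deriv_minus_1)
    show "\<exists>\<^sub>F w in at w. W.f w \<noteq> 0" using iso by (auto simp: isolated_zero_def intro: eventually_frequently)
  qed (use z hol in \<open>auto intro: isolated_singularity_at_analytic not_essential_analytic\<close>)
  hence z0: "zorder (deriv W.f) w = 0" using z by simp
  have "W.f w = 0" using w W.zero by blast
  moreover have "deriv W.f w \<noteq> 0"
  proof
    assume d0: "deriv W.f w = 0"
    have "deriv W.f analytic_on {w}" using hol by (rule analytic_deriv)
    \<comment> \<open>Otherwise the derivative is identically 0 and \<open>W.f\<close> is constant,
      although it takes the value 0 at \<open>w\<close> and 1 at 0.\<close>
    moreover have "\<exists>\<^sub>F z in at w. deriv W.f z \<noteq> 0"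
    proof (rule ccontr)
      assume "\<not> (\<exists>\<^sub>F z in at w. deriv W.f z \<noteq> 0)"
      hence ev: "\<forall>\<^sub>F z in at w. deriv W.f z = 0" by (simp add: frequently_def)
      have "deriv W.f z = 0" for z
      proof (rule analytic_continuation[of "deriv W.f" UNIV "{z. deriv W.f z = 0}" w])
        show "w islimpt {z. deriv W.f z = 0}"
          using ev by (simp add: islimpt_conv_frequently_at eventually_frequently)
      qed (auto intro!: holomorphic_intros convex_connected)
      hence "W.f constant_on UNIV"
        using has_field_derivative_0_imp_constant_on[of UNIV W.f]
        by (metis UNIV_I W.holomorphic connected_UNIV holomorphic_derivI open_UNIV)
      thus False using \<open>W.f w = 0\<close> Wf_0 by (auto simp: constant_on_def)
    qed
    ultimately have "zorder (deriv W.f) w > 0" using d0 zorder_pos_iff' by blast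
    thus False using z0 by simp
  qed
  ultimately show ?thesis using False by (simp add: deriv_sigma)
qed (simp add: deriv_sigma Wf_0)

text \<open>Termwise logarithmic differentiation of the product. The sum may include w = 0, because
  x / 0 = 0 reduces that term to 1/z, the contribution of the factor z of \<sigma>.\<close>

lemma zeta_has_sum:
  assumes "z \<notin> L"
  shows "((\<lambda>w. 1 / (z - w) + 1 / w + z / w\<^sup>2) has_sum wzeta z) L"
proof -
  have "z \<noteq> 0" using assms lattice_0 by metis
  have nz: "W.f z \<noteq> 0" using assms range_enum W.zero by auto
  have ne: "z \<noteq> enum n" for n using assms enum_in by auto
  let ?t = "\<lambda>w. 1 / (z - w) + 1 / w + z / w\<^sup>2"
  have "(\<lambda>k. deriv (\<lambda>z. weierstrass_factor 2 (z / enum k)) z / weierstrass_factor 2 (z / enum k)) sums (deriv W.f z / W.f z)"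
  proof (rule logderiv_prodinf_complex_uniform_limit)
    show "uniform_limit (ball 0 (norm z + 1)) (\<lambda>n x. \<Prod>k<n. weierstrass_factor 2 (x / enum k)) W.f sequentially"
      by (rule uniform_limit_on_subset[OF W.uniform_limit[of "norm z + 1"]]) (auto intro: add_nonneg_pos)
  qed (use nz enum_in in \<open>auto intro!: holomorphic_intros\<close>)
  moreover have "deriv (\<lambda>z. weierstrass_factor 2 (z / enum k)) z / weierstrass_factor 2 (z / enum k) = ?t (enum k)" for k
  proof -
    let ?w = "enum k"
    have "((\<lambda>z. weierstrass_factor 2 (z / ?w)) has_field_derivative
       ((- 1 / ?w) + (1 - z / ?w) * (1 / ?w + z / ?w\<^sup>2)) * exp (z / ?w + (z / ?w)\<^sup>2 / 2)) (at z)"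
      unfolding weierstrass_factor_2
      by (rule derivative_eq_intros refl | simp add: enum_in)+
        (simp add: enum_in field_simps power2_eq_square)
    hence "deriv (\<lambda>z. weierstrass_factor 2 (z / ?w)) z =
       ((- 1 / ?w) + (1 - z / ?w) * (1 / ?w + z / ?w\<^sup>2)) * exp (z / ?w + (z / ?w)\<^sup>2 / 2)"
      by (rule DERIV_imp_deriv)
    thus ?thesis using ne[of k] enum_in[of k] by (simp add: weierstrass_factor_2 divide_simps power2_eq_square) (simp add: algebra_simps)
  qed
  ultimately have sums: "(\<lambda>k. ?t (enum k)) sums (deriv W.f z / W.f z)" by simp
  have "summable (\<lambda>k. norm (?t (enum k)))"
  proof (rule summable_comparison_test_ev)
    have "eventually (\<lambda>n. norm (enum n) > 2 * norm z) sequentially"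
      using filterlim_enum by (metis filterlim_at_infinity_imp_norm_at_top filterlim_at_top_dense)
    thus "\<forall>\<^sub>F n in sequentially. norm (norm (?t (enum n))) \<le> 2 * norm z ^ 2 * (1 / norm (enum n) ^ 3)"
    proof eventually_elim
      case (elim n)
      let ?w = "enum n"
      have w: "norm ?w > 0" using enum_in by simp
      have 1: "norm (z - ?w) \<ge> norm ?w / 2" using elim norm_triangle_ineq2[of ?w z] by (simp add: norm_minus_commute)
      have "?t ?w = z\<^sup>2 / (?w\<^sup>2 * (z - ?w))"
        using ne[of n] enum_in[of n] by (simp add: divide_simps power2_eq_square) (simp add: algebra_simps)
      hence "norm (?t ?w) = norm z ^ 2 / (norm ?w ^ 2 * norm (z - ?w))" by (simp add: norm_divide norm_mult norm_power)
      also have "\<dots> \<le> norm z ^ 2 / (norm ?w ^ 2 * (norm ?w / 2))"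
        using 1 w by (intro divide_left_mono mult_left_mono) (auto intro!: mult_pos_pos simp: ne)
      also have "\<dots> = 2 * norm z ^ 2 * (1 / norm ?w ^ 3)" using w by (simp add: field_simps eval_nat_numeral)
      finally show ?case by simp
    qed
    show "summable (\<lambda>n. 2 * norm z ^ 2 * (1 / norm (enum n) ^ 3))" by (intro summable_mult summable_enum)
  qed
  from norm_summable_imp_has_sum[OF this sums]
  have "(?t has_sum (deriv W.f z / W.f z)) (L - {0})"
    using has_sum_reindex[of enum UNIV ?t] bij_enum by (simp add: bij_betw_def o_def)
  moreover have "(?t has_sum ?t 0) {0}" by (rule has_sum_finiteI) auto
  ultimately have "(?t has_sum (deriv W.f z / W.f z + ?t 0)) ((L - {0}) \<union> {0})"
    by (rule has_sum_Un_disjoint) auto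
  moreover have "deriv W.f z / W.f z + ?t 0 = wzeta z"
    using \<open>z \<noteq> 0\<close> nz by (simp add: weierstrass_zeta_def deriv_sigma sigma_eq field_simps)
  moreover have "(L - {0}) \<union> {0} = L" by auto
  ultimately show ?thesis by simp
qed

end

section \<open>Logarithmic derivatives and quasi-periods\<close>

definition logderiv :: "(complex \<Rightarrow> complex) \<Rightarrow> complex \<Rightarrow> complex" where
  "logderiv f z = deriv f z / f z"

lemma has_field_derivative_transfer_ev:
  assumes "eventually (\<lambda>x. f x = g x) (nhds z)" "(f has_field_derivative u) (at z)"
  shows "(g has_field_derivative u) (at z)"
  using DERIV_cong_ev[OF refl assms(1) refl] assms(2) by blast

lemma logderiv_odd:
  assumes "f holomorphic_on UNIV" "\<And>z. f (- z) = - f z"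
  shows "logderiv f (- z) = - logderiv f z"
proof -
  have d: "(f has_field_derivative deriv f z) (at z)" for z
    using assms(1) holomorphic_derivI open_UNIV by blast
  have "((\<lambda>z. f (- z)) has_field_derivative - deriv f (- z)) (at z)"
    using DERIV_chain2[OF d, of uminus "- 1" z UNIV] by (simp add: DERIV_minus[OF DERIV_ident])
  moreover have "((\<lambda>z. f (- z)) has_field_derivative - deriv f z) (at z)"
    using d by (auto simp: assms(2) intro!: derivative_eq_intros)
  ultimately have "deriv f (- z) = deriv f z" using DERIV_unique neg_equal_iff_equal by blast
  thus ?thesis by (simp add: logderiv_def assms(2))
qed

lemma logderiv_shift:
  assumes "f holomorphic_on UNIV" "\<And>z. f (z + w) = exp (a * z + b) * f z" "f z \<noteq> 0"
  shows "logderiv f (z + w) = logderiv f z + a"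
proof -
  have d: "(f has_field_derivative deriv f z) (at z)" for z
    using assms(1) holomorphic_derivI open_UNIV by blast
  have "((\<lambda>z. f (z + w)) has_field_derivative deriv f (z + w)) (at z)"
    using d DERIV_shift by blast
  moreover have "((\<lambda>z. f (z + w)) has_field_derivative exp (a * z + b) * (a * f z + deriv f z)) (at z)"
    using d unfolding assms(2) by (auto intro!: derivative_eq_intros simp: algebra_simps)
  ultimately have "deriv f (z + w) = exp (a * z + b) * (a * f z + deriv f z)" using DERIV_unique by blast
  thus ?thesis using assms(3) by (simp add: logderiv_def assms(2) add_divide_distrib)
qed

text \<open>Carries the simplicity of a zero from one lattice point to the next: the term with
  \<open>a\<close> in the derivative disappears at a zero.\<close>

lemma deriv_shift_zero:
  assumes "f holomorphic_on UNIV" "\<And>z. f (z + w) = exp (a * z + b) * f z" "f z = 0"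
  shows "deriv f (z + w) = 0 \<longleftrightarrow> deriv f z = 0"
proof -
  have d: "(f has_field_derivative deriv f z) (at z)" for z
    using assms(1) holomorphic_derivI open_UNIV by blast
  have "((\<lambda>z. f (z + w)) has_field_derivative deriv f (z + w)) (at z)"
    using d DERIV_shift by blast
  moreover have "((\<lambda>z. f (z + w)) has_field_derivative exp (a * z + b) * (a * f z + deriv f z)) (at z)"
    using d unfolding assms(2) by (auto intro!: derivative_eq_intros simp: algebra_simps)
  ultimately have "deriv f (z + w) = exp (a * z + b) * (a * f z + deriv f z)" using DERIV_unique by blast
  thus ?thesis using assms(3) by simp
qed

context upper_lattice
begin

lemma zeta_eq_logderiv: "wzeta = logderiv wsigma"
  by (simp add: fun_eq_iff weierstrass_zeta_def logderiv_def)

lemma zeta_uminus: assumes "z \<notin> L" shows "wzeta (- z) = - wzeta z"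
proof -
  let ?t = "\<lambda>z w. 1 / (z - w) + 1 / w + z / w\<^sup>2"
  have "uminus ` L = L"
  proof (intro equalityI subsetI)
    fix w assume "w \<in> L"
    thus "w \<in> uminus ` L" by (intro image_eqI[of _ _ "- w"]) auto
  qed auto
  with zeta_has_sum[of "- z"] assms have "(?t (- z) has_sum wzeta (- z)) (uminus ` L)" by simp
  hence "(?t (- z) \<circ> uminus has_sum wzeta (- z)) L" by (subst (asm) has_sum_reindex) auto
  moreover have "?t (- z) \<circ> uminus = (\<lambda>w. - ?t z w)"
    by (auto simp: fun_eq_iff field_simps divide_simps)
  ultimately have "((\<lambda>w. - ?t z w) has_sum wzeta (- z)) L" by simp
  moreover have "((\<lambda>w. - ?t z w) has_sum - wzeta z) L"
    by (rule has_sum_uminusI[OF zeta_has_sum[OF assms]])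
  ultimately show ?thesis using has_sum_unique by blast
qed

text \<open>The correction terms 1/w + z/w^2 are affine in z and drop out of a second difference.
  What remains depends on z and w only through z - w, so that translation by a lattice point merely
  permutes the summands.\<close>

lemma zeta_second_difference:
  assumes "z \<notin> L" "z + h \<notin> L" "z + k \<notin> L" "z + h + k \<notin> L"
  shows "((\<lambda>w. 1 / (z - w) - 1 / (z + h - w) - 1 / (z + k - w) + 1 / (z + h + k - w)) has_sum
           (wzeta z - wzeta (z + h) - wzeta (z + k) + wzeta (z + h + k))) L"
proof -
  let ?t = "\<lambda>z w. 1 / (z - w) + 1 / w + z / w\<^sup>2"
  have "((\<lambda>w. ?t z w + (- ?t (z + h) w) + (- ?t (z + k) w) + ?t (z + h + k) w) has_sum
           (wzeta z + (- wzeta (z + h)) + (- wzeta (z + k)) + wzeta (z + h + k))) L"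
    using assms by (intro has_sum_add has_sum_uminusI zeta_has_sum)
  also have "(\<lambda>w. ?t z w + (- ?t (z + h) w) + (- ?t (z + k) w) + ?t (z + h + k) w) =
     (\<lambda>w. 1 / (z - w) - 1 / (z + h - w) - 1 / (z + k - w) + 1 / (z + h + k - w))"
    by (simp add: fun_eq_iff add_divide_distrib)
  finally show ?thesis by simp
qed

lemma zeta_second_difference_periodic:
  assumes "\<omega> \<in> L" "z \<notin> L" "z + h \<notin> L" "z + k \<notin> L" "z + h + k \<notin> L"
  shows "wzeta (z + \<omega>) - wzeta (z + \<omega> + h) - wzeta (z + \<omega> + k) + wzeta (z + \<omega> + h + k) =
         wzeta z - wzeta (z + h) - wzeta (z + k) + wzeta (z + h + k)"
proof -
  let ?G = "\<lambda>z w. 1 / (z - w) - 1 / (z + h - w) - 1 / (z + k - w) + 1 / (z + h + k - w)"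
  have *: "z + \<omega> + h = (z + h) + \<omega>" "z + \<omega> + k = (z + k) + \<omega>" "z + \<omega> + h + k = (z + h + k) + \<omega>" by auto
  have 1: "(?G (z + \<omega>) has_sum
     (wzeta (z + \<omega>) - wzeta (z + \<omega> + h) - wzeta (z + \<omega> + k) + wzeta (z + \<omega> + h + k))) L"
    by (rule zeta_second_difference)
      (use assms lattice_add_iff[OF assms(1), of z] lattice_add_iff[OF assms(1), of "z + h"]
        lattice_add_iff[OF assms(1), of "z + k"] lattice_add_iff[OF assms(1), of "z + h + k"] in \<open>simp_all add: add_ac\<close>)
  have im: "(\<lambda>w. w + \<omega>) ` L = L"
  proof (intro equalityI subsetI)
    fix w assume "w \<in> L"
    hence "w - \<omega> \<in> L" using assms(1) by (rule lattice_diff)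
    thus "w \<in> (\<lambda>w. w + \<omega>) ` L" by (intro image_eqI[of _ _ "w - \<omega>"]) auto
  qed (use assms(1) lattice_add in auto)
  have "(?G (z + \<omega>) \<circ> (\<lambda>w. w + \<omega>) has_sum
     (wzeta (z + \<omega>) - wzeta (z + \<omega> + h) - wzeta (z + \<omega> + k) + wzeta (z + \<omega> + h + k))) L"
    using 1 has_sum_reindex[of "\<lambda>w. w + \<omega>" L "?G (z + \<omega>)"] im by (simp add: inj_on_def)
  moreover have "?G (z + \<omega>) \<circ> (\<lambda>w. w + \<omega>) = ?G z"
    by (simp add: fun_eq_iff algebra_simps)
  ultimately have 2: "(?G z has_sum
     (wzeta (z + \<omega>) - wzeta (z + \<omega> + h) - wzeta (z + \<omega> + k) + wzeta (z + \<omega> + h + k))) L"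
    by simp
  show ?thesis by (rule has_sum_unique[OF 2 zeta_second_difference[OF assms(2-5)]])
qed

lemma zeta_holomorphic: "wzeta holomorphic_on (- L)"
proof -
  have "deriv wsigma holomorphic_on (- L)"
    by (rule holomorphic_on_subset[OF holomorphic_deriv[OF sigma_holomorphic open_UNIV]]) auto
  hence "(\<lambda>z. deriv wsigma z / wsigma z) holomorphic_on (- L)"
    by (intro holomorphic_on_divide sigma_holomorphic) (auto simp: sigma_eq_0_iff)
  thus ?thesis by (simp add: weierstrass_zeta_def[abs_def])
qed

lemma exists_not_lattice: "\<exists>z. z \<notin> L"
  using eventually_happens[OF eventually_not_lattice[of 0]] by auto

text \<open>The increment \<open>D\<close> of \<zeta> over a period has vanishing second
  differences, hence is affine. Oddness of \<zeta> makes it symmetric under z \<mapsto> -z -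
  \<omega>, and an affine function with this symmetry is constant.\<close>

lemma zeta_quasi_periodic:
  assumes "\<omega> \<in> L"
  shows "\<exists>\<eta>. \<forall>z. z \<notin> L \<longrightarrow> wzeta (z + \<omega>) = wzeta z + \<eta>"
proof -
  define D where "D z = wzeta (z + \<omega>) - wzeta z" for z
  have D_hol: "D holomorphic_on (- L)"
    unfolding D_def
  proof (intro holomorphic_intros zeta_holomorphic)
    have "(\<lambda>z. z + \<omega>) ` (- L) \<subseteq> - L" using assms lattice_add_iff by auto
    thus "(\<lambda>x. wzeta (x + \<omega>)) holomorphic_on - L"
      using holomorphic_on_compose_gen[OF _ zeta_holomorphic, of "\<lambda>z. z + \<omega>" "- L"]
      by (simp add: o_def holomorphic_on_add holomorphic_on_ident holomorphic_on_const)
  qed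
  have D_deriv: "(D has_field_derivative deriv D z) (at z)" if "z \<notin> L" for z
    using holomorphic_derivI[OF D_hol open_complement_lattice] that by auto
  have same: "deriv D p = deriv D p'" if p: "p \<notin> L" "p' \<notin> L" for p p'
  proof -
    define k where "k = p' - p"
    have p': "p' = p + k" by (simp add: k_def)
    have "((\<lambda>x. D (x + k)) has_field_derivative deriv D (p + k)) (at p)"
      using D_deriv p DERIV_shift unfolding p' by blast
    hence 1: "((\<lambda>x. D x - D (x + k)) has_field_derivative (deriv D p - deriv D (p + k))) (at p)"
      using D_deriv[OF p(1)] by (intro derivative_intros)
    have ev1: "eventually (\<lambda>x. x \<in> - L) (nhds p)"
      using p open_complement_lattice by (intro eventually_nhds_in_open) auto
    have "eventually (\<lambda>x. x \<in> - L) (nhds (p + k))"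
      using p open_complement_lattice by (intro eventually_nhds_in_open) (auto simp: p')
    moreover have "filterlim (\<lambda>x. x + k) (nhds (p + k)) (nhds p)"
      by (intro tendsto_add filterlim_ident tendsto_const)
    ultimately have ev2: "eventually (\<lambda>x. x + k \<in> - L) (nhds p)" by (rule eventually_compose_filterlim)
    \<comment> \<open>The second difference of \<zeta> at p with increments x - p and k, compared
      with the one at p + \<omega>.\<close>
    have "eventually (\<lambda>x. D x - D (x + k) = D p - D (p + k)) (nhds p)"
      using ev1 ev2
    proof eventually_elim
      case (elim x)
      have e1: "p + (x - p) = x" "p + (x - p) + k = x + k" by auto
      have e2: "p + \<omega> + (x - p) = x + \<omega>" "p + \<omega> + (x - p) + k = x + k + \<omega>" "p + \<omega> + k = p + k + \<omega>" by auto
      show ?case using zeta_second_difference_periodic[OF assms, of p "x - p" k, unfolded e1 e2] elim p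
        by (simp add: D_def p' algebra_simps)
    qed
    hence "((\<lambda>x. D p - D (p + k)) has_field_derivative (deriv D p - deriv D (p + k))) (at p)"
      using 1 by (rule has_field_derivative_transfer_ev)
    hence "deriv D p - deriv D (p + k) = 0" using DERIV_const DERIV_unique by blast
    thus ?thesis by (simp add: p')
  qed
  obtain z0 where z0: "z0 \<notin> L" using exists_not_lattice by blast
  define a where "a = deriv D z0"
  have "(\<lambda>z. D z - a * z) constant_on (- L)"
  proof (rule has_field_derivative_0_imp_constant_on)
    fix z assume "z \<in> - L"
    hence "(D has_field_derivative a) (at z)" using D_deriv[of z] same[OF z0, of z] by (simp add: a_def)
    thus "((\<lambda>z. D z - a * z) has_field_derivative 0) (at z)" by (auto intro!: derivative_eq_intros)
  qed (use open_complement_lattice connected_complement_lattice in auto)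
  then obtain b where b: "\<And>z. z \<notin> L \<Longrightarrow> D z = a * z + b" by (force simp: constant_on_def algebra_simps)
  have odd: "a * (2 * z + \<omega>) = 0" if z: "z \<notin> L" for z
  proof -
    have z': "z + \<omega> \<notin> L" "- z - \<omega> \<notin> L"
      using z assms lattice_add_iff[of \<omega> z] lattice_uminus_iff[of "z + \<omega>"] by auto
    have "D (- z - \<omega>) = wzeta (- z) - wzeta (- (z + \<omega>))" by (simp add: D_def)
    also have "\<dots> = D z" using z z' by (simp add: D_def zeta_uminus del: minus_add_distrib)
    finally have "D z - D (- z - \<omega>) = 0" by simp
    moreover have "D z - D (- z - \<omega>) = a * (2 * z + \<omega>)" unfolding b[OF z] b[OF z'(2)] by (simp add: algebra_simps)
    ultimately show ?thesis by simp
  qed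
  have "z0 + 1 \<notin> L" using z0 lattice_add_iff[of 1 z0] by simp
  have "a * 2 = a * (2 * (z0 + 1) + \<omega>) - a * (2 * z0 + \<omega>)" by (simp add: algebra_simps)
  also have "\<dots> = 0" unfolding odd[OF z0] odd[OF \<open>z0 + 1 \<notin> L\<close>] by simp
  finally have "a * 2 = 0" .
  hence "a = 0" by simp
  with b show ?thesis by (auto simp: D_def algebra_simps)
qed

lemma quasi_period:
  assumes "\<omega> \<in> L" "z \<notin> L"
  shows "wzeta (z + \<omega>) = wzeta z + quasi_period L \<omega>"
proof -
  obtain \<eta> where \<eta>: "\<forall>z. z \<notin> L \<longrightarrow> wzeta (z + \<omega>) = wzeta z + \<eta>" using zeta_quasi_periodic assms by blast
  have "quasi_period L \<omega> = \<eta>"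
    unfolding quasi_period_def
  proof (rule the_equality)
    fix \<eta>' assume "\<forall>z. z \<notin> L \<longrightarrow> wzeta (z + \<omega>) = wzeta z + \<eta>'"
    thus "\<eta>' = \<eta>" using \<eta> assms(2) by auto
  qed (use \<eta> in auto)
  thus ?thesis using \<eta> assms by simp
qed

section \<open>Comparing functions of sigma type\<close>

text \<open>What \<sigma>, the theta product and its inverted form have in common; it determines a
  function up to a factor C exp(\<alpha> z^2). For \<sigma> the symmetries have been established on
  the level of \<zeta>, whence the conditions on \<open>logderiv\<close>.\<close>

definition sigma_like :: "(complex \<Rightarrow> complex) \<Rightarrow> bool" where
  "sigma_like s \<longleftrightarrow> s holomorphic_on UNIV \<and> (\<forall>z. s z = 0 \<longleftrightarrow> z \<in> L) \<and> (\<forall>w\<in>L. deriv s w \<noteq> 0) \<and>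
     (\<forall>z. z \<notin> L \<longrightarrow> logderiv s (- z) = - logderiv s z) \<and>
     (\<forall>\<omega>\<in>{\<tau>, 1}. \<exists>\<eta>. \<forall>z. z \<notin> L \<longrightarrow> logderiv s (z + \<omega>) = logderiv s z + \<eta>)"

lemma sigma_like_wsigma: "sigma_like wsigma"
  unfolding sigma_like_def
  using sigma_holomorphic sigma_eq_0_iff deriv_sigma_nonzero zeta_uminus zeta_quasi_periodic
  by (auto simp flip: zeta_eq_logderiv)

lemma periodic_bounded:
  assumes "continuous_on UNIV g" "\<And>z. g (z + \<tau>) = g z" "\<And>z. g (z + 1) = (g z :: complex)"
  shows "bounded (range g)"
proof -
  have 1: "g (z + of_int m * \<tau>) = g z" for z m
  proof (induction m rule: int_induct[of _ 0])
    case (step1 i) thus ?case using assms(2)[of "z + of_int i * \<tau>"] by (simp add: algebra_simps)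
  next
    case (step2 i) thus ?case using assms(2)[of "z + of_int (i - 1) * \<tau>"] by (simp add: algebra_simps)
  qed simp
  have 2: "g (z + of_int m) = g z" for z m
  proof (induction m rule: int_induct[of _ 0])
    case (step1 i) thus ?case using assms(3)[of "z + of_int i"] by (simp add: algebra_simps)
  next
    case (step2 i) thus ?case using assms(3)[of "z + of_int (i - 1)"] by (simp add: algebra_simps)
  qed simp
  define K where "K = (\<lambda>(x, y). of_real x * \<tau> + of_real y) ` ({0..1} \<times> {0..1})"
  have "compact K" unfolding K_def
    by (intro compact_continuous_image compact_Times compact_Icc) (auto intro!: continuous_intros simp: case_prod_unfold)
  hence "bounded (g ` K)"
    using assms(1) by (intro compact_imp_bounded compact_continuous_image) (auto intro: continuous_on_subset)
  moreover have "range g \<subseteq> g ` K"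
  proof safe
    fix z
    define x where "x = Im z / Im \<tau>"
    define y where "y = Re z - x * Re \<tau>"
    have z: "z = of_real x * \<tau> + of_real y"
      using Im_tau by (simp add: complex_eq_iff x_def y_def)
    have "g z = g ((of_real (frac x) * \<tau> + of_real (frac y) + of_int \<lfloor>x\<rfloor> * \<tau>) + of_int \<lfloor>y\<rfloor>)"
      by (subst z) (simp add: frac_def algebra_simps)
    also have "\<dots> = g (of_real (frac x) * \<tau> + of_real (frac y))" using 1 2 by simp
    finally have "g z = g (of_real (frac x) * \<tau> + of_real (frac y))" .
    moreover have "of_real (frac x) * \<tau> + of_real (frac y) \<in> K" unfolding K_def
      by (rule image_eqI[of _ _ "(frac x, frac y)"]) (auto simp: frac_ge_0 frac_lt_1 less_imp_le)
    ultimately show "g z \<in> g ` K" by blast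
  qed
  ultimately show ?thesis using bounded_subset by blast
qed

text \<open>The quotient extends to an entire function without zeros. The derivative of its
  logarithmic derivative is doubly periodic, hence constant by Liouville; so the logarithmic
  derivative is affine, and linear by oddness. Integration gives the Gaussian factor.\<close>

theorem sigma_like_quotient:
  assumes s1: "sigma_like s1" and s2: "sigma_like s2"
  obtains C \<alpha> where "C \<noteq> 0" "\<And>z. s1 z = C * exp (\<alpha> * z\<^sup>2) * s2 z"
    "\<And>z. z \<notin> L \<Longrightarrow> logderiv s1 z = logderiv s2 z + 2 * \<alpha> * z"
proof -
  \<comment> \<open>At a common simple zero the value is the limit that l'Hospital's rule
    gives.\<close>
  define Q where "Q z = (if z \<in> L then deriv s1 z / deriv s2 z else s1 z / s2 z)" for z
  have hol: "s1 holomorphic_on UNIV" "s2 holomorphic_on UNIV" using s1 s2 by (auto simp: sigma_like_def)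
  have dd: "(s1 has_field_derivative deriv s1 z) (at z)" "(s2 has_field_derivative deriv s2 z) (at z)" for z
    using hol holomorphic_derivI open_UNIV by blast+
  have zero: "s1 z = 0 \<longleftrightarrow> z \<in> L" "s2 z = 0 \<longleftrightarrow> z \<in> L" for z using s1 s2 by (auto simp: sigma_like_def)
  have dnz: "deriv s1 w \<noteq> 0" "deriv s2 w \<noteq> 0" if "w \<in> L" for w using s1 s2 that by (auto simp: sigma_like_def)
  have Q_nz: "Q z \<noteq> 0" for z using dnz zero by (simp add: Q_def)
  have Q_hol_c: "Q holomorphic_on (- L)"
  proof (rule holomorphic_transform)
    show "(\<lambda>z. s1 z / s2 z) holomorphic_on (- L)"
      using hol zero by (intro holomorphic_intros) (auto intro: holomorphic_on_subset)
  qed (simp add: Q_def)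
  have "Q analytic_on {w}" for w
  proof -
    have "eventually (\<lambda>z. z \<notin> L) (at w)" by (rule eventually_not_lattice)
    then obtain B where B: "open B" "w \<in> B" "\<And>z. z \<in> B \<Longrightarrow> z \<noteq> w \<Longrightarrow> z \<notin> L"
      unfolding eventually_at_topological by auto
    have "Q holomorphic_on B"
    proof (rule no_isolated_singularity'[where K = "{w}"])
      show "Q holomorphic_on B - {w}" by (rule holomorphic_on_subset[OF Q_hol_c]) (use B in auto)
      fix z assume "z \<in> {w}"
      have "(Q \<longlongrightarrow> Q w) (at w)"
      proof (cases "w \<in> L")
        case True
        have "((\<lambda>z. s1 z / s2 z) \<longlongrightarrow> deriv s1 w / deriv s2 w) (at w)"
          by (rule lhopital_complex_simple[OF dd]) (use zero dnz True in auto)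
        moreover have "eventually (\<lambda>z. s1 z / s2 z = Q z) (at w)"
          using eventually_not_lattice[of w] by eventually_elim (simp add: Q_def)
        ultimately have "(Q \<longlongrightarrow> deriv s1 w / deriv s2 w) (at w)" by (rule Lim_transform_eventually)
        thus ?thesis using True by (simp add: Q_def)
      next
        case False
        hence "isCont Q w" using holomorphic_on_imp_continuous_on[OF Q_hol_c]
          by (simp add: continuous_on_eq_continuous_at[OF open_complement_lattice])
        thus ?thesis by (rule isContD)
      qed
      thus "(Q \<longlongrightarrow> Q z) (at z within B)" using \<open>z \<in> {w}\<close> by (auto intro: tendsto_within_subset)
    qed (use B in auto)
    thus ?thesis using B analytic_at by blast
  qed
  hence "Q analytic_on UNIV" using analytic_on_analytic_at by blast
  hence Q_hol: "Q holomorphic_on UNIV" by (rule analytic_imp_holomorphic)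
  define D where "D z = deriv Q z / Q z" for z
  have D_hol: "D holomorphic_on UNIV" unfolding D_def
    using Q_nz by (intro holomorphic_intros Q_hol) auto
  have D_eq: "D z = logderiv s1 z - logderiv s2 z" if z: "z \<notin> L" for z
  proof -
    have "((\<lambda>z. s1 z / s2 z) has_field_derivative (deriv s1 z * s2 z - s1 z * deriv s2 z) / (s2 z * s2 z)) (at z)"
      by (rule DERIV_divide[OF dd]) (use z zero in auto)
    moreover have "eventually (\<lambda>x. s1 x / s2 x = Q x) (nhds z)"
      using eventually_nhds_in_open[OF open_complement_lattice, of z] z by (auto elim!: eventually_mono simp: Q_def)
    ultimately have "(Q has_field_derivative (deriv s1 z * s2 z - s1 z * deriv s2 z) / (s2 z * s2 z)) (at z)"
      by (rule has_field_derivative_transfer_ev[rotated])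
    hence "deriv Q z = (deriv s1 z * s2 z - s1 z * deriv s2 z) / (s2 z * s2 z)" by (rule DERIV_imp_deriv)
    thus ?thesis using z zero[of z] by (simp add: D_def Q_def logderiv_def field_simps)
  qed
  have per: "deriv D (z + \<omega>) = deriv D z" if w: "\<omega> \<in> {\<tau>, 1}" for z \<omega>
  proof -
    have wL: "\<omega> \<in> L" using w by auto
    obtain \<eta>1 \<eta>2 where \<eta>: "\<And>z. z \<notin> L \<Longrightarrow> logderiv s1 (z + \<omega>) = logderiv s1 z + \<eta>1"
      "\<And>z. z \<notin> L \<Longrightarrow> logderiv s2 (z + \<omega>) = logderiv s2 z + \<eta>2"
      using s1 s2 w unfolding sigma_like_def by metis
    define E where "E z = D (z + \<omega>) - D z - (\<eta>1 - \<eta>2)" for z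
    have hs: "(\<lambda>z. D (z + \<omega>)) holomorphic_on UNIV"
      using holomorphic_on_compose_gen[OF _ D_hol, of "\<lambda>z. z + \<omega>" UNIV]
      by (simp add: o_def holomorphic_on_add holomorphic_on_ident holomorphic_on_const)
    have E_hol: "E holomorphic_on UNIV" unfolding E_def by (intro holomorphic_intros D_hol hs)
    have E0: "E z = 0" if "z \<notin> L" for z
      using that \<eta>[OF that] D_eq[of z] D_eq[of "z + \<omega>"] lattice_add_iff[OF wL, of z] by (simp add: E_def)
    have "E z = 0" for z
    proof (rule analytic_continuation_open[OF open_complement_lattice open_UNIV _ _ _ E_hol, of "\<lambda>_. 0"])
      show "- L \<noteq> {}" using exists_not_lattice by blast
      show "connected (UNIV :: complex set)" by (intro convex_connected convex_UNIV)
    qed (use E0 in auto)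
    hence "D (z + \<omega>) = D z + (\<eta>1 - \<eta>2)" for z
      using E_def[of z] by (metis diff_eq_diff_eq diff_zero add_diff_cancel_left' diff_add_cancel eq_iff_diff_eq_0 add.commute)
    hence eq: "(\<lambda>z. D (z + \<omega>)) = (\<lambda>z. D z + (\<eta>1 - \<eta>2))" by blast
    have dD: "(D has_field_derivative deriv D z) (at z)" for z
      using D_hol holomorphic_derivI open_UNIV by blast
    have "((\<lambda>z. D (z + \<omega>)) has_field_derivative deriv D (z + \<omega>)) (at z)"
      using dD DERIV_shift by blast
    moreover have "((\<lambda>z. D (z + \<omega>)) has_field_derivative deriv D z) (at z)"
      unfolding eq using dD[of z] by (auto intro!: derivative_eq_intros)
    ultimately show ?thesis using DERIV_unique by blast
  qed
  have dD_hol: "deriv D holomorphic_on UNIV" by (intro holomorphic_intros D_hol) auto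
  have "bounded (range (deriv D))"
    by (rule periodic_bounded) (use per in \<open>auto intro: holomorphic_on_imp_continuous_on[OF dD_hol]\<close>)
  hence "deriv D constant_on UNIV" using Liouville_theorem[OF dD_hol] by blast
  then obtain \<beta> where \<beta>: "\<And>z. deriv D z = \<beta>" by (auto simp: constant_on_def)
  have "(\<lambda>z. D z - \<beta> * z) constant_on UNIV"
  proof (rule has_field_derivative_0_imp_constant_on)
    fix z :: complex
    have "(D has_field_derivative \<beta>) (at z)" using D_hol \<beta> holomorphic_derivI open_UNIV by (metis UNIV_I)
    thus "((\<lambda>z. D z - \<beta> * z) has_field_derivative 0) (at z)" by (auto intro!: derivative_eq_intros)
  qed (auto intro: convex_connected)
  then obtain \<gamma> where "\<And>z. D z - \<beta> * z = \<gamma>" by (auto simp: constant_on_def)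
  hence \<gamma>: "D z = \<beta> * z + \<gamma>" for z by (metis diff_add_cancel add.commute)
  obtain z0 where z0: "z0 \<notin> L" using exists_not_lattice by blast
  have "D (- z0) = - D z0" using z0 s1 s2 by (simp add: D_eq sigma_like_def)
  hence "\<gamma> = 0" by (simp add: \<gamma>)
  with \<gamma> have D: "D z = \<beta> * z" for z by simp
  have "(\<lambda>z. Q z * exp (- \<beta> * z\<^sup>2 / 2)) constant_on UNIV"
  proof (rule has_field_derivative_0_imp_constant_on)
    fix z :: complex
    have "(Q has_field_derivative deriv Q z) (at z)" using Q_hol holomorphic_derivI open_UNIV by blast
    moreover have "deriv Q z = \<beta> * z * Q z" using D[of z] Q_nz[of z] by (simp add: D_def field_simps)
    ultimately have "(Q has_field_derivative \<beta> * z * Q z) (at z)" by simp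
    thus "((\<lambda>z. Q z * exp (- \<beta> * z\<^sup>2 / 2)) has_field_derivative 0) (at z)"
      by (auto intro!: derivative_eq_intros)
  qed (auto intro: convex_connected)
  then obtain C where C: "\<And>z. Q z * exp (- \<beta> * z\<^sup>2 / 2) = C" by (auto simp: constant_on_def)
  have QC: "Q z = C * exp (\<beta> / 2 * z\<^sup>2)" for z
  proof -
    have "C * exp (\<beta> / 2 * z\<^sup>2) = Q z * (exp (- \<beta> * z\<^sup>2 / 2) * exp (\<beta> / 2 * z\<^sup>2))" by (simp add: C[of z, symmetric] mult_ac)
    also have "exp (- \<beta> * z\<^sup>2 / 2) * exp (\<beta> / 2 * z\<^sup>2) = 1" by (simp flip: exp_add)
    finally show ?thesis by simp
  qed
  show ?thesis
  proof (rule that[of C "\<beta> / 2"])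
    show "C \<noteq> 0" using QC[of 0] Q_nz[of 0] by auto
    show "s1 z = C * exp (\<beta> / 2 * z\<^sup>2) * s2 z" for z
      using QC[of z] zero[of z] by (cases "z \<in> L") (auto simp: Q_def field_simps)
    show "logderiv s1 z = logderiv s2 z + 2 * (\<beta> / 2) * z" if "z \<notin> L" for z
      using D_eq[OF that] D[of z] by (simp add: algebra_simps)
  qed
qed

end

section \<open>The product formula for Siegel functions\<close>

definition ex :: "complex \<Rightarrow> complex" where "ex z = exp (2 * of_real pi * \<i> * z)"

lemma ex_add: "ex (z + w) = ex z * ex w" by (simp add: ex_def algebra_simps flip: exp_add)
lemma ex_uminus: "ex (- z) = inverse (ex z)" by (simp add: ex_def exp_minus)
lemma ex_diff: "ex (z - w) = ex z / ex w" by (simp add: ex_def algebra_simps flip: exp_diff)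
lemma ex_nonzero [simp]: "ex z \<noteq> 0" by (simp add: ex_def)
lemma ex_of_nat_mult: "ex (of_nat n * z) = ex z ^ n"
  unfolding ex_def by (subst exp_of_nat_mult[symmetric]) (simp add: mult_ac)
lemma ex_0 [simp]: "ex 0 = 1" by (simp add: ex_def)

lemma ex_eq_1_iff: "ex z = 1 \<longleftrightarrow> (\<exists>n::int. z = of_int n)"
proof
  assume "ex z = 1"
  then obtain n :: int where n: "Re (2 * of_real pi * \<i> * z) = 0" "Im (2 * of_real pi * \<i> * z) = of_int (2 * n) * pi"
    unfolding ex_def exp_eq_1 by blast
  hence "Im z = 0" "Re z = of_int n" by (simp_all)
  thus "\<exists>n::int. z = of_int n" by (auto simp: complex_eq_iff)
next
  assume "\<exists>n::int. z = of_int n"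
  thus "ex z = 1" unfolding ex_def exp_eq_1 by auto
qed

lemma ex_of_int [simp]: "ex (of_int n) = 1" using ex_eq_1_iff by blast
lemma ex_1 [simp]: "ex 1 = 1" using ex_of_int[of 1] by simp

lemma norm_ex: "norm (ex z) = exp (- 2 * pi * Im z)" by (simp add: ex_def)

lemma norm_ex_less_1: "Im \<tau> > 0 \<Longrightarrow> norm (ex \<tau>) < 1" by (simp add: norm_ex)

lemma ex_holomorphic [holomorphic_intros]: "f holomorphic_on A \<Longrightarrow> (\<lambda>z. ex (f z)) holomorphic_on A"
  unfolding ex_def by (intro holomorphic_intros)

lemma ex_eq_square: "ex z = exp (of_real pi * \<i> * z) ^ 2"
  by (simp add: ex_def power2_eq_square mult_ac flip: exp_add)

text \<open>Jacobi's theta function as a triple product, without the factors that depend on \<tau>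
  alone. The exponential in front makes it odd in z.\<close>

definition theta :: "complex \<Rightarrow> complex \<Rightarrow> complex" where
  "theta \<tau> z = exp (- of_real pi * \<i> * z) * qpoch (ex z) (ex \<tau>) * qpoch (ex (\<tau> - z)) (ex \<tau>)"

text \<open>The product formula for the Siegel function, with complex characteristic (a, b);
  \<open>siegel_function_eq\<close> makes the identification for rational ones.\<close>

definition sieg :: "complex \<Rightarrow> complex \<Rightarrow> complex \<Rightarrow> complex" where
  "sieg a b \<tau> = \<i> * exp (of_real pi * \<i> * (a * (a * \<tau> + b) + \<tau> / 6)) * theta \<tau> (a * \<tau> + b)"

context upper_lattice
begin

abbreviation "q \<equiv> ex \<tau>"

lemma norm_q: "norm q < 1" using Im_tau by (rule norm_ex_less_1)

lemma theta_holomorphic: "theta \<tau> holomorphic_on UNIV"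
proof -
  have 1: "(\<lambda>z. qpoch (ex z) q) holomorphic_on UNIV"
    using holomorphic_on_compose_gen[OF _ qpoch_holomorphic[OF norm_q], of ex UNIV]
    by (simp add: o_def ex_holomorphic holomorphic_on_ident)
  have 2: "(\<lambda>z. qpoch (ex (\<tau> - z)) q) holomorphic_on UNIV"
    using holomorphic_on_compose_gen[OF _ qpoch_holomorphic[OF norm_q], of "\<lambda>z. ex (\<tau> - z)" UNIV]
    by (simp add: o_def ex_holomorphic holomorphic_on_ident holomorphic_on_diff holomorphic_on_const)
  show ?thesis unfolding theta_def[abs_def] by (intro holomorphic_intros 1 2)
qed

lemma theta_eq_0_iff: "theta \<tau> z = 0 \<longleftrightarrow> z \<in> L"
proof -
  have "theta \<tau> z = 0 \<longleftrightarrow> (\<exists>n. ex (z + of_nat n * \<tau>) = 1) \<or> (\<exists>n. ex (of_nat (Suc n) * \<tau> - z) = 1)"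
    by (simp add: theta_def qpoch_eq_0_iff[OF norm_q] ex_of_nat_mult[symmetric] ex_add[symmetric] algebra_simps)
  also have "\<dots> \<longleftrightarrow> (\<exists>n m. z = of_int m - of_nat n * \<tau>) \<or> (\<exists>n m. z = of_nat (Suc n) * \<tau> - of_int m)"
  proof -
    have "x - z = y \<longleftrightarrow> z = x - y" "z + x = y \<longleftrightarrow> z = y - x" for x y :: complex by (auto simp: algebra_simps)
    thus ?thesis unfolding ex_eq_1_iff by (simp only:)
  qed
  also have "\<dots> \<longleftrightarrow> z \<in> L"
  proof
    assume "(\<exists>n m. z = of_int m - of_nat n * \<tau>) \<or> (\<exists>n m. z = of_nat (Suc n) * \<tau> - of_int m)"
    thus "z \<in> L"
    proof (elim disjE exE)
      fix n :: nat and m :: int assume "z = of_int m - of_nat n * \<tau>"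
      thus ?thesis unfolding lattice_iff by (intro exI[of _ "- int n"] exI[of _ m]) simp
    next
      fix n :: nat and m :: int assume "z = of_nat (Suc n) * \<tau> - of_int m"
      thus ?thesis unfolding lattice_iff by (intro exI[of _ "int (Suc n)"] exI[of _ "- m"]) simp
    qed
  next
    assume "z \<in> L"
    then obtain m n where mn: "z = of_int m * \<tau> + of_int n" by (auto simp: lattice_iff)
    show "(\<exists>n m. z = of_int m - of_nat n * \<tau>) \<or> (\<exists>n m. z = of_nat (Suc n) * \<tau> - of_int m)"
    proof (cases "m \<le> 0")
      case True
      hence "z = of_int n - of_nat (nat (- m)) * \<tau>" by (simp add: mn of_nat_nat)
      thus ?thesis by blast
    next
      case False
      hence "z = of_nat (Suc (nat (m - 1))) * \<tau> - of_int (- n)" by (simp add: mn of_nat_nat)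
      thus ?thesis by blast
    qed
  qed
  finally show ?thesis .
qed

lemma theta_eq: "theta \<tau> z = (exp (- of_real pi * \<i> * z) - exp (of_real pi * \<i> * z)) *
    (qpoch (ex (\<tau> + z)) q * qpoch (ex (\<tau> - z)) q)"
proof -
  have "qpoch (ex z) q = (1 - ex z) * qpoch (ex (\<tau> + z)) q"
    by (subst qpoch_rec[OF norm_q]) (simp add: ex_add mult_ac)
  moreover have "exp (- of_real pi * \<i> * z) * (1 - ex z) = exp (- of_real pi * \<i> * z) - exp (of_real pi * \<i> * z)"
    by (simp add: ex_eq_square exp_minus right_diff_distrib power2_eq_square)
  ultimately show ?thesis by (simp add: theta_def mult.assoc[symmetric])
qed

lemma theta_uminus: "theta \<tau> (- z) = - theta \<tau> z"
  unfolding theta_eq by (simp add: algebra_simps)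

lemma theta_add_1: "theta \<tau> (z + 1) = exp (0 * z + of_real pi * \<i>) * theta \<tau> z"
proof -
  have "exp (- (of_real pi * \<i> * (z + 1))) = - exp (- (of_real pi * \<i> * z))"
    by (simp add: exp_diff exp_add algebra_simps exp_minus inverse_eq_divide)
  moreover have "ex (\<tau> - (z + 1)) = ex (\<tau> - z)" using ex_diff[of "\<tau> - z" 1] by (simp add: algebra_simps)
  ultimately show ?thesis by (simp add: theta_def ex_add)
qed

lemma theta_add_tau: "theta \<tau> (z + \<tau>) = exp ((- 2 * of_real pi * \<i>) * z + (of_real pi * \<i> - of_real pi * \<i> * \<tau>)) * theta \<tau> z"
proof -
  have 1: "qpoch (ex z) q = (1 - ex z) * qpoch (ex (z + \<tau>)) q"
    by (subst qpoch_rec[OF norm_q]) (simp add: ex_add)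
  have 2: "qpoch (ex (- z)) q = (1 - ex (- z)) * qpoch (ex (\<tau> - z)) q"
    by (subst qpoch_rec[OF norm_q]) (simp add: ex_add[symmetric])
  have "exp (- of_real pi * \<i> * (z + \<tau>)) * (1 - ex (- z)) =
     exp ((- 2 * of_real pi * \<i>) * z + (of_real pi * \<i> - of_real pi * \<i> * \<tau>)) * exp (- of_real pi * \<i> * z) * (1 - ex z)"
  proof -
    define A where "A = exp (of_real pi * \<i> * z)"
    define T where "T = exp (of_real pi * \<i> * \<tau>)"
    have nz: "A \<noteq> 0" "T \<noteq> 0" by (auto simp: A_def T_def)
    have 1: "exp (- of_real pi * \<i> * (z + \<tau>)) = inverse A * inverse T"
      by (simp add: A_def T_def algebra_simps flip: exp_minus exp_add)
    have 2: "exp ((- 2 * of_real pi * \<i>) * z + (of_real pi * \<i> - of_real pi * \<i> * \<tau>)) = - inverse (A ^ 2) * inverse T"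
      unfolding exp_add exp_diff
      by (simp add: A_def T_def power2_eq_square divide_inverse mult_ac flip: exp_minus exp_add)
    have 3: "exp (- of_real pi * \<i> * z) = inverse A" by (simp add: A_def flip: exp_minus)
    show ?thesis unfolding 1 2 3 ex_uminus unfolding ex_eq_square A_def[symmetric]
      using nz by (simp add: field_simps power2_eq_square)
  qed
  hence "exp (- of_real pi * \<i> * (z + \<tau>)) * (1 - ex (- z)) * (qpoch (ex (z + \<tau>)) q * qpoch (ex (\<tau> - z)) q) =
     exp ((- 2 * of_real pi * \<i>) * z + (of_real pi * \<i> - of_real pi * \<i> * \<tau>)) * exp (- of_real pi * \<i> * z) * (1 - ex z)
       * (qpoch (ex (z + \<tau>)) q * qpoch (ex (\<tau> - z)) q)" by simp
  thus ?thesis by (simp add: theta_def 1 2 mult_ac)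
qed

lemma deriv_theta_0: "deriv (theta \<tau>) 0 = - 2 * of_real pi * \<i> * qpoch q q ^ 2"
proof -
  define g where "g z = qpoch (ex (\<tau> + z)) q * qpoch (ex (\<tau> - z)) q" for z
  have 1: "(\<lambda>z. qpoch (ex (\<tau> + z)) q) holomorphic_on UNIV"
    using holomorphic_on_compose_gen[OF _ qpoch_holomorphic[OF norm_q], of "\<lambda>z. ex (\<tau> + z)" UNIV]
    by (simp add: o_def ex_holomorphic holomorphic_on_ident holomorphic_on_add holomorphic_on_const)
  have 2: "(\<lambda>z. qpoch (ex (\<tau> - z)) q) holomorphic_on UNIV"
    using holomorphic_on_compose_gen[OF _ qpoch_holomorphic[OF norm_q], of "\<lambda>z. ex (\<tau> - z)" UNIV]
    by (simp add: o_def ex_holomorphic holomorphic_on_ident holomorphic_on_diff holomorphic_on_const)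
  have "g holomorphic_on UNIV" unfolding g_def[abs_def] by (intro holomorphic_intros 1 2)
  hence g: "(g has_field_derivative deriv g 0) (at 0)" using holomorphic_derivI open_UNIV by blast
  have "(theta \<tau> has_field_derivative - 2 * of_real pi * \<i> * g 0) (at 0)"
    unfolding theta_eq[abs_def] g_def[symmetric]
    by (rule derivative_eq_intros g refl | simp)+
  thus ?thesis by (auto simp: g_def power2_eq_square dest: DERIV_imp_deriv)
qed

lemma qpoch_q_nonzero: "qpoch q q \<noteq> 0"
proof
  assume "qpoch q q = 0"
  then obtain n where "q * q ^ n = 1" using qpoch_eq_0_iff[OF norm_q] by blast
  hence "norm (q ^ Suc n) = 1" by simp
  moreover have "norm (q ^ Suc n) < 1" using norm_q power_Suc_less_one[of "norm q"]
    by (simp add: norm_power norm_mult del: power_Suc)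
  ultimately show False by simp
qed

text \<open>Direct differentiation settles the zero at 0; the two shifts move the result to all
  lattice points.\<close>

lemma deriv_theta_nonzero: assumes "w \<in> L" shows "deriv (theta \<tau>) w \<noteq> 0"
proof -
  have 1: "deriv (theta \<tau>) (z + 1) = 0 \<longleftrightarrow> deriv (theta \<tau>) z = 0" if "z \<in> L" for z
    by (rule deriv_shift_zero[OF theta_holomorphic theta_add_1]) (use that theta_eq_0_iff in simp)
  have 2: "deriv (theta \<tau>) (z + \<tau>) = 0 \<longleftrightarrow> deriv (theta \<tau>) z = 0" if "z \<in> L" for z
    by (rule deriv_shift_zero[OF theta_holomorphic theta_add_tau]) (use that theta_eq_0_iff in simp)
  have mt: "of_int m * \<tau> \<in> L" for m :: int unfolding lattice_iff by (intro exI[of _ m] exI[of _ 0]) simp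
  have mn: "of_int m * \<tau> + of_int n \<in> L" for m n :: int unfolding lattice_iff by blast
  have a: "deriv (theta \<tau>) (of_int m * \<tau>) \<noteq> 0" for m
  proof (induction m rule: int_induct[of _ 0])
    case base thus ?case using deriv_theta_0 qpoch_q_nonzero by simp
  next
    case (step1 i) thus ?case using 2[OF mt[of i]] by (simp add: algebra_simps)
  next
    case (step2 i) thus ?case using 2[OF mt[of "i - 1"]] by (simp add: algebra_simps)
  qed
  have "deriv (theta \<tau>) (of_int m * \<tau> + of_int n) \<noteq> 0" for m n
  proof (induction n rule: int_induct[of _ 0])
    case base thus ?case using a by simp
  next
    case (step1 i) thus ?case using 1[OF mn[of m i]] by (simp add: algebra_simps)
  next
    case (step2 i) thus ?case using 1[OF mn[of m "i - 1"]] by (simp add: algebra_simps)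
  qed
  thus ?thesis using assms by (auto simp: lattice_iff)
qed

lemma logderiv_theta_add_tau: "z \<notin> L \<Longrightarrow> logderiv (theta \<tau>) (z + \<tau>) = logderiv (theta \<tau>) z + (- 2 * of_real pi * \<i>)"
  by (rule logderiv_shift[OF theta_holomorphic theta_add_tau]) (simp add: theta_eq_0_iff)

lemma logderiv_theta_add_1: "z \<notin> L \<Longrightarrow> logderiv (theta \<tau>) (z + 1) = logderiv (theta \<tau>) z"
  using logderiv_shift[OF theta_holomorphic theta_add_1] by (simp add: theta_eq_0_iff)

lemma sigma_like_theta: "sigma_like (theta \<tau>)"
  unfolding sigma_like_def
proof (intro conjI allI ballI impI)
  fix \<omega> assume "\<omega> \<in> {\<tau>, 1}"
  thus "\<exists>\<eta>. \<forall>z. z \<notin> L \<longrightarrow> logderiv (theta \<tau>) (z + \<omega>) = logderiv (theta \<tau>) z + \<eta>"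
    using logderiv_theta_add_tau logderiv_theta_add_1 by (auto intro: exI[of _ "- 2 * of_real pi * \<i>"] exI[of _ 0])
qed (use theta_holomorphic theta_eq_0_iff deriv_theta_nonzero logderiv_odd[OF theta_holomorphic theta_uminus] in auto)

lemma dedekind_eta_square: "(dedekind_eta \<tau>)\<^sup>2 = exp (of_real pi * \<i> * (\<tau> / 6)) * (qpoch q q)\<^sup>2"
proof -
  have "dedekind_eta \<tau> = exp (2 * of_real pi * \<i> * \<tau> / 24) * qpoch q q"
    by (simp add: dedekind_eta_def qpoch_def ex_def)
  hence "(dedekind_eta \<tau>)\<^sup>2 = (exp (2 * of_real pi * \<i> * \<tau> / 24))\<^sup>2 * (qpoch q q)\<^sup>2" by (simp add: power_mult_distrib)
  also have "(exp (2 * of_real pi * \<i> * \<tau> / 24))\<^sup>2 = exp (of_real pi * \<i> * (\<tau> / 6))"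
    by (simp add: power2_eq_square mult_ac flip: exp_add)
  finally show ?thesis .
qed

text \<open>With \<sigma> = C exp(\<alpha> z^2) \<theta>, the quasi-periods are 2 \<alpha> \<tau> -
  2 \<pi> i and 2 \<alpha>, so the exponential in the Klein form cancels the unknown Gaussian
  factor. The constant C follows from \<sigma>'(0) = 1 and is absorbed by the square of the eta
  function.\<close>

theorem siegel_function_eq: "siegel_function (r, s) \<tau> = sieg (of_rat r) (of_rat s) \<tau>"
proof -
  define z where "z = of_rat r * \<tau> + of_rat s"
  obtain C \<alpha> where C: "C \<noteq> 0" "\<And>z. wsigma z = C * exp (\<alpha> * z\<^sup>2) * theta \<tau> z"
    "\<And>z. z \<notin> L \<Longrightarrow> logderiv wsigma z = logderiv (theta \<tau>) z + 2 * \<alpha> * z"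
    using sigma_like_quotient[OF sigma_like_wsigma sigma_like_theta] by metis
  obtain z0 where z0: "z0 \<notin> L" using exists_not_lattice by blast
  have z0': "z0 + \<tau> \<notin> L" "z0 + 1 \<notin> L" using z0 by (simp_all add: lattice_add_iff)
  have \<eta>1: "quasi_period L \<tau> = 2 * \<alpha> * \<tau> - 2 * of_real pi * \<i>"
  proof -
    have "quasi_period L \<tau> = logderiv wsigma (z0 + \<tau>) - logderiv wsigma z0"
      using quasi_period[OF lattice_tau z0] by (simp add: zeta_eq_logderiv)
    also have "\<dots> = 2 * \<alpha> * \<tau> - 2 * of_real pi * \<i>"
      unfolding C(3)[OF z0] C(3)[OF z0'(1)] logderiv_theta_add_tau[OF z0] by (simp add: algebra_simps)
    finally show ?thesis .
  qed
  have \<eta>2: "quasi_period L 1 = 2 * \<alpha>"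
  proof -
    have "quasi_period L 1 = logderiv wsigma (z0 + 1) - logderiv wsigma z0"
      using quasi_period[OF lattice_1 z0] by (simp add: zeta_eq_logderiv)
    also have "\<dots> = 2 * \<alpha>"
      unfolding C(3)[OF z0] C(3)[OF z0'(2)] logderiv_theta_add_1[OF z0] by (simp add: algebra_simps)
    finally show ?thesis .
  qed
  have th0: "theta \<tau> 0 = 0" by (simp add: theta_eq_0_iff)
  have "deriv wsigma 0 = 1" by (simp add: deriv_sigma Wf_0)
  moreover have "(wsigma has_field_derivative C * deriv (theta \<tau>) 0) (at 0)"
  proof -
    have t: "(theta \<tau> has_field_derivative deriv (theta \<tau>) 0) (at 0)" using theta_holomorphic holomorphic_derivI open_UNIV by blast
    have "((\<lambda>z. C * exp (\<alpha> * z\<^sup>2) * theta \<tau> z) has_field_derivative C * deriv (theta \<tau>) 0) (at 0)"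
      by (rule derivative_eq_intros t refl | simp add: th0)+
    thus ?thesis using C(2) by presburger
  qed
  ultimately have C1: "C * (- 2 * of_real pi * \<i> * qpoch q q ^ 2) = 1"
    using deriv_theta_0 DERIV_imp_deriv by metis
  have "siegel_function (r, s) \<tau> = 2 * of_real pi * (dedekind_eta \<tau>)\<^sup>2 *
     (exp (- (of_rat r * quasi_period L \<tau> + of_rat s * quasi_period L 1) * z / 2) * wsigma z)"
    by (simp add: siegel_function_def klein_form_def Let_def z_def)
  also have "- (of_rat r * quasi_period L \<tau> + of_rat s * quasi_period L 1) * z / 2 =
      of_real pi * \<i> * (of_rat r * z) - \<alpha> * z\<^sup>2"
    unfolding \<eta>1 \<eta>2 by (simp add: z_def power2_eq_square field_simps)
  also have "exp \<dots> * wsigma z = C * exp (of_real pi * \<i> * (of_rat r * z)) * theta \<tau> z"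
    unfolding C(2) exp_diff by simp
  also have "2 * of_real pi * (dedekind_eta \<tau>)\<^sup>2 * (C * exp (of_real pi * \<i> * (of_rat r * z)) * theta \<tau> z) =
      (C * (- 2 * of_real pi * \<i> * qpoch q q ^ 2)) * (\<i> * (exp (of_real pi * \<i> * (of_rat r * z)) * exp (of_real pi * \<i> * (\<tau> / 6))) * theta \<tau> z)"
    unfolding dedekind_eta_square by (simp add: algebra_simps)
  also have "\<dots> = sieg (of_rat r) (of_rat s) \<tau>"
    unfolding C1 by (simp add: sieg_def z_def algebra_simps flip: exp_add)
  finally show ?thesis .
qed

end

section \<open>Transformation of Siegel functions\<close>

text \<open>As a function of z the left-hand side is of sigma type for the lattice of \<tau>, since
  division by \<tau> maps this lattice onto that of -1/\<tau>. Comparing the increments over the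
  period \<tau> gives \<alpha> = \<pi> i / \<tau>.\<close>

lemma theta_inversion:
  assumes "Im \<tau> > 0"
  obtains C where "C \<noteq> 0" "\<And>z. theta (- 1 / \<tau>) (z / \<tau>) = C * exp (of_real pi * \<i> * z\<^sup>2 / \<tau>) * theta \<tau> z"
proof -
  have t0: "\<tau> \<noteq> 0" using assms by auto
  have im: "Im (- 1 / \<tau>) > 0" using assms t0 by (simp add: Im_divide power2_eq_square field_simps sum_squares_gt_zero_iff complex_eq_iff)
  interpret A: upper_lattice \<tau> by standard fact
  interpret B: upper_lattice "- 1 / \<tau>" by standard fact
  define s where "s z = theta (- 1 / \<tau>) (z / \<tau>)" for z
  have Lat: "z / \<tau> \<in> B.L \<longleftrightarrow> z \<in> A.L" for z
  proof -
    have "z / \<tau> \<in> B.L \<longleftrightarrow> (\<exists>m n. z / \<tau> = of_int m * (- 1 / \<tau>) + of_int n)" by (rule B.lattice_iff)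
    also have "\<dots> \<longleftrightarrow> (\<exists>m n. z = of_int n * \<tau> + of_int (- m))"
      using t0 by (simp add: field_simps)
    also have "\<dots> \<longleftrightarrow> z \<in> A.L" unfolding A.lattice_iff
      by (metis minus_minus)
    finally show ?thesis .
  qed
  have s_hol: "s holomorphic_on UNIV"
    using holomorphic_on_compose_gen[OF _ B.theta_holomorphic, of "\<lambda>z. z / \<tau>" UNIV] t0
    by (simp add: o_def s_def[abs_def] holomorphic_on_divide holomorphic_on_ident holomorphic_on_const)
  have s_deriv: "deriv s z = deriv (theta (- 1 / \<tau>)) (z / \<tau>) / \<tau>" for z
  proof -
    have "(theta (- 1 / \<tau>) has_field_derivative deriv (theta (- 1 / \<tau>)) (z / \<tau>)) (at (z / \<tau>))"
      using B.theta_holomorphic holomorphic_derivI open_UNIV by blast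
    from DERIV_chain2[where g = "\<lambda>z. z / \<tau>" and x = z, OF this, of "1 / \<tau>" UNIV]
    have "(s has_field_derivative deriv (theta (- 1 / \<tau>)) (z / \<tau>) / \<tau>) (at z)"
      using DERIV_cdivide[OF DERIV_ident, where x = z and c = \<tau> and s = UNIV] by (simp add: s_def[abs_def])
    thus ?thesis by (rule DERIV_imp_deriv)
  qed
  have ld: "logderiv s z = logderiv (theta (- 1 / \<tau>)) (z / \<tau>) / \<tau>" for z
    by (simp add: logderiv_def s_deriv s_def)
  have sh1: "logderiv s (z + \<tau>) = logderiv s z" if "z \<notin> A.L" for z
    using B.logderiv_theta_add_1[of "z / \<tau>"] that t0 Lat[of z] by (simp add: ld add_divide_distrib)
  have sh2: "logderiv s (z + 1) = logderiv s z + 2 * of_real pi * \<i> / \<tau>" if "z \<notin> A.L" for z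
  proof -
    have "z + 1 \<notin> A.L" using that A.lattice_add_iff[of 1 z] by simp
    hence n: "(z + 1) / \<tau> \<notin> B.L" using Lat by blast
    have "(z + 1) / \<tau> + - 1 / \<tau> = z / \<tau>" using t0 by (simp add: field_simps)
    thus ?thesis using B.logderiv_theta_add_tau[OF n] by (simp add: ld add_divide_distrib diff_divide_distrib)
  qed
  have sl: "A.sigma_like s" unfolding A.sigma_like_def
  proof (intro conjI allI ballI impI)
    fix w assume "w \<in> A.L" thus "deriv s w \<noteq> 0" using Lat B.deriv_theta_nonzero t0 by (simp add: s_deriv)
  next
    fix \<omega> assume "\<omega> \<in> {\<tau>, 1}"
    thus "\<exists>\<eta>. \<forall>z. z \<notin> A.L \<longrightarrow> logderiv s (z + \<omega>) = logderiv s z + \<eta>"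
      using sh1 sh2 by (auto intro: exI[of _ 0] exI[of _ "2 * of_real pi * \<i> / \<tau>"])
  next
    fix z show "logderiv s (- z) = - logderiv s z"
    proof (rule logderiv_odd[OF s_hol])
      fix z show "s (- z) = - s z" using B.theta_uminus[of "z / \<tau>"] by (simp add: s_def)
    qed
  qed (use s_hol Lat B.theta_eq_0_iff s_def in auto)
  obtain C \<alpha> where C: "C \<noteq> 0" "\<And>z. s z = C * exp (\<alpha> * z\<^sup>2) * theta \<tau> z"
    "\<And>z. z \<notin> A.L \<Longrightarrow> logderiv s z = logderiv (theta \<tau>) z + 2 * \<alpha> * z"
    using A.sigma_like_quotient[OF sl A.sigma_like_theta] by metis
  obtain z0 where z0: "z0 \<notin> A.L" using A.exists_not_lattice by blast
  hence z0': "z0 + \<tau> \<notin> A.L" by (simp add: A.lattice_add_iff)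
  have "\<alpha> * \<tau> = of_real pi * \<i>"
  proof -
    have "logderiv (theta \<tau>) z0 + - 2 * of_real pi * \<i> + 2 * \<alpha> * (z0 + \<tau>) = logderiv (theta \<tau>) z0 + 2 * \<alpha> * z0"
      using sh1[OF z0] unfolding C(3)[OF z0] C(3)[OF z0'] A.logderiv_theta_add_tau[OF z0] .
    hence "2 * (\<alpha> * \<tau>) = 2 * (of_real pi * \<i>)" by (simp add: algebra_simps)
    thus ?thesis by simp
  qed
  hence "\<alpha> = of_real pi * \<i> / \<tau>" using t0 by (simp add: field_simps)
  hence "theta (- 1 / \<tau>) (z / \<tau>) = C * exp (of_real pi * \<i> * z\<^sup>2 / \<tau>) * theta \<tau> z" for z
    using C(2)[of z] by (simp add: s_def)
  thus ?thesis using that C(1) by blast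
qed

text \<open>The point is that \<epsilon> depends on \<tau> but not on the characteristic, so that
  characteristics of order 2 will suffice to determine it.\<close>

lemma sieg_inversion_aux:
  assumes "Im \<tau> > 0"
  obtains \<epsilon> where "\<epsilon> \<noteq> 0" "\<And>a b. sieg a b (- 1 / \<tau>) = \<epsilon> * sieg b (- a) \<tau>"
proof -
  have t0: "\<tau> \<noteq> 0" using assms by auto
  obtain C where C: "C \<noteq> 0" "\<And>z. theta (- 1 / \<tau>) (z / \<tau>) = C * exp (of_real pi * \<i> * z\<^sup>2 / \<tau>) * theta \<tau> z"
    using theta_inversion[OF assms] by blast
  define \<epsilon> where "\<epsilon> = C * exp (of_real pi * \<i> * (- 1 / \<tau> / 6 - \<tau> / 6))"
  have "sieg a b (- 1 / \<tau>) = \<epsilon> * sieg b (- a) \<tau>" for a b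
  proof -
    define z where "z = b * \<tau> - a"
    have z: "a * (- 1 / \<tau>) + b = z / \<tau>" using t0 by (simp add: z_def field_simps)
    have "sieg a b (- 1 / \<tau>) = \<i> * exp (of_real pi * \<i> * (a * (z / \<tau>) + (- 1 / \<tau>) / 6)) * theta (- 1 / \<tau>) (z / \<tau>)"
      by (simp only: sieg_def z)
    also have "\<dots> = \<i> * C * (exp (of_real pi * \<i> * (a * (z / \<tau>) + (- 1 / \<tau>) / 6)) * exp (of_real pi * \<i> * z\<^sup>2 / \<tau>)) * theta \<tau> z"
      unfolding C(2) by (simp add: mult_ac)
    also have "exp (of_real pi * \<i> * (a * (z / \<tau>) + (- 1 / \<tau>) / 6)) * exp (of_real pi * \<i> * z\<^sup>2 / \<tau>) =
       exp (of_real pi * \<i> * (- 1 / \<tau> / 6 - \<tau> / 6)) * exp (of_real pi * \<i> * (b * z + \<tau> / 6))"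
      unfolding exp_add[symmetric] using t0
      by (intro arg_cong[of _ _ exp]) (simp add: z_def field_simps power2_eq_square)
    finally show ?thesis by (simp add: sieg_def \<epsilon>_def z_def mult_ac)
  qed
  moreover have "\<epsilon> \<noteq> 0" using C(1) by (simp add: \<epsilon>_def)
  ultimately show ?thesis using that by blast
qed

lemma sieg_uminus: "Im \<tau> > 0 \<Longrightarrow> sieg (- a) (- b) \<tau> = - sieg a b \<tau>"
  using upper_lattice.theta_uminus[of \<tau> "a * \<tau> + b"]
  by (simp add: sieg_def upper_lattice_def algebra_simps)

lemma sieg_add_right: "Im \<tau> > 0 \<Longrightarrow> sieg a (b + 1) \<tau> = - exp (of_real pi * \<i> * a) * sieg a b \<tau>"
  using upper_lattice.theta_add_1[of \<tau> "a * \<tau> + b"]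
  by (simp add: sieg_def upper_lattice_def algebra_simps exp_add)

lemma sieg_add_left: "Im \<tau> > 0 \<Longrightarrow> sieg (a + 1) b \<tau> = - exp (- of_real pi * \<i> * b) * sieg a b \<tau>"
proof -
  assume *: "Im \<tau> > 0"
  define z where "z = a * \<tau> + b"
  have z: "(a + 1) * \<tau> + b = z + \<tau>" by (simp add: z_def algebra_simps)
  have "sieg (a + 1) b \<tau> = \<i> * exp (of_real pi * \<i> * ((a + 1) * (z + \<tau>) + \<tau> / 6)) *
      (exp ((- 2 * of_real pi * \<i>) * z + (of_real pi * \<i> - of_real pi * \<i> * \<tau>)) * theta \<tau> z)"
    unfolding sieg_def z using upper_lattice.theta_add_tau[of \<tau> z] * by (simp add: upper_lattice_def)
  also have "\<dots> = \<i> * (exp (of_real pi * \<i> * ((a + 1) * (z + \<tau>) + \<tau> / 6)) *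
      exp ((- 2 * of_real pi * \<i>) * z + (of_real pi * \<i> - of_real pi * \<i> * \<tau>))) * theta \<tau> z" by (simp only: mult_ac)
  also have "exp (of_real pi * \<i> * ((a + 1) * (z + \<tau>) + \<tau> / 6)) *
      exp ((- 2 * of_real pi * \<i>) * z + (of_real pi * \<i> - of_real pi * \<i> * \<tau>)) =
      exp (of_real pi * \<i>) * exp (- of_real pi * \<i> * b) * exp (of_real pi * \<i> * (a * z + \<tau> / 6))"
    unfolding exp_add[symmetric] by (intro arg_cong[of _ _ exp]) (simp add: z_def field_simps)
  finally show ?thesis by (simp add: sieg_def z_def mult_ac)
qed

lemma sieg_translation: "sieg a b (\<tau> + 1) = exp (of_real pi * \<i> / 6) * sieg a (a + b) \<tau>"
proof -
  have "ex (\<tau> + 1) = ex \<tau>" "ex (\<tau> + 1 - z) = ex (\<tau> - z)" for z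
    using ex_add[of "\<tau> - z" 1] by (simp_all add: ex_add algebra_simps)
  hence th: "theta (\<tau> + 1) = theta \<tau>" by (simp add: theta_def[abs_def])
  show ?thesis unfolding sieg_def th by (simp add: algebra_simps add_divide_distrib exp_add)
qed

section \<open>Siegel functions as functions of \<tau>\<close>

lemma open_upper_half_plane: "open upper_half_plane"
  by (simp add: open_halfspace_Im_gt)

lemma connected_upper_half_plane: "connected upper_half_plane"
  by (intro convex_connected convex_halfspace_Im_gt)

lemma qpoch_ex_holomorphic:
  assumes "f holomorphic_on upper_half_plane"
  shows "(\<lambda>\<tau>. qpoch (f \<tau>) (ex \<tau>)) holomorphic_on upper_half_plane"
  unfolding qpoch_def
proof (rule prodinf_holomorphic)
  fix z assume "z \<in> upper_half_plane"
  then obtain d where d: "d > 0" "cball z d \<subseteq> upper_half_plane"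
    using open_upper_half_plane open_contains_cball by blast
  have "continuous_on (cball z d) f"
    using assms d(2) holomorphic_on_imp_continuous_on holomorphic_on_subset by blast
  hence "bounded (f ` cball z d)" by (intro compact_imp_bounded compact_continuous_image) auto
  then obtain C where C: "C > 0" "\<And>w. w \<in> cball z d \<Longrightarrow> norm (f w) \<le> C"
    unfolding bounded_pos by blast
  have hc: "continuous_on (cball z d) (\<lambda>w. norm (ex w))" unfolding ex_def by (intro continuous_intros)
  have "cball z d \<noteq> {}" using d(1) by simp
  then obtain w0 where w0: "w0 \<in> cball z d" "\<And>w. w \<in> cball z d \<Longrightarrow> norm (ex w) \<le> norm (ex w0)"
    using continuous_attains_sup[OF compact_cball _ hc] by blast
  define r where "r = norm (ex w0)"
  have r: "r < 1" "r \<ge> 0" using w0(1) d(2) norm_ex_less_1[of w0] by (auto simp: r_def)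
  have "norm ((1 - f w * ex w ^ n) - 1) \<le> C * r ^ n" if "w \<in> cball z d" for w n
    using C(2)[OF that] w0(2)[OF that] C(1) r unfolding r_def[symmetric]
    by (simp add: norm_mult norm_power mult_mono power_mono)
  moreover have "summable (\<lambda>n. C * r ^ n)" using r by (intro summable_mult summable_geometric) auto
  ultimately show "\<exists>d>0. cball z d \<subseteq> upper_half_plane \<and> (\<exists>M. summable M \<and>
       (\<forall>n. \<forall>w\<in>cball z d. norm ((1 - f w * ex w ^ n) - 1) \<le> M n))"
    using d by blast
qed (use open_upper_half_plane assms in \<open>auto intro!: holomorphic_intros\<close>)

lemma sieg_holomorphic: "sieg a b holomorphic_on upper_half_plane"
proof -
  have "(\<lambda>\<tau>. qpoch (ex (a * \<tau> + b)) (ex \<tau>)) holomorphic_on upper_half_plane"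
    "(\<lambda>\<tau>. qpoch (ex (\<tau> - (a * \<tau> + b))) (ex \<tau>)) holomorphic_on upper_half_plane"
    by (intro qpoch_ex_holomorphic holomorphic_intros)+
  thus ?thesis unfolding sieg_def[abs_def] theta_def by (intro holomorphic_intros) auto
qed

lemma sieg_eq_0_iff:
  assumes "Im \<tau> > 0"
  shows "sieg (of_real a) (of_real b) \<tau> = 0 \<longleftrightarrow> a \<in> \<int> \<and> b \<in> \<int>"
proof -
  interpret upper_lattice \<tau> by standard fact
  have "sieg (of_real a) (of_real b) \<tau> = 0 \<longleftrightarrow> of_real a * \<tau> + of_real b \<in> L"
    by (simp add: sieg_def theta_eq_0_iff)
  also have "\<dots> \<longleftrightarrow> (\<exists>m n. a = of_int m \<and> b = of_int n)"
    unfolding lattice_iff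
  proof (intro ex_cong1 iffI)
    fix m n assume *: "of_real a * \<tau> + of_real b = of_int m * \<tau> + of_int n"
    from arg_cong[OF *, of Im] assms have "a = of_int m" by simp
    with arg_cong[OF *, of Re] show "a = of_int m \<and> b = of_int n" by simp
  qed auto
  also have "\<dots> \<longleftrightarrow> a \<in> \<int> \<and> b \<in> \<int>" by (auto simp: Ints_def)
  finally show ?thesis .
qed

lemma half_not_Ints: "(1 / 2 :: real) \<notin> \<int>"
proof
  assume "(1 / 2 :: real) \<in> \<int>"
  then obtain n :: int where "1 / 2 = (of_int n :: real)" by (auto simp: Ints_def)
  hence "of_int (2 * n) = (1 :: real)" by simp
  hence "2 * n = 1" by linarith
  thus False by presburger
qed

lemma Im_moebius:
  assumes "Im \<tau> > 0" "a * d - b * c = (1::int)"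
  shows "of_int c * \<tau> + of_int d \<noteq> (0::complex)"
    "Im ((of_int a * \<tau> + of_int b) / (of_int c * \<tau> + of_int d)) = Im \<tau> / norm (of_int c * \<tau> + of_int d) ^ 2"
    "Im ((of_int a * \<tau> + of_int b) / (of_int c * \<tau> + of_int d)) > 0"
proof -
  show 1: "of_int c * \<tau> + of_int d \<noteq> (0::complex)"
  proof
    assume *: "of_int c * \<tau> + of_int d = (0::complex)"
    from arg_cong[OF *, of Im] assms have "c = 0" by simp
    with * have "d = 0" by simp
    with \<open>c = 0\<close> assms show False by simp
  qed
  have "of_int a * of_int d - of_int b * of_int c = (1::real)"
    using assms(2) by (metis of_int_1 of_int_diff of_int_mult)
  hence "of_int a * Im \<tau> * (of_int c * Re \<tau> + of_int d) - (of_int a * Re \<tau> + of_int b) * (of_int c * Im \<tau>) = Im \<tau>"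
    by (simp add: algebra_simps)
  thus 2: "Im ((of_int a * \<tau> + of_int b) / (of_int c * \<tau> + of_int d)) = Im \<tau> / norm (of_int c * \<tau> + of_int d) ^ 2"
    by (simp add: Im_divide cmod_power2)
  show "Im ((of_int a * \<tau> + of_int b) / (of_int c * \<tau> + of_int d)) > 0"
    unfolding 2 using 1 assms by simp
qed

lemma Im_inversion: "Im \<tau> > 0 \<Longrightarrow> Im (- 1 / \<tau>) > 0"
  using Im_moebius(3)[of \<tau> 0 0 "- 1" 1] by simp

lemma exp_pi_i_half: "exp (of_real pi * \<i> / 2) = \<i>"
  using exp_Euler[of "of_real (pi / 2)"] by (simp add: mult_ac cos_of_real sin_of_real)

lemma ex_half: "ex (1 / 2) = - 1" by (simp add: ex_def)

text \<open>Up to a root of unity this is the square of Weber's identity f f1 f2 = sqrt 2; it comes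
  down to Euler's identity. It serves to determine the constant in the inversion law.\<close>

lemma sieg_level_2:
  assumes "Im \<tau> > 0"
  shows "sieg (1/2) 0 \<tau> * sieg 0 (1/2) \<tau> * sieg (1/2) (1/2) \<tau> = 2 * \<i> ^ 3 * exp (of_real pi * \<i> * (- 3 / 4))"
proof -
  define r where "r = ex (\<tau> / 2)"
  have rq: "r ^ 2 = ex \<tau>" by (simp add: r_def ex_add[symmetric] power2_eq_square)
  have nq: "norm (ex \<tau>) < 1" using assms by (rule norm_ex_less_1)
  have t1: "theta \<tau> (\<tau> / 2) = exp (- of_real pi * \<i> * (\<tau> / 2)) * qpoch r (ex \<tau>) ^ 2"
    by (simp add: theta_def r_def power2_eq_square)
  have "qpoch (- 1) (ex \<tau>) = 2 * qpoch (- ex \<tau>) (ex \<tau>)" by (subst qpoch_rec[OF nq]) simp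
  hence t2: "theta \<tau> (1 / 2) = exp (- of_real pi * \<i> * (1 / 2)) * 2 * qpoch (- ex \<tau>) (ex \<tau>) ^ 2"
    using ex_diff[of \<tau> "1/2"] ex_half by (simp add: theta_def power2_eq_square)
  have "ex (\<tau> - (\<tau> / 2 + 1 / 2)) = - r" using ex_diff[of "\<tau> / 2" "1/2"] ex_half
    by (simp add: r_def diff_diff_eq[symmetric])
  moreover have "ex (\<tau> / 2 + 1 / 2) = - r" using ex_add[of "\<tau> / 2" "1/2"] ex_half by (simp add: r_def)
  ultimately have t3: "theta \<tau> (\<tau> / 2 + 1 / 2) = exp (- of_real pi * \<i> * (\<tau> / 2 + 1 / 2)) * qpoch (- r) (ex \<tau>) ^ 2"
    by (simp only: theta_def power2_eq_square mult.assoc)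
  have one: "qpoch r (ex \<tau>) ^ 2 * qpoch (- ex \<tau>) (ex \<tau>) ^ 2 * qpoch (- r) (ex \<tau>) ^ 2 = 1"
  proof -
    have "qpoch r (ex \<tau>) * qpoch (- r) (ex \<tau>) = qpoch (ex \<tau>) ((ex \<tau>)\<^sup>2)" using qpoch_uminus[OF nq, of r] rq by simp
    hence "(qpoch r (ex \<tau>) * qpoch (- r) (ex \<tau>) * qpoch (- ex \<tau>) (ex \<tau>)) ^ 2 = 1"
      using qpoch_euler[OF nq] by simp
    thus ?thesis by (simp add: power_mult_distrib mult_ac)
  qed
  have "sieg (1/2) 0 \<tau> * sieg 0 (1/2) \<tau> * sieg (1/2) (1/2) \<tau> = 2 * \<i> ^ 3 *
     (exp (of_real pi * \<i> * (1 / 2 * (\<tau> / 2) + \<tau> / 6)) * exp (of_real pi * \<i> * (\<tau> / 6)) *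
      exp (of_real pi * \<i> * (1 / 2 * (\<tau> / 2 + 1 / 2) + \<tau> / 6)) * exp (- of_real pi * \<i> * (\<tau> / 2)) *
      exp (- of_real pi * \<i> * (1 / 2)) * exp (- of_real pi * \<i> * (\<tau> / 2 + 1 / 2))) *
     (qpoch r (ex \<tau>) ^ 2 * qpoch (- ex \<tau>) (ex \<tau>) ^ 2 * qpoch (- r) (ex \<tau>) ^ 2)"
    using t1 t2 t3 by (simp add: sieg_def power3_eq_cube mult_ac)
  also have "exp (of_real pi * \<i> * (1 / 2 * (\<tau> / 2) + \<tau> / 6)) * exp (of_real pi * \<i> * (\<tau> / 6)) *
      exp (of_real pi * \<i> * (1 / 2 * (\<tau> / 2 + 1 / 2) + \<tau> / 6)) * exp (- of_real pi * \<i> * (\<tau> / 2)) *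
      exp (- of_real pi * \<i> * (1 / 2)) * exp (- of_real pi * \<i> * (\<tau> / 2 + 1 / 2)) =
      exp (of_real pi * \<i> * (- 3 / 4))"
    unfolding exp_add[symmetric] by (intro arg_cong[of _ _ exp]) (simp add: field_simps)
  finally show ?thesis using one by simp
qed

text \<open>The level 2 product is the same constant at \<tau> and at -1/\<tau>, which forces the
  cube of the factor to be i. By continuity the factor is then constant, and at the fixed point
  \<tau> = i its square is -1; together this leaves only -i.\<close>

lemma sieg_inversion:
  assumes "Im \<tau> > 0"
  shows "sieg a b (- 1 / \<tau>) = - \<i> * sieg b (- a) \<tau>"
proof -
  define e where "e \<tau> = sieg (1/2) 0 (- 1 / \<tau>) / sieg 0 (- 1/2) \<tau>" for \<tau>
  have nz: "sieg 0 (- 1/2) \<tau> \<noteq> 0" "sieg (1/2) 0 \<tau> \<noteq> 0" if "Im \<tau> > 0" for \<tau>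
    using sieg_eq_0_iff[OF that, of 0 "- 1/2"] sieg_eq_0_iff[OF that, of "1/2" 0] half_not_Ints
      minus_in_Ints_iff[of "1/2::real"] by auto
  have law: "sieg a b (- 1 / \<tau>) = e \<tau> * sieg b (- a) \<tau>" if \<tau>: "Im \<tau> > 0" for \<tau> a b
  proof -
    obtain \<epsilon> where \<epsilon>: "\<epsilon> \<noteq> 0" "\<And>a b. sieg a b (- 1 / \<tau>) = \<epsilon> * sieg b (- a) \<tau>"
      using sieg_inversion_aux[OF \<tau>] by metis
    have "e \<tau> = \<epsilon>" using \<epsilon>(2)[of "1/2" 0] nz(1)[OF \<tau>] by (simp add: e_def)
    thus ?thesis using \<epsilon>(2) by simp
  qed
  have cube: "e \<tau> ^ 3 = \<i>" if \<tau>: "Im \<tau> > 0" for \<tau>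
  proof -
    define K where "K = 2 * \<i> ^ 3 * exp (of_real pi * \<i> * (- 3 / 4))"
    have K: "K \<noteq> 0" by (simp add: K_def)
    have s2: "sieg 0 (1/2) \<tau> = - sieg 0 (- 1/2) \<tau>" using sieg_add_right[OF \<tau>, of 0 "- 1/2"] by simp
    have s3: "sieg (1/2) (1/2) \<tau> = - \<i> * sieg (1/2) (- 1/2) \<tau>"
      using sieg_add_right[OF \<tau>, of "1/2" "- 1/2"] exp_pi_i_half by simp
    have "K = sieg (1/2) 0 (- 1 / \<tau>) * sieg 0 (1/2) (- 1 / \<tau>) * sieg (1/2) (1/2) (- 1 / \<tau>)"
      using sieg_level_2[OF Im_inversion[OF \<tau>]] by (simp add: K_def)
    also have "\<dots> = e \<tau> ^ 3 * (sieg (1/2) 0 \<tau> * sieg 0 (- 1/2) \<tau> * sieg (1/2) (- 1/2) \<tau>)"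
      using law[OF \<tau>] by (simp add: power3_eq_cube)
    also have "sieg (1/2) 0 \<tau> * sieg 0 (- 1/2) \<tau> * sieg (1/2) (- 1/2) \<tau> = - \<i> * K"
    proof -
      have "K = \<i> * (sieg (1/2) 0 \<tau> * sieg 0 (- 1/2) \<tau> * sieg (1/2) (- 1/2) \<tau>)"
        using sieg_level_2[OF \<tau>, folded K_def] unfolding s2 s3 by (simp add: mult_ac)
      thus ?thesis by (simp add: mult.assoc[symmetric])
    qed
    finally have "K * (e \<tau> ^ 3 * (- \<i>)) = K * 1" by (simp add: mult_ac)
    hence "e \<tau> ^ 3 * (- \<i>) = 1" using K by (simp only: mult_cancel_left) simp
    hence "e \<tau> ^ 3 * (- \<i>) * \<i> = \<i>" by (simp only: mult_1_left)
    thus ?thesis by (simp add: mult.assoc)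
  qed
  have "(\<lambda>\<tau>. - 1 / \<tau>) holomorphic_on upper_half_plane" by (intro holomorphic_intros) auto
  moreover have "(\<lambda>\<tau>. - 1 / \<tau>) ` upper_half_plane \<subseteq> upper_half_plane" using Im_inversion by auto
  ultimately have "(\<lambda>\<tau>. sieg (1/2) 0 (- 1 / \<tau>)) holomorphic_on upper_half_plane"
    using holomorphic_on_compose_gen[OF _ sieg_holomorphic] by (simp add: o_def)
  hence "e holomorphic_on upper_half_plane" unfolding e_def[abs_def]
    using nz by (intro holomorphic_intros sieg_holomorphic) auto
  hence ec: "continuous_on upper_half_plane e" by (rule holomorphic_on_imp_continuous_on)
  have "finite (e ` upper_half_plane)"
    by (rule finite_subset[OF _ finite_nth_roots[of 3 \<i>]]) (use cube in auto)
  hence const: "e constant_on upper_half_plane"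
    using continuous_finite_range_constant[OF connected_upper_half_plane ec] by blast
  have i: "Im \<i> > 0" "- 1 / \<i> = \<i>" by (auto simp: complex_eq_iff)
  have "sieg (1/2) 0 \<i> = e \<i> * sieg 0 (- 1/2) \<i>" using law[OF i(1), of "1/2" 0] i(2) by simp
  also have "sieg 0 (- 1/2) \<i> = e \<i> * sieg (- 1/2) 0 \<i>" using law[OF i(1), of 0 "- 1/2"] i(2) by simp
  also have "sieg (- 1/2) 0 \<i> = - sieg (1/2) 0 \<i>" using sieg_uminus[OF i(1), of "1/2" 0] by simp
  finally have *: "sieg (1/2) 0 \<i> = e \<i> * (e \<i> * - sieg (1/2) 0 \<i>)" .
  have "(e \<i> ^ 2 + 1) * sieg (1/2) 0 \<i> = sieg (1/2) 0 \<i> - e \<i> * (e \<i> * - sieg (1/2) 0 \<i>)"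
    by (simp add: power2_eq_square algebra_simps)
  also have "\<dots> = 0" by (rule right_minus_eq[THEN iffD2, OF *])
  finally have "(e \<i> ^ 2 + 1) * sieg (1/2) 0 \<i> = 0" .
  hence "e \<i> ^ 2 = - 1" using nz(2)[OF i(1)] by (simp add: eq_neg_iff_add_eq_0)
  moreover have "e \<i> ^ 3 = e \<i> ^ 2 * e \<i>" by (simp add: power2_eq_square power3_eq_cube)
  ultimately have "- e \<i> = \<i>" using cube[OF i(1)] by simp
  hence "e \<i> = - \<i>" by (metis minus_minus)
  hence "e \<tau> = - \<i>" using const assms i(1) by (auto simp: constant_on_def)
  thus ?thesis using law[OF assms] by simp
qed

lemma sieg_translation_int: "sieg a b (\<tau> + of_int k) = exp (of_real pi * \<i> / 6) powi k * sieg a (b + of_int k * a) \<tau>"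
proof -
  define w where "w = exp (of_real pi * \<i> / 6)"
  have w: "w \<noteq> 0" by (simp add: w_def)
  have "\<forall>b. sieg a b (\<tau> + of_int k) = w powi k * sieg a (b + of_int k * a) \<tau>"
  proof (induction k rule: int_induct[of _ 0])
    case (step1 i)
    show ?case
    proof
      fix b
      have "sieg a b (\<tau> + of_int (i + 1)) = w * sieg a (a + b) (\<tau> + of_int i)"
        using sieg_translation[of a b "\<tau> + of_int i"] by (simp add: w_def add_ac)
      also have "\<dots> = w powi (i + 1) * sieg a (b + of_int (i + 1) * a) \<tau>"
        using step1 w by (simp add: power_int_add algebra_simps)
      finally show "sieg a b (\<tau> + of_int (i + 1)) = w powi (i + 1) * sieg a (b + of_int (i + 1) * a) \<tau>" .
    qed
  next
    case (step2 i)
    show ?case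
    proof
      fix b
      have "w * sieg a b (\<tau> + of_int (i - 1)) = sieg a (b - a) (\<tau> + of_int i)"
        using sieg_translation[of a "b - a" "\<tau> + of_int (i - 1)"] by (simp add: w_def add_ac)
      also have "\<dots> = w * (w powi (i - 1) * sieg a (b + of_int (i - 1) * a) \<tau>)"
        using step2 w by (simp add: power_int_diff algebra_simps)
      finally show "sieg a b (\<tau> + of_int (i - 1)) = w powi (i - 1) * sieg a (b + of_int (i - 1) * a) \<tau>"
        using w by simp
    qed
  qed simp
  thus ?thesis by (simp add: w_def)
qed

lemma w12: "(exp (of_real pi * \<i> / 6)) ^ 12 = (1::complex)"
proof -
  have "(exp (of_real pi * \<i> / 6)) ^ 12 = ex 1"
    unfolding ex_def exp_of_nat_mult[symmetric] by (intro arg_cong[of _ _ exp]) simp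
  thus ?thesis by simp
qed

lemma w12_powi: "((exp (of_real pi * \<i> / 6)) powi k) ^ 12 = (1::complex)"
  by (metis w12 mult.commute power_int_1_left power_int_mult power_int_of_nat)

text \<open>Euclid's algorithm on the lower row: a translation reduces d modulo c, an inversion
  exchanges the two. All multipliers met on the way are powers of exp(\<pi> i / 6).\<close>

theorem sieg_SL2:
  assumes "a * d - b * c = (1::int)"
  obtains \<epsilon> where "\<epsilon> ^ 12 = 1"
    "\<And>r s \<tau>. Im \<tau> > 0 \<Longrightarrow> sieg r s ((of_int a * \<tau> + of_int b) / (of_int c * \<tau> + of_int d)) =
        \<epsilon> * sieg (r * of_int a + s * of_int c) (r * of_int b + s * of_int d) \<tau>"
proof -
  have "\<exists>\<epsilon>. \<epsilon> ^ 12 = 1 \<and> (\<forall>r s \<tau>. Im \<tau> > 0 \<longrightarrow>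
      sieg r s ((of_int a * \<tau> + of_int b) / (of_int c * \<tau> + of_int d)) =
        \<epsilon> * sieg (r * of_int a + s * of_int c) (r * of_int b + s * of_int d) \<tau>)"
    using assms
  proof (induction "nat \<bar>c\<bar>" arbitrary: a b c d rule: less_induct)
    case less
    let ?w = "exp (of_real pi * \<i> / 6) :: complex"
    show ?case
    proof (cases "c = 0")
      case True
      hence ad: "a * d = 1" using less.prems by simp
      hence "a = 1 \<and> d = 1 \<or> a = - 1 \<and> d = - 1" using zmult_eq_1_iff by simp
      thus ?thesis
      proof
        assume 1: "a = 1 \<and> d = 1"
        show ?thesis by (rule exI[of _ "?w powi b"])
          (use True 1 in \<open>auto simp: sieg_translation_int w12_powi mult.commute[of _ "of_int b"] add.commute\<close>)
      next
        assume 1: "a = - 1 \<and> d = - 1"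
        have "sieg r s ((of_int a * \<tau> + of_int b) / (of_int c * \<tau> + of_int d)) =
          - (?w powi (- b)) * sieg (r * of_int a + s * of_int c) (r * of_int b + s * of_int d) \<tau>" if "Im \<tau> > 0" for r s \<tau>
        proof -
          have "(of_int a * \<tau> + of_int b) / (of_int c * \<tau> + of_int d) = \<tau> + of_int (- b)"
            using True 1 by simp
          moreover have "sieg (r * of_int a + s * of_int c) (r * of_int b + s * of_int d) \<tau> = - sieg r (s + of_int (- b) * r) \<tau>"
            using sieg_uminus[OF that, of r "s - of_int b * r"] True 1 by (simp add: algebra_simps)
          ultimately show ?thesis by (simp only: sieg_translation_int) simp
        qed
        moreover have "(- (?w powi (- b))) ^ 12 = 1" using w12_powi[of "- b"] by simp
        ultimately show ?thesis by blast
      qed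
    next
      case False
      \<comment> \<open>Chosen such that d + k c = d mod c, which becomes the new lower left
        entry.\<close>
      define k where "k = - (d div c)"
      define b' where "b' = b + k * a"
      define d' where "d' = d + k * c"
      have d': "d' = d mod c" by (simp add: d'_def k_def minus_div_mult_eq_mod)
      have "nat \<bar>d'\<bar> < nat \<bar>c\<bar>" using False abs_mod_less[of c d] by (simp add: d')
      moreover have "b' * (- c) - (- a) * d' = 1" using less.prems by (simp add: b'_def d'_def algebra_simps)
      ultimately obtain \<epsilon> where \<epsilon>: "\<epsilon> ^ 12 = 1" and law: "\<And>r s \<tau>. Im \<tau> > 0 \<Longrightarrow>
          sieg r s ((of_int b' * \<tau> + of_int (- a)) / (of_int d' * \<tau> + of_int (- c))) =
        \<epsilon> * sieg (r * of_int b' + s * of_int d') (r * of_int (- a) + s * of_int (- c)) \<tau>"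
        using less.hyps[of d' b' "- c" "- a"] by blast
      have "sieg r s ((of_int a * \<tau> + of_int b) / (of_int c * \<tau> + of_int d)) =
          (\<epsilon> * \<i> * ?w powi (- k)) * sieg (r * of_int a + s * of_int c) (r * of_int b + s * of_int d) \<tau>" if \<tau>: "Im \<tau> > 0" for r s \<tau>
      proof -
        define \<tau>1 where "\<tau>1 = \<tau> + of_int (- k)"
        have im1: "Im \<tau>1 > 0" using \<tau> by (simp add: \<tau>1_def)
        hence n1: "\<tau>1 \<noteq> 0" by auto
        have c1: "of_int b' * (- 1 / \<tau>1) + of_int (- a) = - (of_int a * \<tau> + of_int b) / \<tau>1"
          "of_int d' * (- 1 / \<tau>1) + of_int (- c) = - (of_int c * \<tau> + of_int d) / \<tau>1"
          using n1 by (simp_all add: field_simps) (simp_all add: \<tau>1_def b'_def d'_def algebra_simps)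
        have arg: "(of_int a * \<tau> + of_int b) / (of_int c * \<tau> + of_int d) =
           (of_int b' * (- 1 / \<tau>1) + of_int (- a)) / (of_int d' * (- 1 / \<tau>1) + of_int (- c))"
        proof -
          have "x / y = (- x / \<tau>1) / (- y / \<tau>1)" for x y :: complex
            using n1 by (cases "y = 0") (simp_all add: field_simps)
          thus ?thesis unfolding c1 .
        qed
        have "sieg r s ((of_int a * \<tau> + of_int b) / (of_int c * \<tau> + of_int d)) =
          \<epsilon> * sieg (r * of_int b' + s * of_int d') (r * of_int (- a) + s * of_int (- c)) (- 1 / \<tau>1)"
          unfolding arg by (rule law[OF Im_inversion[OF im1]])
        also have "\<dots> = \<epsilon> * (- \<i>) * sieg (- (r * of_int a + s * of_int c)) (- (r * of_int b' + s * of_int d')) \<tau>1"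
          unfolding sieg_inversion[OF im1] by (simp add: algebra_simps)
        also have "\<dots> = \<epsilon> * \<i> * sieg (r * of_int a + s * of_int c) (r * of_int b' + s * of_int d') \<tau>1"
          unfolding sieg_uminus[OF im1] by simp
        also have "\<dots> = \<epsilon> * \<i> * ?w powi (- k) * sieg (r * of_int a + s * of_int c)
            (r * of_int b' + s * of_int d' + of_int (- k) * (r * of_int a + s * of_int c)) \<tau>"
          unfolding \<tau>1_def sieg_translation_int by simp
        also have "r * of_int b' + s * of_int d' + of_int (- k) * (r * of_int a + s * of_int c) = r * of_int b + s * of_int d"
          by (simp add: b'_def d'_def algebra_simps)
        finally show ?thesis .
      qed
      moreover have "(\<epsilon> * \<i> * ?w powi (- k)) ^ 12 = 1"
        unfolding power_mult_distrib w12_powi \<epsilon> by (simp add: eval_nat_numeral)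
      ultimately show ?thesis by blast
    qed
  qed
  thus ?thesis using that by blast
qed

text \<open>Here the exact multiplier matters, whereas \<open>sieg_SL2\<close> only bounds its
  order: the divisibility by 12 of the sum of the exponents will be read off from it. The map is an
  inversion, a translation by -1 and another inversion.\<close>

lemma sieg_lower_unipotent:
  assumes "Im \<tau> > 0"
  shows "sieg r s (\<tau> / (\<tau> + 1)) = exp (- (of_real pi * \<i> / 6)) * sieg (r + s) s \<tau>"
proof -
  define \<tau>1 where "\<tau>1 = - 1 / \<tau> + of_int (- 1)"
  have t: "\<tau> \<noteq> 0" "\<tau> + 1 \<noteq> 0" using assms by (auto simp: complex_eq_iff)
  have im1: "Im (- 1 / \<tau>) > 0" using Im_inversion assms by blast
  hence im: "Im \<tau>1 > 0" by (simp add: \<tau>1_def)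
  have "\<tau>1 \<noteq> 0" using im by auto
  have "\<tau>1 = - (\<tau> + 1) / \<tau>" using t by (simp add: \<tau>1_def field_simps)
  hence "\<tau> / (\<tau> + 1) * \<tau>1 = - 1" using t by (simp add: divide_simps) (simp add: algebra_simps)
  hence "\<tau> / (\<tau> + 1) = - 1 / \<tau>1" using \<open>\<tau>1 \<noteq> 0\<close> by (metis nonzero_eq_divide_eq)
  hence "sieg r s (\<tau> / (\<tau> + 1)) = - \<i> * sieg s (- r) \<tau>1" using sieg_inversion[OF im] by simp
  also have "\<dots> = - \<i> * exp (- (of_real pi * \<i> / 6)) * sieg s (- r - s) (- 1 / \<tau>)"
    unfolding \<tau>1_def sieg_translation_int by (simp add: exp_minus power_int_minus)
  also have "\<dots> = - exp (- (of_real pi * \<i> / 6)) * sieg (- (r + s)) (- s) \<tau>"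
    unfolding sieg_inversion[OF assms] by (simp add: mult_ac)
  finally show ?thesis using sieg_uminus[OF assms, of "r + s" s] by simp
qed

section \<open>Algebraic lemmas\<close>

interpretation rat_vs: vector_space "\<lambda>(r::rat) (x::complex). of_rat r * x"
  by standard (auto simp: of_rat_add of_rat_mult algebra_simps)

interpretation rat_vs_1: vector_space "(*) :: rat \<Rightarrow> rat \<Rightarrow> rat"
  by standard (auto simp: algebra_simps)

text \<open>Used twice: to measure divisibility in the ring generated by a root of unity, and to
  make the coefficients of a relation rational.\<close>

lemma exists_rat_functional:
  assumes "(c::complex) \<noteq> 0"
  obtains lam :: "complex \<Rightarrow> rat" where "lam c = 1" "\<And>x y. lam (x + y) = lam x + lam y" "\<And>r x. lam (of_rat r * x) = r * lam x"
proof -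
  interpret vector_space_pair "\<lambda>(r::rat) (x::complex). of_rat r * x" "(*) :: rat \<Rightarrow> rat \<Rightarrow> rat" ..
  have "rat_vs.independent {c}" using assms by (simp add: rat_vs.independent_insert)
  from linear_independent_extend[OF this, of "\<lambda>_. 1"]
  obtain g where g: "Vector_Spaces.linear (\<lambda>(r::rat) (x::complex). of_rat r * x) (*) g" "g c = 1" by auto
  show ?thesis
    by (rule that[of g]) (use g linear_add[OF g(1)] linear_scale[OF g(1)] in auto)
qed

lemma functional_sum:
  assumes "\<And>x y. lam (x + y) = lam x + lam (y::complex)"
  shows "lam (\<Sum>i\<in>A. f i) = (\<Sum>i\<in>A. lam (f i) :: rat)"
proof -
  have 0: "lam 0 = 0" using assms[of 0 0] by simp
  show ?thesis by (induction A rule: infinite_finite_induct) (auto simp: assms 0)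
qed

text \<open>Take for k the product of the primes that divide M but not a. Then every prime divisor
  of M divides exactly one of \<open>a\<close> and \<open>k * d\<close>.\<close>

lemma coprime_shift:
  fixes a d M :: int
  assumes "gcd a (gcd d M) = 1" "M \<noteq> 0"
  obtains k where "coprime (a + k * d) M"
proof -
  define k where "k = \<Prod>{p. prime p \<and> p dvd M \<and> \<not> p dvd a}"
  have fin: "finite {p. prime p \<and> p dvd M \<and> \<not> p dvd a}"
    by (rule finite_subset[OF _ finite_divisors_int[OF assms(2)]]) auto
  have "coprime (a + k * d) M"
  proof (rule ccontr)
    assume "\<not> coprime (a + k * d) M"
    then obtain p where p: "prime p" "p dvd a + k * d" "p dvd M"
      using coprime_iff_gcd_eq_1 prime_divisor_exists[of "gcd (a + k * d) M"] assms(2)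
      by (metis dvd_gcdD1 dvd_gcdD2 gcd_eq_0_iff is_unit_gcd)
    show False
    proof (cases "p dvd a")
      case True
      hence "p dvd k * d" using p(2) by (simp add: dvd_add_right_iff)
      hence "p dvd k \<or> p dvd d" using p(1) prime_dvd_mult_iff by blast
      moreover have "\<not> p dvd d" using True p assms(1) by (metis gcd_greatest_iff not_prime_unit)
      ultimately have "p dvd k" by blast
      then obtain r where "prime r" "\<not> r dvd a" "p dvd r"
        unfolding k_def using p(1) fin by (auto simp: prime_dvd_prod_iff)
      thus False using True p(1) primes_dvd_imp_eq by blast
    next
      case False
      hence "p dvd k" unfolding k_def using p fin by (intro dvd_prodI[of _ p "\<lambda>x. x", simplified]) auto
      thus False using False p(2) by (metis dvd_add_left_iff dvd_mult2)
    qed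
  qed
  thus ?thesis using that by blast
qed

text \<open>Integer polynomials in one variable, as functions on \<complex>. The coefficients of the
  expansions at the cusps will be values of such functions at roots of unity, and closure under the
  ring operations is what has to be tracked.\<close>

inductive_set zpol :: "(complex \<Rightarrow> complex) set" where
  const: "(\<lambda>_. of_int c) \<in> zpol"
| ident: "(\<lambda>w. w) \<in> zpol"
| add: "f \<in> zpol \<Longrightarrow> g \<in> zpol \<Longrightarrow> (\<lambda>w. f w + g w) \<in> zpol"
| mult: "f \<in> zpol \<Longrightarrow> g \<in> zpol \<Longrightarrow> (\<lambda>w. f w * g w) \<in> zpol"

lemma zpol_0: "(\<lambda>_. 0) \<in> zpol" using zpol.const[of 0] by simp
lemma zpol_1: "(\<lambda>_. 1) \<in> zpol" using zpol.const[of 1] by simp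
lemma zpol_uminus: "f \<in> zpol \<Longrightarrow> (\<lambda>w. - f w) \<in> zpol" using zpol.mult[OF zpol.const[of "- 1"]] by simp
lemma zpol_diff: "f \<in> zpol \<Longrightarrow> g \<in> zpol \<Longrightarrow> (\<lambda>w. f w - g w) \<in> zpol"
  using zpol.add[OF _ zpol_uminus] by simp
lemma zpol_power: "f \<in> zpol \<Longrightarrow> (\<lambda>w. f w ^ n) \<in> zpol"
  by (induction n) (auto intro: zpol.mult zpol_1)
lemma zpol_sum: "(\<And>i. i \<in> A \<Longrightarrow> f i \<in> zpol) \<Longrightarrow> (\<lambda>w. \<Sum>i\<in>A. f i w) \<in> zpol"
  by (induction A rule: infinite_finite_induct) (auto intro: zpol.add zpol_0)
lemma zpol_comp_power: "f \<in> zpol \<Longrightarrow> (\<lambda>w. f (w ^ n)) \<in> zpol"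
  by (induction rule: zpol.induct) (auto intro: zpol.intros zpol_power)

text \<open>The congruence f(w^l) \<equiv> f(w)^l modulo l: Fermat's little theorem for constants,
  divisibility of binomial coefficients for sums.\<close>

lemma zpol_frobenius:
  assumes "prime l" "f \<in> zpol"
  shows "\<exists>g\<in>zpol. \<forall>w. f (w ^ l) = f w ^ l + of_nat l * g w"
  using assms(2)
proof (induction rule: zpol.induct)
  case (const c)
  have "[c ^ l = c] (mod int l)"
  proof (cases "int l dvd c")
    case True
    hence "int l dvd c ^ l" using assms(1) by (metis dvd_power_same dvd_trans dvd_power prime_gt_0_nat)
    with True show ?thesis by (simp add: cong_iff_dvd_diff)
  next
    case False
    have "[c ^ (l - 1) = 1] (mod int l)"
    proof -
      have "prime (int l)" using assms(1) by simp
      hence "coprime c (int l)" using False prime_imp_coprime coprime_commute by blast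
      define a where "a = nat (c mod int l)"
      have l: "l > 0" using assms(1) prime_gt_0_nat by blast
      have ca: "[c = int a] (mod int l)" using l by (simp add: a_def cong_def)
      have "\<not> l dvd a" using False ca cong_dvd_iff[of c "int a" "int l"] by auto
      hence "[a ^ (l - 1) = 1] (mod l)" using fermat_theorem assms(1) by blast
      hence "[int a ^ (l - 1) = 1] (mod int l)" by (metis cong_int_iff of_nat_1 of_nat_power)
      thus ?thesis using ca cong_pow cong_trans by blast
    qed
    hence "[c ^ (l - 1) * c = 1 * c] (mod int l)" by (intro cong_mult) auto
    thus ?thesis using assms(1) by (metis mult_1 power_minus_mult prime_gt_0_nat)
  qed
  hence "int l dvd c - c ^ l" by (simp add: cong_iff_dvd_diff dvd_diff_commute)
  then obtain k where "c - c ^ l = int l * k" by blast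
  hence "c = c ^ l + int l * k" by simp
  hence "complex_of_int c = of_int (c ^ l + int l * k)" by (rule arg_cong)
  thus ?case by (intro bexI[of _ "\<lambda>_. of_int k"]) (auto intro: zpol.const)
next
  case ident thus ?case by (intro bexI[of _ "\<lambda>_. 0"]) (auto intro: zpol_0)
next
  case (add f g)
  then obtain f' g' where fg: "f' \<in> zpol" "g' \<in> zpol" "\<And>w. f (w ^ l) = f w ^ l + of_nat l * f' w"
    "\<And>w. g (w ^ l) = g w ^ l + of_nat l * g' w" by blast
  define h where "h w = (\<Sum>k\<in>{1..<l}. of_int (int ((l choose k) div l)) * (f w ^ k * g w ^ (l - k)))" for w
  have h: "h \<in> zpol" unfolding h_def[abs_def]
    by (intro zpol_sum zpol.mult zpol.const zpol_power add)
  have "(f w + g w) ^ l = f w ^ l + g w ^ l + of_nat l * h w" for w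
  proof -
    have l: "l \<ge> 2" using assms(1) prime_ge_2_nat by blast
    have "(f w + g w) ^ l = (\<Sum>k\<le>l. of_nat (l choose k) * f w ^ k * g w ^ (l - k))" by (rule binomial_ring)
    also have "{..l} = insert 0 (insert l {1..<l})" using l by auto
    also have "(\<Sum>k\<in>insert 0 (insert l {1..<l}). of_nat (l choose k) * f w ^ k * g w ^ (l - k)) =
       g w ^ l + (f w ^ l + (\<Sum>k\<in>{1..<l}. of_nat (l choose k) * f w ^ k * g w ^ (l - k)))" using l by simp
    also have "(\<Sum>k\<in>{1..<l}. of_nat (l choose k) * f w ^ k * g w ^ (l - k)) = of_nat l * h w"
      unfolding h_def sum_distrib_left
    proof (rule sum.cong)
      fix k assume k: "k \<in> {1..<l}"
      hence "l dvd (l choose k)" using assms(1) by (intro dvd_choose_prime) auto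
      hence "l * ((l choose k) div l) = (l choose k)" by simp
      hence "of_nat (l choose k) = (of_nat l * of_nat ((l choose k) div l) :: complex)" by (metis of_nat_mult)
      thus "of_nat (l choose k) * f w ^ k * g w ^ (l - k) = of_nat l * (of_int (int ((l choose k) div l)) * (f w ^ k * g w ^ (l - k)))"
        by (simp add: mult_ac)
    qed simp
    finally show ?thesis by simp
  qed
  hence "f (w ^ l) + g (w ^ l) = (f w + g w) ^ l + of_nat l * (f' w + g' w - h w)" for w
    by (simp add: fg algebra_simps)
  thus ?case by (intro bexI[of _ "\<lambda>w. f' w + g' w - h w"]) (auto intro!: zpol_diff zpol.add fg h)
next
  case (mult f g)
  then obtain f' g' where fg: "f' \<in> zpol" "g' \<in> zpol" "\<And>w. f (w ^ l) = f w ^ l + of_nat l * f' w"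
    "\<And>w. g (w ^ l) = g w ^ l + of_nat l * g' w" by blast
  have "f (w ^ l) * g (w ^ l) = (f w * g w) ^ l + of_nat l * (f w ^ l * g' w + f' w * g w ^ l + of_int (int l) * (f' w * g' w))" for w
    by (simp add: fg algebra_simps power_mult_distrib)
  thus ?case
    by (intro bexI[of _ "\<lambda>w. f w ^ l * g' w + f' w * g w ^ l + of_int (int l) * (f' w * g' w)"])
       (auto intro!: zpol.add zpol.mult zpol_power zpol.const[of "int l", simplified] fg mult)
qed

text \<open>On the ring generated by w, which finitely many powers of w span, a rational functional
  with \<open>lam \<alpha> = 1\<close> takes values with a common denominator D. So \<alpha> = l
  g(w) makes D a multiple of l, and l \<le> D.\<close>

lemma zpol_divisibility_bound:
  assumes "w ^ N = (1::complex)" "N > 0" "\<alpha> \<noteq> 0"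
  shows "\<exists>B. \<forall>l>B. \<forall>g\<in>zpol. \<alpha> \<noteq> of_nat l * g w"
proof -
  obtain lam :: "complex \<Rightarrow> rat" where lam: "lam \<alpha> = 1" "\<And>x y. lam (x + y) = lam x + lam y" "\<And>r x. lam (of_rat r * x) = r * lam x"
    using exists_rat_functional[OF assms(3)] by blast
  define D where "D = (\<Prod>j<N. snd (quotient_of (lam (w ^ j))))"
  have D: "D > 0" unfolding D_def by (intro prod_pos) (simp add: quotient_of_denom_pos')
  have D1: "of_int D * lam (w ^ j) \<in> \<int>" for j
  proof -
    have "w ^ j = w ^ (j mod N)"
      by (metis assms(1) mult_1 mod_div_decomp power_add power_mult power_one mult.commute)
    moreover have "snd (quotient_of (lam (w ^ (j mod N)))) dvd D" unfolding D_def
      by (rule dvd_prodI) (use assms(2) in auto)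
    then obtain k where "D = snd (quotient_of (lam (w ^ (j mod N)))) * k" by blast
    moreover have "lam (w ^ (j mod N)) = of_int (fst (quotient_of (lam (w ^ (j mod N))))) / of_int (snd (quotient_of (lam (w ^ (j mod N)))))"
      by (metis quotient_of_div surjective_pairing)
    moreover have "snd (quotient_of (lam (w ^ (j mod N)))) > 0" by (simp add: quotient_of_denom_pos')
    ultimately have "of_int D * lam (w ^ j) = of_int (k * fst (quotient_of (lam (w ^ (j mod N)))))"
      by (simp add: field_simps)
    thus ?thesis by simp
  qed
  have scale: "lam (of_int c * x) = of_int c * lam x" for c x using lam(3)[of "of_int c" x] by simp
  \<comment> \<open>The x with this integrality form a module over the ring generated by w.\<close>
  have P: "f \<in> zpol \<Longrightarrow> \<forall>x. (\<forall>j. of_int D * lam (x * w ^ j) \<in> \<int>) \<longrightarrow> (\<forall>j. of_int D * lam (x * f w * w ^ j) \<in> \<int>)" for f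
  proof (induction rule: zpol.induct)
    case (const c)
    have "of_int D * lam (x * of_int c * w ^ j) = of_int c * (of_int D * lam (x * w ^ j))" for x j
      using scale[of c "x * w ^ j"] by (simp add: mult_ac)
    thus ?case by (simp only:) (auto intro: Ints_mult)
  next
    case ident
    have "x * w * w ^ j = x * w ^ Suc j" for x j by simp
    thus ?case by (simp only:) blast
  next
    case (add f g)
    have "of_int D * lam (x * (f w + g w) * w ^ j) = of_int D * lam (x * f w * w ^ j) + of_int D * lam (x * g w * w ^ j)" for x j
      using lam(2)[of "x * f w * w ^ j" "x * g w * w ^ j"] by (simp add: algebra_simps)
    thus ?case using add.IH by auto
  next
    case (mult f g)
    have "x * (f w * g w) * w ^ j = (x * f w) * g w * w ^ j" for x j by simp
    thus ?case using mult.IH by (simp only:) blast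
  qed
  have fD: "of_int D * lam (f w) \<in> \<int>" if "f \<in> zpol" for f
    using P[OF that, rule_format, of 1 0] D1 by simp
  show ?thesis
  proof (intro exI[of _ "nat D"] allI impI ballI notI)
    fix l g assume l: "nat D < l" and g: "g \<in> zpol" and eq: "\<alpha> = of_nat l * g w"
    have "1 = of_nat l * lam (g w)" using lam(1) eq scale[of "int l" "g w"] by simp
    hence "of_int D = of_int (int l) * (of_int D * lam (g w))" by simp
    moreover obtain m where "of_int D * lam (g w) = of_int m" using fD[OF g] by (auto simp: Ints_def)
    ultimately have "(of_int D :: rat) = of_int (int l * m)" by simp
    hence "D = int l * m" using of_int_eq_iff by blast
    hence "int l dvd D" by simp
    hence "int l \<le> D" using D zdvd_imp_le by blast
    thus False using l by simp
  qed
qed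

text \<open>If \<open>f(w) = 0\<close>, then \<open>f(w\<^sup>l)\<close> is divisible by \<open>l\<close> for every prime \<open>l\<close>, hence \<open>0\<close> for large \<open>l\<close>.
  This handles all exponents without small prime factors, and every class prime to \<open>N\<close> contains one.\<close>

theorem zpol_galois:
  assumes "w ^ N = (1::complex)" "N > 0" "coprime s N" "f \<in> zpol" "f w = 0"
  shows "f (w ^ s) = 0"
proof -
  have "\<forall>j\<in>{..<N}. \<exists>B. f (w ^ j) \<noteq> 0 \<longrightarrow> (\<forall>l>B. \<forall>g\<in>zpol. f (w ^ j) \<noteq> of_nat l * g w)"
    using zpol_divisibility_bound[OF assms(1,2)] by blast
  then obtain B where B: "\<And>j l g. j < N \<Longrightarrow> f (w ^ j) \<noteq> 0 \<Longrightarrow> l > B j \<Longrightarrow> g \<in> zpol \<Longrightarrow> f (w ^ j) \<noteq> of_nat l * g w"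
    by (metis lessThan_iff)
  \<comment> \<open>M is at least every bound \<open>B j\<close>; the summand 2 makes
    \<open>fact M\<close> larger than 1, so that t = 0 is not coprime to it.\<close>
  define M where "M = 2 + (\<Sum>j<N. B j)"
  have M: "B j \<le> M" if "j < N" for j
  proof -
    have "B j \<le> (\<Sum>j<N. B j)" using that by (intro member_le_sum) auto
    thus ?thesis by (simp add: M_def)
  qed
  have red: "w ^ j = w ^ (j mod N)" for j
    by (metis assms(1) mult_1 mod_div_decomp power_add power_mult power_one mult.commute)
  \<comment> \<open>Induction that peels off one prime factor l of t at a time; coprimality to
    \<open>fact M\<close> makes every such l larger than M.\<close>
  have main: "f (w ^ t) = 0" if "coprime t (fact M)" for t :: nat
    using that
  proof (induction t rule: less_induct)
    case (less t)
    show ?case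
    proof (cases "t = 1")
      case True thus ?thesis using assms(5) by simp
    next
      case False
      then obtain l where l: "prime l" "l dvd t" using prime_factor_nat by blast
      have "t \<noteq> 0"
      proof
        assume "t = 0"
        hence "fact M = (1::nat)" using less.prems by simp
        moreover have "(fact M :: nat) \<ge> M" by (rule fact_ge_self)
        ultimately show False by (simp add: M_def)
      qed
      obtain u where u: "t = l * u" using l(2) by blast
      have "u < t" using u \<open>t \<noteq> 0\<close> prime_gt_1_nat[OF l(1)] by simp
      moreover have "coprime u (fact M)" using less.prems u by simp
      ultimately have fu: "f (w ^ u) = 0" using less.IH by blast
      have "l > M"
      proof (rule ccontr)
        assume "\<not> l > M"
        hence "l dvd fact M" using l(1) prime_ge_1_nat by (intro dvd_fact) auto
        thus False using less.prems l by (meson coprime_common_divisor not_prime_unit)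
      qed
      obtain g where g: "g \<in> zpol" "\<And>w. f (w ^ l) = f w ^ l + of_nat l * g w"
        using zpol_frobenius[OF l(1) assms(4)] by blast
      have "f (w ^ t) = of_nat l * g (w ^ u)"
        using g(2)[of "w ^ u"] fu prime_gt_0_nat[OF l(1)] by (simp add: u power_mult[symmetric] mult.commute)
      hence eq: "f (w ^ (t mod N)) = of_nat l * (\<lambda>w. g (w ^ u)) w" using red by simp
      have "t mod N < N" using assms(2) by simp
      with B[of "t mod N" l "\<lambda>w. g (w ^ u)"] eq zpol_comp_power[OF g(1)] M[of "t mod N"] \<open>l > M\<close>
      have "f (w ^ (t mod N)) = 0" by fastforce
      thus ?thesis using red by simp
    qed
  qed
  have "gcd (int s) (gcd (int N) (fact M)) = 1"
  proof -
    have "coprime (int s) (int N)" using assms(3) by simp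
    hence "gcd (gcd (int s) (int N)) (fact M) = 1" by (simp add: coprime_iff_gcd_eq_1)
    thus ?thesis using gcd.assoc[of "int s" "int N" "fact M"] by (simp only:)
  qed
  \<comment> \<open>A representative of the class of s modulo N without prime factors up to
    M.\<close>
  then obtain k where k: "coprime (int s + k * int N) (fact M)"
    using coprime_shift[of "int s" "int N" "fact M"] by auto
  define t where "t = nat ((int s + k * int N) mod (int N * fact M))"
  have pos: "int N * fact M > 0" using assms(2) by simp
  have t: "int t = (int s + k * int N) mod (int N * fact M)" using pos by (simp add: t_def)
  have "coprime (int t) (fact M)"
    unfolding t using k by (metis coprime_mod_left_iff dvd_triv_right fact_nonzero mod_mod_cancel coprime_commute coprime_mod_right_iff)
  hence ct: "coprime t (fact M)" by (metis coprime_int_iff of_nat_fact)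
  have "int t mod int N = int s mod int N" unfolding t by (simp add: mod_mod_cancel)
  hence "t mod N = s mod N" by (metis of_nat_eq_iff of_nat_mod)
  thus ?thesis using main[OF ct] red by metis
qed

text \<open>Gaussian elimination without fractions: one unknown \<open>j0\<close> is eliminated by
  cross-multiplication with the pivot \<open>M i0 j0\<close>, which costs one equation and one
  unknown.\<close>

lemma int_linear_system:
  fixes M :: "'i \<Rightarrow> 'j \<Rightarrow> int"
  assumes "finite I" "finite J" "card I < card J"
  obtains c where "\<exists>j\<in>J. c j \<noteq> 0" "\<And>i. i \<in> I \<Longrightarrow> (\<Sum>j\<in>J. c j * M i j) = 0"
proof -
  have "\<exists>c. (\<exists>j\<in>J. c j \<noteq> 0) \<and> (\<forall>i\<in>I. (\<Sum>j\<in>J. c j * M i j) = 0)"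
    using assms
  proof (induction I arbitrary: J M rule: finite_induct)
    case empty
    hence "J \<noteq> {}" by auto
    thus ?case by (intro exI[of _ "\<lambda>_. 1"]) auto
  next
    case (insert i0 I)
    show ?case
    proof (cases "\<forall>j\<in>J. M i0 j = 0")
      case True
      have "card I < card J" using insert by simp
      with insert.IH[OF insert.prems(1)] obtain c where "\<exists>j\<in>J. c j \<noteq> 0" "\<forall>i\<in>I. (\<Sum>j\<in>J. c j * M i j) = 0" by blast
      thus ?thesis using True by (intro exI[of _ c]) auto
    next
      case False
      then obtain j0 where j0: "j0 \<in> J" "M i0 j0 \<noteq> 0" by blast
      define J' where "J' = J - {j0}"
      have J': "finite J'" "card I < card J'" using insert.prems insert.hyps j0 by (auto simp: J'_def)
      from insert.IH[OF this, of "\<lambda>i j. M i0 j0 * M i j - M i0 j * M i j0"]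
      obtain c where c: "\<exists>j\<in>J'. c j \<noteq> 0" "\<And>i. i \<in> I \<Longrightarrow> (\<Sum>j\<in>J'. c j * (M i0 j0 * M i j - M i0 j * M i j0)) = 0" by blast
      define c' where "c' j = (if j = j0 then - (\<Sum>j\<in>J'. c j * M i0 j) else M i0 j0 * c j)" for j
      have sum': "(\<Sum>j\<in>J. c' j * M i j) = (\<Sum>j\<in>J'. M i0 j0 * c j * M i j) - (\<Sum>j\<in>J'. c j * M i0 j) * M i j0" for i
      proof -
        have "(\<Sum>j\<in>J. c' j * M i j) = c' j0 * M i j0 + (\<Sum>j\<in>J'. c' j * M i j)"
          using j0 insert.prems by (simp add: J'_def sum.remove)
        also have "(\<Sum>j\<in>J'. c' j * M i j) = (\<Sum>j\<in>J'. M i0 j0 * c j * M i j)"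
          by (rule sum.cong) (auto simp: c'_def J'_def)
        finally show ?thesis by (simp add: c'_def)
      qed
      have "(\<Sum>j\<in>J. c' j * M i0 j) = 0"
        unfolding sum' sum_distrib_right by (simp add: mult_ac)
      moreover have "(\<Sum>j\<in>J. c' j * M i j) = 0" if "i \<in> I" for i
      proof -
        have "(\<Sum>j\<in>J. c' j * M i j) = (\<Sum>j\<in>J'. c j * (M i0 j0 * M i j - M i0 j * M i j0))"
          unfolding sum' sum_distrib_right sum_subtractf[symmetric] by (simp add: algebra_simps)
        thus ?thesis using c(2)[OF that] by simp
      qed
      moreover have "\<exists>j\<in>J. c' j \<noteq> 0" using c(1) j0 by (auto simp: c'_def J'_def)
      ultimately show ?thesis by blast
    qed
  qed
  thus ?thesis using that by blast
qed

text \<open>All powers of the denominator of x divide the fixed nonzero integer d.\<close>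

lemma Rats_bounded_powers_imp_Ints:
  assumes "(x::complex) \<in> \<rat>" "d \<in> \<int>" "d \<noteq> 0" "\<And>n::nat. d * x ^ n \<in> \<int>"
  shows "x \<in> \<int>"
proof -
  obtain r where r: "x = of_rat r" using assms(1) by (auto simp: Rats_def)
  obtain a b where ab: "r = of_int a / of_int b" "b > 0" "coprime a b"
    by (metis quotient_of_coprime quotient_of_denom_pos quotient_of_div surj_pair)
  obtain d' where d': "d = of_int d'" using assms(2) by (auto simp: Ints_def)
  have d0: "d' \<noteq> 0" using assms(3) d' by auto
  have dv: "b ^ n dvd d'" for n
  proof -
    obtain m where m: "d * x ^ n = of_int m" using assms(4) by (auto simp: Ints_def)
    have x: "x = of_int a / of_int b" by (simp add: r ab(1) of_rat_divide)
    have "of_int d' * of_int a ^ n = (of_int m * of_int b ^ n :: complex)"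
      using m ab(2) by (simp add: d' x power_divide field_simps)
    hence "d' * a ^ n = m * b ^ n" by (metis of_int_eq_iff of_int_mult of_int_power)
    hence "b ^ n dvd d' * a ^ n" by simp
    moreover have "coprime (b ^ n) (a ^ n)" using ab(3) by (simp add: coprime_commute)
    ultimately show ?thesis using coprime_dvd_mult_left_iff by blast
  qed
  have "b = 1"
  proof (rule ccontr)
    assume "b \<noteq> 1"
    hence b2: "b \<ge> 2" using ab(2) by simp
    define n where "n = nat \<bar>d'\<bar>"
    have "\<bar>b ^ n\<bar> \<le> \<bar>d'\<bar>" using dvd_imp_le_int[OF d0 dv[of n]] .
    hence "b ^ n \<le> \<bar>d'\<bar>" using ab(2) by simp
    moreover have "(2::int) ^ n \<le> b ^ n" using b2 by (intro power_mono) auto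
    moreover have "int n < 2 ^ n" by (simp add: of_nat_less_two_power)
    ultimately show False by (simp add: n_def)
  qed
  thus ?thesis by (simp add: r ab(1))
qed

section \<open>Power series with integral coefficients\<close>

definition fps_over :: "complex set \<Rightarrow> complex fps \<Rightarrow> bool" where
  "fps_over K F \<longleftrightarrow> (\<forall>n. fps_nth F n \<in> K)"

lemma fps_over_mult: "fps_over \<int> F \<Longrightarrow> fps_over \<int> G \<Longrightarrow> fps_over \<int> (F * G)"
  unfolding fps_over_def fps_mult_nth by (auto intro!: Ints_sum)
lemma fps_over_add: "fps_over \<int> F \<Longrightarrow> fps_over \<int> G \<Longrightarrow> fps_over \<int> (F + G)"
  by (auto simp: fps_over_def)
lemma fps_over_1: "fps_over \<int> 1"
  by (auto simp: fps_over_def)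
lemma fps_over_power: "fps_over \<int> F \<Longrightarrow> fps_over \<int> (F ^ n)"
  by (induction n) (auto intro: fps_over_mult fps_over_1)
lemma fps_over_const: "c \<in> \<int> \<Longrightarrow> fps_over \<int> (fps_const c)"
  by (auto simp: fps_over_def)
lemma fps_over_sum: "(\<And>i. i \<in> A \<Longrightarrow> fps_over \<int> (F i)) \<Longrightarrow> fps_over \<int> (\<Sum>i\<in>A. F i)"
  by (induction A rule: infinite_finite_induct) (auto intro: fps_over_add fps_over_const[of 0, simplified])

lemma fps_over_inverse:
  assumes "fps_over \<int> F" "fps_nth F 0 = 1"
  shows "fps_over \<int> (inverse F)"
proof -
  have "fps_nth (inverse F) n \<in> \<int>" for n
  proof (induction n rule: less_induct)
    case (less n)
    show ?case
    proof (cases n)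
      case 0 thus ?thesis using assms(2) by simp
    next
      case (Suc m)
      have "fps_nth (inverse F * F) n = 0" using inverse_mult_eq_1[of F] assms(2) Suc by simp
      hence "(\<Sum>i\<le>n. fps_nth (inverse F) i * fps_nth F (n - i)) = 0" by (simp add: fps_mult_nth atLeast0AtMost)
      moreover have "{..n} = insert n {..<n}" by auto
      ultimately have "fps_nth (inverse F) n = - (\<Sum>i<n. fps_nth (inverse F) i * fps_nth F (n - i))" using assms(2) by (simp add: add_eq_0_iff2)
      thus ?thesis using less assms(1) by (auto simp: fps_over_def intro!: Ints_minus Ints_sum Ints_mult)
    qed
  qed
  thus ?thesis by (simp add: fps_over_def)
qed

text \<open>The lowest coefficient of D g^n is that of D times the n-th power of g(0), so g(0) has
  bounded denominators and is an integer. Subtracting it and dividing by the variable preserves the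
  hypotheses and moves the next coefficient into its place.\<close>

theorem fps_completely_integrally_closed:
  assumes D: "fps_over \<int> D" "D \<noteq> 0" and g: "fps_over \<rat> g" and Dg: "\<And>n. fps_over \<int> (D * g ^ n)"
  shows "fps_over \<int> g"
proof -
  have g0: "fps_nth g 0 \<in> \<int>" if "fps_over \<rat> g" "\<And>n. fps_over \<int> (D * g ^ n)" for g
  proof -
      define s where "s = subdegree D"
      have d: "fps_nth D s \<noteq> 0" using D(2) by (simp add: s_def)
      show ?thesis
      proof (rule Rats_bounded_powers_imp_Ints[of _ "fps_nth D s"])
        fix n
        have "fps_nth (D * g ^ n) s = (\<Sum>i=0..s. fps_nth D i * fps_nth (g ^ n) (s - i))" by (rule fps_mult_nth)
        also have "\<dots> = (\<Sum>i\<in>{s}. fps_nth D i * fps_nth (g ^ n) (s - i))"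
        proof (rule sum.mono_neutral_right)
          have "fps_nth D i = 0" if "i < s" for i using that nth_less_subdegree_zero[of i D] by (simp add: s_def)
          thus "\<forall>i\<in>{0..s} - {s}. fps_nth D i * fps_nth (g ^ n) (s - i) = 0" by simp
        qed simp_all
        finally have "fps_nth (D * g ^ n) s = fps_nth D s * fps_nth (g ^ n) 0" by simp
        moreover have "fps_nth (D * g ^ n) s \<in> \<int>" using that(2)[of n] unfolding fps_over_def by blast
        ultimately show "fps_nth D s * fps_nth g 0 ^ n \<in> \<int>" by (simp add: fps_power_zeroth)
      qed (use d D(1) that(1) in \<open>auto simp: fps_over_def\<close>)
    qed
  have "fps_nth g k \<in> \<int>" for k
    using g Dg
  proof (induction k arbitrary: g)
    case 0
    thus ?case using g0 by blast
  next
    case (Suc k)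
    have g0: "fps_nth g 0 \<in> \<int>" using g0 Suc.prems by blast
    define h where "h = fps_shift 1 (g - fps_const (fps_nth g 0))"
    have gh: "g - fps_const (fps_nth g 0) = h * fps_X"
      unfolding h_def by (rule fps_ext) (simp add: fps_X_mult_right_nth)
    have "fps_over \<int> (D * (g - fps_const (fps_nth g 0)) ^ n)" for n
    proof -
      have "D * (g - fps_const (fps_nth g 0)) ^ n = D * (g + fps_const (- (fps_nth g 0))) ^ n" by (metis diff_conv_add_uminus fps_const_neg)
      also have "\<dots> = (\<Sum>k\<le>n. of_nat (n choose k) * fps_const (- (fps_nth g 0)) ^ (n - k) * (D * g ^ k))"
        by (simp add: binomial_ring sum_distrib_left mult_ac)
      also have "fps_over \<int> \<dots>"
        using g0 by (intro fps_over_sum fps_over_mult fps_over_power fps_over_const Suc.prems(2))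
           (auto simp: fps_over_def fps_of_nat[symmetric])
      finally show ?thesis .
    qed
    hence "fps_over \<int> (D * h ^ n * fps_X ^ n)" for n unfolding gh by (simp add: power_mult_distrib mult_ac)
    hence Dh: "fps_over \<int> (D * h ^ n)" for n
      unfolding fps_over_def by (metis add_diff_cancel_right' fps_X_power_mult_right_nth not_add_less2)
    have "fps_over \<rat> h" using Suc.prems(1) by (auto simp: h_def fps_over_def)
    from Suc.IH[OF this Dh] show ?case by (simp add: h_def)
  qed
  thus ?thesis by (simp add: fps_over_def)
qed

section \<open>q-expansions\<close>

text \<open>In the parameter q^(1/N) the neighbourhoods of the cusp are the punctured neighbourhoods
  of 0, so statements for large imaginary part become statements about germs at 0.\<close>

lemma filtermap_ex:
  assumes "N > 0"
  shows "filtermap (\<lambda>\<tau>. ex (\<tau> / of_nat N)) (filtercomap Im at_top) = at 0"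
proof (rule filter_eqI)
  fix P
  have norm_x: "norm (ex (\<tau> / of_nat N)) = exp (- (2 * pi / real N) * Im \<tau>)" for \<tau>
    by (simp add: norm_ex)
  have "eventually P (filtermap (\<lambda>\<tau>. ex (\<tau> / of_nat N)) (filtercomap Im at_top)) \<longleftrightarrow>
      (\<exists>B. \<forall>\<tau>. Im \<tau> > B \<longrightarrow> P (ex (\<tau> / of_nat N)))"
    by (simp add: eventually_filtermap eventually_filtercomap_at_top_dense)
  also have "\<dots> \<longleftrightarrow> (\<exists>r>0. \<forall>z. z \<noteq> 0 \<and> norm z < r \<longrightarrow> P z)"
  proof
    assume "\<exists>B. \<forall>\<tau>. Im \<tau> > B \<longrightarrow> P (ex (\<tau> / of_nat N))"
    then obtain B where B: "\<And>\<tau>. Im \<tau> > B \<Longrightarrow> P (ex (\<tau> / of_nat N))" by blast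
    show "\<exists>r>0. \<forall>z. z \<noteq> 0 \<and> norm z < r \<longrightarrow> P z"
    proof (intro exI[of _ "exp (- (2 * pi / real N) * B)"] conjI allI impI, goal_cases)
      case (2 z)
      define \<tau> where "\<tau> = of_nat N * Ln z / (2 * of_real pi * \<i>)"
      have z: "ex (\<tau> / of_nat N) = z" using 2 assms by (simp add: ex_def \<tau>_def)
      have "exp (- (2 * pi / real N) * Im \<tau>) < exp (- (2 * pi / real N) * B)"
        using 2 norm_x[of \<tau>] z by simp
      hence "Im \<tau> > B" using assms by (simp add: mult_less_cancel_left divide_less_cancel)
      from B[OF this] z show ?case by simp
    qed simp
  next
    assume "\<exists>r>0. \<forall>z. z \<noteq> 0 \<and> norm z < r \<longrightarrow> P z"
    then obtain r where r: "r > 0" "\<And>z. z \<noteq> 0 \<Longrightarrow> norm z < r \<Longrightarrow> P z" by blast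
    show "\<exists>B. \<forall>\<tau>. Im \<tau> > B \<longrightarrow> P (ex (\<tau> / of_nat N))"
    proof (intro exI[of _ "- (real N / (2 * pi)) * ln r"] allI impI)
      fix \<tau> assume "Im \<tau> > - (real N / (2 * pi)) * ln r"
      hence "- (2 * pi / real N) * Im \<tau> < ln r" using assms by (simp add: field_simps)
      hence "norm (ex (\<tau> / of_nat N)) < r" using r(1) norm_x by (metis exp_less_cancel_iff exp_ln)
      thus "P (ex (\<tau> / of_nat N))" using r(2) by simp
    qed
  qed
  also have "\<dots> \<longleftrightarrow> eventually P (at 0)"
    by (auto simp: eventually_at dist_norm)
  finally show "eventually P (filtermap (\<lambda>\<tau>. ex (\<tau> / of_nat N)) (filtercomap Im at_top)) \<longleftrightarrow> eventually P (at 0)" .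
qed

lemma eventually_ex_iff:
  assumes "N > 0"
  shows "(\<forall>\<^sub>F \<tau> in filtercomap Im at_top. P (ex (\<tau> / of_nat N))) \<longleftrightarrow> eventually P (at 0)"
  using arg_cong[OF filtermap_ex[OF assms], of "eventually P"] by (simp add: eventually_filtermap)

lemma has_q_expansion_def': "has_q_expansion N f F \<longleftrightarrow> fls_conv_radius F > 0 \<and>
    (\<forall>\<^sub>F \<tau> in filtercomap Im at_top. f \<tau> = eval_fls F (ex (\<tau> / of_nat N)))"
  by (simp add: has_q_expansion_def ex_def)

lemma has_q_expansionI:
  assumes "N > 0" "g has_laurent_expansion F" "\<forall>\<^sub>F \<tau> in filtercomap Im at_top. f \<tau> = g (ex (\<tau> / of_nat N))"
  shows "has_q_expansion N f F"
proof -
  have "\<forall>\<^sub>F \<tau> in filtercomap Im at_top. eval_fls F (ex (\<tau> / of_nat N)) = g (ex (\<tau> / of_nat N))"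
    using assms(2) eventually_ex_iff[OF assms(1), of "\<lambda>z. eval_fls F z = g z"] by (simp add: has_laurent_expansion_def)
  with assms(3) have "\<forall>\<^sub>F \<tau> in filtercomap Im at_top. f \<tau> = eval_fls F (ex (\<tau> / of_nat N))"
    by eventually_elim simp
  thus ?thesis using assms(2) by (simp add: has_q_expansion_def' has_laurent_expansion_def)
qed

lemma has_q_expansion_laurent: "has_q_expansion N f F \<Longrightarrow> eval_fls F has_laurent_expansion F"
  by (simp add: has_q_expansion_def eval_fls_has_laurent_expansion)

lemma has_q_expansion_ev: "has_q_expansion N f F \<Longrightarrow> \<forall>\<^sub>F \<tau> in filtercomap Im at_top. f \<tau> = eval_fls F (ex (\<tau> / of_nat N))"
  by (simp add: has_q_expansion_def')

lemma has_q_expansion_cong: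
  assumes "\<forall>\<^sub>F \<tau> in filtercomap Im at_top. f \<tau> = g \<tau>" "has_q_expansion N f F"
  shows "has_q_expansion N g F"
proof -
  have "\<forall>\<^sub>F \<tau> in filtercomap Im at_top. g \<tau> = eval_fls F (ex (\<tau> / of_nat N))"
    using assms(1) has_q_expansion_ev[OF assms(2)] by eventually_elim simp
  thus ?thesis using assms(2) by (simp add: has_q_expansion_def')
qed

lemma eventually_upper: "\<forall>\<^sub>F \<tau> in filtercomap Im at_top. Im \<tau> > 0"
  by (simp add: eventually_filtercomap_at_top_dense) (auto intro: exI[of _ 0])

lemma has_q_expansion_cong':
  "(\<And>\<tau>. Im \<tau> > 0 \<Longrightarrow> f \<tau> = g \<tau>) \<Longrightarrow> has_q_expansion N f F \<Longrightarrow> has_q_expansion N g F"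
  by (rule has_q_expansion_cong[of f g]) (rule eventually_mono[OF eventually_upper])

lemma has_q_expansion_unique:
  assumes "N > 0" "has_q_expansion N f F" "has_q_expansion N f G"
  shows "F = G"
proof -
  have "\<forall>\<^sub>F \<tau> in filtercomap Im at_top. eval_fls F (ex (\<tau> / of_nat N)) = eval_fls G (ex (\<tau> / of_nat N))"
    using has_q_expansion_ev[OF assms(2)] has_q_expansion_ev[OF assms(3)] by eventually_elim simp
  hence "eventually (\<lambda>z. eval_fls F z = eval_fls G z) (at 0)"
    using eventually_ex_iff[OF assms(1), of "\<lambda>z. eval_fls F z = eval_fls G z"] by simp
  hence "eval_fls G has_laurent_expansion F"
    using has_q_expansion_laurent[OF assms(2)] has_laurent_expansion_cong by blast
  thus ?thesis using has_q_expansion_laurent[OF assms(3)] has_laurent_expansion_unique by blast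
qed

context
  fixes N :: nat
  assumes N: "N > 0"
begin

lemma has_q_expansion_const: "has_q_expansion N (\<lambda>_. c) (fls_const c)"
  by (rule has_q_expansionI[OF N has_laurent_expansion_const]) simp

lemma has_q_expansion_add:
  assumes "has_q_expansion N f F" "has_q_expansion N g G"
  shows "has_q_expansion N (\<lambda>\<tau>. f \<tau> + g \<tau>) (F + G)"
proof (rule has_q_expansionI[OF N has_laurent_expansion_add[OF assms[THEN has_q_expansion_laurent]]])
  show "\<forall>\<^sub>F \<tau> in filtercomap Im at_top. f \<tau> + g \<tau> = eval_fls F (ex (\<tau> / of_nat N)) + eval_fls G (ex (\<tau> / of_nat N))"
    using assms[THEN has_q_expansion_ev] by eventually_elim simp
qed

lemma has_q_expansion_mult:
  assumes "has_q_expansion N f F" "has_q_expansion N g G"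
  shows "has_q_expansion N (\<lambda>\<tau>. f \<tau> * g \<tau>) (F * G)"
proof (rule has_q_expansionI[OF N has_laurent_expansion_mult[OF assms[THEN has_q_expansion_laurent]]])
  show "\<forall>\<^sub>F \<tau> in filtercomap Im at_top. f \<tau> * g \<tau> = eval_fls F (ex (\<tau> / of_nat N)) * eval_fls G (ex (\<tau> / of_nat N))"
    using assms[THEN has_q_expansion_ev] by eventually_elim simp
qed

lemma has_q_expansion_inverse:
  assumes "has_q_expansion N f F"
  shows "has_q_expansion N (\<lambda>\<tau>. inverse (f \<tau>)) (inverse F)"
proof (rule has_q_expansionI[OF N has_laurent_expansion_inverse[OF assms[THEN has_q_expansion_laurent]]])
  show "\<forall>\<^sub>F \<tau> in filtercomap Im at_top. inverse (f \<tau>) = inverse (eval_fls F (ex (\<tau> / of_nat N)))"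
    using assms[THEN has_q_expansion_ev] by eventually_elim simp
qed

lemma has_q_expansion_power: "has_q_expansion N f F \<Longrightarrow> has_q_expansion N (\<lambda>\<tau>. f \<tau> ^ n) (F ^ n)"
proof (induction n)
  case 0 thus ?case using has_q_expansion_const[of 1] by simp
next
  case (Suc n) thus ?case using has_q_expansion_mult[OF Suc.prems Suc.IH] by simp
qed

lemma has_q_expansion_power_int: "has_q_expansion N f F \<Longrightarrow> has_q_expansion N (\<lambda>\<tau>. f \<tau> powi n) (F powi n)"
  unfolding power_int_def by (auto intro: has_q_expansion_power has_q_expansion_inverse)

lemma has_q_expansion_sum:
  "(\<And>i. i \<in> A \<Longrightarrow> has_q_expansion N (f i) (F i)) \<Longrightarrow> has_q_expansion N (\<lambda>\<tau>. \<Sum>i\<in>A. f i \<tau>) (\<Sum>i\<in>A. F i)"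
proof (induction A rule: infinite_finite_induct)
  case (insert x A) thus ?case using has_q_expansion_add by simp
qed (use has_q_expansion_const[of 0] in auto)

lemma has_q_expansion_prod:
  "(\<And>i. i \<in> A \<Longrightarrow> has_q_expansion N (f i) (F i)) \<Longrightarrow> has_q_expansion N (\<lambda>\<tau>. \<Prod>i\<in>A. f i \<tau>) (\<Prod>i\<in>A. F i)"
proof (induction A rule: infinite_finite_induct)
  case (insert x A) thus ?case using has_q_expansion_mult by simp
qed (use has_q_expansion_const[of 1] in auto)

lemma has_q_expansion_ex: "has_q_expansion N (\<lambda>\<tau>. ex (of_int n * \<tau> / of_nat N)) (fls_X_intpow n)"
proof (rule has_q_expansionI[OF N has_laurent_expansion_fps_X_power_int[of n]])
  have "ex (of_int n * \<tau> / of_nat N) = ex (\<tau> / of_nat N) powi n" for \<tau>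
    by (simp add: ex_def exp_power_int mult_ac)
  thus "\<forall>\<^sub>F \<tau> in filtercomap Im at_top. ex (of_int n * \<tau> / of_nat N) = ex (\<tau> / of_nat N) powi n" by simp
qed

lemma periodic_descent:
  assumes "f holomorphic_on upper_half_plane" "\<And>\<tau>. Im \<tau> > 0 \<Longrightarrow> f (\<tau> + of_nat N) = f \<tau>"
  obtains g where "g holomorphic_on ball 0 1 - {0}" "\<And>\<tau>. Im \<tau> > 0 \<Longrightarrow> f \<tau> = g (ex (\<tau> / of_nat N))"
proof -
  define g where "g z = f (of_nat N * Ln z / (2 * of_real pi * \<i>))" for z
  have per: "f (\<tau> + of_nat N * of_int k) = f \<tau>" if "Im \<tau> > 0" for \<tau> k
  proof (induction k rule: int_induct[of _ 0])
    case (step1 i) thus ?case using assms(2)[of "\<tau> + of_nat N * of_int i"] that by (simp add: algebra_simps)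
  next
    case (step2 i) thus ?case using assms(2)[of "\<tau> + of_nat N * of_int (i - 1)"] that by (simp add: algebra_simps)
  qed simp
  have g: "f \<tau> = g (ex (\<tau> / of_nat N))" if \<tau>: "Im \<tau> > 0" for \<tau>
  proof -
    define w where "w = of_nat N * Ln (ex (\<tau> / of_nat N)) / (2 * of_real pi * \<i>)"
    have "ex (w / of_nat N) = ex (\<tau> / of_nat N)" using N by (simp add: w_def ex_def)
    hence "ex ((\<tau> - w) / of_nat N) = 1" by (simp add: ex_diff diff_divide_distrib)
    then obtain k where "(\<tau> - w) / of_nat N = of_int k" using ex_eq_1_iff by blast
    hence tw: "\<tau> = w + of_nat N * of_int k" using N by (simp add: field_simps)
    hence "Im w > 0" using \<tau> by simp
    from per[OF this, of k] tw have "f \<tau> = f w" by simp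
    thus ?thesis by (simp add: g_def w_def)
  qed
  have "g analytic_on {z0}" if z0: "z0 \<in> ball 0 1 - {0}" for z0
  proof -
    define \<tau>0 where "\<tau>0 = of_nat N * Ln z0 / (2 * of_real pi * \<i>)"
    \<comment> \<open>\<open>g\<close> is built with the principal logarithm. To see that it is
      analytic across the branch cut too, a branch centred at \<open>z0\<close> is used, and the
      periodicity of f identifies f \<circ> h with g.\<close>
    define h where "h z = \<tau>0 + of_nat N * Ln (z / z0) / (2 * of_real pi * \<i>)" for z
    have e0: "ex (\<tau>0 / of_nat N) = z0" using z0 N by (simp add: \<tau>0_def ex_def)
    have "exp (- (2 * pi / real N) * Im \<tau>0) < 1" using z0 e0 norm_ex[of "\<tau>0 / of_nat N"] by simp
    hence im0: "Im \<tau>0 > 0" using N by (simp add: field_simps zero_less_mult_iff)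
    have h0: "h z0 = \<tau>0" using z0 by (simp add: h_def)
    have eh: "ex (h z / of_nat N) = z" if "z \<noteq> 0" for z
    proof -
      have "ex (h z / of_nat N) = ex (\<tau>0 / of_nat N) * ex (Ln (z / z0) / (2 * of_real pi * \<i>))"
        using N by (simp add: h_def add_divide_distrib ex_add)
      also have "ex (Ln (z / z0) / (2 * of_real pi * \<i>)) = z / z0" using that z0 by (simp add: ex_def)
      finally show ?thesis using e0 z0 by simp
    qed
    have h_an: "h analytic_on {z0}" unfolding h_def[abs_def]
      using z0 by (intro analytic_intros) auto
    have "f analytic_on {h z0}"
      using assms(1) im0 h0 open_upper_half_plane analytic_on_open analytic_on_subset by (metis (no_types, lifting) empty_subsetI insert_subset mem_Collect_eq)
    hence fh: "(\<lambda>z. f (h z)) analytic_on {z0}"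
      using analytic_on_compose[OF h_an, of f] by (simp add: o_def)
    have "isCont h z0" using h_an analytic_at_imp_isCont by blast
    hence "eventually (\<lambda>z. h z \<in> upper_half_plane) (nhds z0)"
    proof -
      have "(h \<longlongrightarrow> h z0) (nhds z0)"
        using \<open>isCont h z0\<close> by (simp only: isCont_def tendsto_at_iff_tendsto_nhds)
      from topological_tendstoD[OF this open_upper_half_plane] show ?thesis using im0 h0 by simp
    qed
    moreover have "eventually (\<lambda>z. z \<noteq> 0) (nhds z0)" using z0 by (intro t1_space_nhds) auto
    ultimately have "eventually (\<lambda>z. f (h z) = g z) (nhds z0)"
      by eventually_elim (use g eh in auto)
    thus ?thesis using fh analytic_at_cong by fast
  qed
  hence "g holomorphic_on ball 0 1 - {0}" using analytic_on_analytic_at analytic_imp_holomorphic by blast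
  thus ?thesis using g that by blast
qed

lemma periodic_descent_regular:
  assumes "f holomorphic_on upper_half_plane" "\<And>\<tau>. Im \<tau> > 0 \<Longrightarrow> f (\<tau> + of_nat N) = f \<tau>"
    and "has_q_expansion N f F" "fls_subdegree F \<ge> 0"
  obtains g where "g holomorphic_on ball 0 1" "\<And>\<tau>. Im \<tau> > 0 \<Longrightarrow> f \<tau> = g (ex (\<tau> / of_nat N))"
    "g 0 = fls_nth F 0"
proof -
  obtain g where g: "g holomorphic_on ball 0 1 - {0}" "\<And>\<tau>. Im \<tau> > 0 \<Longrightarrow> f \<tau> = g (ex (\<tau> / of_nat N))"
    using periodic_descent[OF assms(1,2)] by blast
  define h where "h z = (if z = 0 then fls_nth F 0 else g z)" for z
  have "\<forall>\<^sub>F \<tau> in filtercomap Im at_top. g (ex (\<tau> / of_nat N)) = eval_fls F (ex (\<tau> / of_nat N))"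
    using has_q_expansion_ev[OF assms(3)] eventually_upper by eventually_elim (simp add: g(2))
  hence "eventually (\<lambda>z. g z = eval_fls F z) (at 0)"
    using eventually_ex_iff[OF N, of "\<lambda>z. g z = eval_fls F z"] by simp
  hence "g has_laurent_expansion F"
    using has_q_expansion_laurent[OF assms(3)] has_laurent_expansion_cong by blast
  hence lim: "g \<midarrow>0\<rightarrow> fls_nth F 0" using has_laurent_expansion_imp_tendsto_0 assms(4) by blast
  have "h holomorphic_on ball 0 1"
  proof (rule no_isolated_singularity'[where K = "{0}"])
    have "eventually (\<lambda>z. g z = h z) (at 0)" by (auto simp: h_def eventually_at_filter)
    with lim have "(h \<longlongrightarrow> h 0) (at 0)" using tendsto_cong[of g h] by (simp add: h_def)
    thus "(h \<longlongrightarrow> h z) (at z within ball 0 1)" if "z \<in> {0}" for z using that tendsto_within_subset by blast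
    show "h holomorphic_on ball 0 1 - {0}" by (rule holomorphic_transform[OF g(1)]) (simp add: h_def)
  qed auto
  moreover have "f \<tau> = h (ex (\<tau> / of_nat N))" if "Im \<tau> > 0" for \<tau> using g(2)[OF that] by (simp add: h_def)
  ultimately show ?thesis using that by (simp add: h_def)
qed

section \<open>The q-expansion of Siegel functions\<close>

definition qseries_part :: "complex \<Rightarrow> nat \<Rightarrow> nat \<Rightarrow> complex fps" where
  "qseries_part c a M = (\<Prod>n<M. 1 - fps_const c * fps_X ^ (a + n * N))"

text \<open>The formal product of all factors. The factor of index n differs from 1 only from degree
  a + n N on, and N > 0, so the coefficient of degree j is settled by the first j + 1
  factors.\<close>

definition qseries :: "complex \<Rightarrow> nat \<Rightarrow> complex fps" where
  "qseries c a = Abs_fps (\<lambda>j. fps_nth (qseries_part c a (Suc j)) j)"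

lemma qseries_part_Suc: "fps_nth (qseries_part c a (Suc M)) j =
   fps_nth (qseries_part c a M) j - (if j < a + M * N then 0 else c * fps_nth (qseries_part c a M) (j - (a + M * N)))"
proof -
  have "qseries_part c a (Suc M) = qseries_part c a M - fps_X ^ (a + M * N) * (fps_const c * qseries_part c a M)"
    by (simp add: qseries_part_def algebra_simps)
  thus ?thesis by (simp add: fps_X_power_mult_nth)
qed

lemma qseries_part_stable:
  assumes "j < a + M * N" "M \<le> M'"
  shows "fps_nth (qseries_part c a M') j = fps_nth (qseries_part c a M) j"
  using assms(2)
proof (induction M' rule: dec_induct)
  case (step n)
  have "M * N \<le> n * N" using step by simp
  hence "j < a + n * N" using assms(1) by linarith
  thus ?case using step by (simp add: qseries_part_Suc)
qed simp

lemma qseries_nth: "j < a + M * N \<Longrightarrow> fps_nth (qseries c a) j = fps_nth (qseries_part c a M) j"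
proof -
  assume j: "j < a + M * N"
  define t where "t = Suc j * N"
  have "Suc j * 1 \<le> t" unfolding t_def using N by (intro mult_le_mono) auto
  hence "j < t" by simp
  hence "j < a + t" by simp
  hence "j < a + Suc j * N" unfolding t_def .
  hence "fps_nth (qseries_part c a (max M (Suc j))) j = fps_nth (qseries_part c a (Suc j)) j"
    by (rule qseries_part_stable) simp
  moreover have "fps_nth (qseries_part c a (max M (Suc j))) j = fps_nth (qseries_part c a M) j"
    using j by (rule qseries_part_stable) simp
  ultimately show ?thesis by (simp add: qseries_def)
qed

lemma qpoch_x_bound:
  fixes x c :: complex
  assumes "norm x \<le> r" "r < 1"
  shows "norm ((1 - c * x ^ a * (x ^ N) ^ n) - 1) \<le> norm c * r ^ n"
proof -
  have "norm (x ^ a * (x ^ N) ^ n) = norm x ^ (a + N * n)" by (simp add: norm_mult norm_power power_add power_mult)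
  also have "\<dots> \<le> norm x ^ n" using assms N by (intro power_decreasing) (auto intro: trans_le_add2)
  also have "\<dots> \<le> r ^ n" using assms by (intro power_mono) auto
  finally show ?thesis by (simp add: norm_mult mult.assoc mult_left_mono)
qed

lemma qpoch_x_uniform_limit:
  assumes "0 < r" "r < 1"
  shows "uniform_limit (cball 0 r) (\<lambda>M x. \<Prod>n<M. 1 - c * x ^ a * (x ^ N) ^ n) (\<lambda>x. qpoch (c * x ^ a) (x ^ N)) sequentially"
  unfolding qpoch_def
  by (rule prodinf_uniform_limit[where M = "\<lambda>n. norm c * r ^ n"])
     (use assms qpoch_x_bound in \<open>auto intro!: continuous_intros summable_mult summable_geometric\<close>)

lemma qpoch_x_holomorphic: "(\<lambda>x. qpoch (c * x ^ a) (x ^ N)) holomorphic_on ball 0 1"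
proof (rule holomorphic_uniform_sequence[OF open_ball])
  fix z :: complex assume "z \<in> ball 0 1"
  hence z: "norm z < 1" by simp
  define r where "r = (1 + norm z) / 2"
  define d where "d = (1 - norm z) / 2"
  have r: "r > 0" "r < 1" "d > 0" using z by (auto simp: r_def d_def add_pos_nonneg)
  have sub: "cball z d \<subseteq> cball 0 r" by (simp add: cball_subset_cball_iff d_def r_def field_simps)
  hence "cball z d \<subseteq> ball 0 1" using r by fastforce
  thus "\<exists>d>0. cball z d \<subseteq> ball 0 1 \<and> uniform_limit (cball z d) (\<lambda>M x. \<Prod>n<M. 1 - c * x ^ a * (x ^ N) ^ n) (\<lambda>x. qpoch (c * x ^ a) (x ^ N)) sequentially"
    using r sub uniform_limit_on_subset[OF qpoch_x_uniform_limit[OF r(1,2)]] by blast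
qed (auto intro!: holomorphic_intros)

lemma qpoch_x_fps: "(\<lambda>x. qpoch (c * x ^ a) (x ^ N)) has_fps_expansion qseries c a"
proof -
  have "(\<lambda>x. qpoch (c * x ^ a) (x ^ N)) analytic_on {0}"
    using qpoch_x_holomorphic[of c a] analytic_on_open[OF open_ball] by (meson analytic_on_subset centre_in_ball empty_subsetI insert_subset zero_less_one)
  hence fe: "(\<lambda>x. qpoch (c * x ^ a) (x ^ N)) has_fps_expansion fps_expansion (\<lambda>x. qpoch (c * x ^ a) (x ^ N)) 0"
    by (rule analytic_at_imp_has_fps_expansion_0)
  have "fps_expansion (\<lambda>x. qpoch (c * x ^ a) (x ^ N)) 0 = qseries c a"
  proof (rule uniform_limit_imp_fps_expansion_eq[OF _ _ _ fe])
    show "(\<lambda>M. qseries_part c a M) \<longlonglongrightarrow> qseries c a"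
      unfolding tendsto_fps_iff
    proof
      fix j
      show "\<forall>\<^sub>F M in sequentially. fps_nth (qseries_part c a M) j = fps_nth (qseries c a) j"
        using eventually_ge_at_top[of "Suc j"]
      proof eventually_elim
        case (elim M)
        have "M \<le> M * N" using N by simp
        hence "j < a + M * N" using elim by linarith
        thus ?case by (simp add: qseries_nth)
      qed
    qed
    show "uniform_limit (ball 0 (1/2)) (\<lambda>M x. \<Prod>n<M. 1 - c * x ^ a * (x ^ N) ^ n) (\<lambda>x. qpoch (c * x ^ a) (x ^ N)) sequentially"
      by (rule uniform_limit_on_subset[OF qpoch_x_uniform_limit[of "1/2"]]) auto
    have "(\<lambda>x. \<Prod>n<M. 1 - c * x ^ (a + n * N)) has_fps_expansion qseries_part c a M" for M
      unfolding qseries_part_def by (intro fps_expansion_intros)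
    thus "\<forall>\<^sub>F M in sequentially. (\<lambda>x. \<Prod>n<M. 1 - c * x ^ a * (x ^ N) ^ n) has_fps_expansion qseries_part c a M"
      by (simp add: power_add power_mult mult.commute[of _ N] mult.assoc)
  qed (auto intro!: holomorphic_intros always_eventually)
  with fe show ?thesis by simp
qed

lemma qseries_0: "fps_nth (qseries c a) 0 = (if a = 0 then 1 - c else 1)"
proof -
  have "fps_nth (qseries c a) 0 = fps_nth (qseries_part c a 1) 0" using N by (intro qseries_nth) simp
  thus ?thesis by (simp add: qseries_part_def)
qed

lemma qseries_low: "j < a + N \<Longrightarrow> fps_nth (qseries c a) j = fps_nth (1 - fps_const c * fps_X ^ a) j"
  by (subst qseries_nth[of _ _ 1]) (auto simp: qseries_part_def)

lemma qseries_zpol: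
  assumes "f \<in> zpol"
  shows "(\<lambda>w. fps_nth (qseries (f w) a) j) \<in> zpol"
proof -
  have "(\<lambda>w. fps_nth (qseries_part (f w) a M) j) \<in> zpol" for M
  proof (induction M arbitrary: j)
    case 0
    show ?case using zpol_0 zpol_1 by (cases j) (auto simp: qseries_part_def)
  next
    case (Suc M)
    have "(\<lambda>w. fps_nth (qseries_part (f w) a M) j - f w * fps_nth (qseries_part (f w) a M) (j - (a + M * N))) \<in> zpol"
      by (intro zpol_diff zpol.mult Suc assms)
    thus ?case using Suc by (cases "j < a + M * N") (auto simp: qseries_part_Suc)
  qed
  thus ?thesis by (simp add: qseries_def)
qed

text \<open>\<open>w ^ (N - 1)\<close> stands for 1/w, in order that the coefficients be polynomials
  in w.\<close>

definition siegel_series :: "nat \<Rightarrow> complex \<Rightarrow> complex fps" where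
  "siegel_series k w = qseries w k * qseries (w ^ (N - 1)) (N - k)"

text \<open>6 N^2 times the Bernoulli polynomial x^2 - x + 1/6 at x = k/N. For 0 \<le> k < N the
  power of q split off from a Siegel function is \<open>siegel_order\<close> divided by 12
  N^2.\<close>

definition siegel_order :: "int \<Rightarrow> int" where
  "siegel_order k = 6 * k\<^sup>2 - 6 * k * int N + (int N)\<^sup>2"

text \<open>The constant C need not be a power of w, but its power with exponent 12 N is one; this
  is what will make the expansions of the functions \<open>phi\<close> polynomial in w.\<close>

lemma sieg_q_expansion:
  fixes k :: nat and l :: int
  assumes "k < N" and w: "w = ex (of_int l / of_nat N)"
  shows "\<exists>C g. C = \<i> * exp (of_real pi * \<i> * ((of_nat k / of_nat N - 1) * (of_int l / of_nat N))) \<and>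
     C ^ (12 * N) = w ^ (6 * k) \<and> g has_fps_expansion siegel_series k w \<and>
     (\<forall>\<tau>. Im \<tau> > 0 \<longrightarrow> sieg (of_nat k / of_nat N) (of_int l / of_nat N) \<tau> =
         C * ex (of_int (siegel_order k) / (12 * of_nat N ^ 2) * \<tau>) * g (ex (\<tau> / of_nat N)))"
proof -
  have n0: "(of_nat N :: complex) \<noteq> 0" using N by simp
  define C where "C = \<i> * exp (of_real pi * \<i> * ((of_nat k / of_nat N - 1) * (of_int l / of_nat N)))"
  define g where "g x = qpoch (w * x ^ k) (x ^ N) * qpoch (w ^ (N - 1) * x ^ (N - k)) (x ^ N)" for x
  have wN: "w ^ N = 1"
  proof -
    have "w ^ N = ex (of_nat N * (of_int l / of_nat N))" unfolding w ex_of_nat_mult ..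
    thus ?thesis using n0 by simp
  qed
  have w1: "w ^ (N - 1) = inverse w"
    using wN N w by (metis ex_nonzero inverse_unique power_minus_mult mult.commute)
  have "C ^ (12 * N) = \<i> ^ (12 * N) * exp (of_nat (12 * N) * (of_real pi * \<i> * ((of_nat k / of_nat N - 1) * (of_int l / of_nat N))))"
    unfolding C_def power_mult_distrib exp_of_nat_mult ..
  also have "\<i> ^ (12 * N) = (\<i> ^ 4) ^ (3 * N)" by (simp add: power_mult[symmetric])
  also have "\<dots> = 1" by simp
  also have "of_nat (12 * N) * (of_real pi * \<i> * ((of_nat k / of_nat N - 1) * (of_int l / of_nat N))) =
     2 * of_real pi * \<i> * (of_nat (6 * k) * (of_int l / of_nat N) - of_int (6 * l))"
    using n0 by (simp add: field_simps)
  also have "exp \<dots> = ex (of_nat (6 * k) * (of_int l / of_nat N) - of_int (6 * l))" by (simp add: ex_def)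
  also have "\<dots> = w ^ (6 * k)" unfolding ex_diff ex_of_nat_mult ex_of_int w by simp
  finally have C1: "C ^ (12 * N) = w ^ (6 * k)" by simp
  have "sieg (of_nat k / of_nat N) (of_int l / of_nat N) \<tau> =
         C * ex (of_int (siegel_order k) / (12 * of_nat N ^ 2) * \<tau>) * g (ex (\<tau> / of_nat N))" if "Im \<tau> > 0" for \<tau>
  proof -
    define x where "x = ex (\<tau> / of_nat N)"
    define z where "z = of_nat k / of_nat N * \<tau> + of_int l / of_nat N"
    have xN: "x ^ N = ex \<tau>" using ex_of_nat_mult[of N "\<tau> / of_nat N"] n0 by (simp add: x_def)
    have ez: "ex z = w * x ^ k"
      using ex_of_nat_mult[of k "\<tau> / of_nat N"] by (simp add: z_def ex_add w x_def mult.commute)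
    have "x ^ N = x ^ (N - k) * x ^ k" using assms(1) by (simp flip: power_add)
    hence ez': "ex (\<tau> - z) = w ^ (N - 1) * x ^ (N - k)"
      unfolding ex_diff ez w1 by (simp add: xN[symmetric] x_def field_simps w)
    have "sieg (of_nat k / of_nat N) (of_int l / of_nat N) \<tau> = \<i> * (exp (of_real pi * \<i> * (of_nat k / of_nat N * z + \<tau> / 6)) *
       exp (- of_real pi * \<i> * z)) * (qpoch (w * x ^ k) (x ^ N) * qpoch (w ^ (N - 1) * x ^ (N - k)) (x ^ N))"
      unfolding sieg_def z_def[symmetric] theta_def ez ez' xN by (simp only: mult_ac)
    also have "exp (of_real pi * \<i> * (of_nat k / of_nat N * z + \<tau> / 6)) * exp (- of_real pi * \<i> * z) =
      exp (of_real pi * \<i> * ((of_nat k / of_nat N - 1) * (of_int l / of_nat N))) * ex (of_int (siegel_order k) / (12 * of_nat N ^ 2) * \<tau>)"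
      unfolding ex_def exp_add[symmetric] z_def siegel_order_def
      by (intro arg_cong[of _ _ exp]) (use n0 in \<open>simp add: field_simps power2_eq_square\<close>)
    finally show ?thesis by (simp add: C_def g_def x_def)
  qed
  moreover have "g has_fps_expansion siegel_series k w"
    unfolding g_def[abs_def] siegel_series_def by (intro fps_expansion_intros qpoch_x_fps)
  ultimately show ?thesis using C1 C_def by blast
qed

end

section \<open>The action of the modular group\<close>

definition mat2 :: "int \<Rightarrow> int \<Rightarrow> int \<Rightarrow> int \<Rightarrow> int ^ 2 ^ 2" where
  "mat2 a b c d = (\<chi> i j. if i = 1 then if j = 1 then a else b else if j = 1 then c else d)"

lemma mat2_nth [simp]: "mat2 a b c d $ 1 $ 1 = a" "mat2 a b c d $ 1 $ 2 = b"
  "mat2 a b c d $ 2 $ 1 = c" "mat2 a b c d $ 2 $ 2 = d"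
  by (auto simp: mat2_def)

lemma SL2Z_iff: "A \<in> SL2Z \<longleftrightarrow> A $ 1 $ 1 * A $ 2 $ 2 - A $ 1 $ 2 * A $ 2 $ 1 = 1"
  by (simp add: SL2Z_def det_2)

lemma mat_mult_nth:
  fixes A B :: "int ^ 2 ^ 2"
  shows "(A ** B) $ i $ j = A $ i $ 1 * B $ 1 $ j + A $ i $ 2 * B $ 2 $ j"
  by (simp add: matrix_matrix_mult_def sum_2)

lemma SL2Z_mult: "A \<in> SL2Z \<Longrightarrow> B \<in> SL2Z \<Longrightarrow> A ** B \<in> SL2Z"
  by (simp add: SL2Z_def det_mul)

lemma SL2_act_eq: "SL2_act A \<tau> = (of_int (A $ 1 $ 1) * \<tau> + of_int (A $ 1 $ 2)) / (of_int (A $ 2 $ 1) * \<tau> + of_int (A $ 2 $ 2))"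
  by (simp add: SL2_act_def moebius_def)

lemma Im_SL2_act: "A \<in> SL2Z \<Longrightarrow> Im \<tau> > 0 \<Longrightarrow> Im (SL2_act A \<tau>) > 0"
  unfolding SL2_act_eq SL2Z_iff by (rule Im_moebius(3))

lemma SL2_act_mult:
  assumes "A \<in> SL2Z" "B \<in> SL2Z" "Im \<tau> > 0"
  shows "SL2_act (A ** B) \<tau> = SL2_act A (SL2_act B \<tau>)"
proof -
  define n where "n = of_int (B $ 2 $ 1) * \<tau> + of_int (B $ 2 $ 2)"
  define m where "m = of_int (B $ 1 $ 1) * \<tau> + of_int (B $ 1 $ 2)"
  have n: "n \<noteq> 0" unfolding n_def using assms(2,3) SL2Z_iff Im_moebius(1) by blast
  have "SL2_act A (SL2_act B \<tau>) = (of_int (A $ 1 $ 1) * (m / n) + of_int (A $ 1 $ 2)) / (of_int (A $ 2 $ 1) * (m / n) + of_int (A $ 2 $ 2))"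
    by (simp add: SL2_act_eq m_def n_def)
  also have "\<dots> = ((of_int (A $ 1 $ 1) * m + of_int (A $ 1 $ 2) * n) / n) / ((of_int (A $ 2 $ 1) * m + of_int (A $ 2 $ 2) * n) / n)"
    using n by (simp add: field_simps)
  also have "\<dots> = (of_int (A $ 1 $ 1) * m + of_int (A $ 1 $ 2) * n) / (of_int (A $ 2 $ 1) * m + of_int (A $ 2 $ 2) * n)"
    using n by simp
  also have "\<dots> = SL2_act (A ** B) \<tau>"
    by (simp add: SL2_act_eq mat_mult_nth m_def n_def algebra_simps)
  finally show ?thesis by simp
qed

definition inv2 :: "int ^ 2 ^ 2 \<Rightarrow> int ^ 2 ^ 2" where
  "inv2 A = mat2 (A $ 2 $ 2) (- A $ 1 $ 2) (- A $ 2 $ 1) (A $ 1 $ 1)"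

lemma inv2_SL2Z: "A \<in> SL2Z \<Longrightarrow> inv2 A \<in> SL2Z"
  by (simp add: SL2Z_iff inv2_def algebra_simps)

lemma mat_1_SL2Z: "mat 1 \<in> SL2Z" by (simp add: SL2Z_def)

lemma SL2_act_1: "SL2_act (mat 1) \<tau> = \<tau>" by (simp add: SL2_act_eq mat_def)

lemma inv2_left: "A \<in> SL2Z \<Longrightarrow> inv2 A ** A = mat 1"
  by (simp add: vec_eq_iff forall_2 mat_mult_nth mat_def inv2_def SL2Z_iff algebra_simps)

lemma inv2_right: "A \<in> SL2Z \<Longrightarrow> A ** inv2 A = mat 1"
  by (simp add: vec_eq_iff forall_2 mat_mult_nth mat_def inv2_def SL2Z_iff algebra_simps)

lemma SL2_act_inv: "A \<in> SL2Z \<Longrightarrow> Im \<tau> > 0 \<Longrightarrow> SL2_act (inv2 A) (SL2_act A \<tau>) = \<tau>"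
  using SL2_act_mult[OF inv2_SL2Z, of A A \<tau>] by (simp add: inv2_left SL2_act_1)

lemma SL2_act_inv': "A \<in> SL2Z \<Longrightarrow> Im \<tau> > 0 \<Longrightarrow> SL2_act A (SL2_act (inv2 A) \<tau>) = \<tau>"
  using SL2_act_mult[OF _ inv2_SL2Z, of A A \<tau>] by (simp add: inv2_right SL2_act_1)

lemma translation_SL2Z: "mat2 1 k 0 1 \<in> SL2Z" by (simp add: SL2Z_iff)
lemma SL2_act_translation: "SL2_act (mat2 1 k 0 1) \<tau> = \<tau> + of_int k" by (simp add: SL2_act_eq)

lemma SL2_act_holomorphic: "A \<in> SL2Z \<Longrightarrow> SL2_act A holomorphic_on upper_half_plane"
  unfolding SL2_act_eq[abs_def] using Im_moebius(1) SL2Z_iff by (intro holomorphic_intros) blast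

lemma holomorphic_SL2_act:
  assumes "A \<in> SL2Z" "f holomorphic_on upper_half_plane"
  shows "(\<lambda>\<tau>. f (SL2_act A \<tau>)) holomorphic_on upper_half_plane"
proof -
  have "SL2_act A ` upper_half_plane \<subseteq> upper_half_plane" using Im_SL2_act[OF assms(1)] by auto
  from holomorphic_on_compose_gen[OF SL2_act_holomorphic[OF assms(1)] assms(2) this] show ?thesis by (simp add: o_def)
qed

text \<open>By Dirichlet approximation there are coprime \<open>c, d\<close> with \<open>\<bar>c\<tau> + d\<bar>\<^sup>2 \<le> 5 Im \<tau>\<close>.\<close>

lemma exists_SL2_large_Im:
  assumes "Im \<tau> > 0"
  obtains A where "A \<in> SL2Z" "Im (SL2_act A \<tau>) \<ge> 1 / 5"
proof (cases "Im \<tau> \<ge> 1")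
  case True
  show ?thesis by (rule that[of "mat 1"]) (use True in \<open>auto simp: mat_1_SL2Z SL2_act_1\<close>)
next
  case False
  define y where "y = Im \<tau>"
  \<comment> \<open>This choice balances the two terms: the approximation error is at most sqrt y
    and k y is at most 2 sqrt y, whence the constant 1 + 4 = 5.\<close>
  define Q where "Q = nat \<lceil>1 / sqrt y\<rceil>"
  have y: "0 < y" "y < 1" using assms False by (auto simp: y_def)
  have sy: "0 < sqrt y" "sqrt y < 1" using y by auto
  have q1: "1 / sqrt y \<ge> 1" using sy by simp
  have Q: "real Q \<ge> 1 / sqrt y" "real Q \<le> 1 / sqrt y + 1"
    using q1 by (auto simp: Q_def)
  have "real Q > 0" using Q(1) q1 by linarith
  hence Q0: "Q > 0" by simp
  obtain h k where hk: "coprime h k" "0 < k" "k \<le> int Q" "\<bar>of_int k * Re \<tau> - of_int h\<bar> < 1 / real Q"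
    using Dirichlet_approx_coprime[OF Q0, of "Re \<tau>"] by blast
  obtain u v where uv: "u * k + v * h = 1" using bezout_int[of k h] hk(1) by (auto simp: coprime_iff_gcd_eq_1 gcd.commute)
  define A where "A = mat2 (- v) (- u) k (- h)"
  have A: "A \<in> SL2Z" using uv by (simp add: A_def SL2Z_iff algebra_simps)
  have "norm (of_int k * \<tau> + of_int (- h)) ^ 2 = (of_int k * Re \<tau> - of_int h) ^ 2 + (of_int k * y) ^ 2"
    by (simp add: cmod_power2 y_def)
  also have "(of_int k * Re \<tau> - of_int h) ^ 2 \<le> (sqrt y) ^ 2"
  proof -
    have "1 / real Q \<le> sqrt y" using Q(1) Q0 sy by (simp add: field_simps)
    hence "\<bar>of_int k * Re \<tau> - of_int h\<bar> \<le> \<bar>sqrt y\<bar>" using hk(4) by simp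
    thus ?thesis unfolding abs_le_square_iff .
  qed
  also have "(of_int k * y) ^ 2 \<le> (2 * sqrt y) ^ 2"
  proof (rule power_mono)
    have "of_int k * y \<le> real Q * y" using hk(3) y by (intro mult_right_mono) linarith+
    also have "\<dots> \<le> (2 / sqrt y) * y"
    proof (intro mult_right_mono)
      have "2 / sqrt y = 1 / sqrt y + 1 / sqrt y" by (simp flip: add_divide_distrib)
      thus "real Q \<le> 2 / sqrt y" using Q(2) q1 by linarith
    qed (use y in auto)
    also have "\<dots> = 2 * (y / sqrt y)" by simp
    also have "y / sqrt y = sqrt y" using y by (intro real_div_sqrt) simp
    finally show "of_int k * y \<le> 2 * sqrt y" .
  qed (use hk y in auto)
  finally have "norm (of_int k * \<tau> + of_int (- h)) ^ 2 \<le> 5 * y" using y by (simp add: power_mult_distrib)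
  moreover have "of_int k * \<tau> + of_int (- h) \<noteq> 0" using Im_moebius(1)[OF assms, of "- v" "- h" "- u" k] uv by (simp add: algebra_simps)
  moreover have "Im (SL2_act A \<tau>) = y / norm (of_int k * \<tau> + of_int (- h)) ^ 2"
    using Im_moebius(2)[OF assms, of "- v" "- h" "- u" k] uv by (simp add: SL2_act_eq A_def y_def algebra_simps)
  ultimately have "Im (SL2_act A \<tau>) \<ge> 1 / 5"
  proof -
    define n where "n = norm (of_int k * \<tau> + of_int (- h)) ^ 2"
    assume *: "norm (of_int k * \<tau> + of_int (- h)) ^ 2 \<le> 5 * y" "of_int k * \<tau> + of_int (- h) \<noteq> 0"
      "Im (SL2_act A \<tau>) = y / norm (of_int k * \<tau> + of_int (- h)) ^ 2"
    have "n > 0" unfolding n_def using *(2) by (intro zero_less_power) (simp only: zero_less_norm_iff not_False_eq_True)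
    moreover have "n \<le> 5 * y" using *(1) by (simp only: n_def)
    ultimately show "1 / 5 \<le> Im (SL2_act A \<tau>)" unfolding *(3) n_def[symmetric] by (simp add: field_simps)
  qed
  thus ?thesis using that A by blast
qed

section \<open>The maximum principle\<close>

text \<open>Every value of a translate f \<circ> A is also a value of some translate at a point of
  imaginary part at least 1/5, that is, in a fixed disc of radius r < 1 in the parameter q^(1/N).
  There are finitely many translates, so the maximum over all of them is attained at an interior
  point, possibly at the cusp itself.\<close>

theorem modular_maximum_principle:
  assumes N: "N > 0" and hol: "f holomorphic_on upper_half_plane"
    and fin: "finite ((\<lambda>A. restrict (\<lambda>\<tau>. f (SL2_act A \<tau>)) upper_half_plane) ` SL2Z)"
    and per: "\<And>A \<tau>. A \<in> SL2Z \<Longrightarrow> Im \<tau> > 0 \<Longrightarrow> f (SL2_act A (\<tau> + of_nat N)) = f (SL2_act A \<tau>)"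
    and exp: "\<And>A. A \<in> SL2Z \<Longrightarrow> \<exists>F. has_q_expansion N (\<lambda>\<tau>. f (SL2_act A \<tau>)) F \<and> fls_subdegree F \<ge> 0"
  obtains c where "\<And>\<tau>. Im \<tau> > 0 \<Longrightarrow> f \<tau> = c"
proof -
  define tr where "tr A = restrict (\<lambda>\<tau>. f (SL2_act A \<tau>)) upper_half_plane" for A
  define \<Theta> where "\<Theta> = tr ` SL2Z"
  have fin\<Theta>: "finite \<Theta>" using fin by (simp add: \<Theta>_def tr_def[abs_def])
  have "\<Theta> \<noteq> {}" using mat_1_SL2Z by (auto simp: \<Theta>_def)
  have "\<exists>g. g holomorphic_on ball 0 1 \<and> (\<forall>\<tau>. Im \<tau> > 0 \<longrightarrow> \<psi> \<tau> = g (ex (\<tau> / of_nat N)))" if "\<psi> \<in> \<Theta>" for \<psi>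
  proof -
    from that obtain A where A: "A \<in> SL2Z" "\<psi> = tr A" by (auto simp: \<Theta>_def)
    obtain F where F: "has_q_expansion N (\<lambda>\<tau>. f (SL2_act A \<tau>)) F" "fls_subdegree F \<ge> 0" using exp A by blast
    obtain g where "g holomorphic_on ball 0 1" "\<And>\<tau>. Im \<tau> > 0 \<Longrightarrow> f (SL2_act A \<tau>) = g (ex (\<tau> / of_nat N))"
      using periodic_descent_regular[OF N holomorphic_SL2_act[OF A(1) hol] per[OF A(1)] F] by metis
    thus ?thesis using A(2) by (intro exI[of _ g]) (simp add: tr_def)
  qed
  then obtain G where G: "\<And>\<psi>. \<psi> \<in> \<Theta> \<Longrightarrow> G \<psi> holomorphic_on ball 0 1"
    "\<And>\<psi> \<tau>. \<psi> \<in> \<Theta> \<Longrightarrow> Im \<tau> > 0 \<Longrightarrow> \<psi> \<tau> = G \<psi> (ex (\<tau> / of_nat N))" by metis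
  \<comment> \<open>The modulus of q^(1/N) on the line of imaginary part 1/5.\<close>
  define r where "r = exp (- (2 * pi / real N) * (1 / 5))"
  have r: "r > 0" "r < 1" using N by (auto simp: r_def)
  have "\<exists>z0\<in>cball 0 r. \<forall>z\<in>cball 0 r. norm (G \<psi> z) \<le> norm (G \<psi> z0)" if "\<psi> \<in> \<Theta>" for \<psi>
  proof (rule continuous_attains_sup)
    have "cball 0 r \<subseteq> (ball 0 1 :: complex set)" using r by auto
    thus "continuous_on (cball 0 r) (\<lambda>z. norm (G \<psi> z))"
      using G(1)[OF that] holomorphic_on_imp_continuous_on continuous_on_subset by (intro continuous_on_norm) blast
  qed (use r in auto)
  then obtain z0 where z0: "\<And>\<psi>. \<psi> \<in> \<Theta> \<Longrightarrow> z0 \<psi> \<in> cball 0 r"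
    "\<And>\<psi> z. \<psi> \<in> \<Theta> \<Longrightarrow> z \<in> cball 0 r \<Longrightarrow> norm (G \<psi> z) \<le> norm (G \<psi> (z0 \<psi>))" by metis
  define m where "m = Max ((\<lambda>\<psi>. norm (G \<psi> (z0 \<psi>))) ` \<Theta>)"
  have "m \<in> (\<lambda>\<psi>. norm (G \<psi> (z0 \<psi>))) ` \<Theta>" unfolding m_def using fin\<Theta> \<open>\<Theta> \<noteq> {}\<close> by (intro Max_in) auto
  then obtain \<psi>0 where \<psi>0: "\<psi>0 \<in> \<Theta>" "m = norm (G \<psi>0 (z0 \<psi>0))" by blast
  have le_m: "norm (G \<psi> (z0 \<psi>)) \<le> m" if "\<psi> \<in> \<Theta>" for \<psi> unfolding m_def using fin\<Theta> that by (intro Max_ge) auto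
  have bound: "norm (G \<psi> z) \<le> m" if \<psi>: "\<psi> \<in> \<Theta>" and z: "z \<in> ball 0 1" for \<psi> z
  proof (cases "z = 0")
    case True
    have "norm (G \<psi> z) \<le> norm (G \<psi> (z0 \<psi>))" using True r by (intro z0(2)[OF \<psi>]) auto
    thus ?thesis using le_m[OF \<psi>] by linarith
  next
    case False
    define \<tau> where "\<tau> = of_nat N * Ln z / (2 * of_real pi * \<i>)"
    have ez: "ex (\<tau> / of_nat N) = z" using False N by (simp add: ex_def \<tau>_def)
    have "exp (- (2 * pi / real N) * Im \<tau>) < 1" using ez norm_ex[of "\<tau> / of_nat N"] z by simp
    hence im: "Im \<tau> > 0" using N by (simp add: field_simps zero_less_mult_iff)
    from \<psi> obtain A where A: "A \<in> SL2Z" "\<psi> = tr A" by (auto simp: \<Theta>_def)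
    obtain B where B: "B \<in> SL2Z" "Im (SL2_act B \<tau>) \<ge> 1 / 5" using exists_SL2_large_Im[OF im] by blast
    define C where "C = A ** inv2 B"
    have C: "C \<in> SL2Z" using A B inv2_SL2Z SL2Z_mult by (simp add: C_def)
    have imB: "Im (SL2_act B \<tau>) > 0" using B(2) by linarith
    have "\<psi> \<tau> = f (SL2_act A (SL2_act (inv2 B) (SL2_act B \<tau>)))"
      using A(2) im by (simp add: tr_def SL2_act_inv[OF B(1) im])
    also have "\<dots> = tr C (SL2_act B \<tau>)"
      using SL2_act_mult[OF A(1) inv2_SL2Z[OF B(1)] imB] imB by (simp add: tr_def C_def)
    finally have "G \<psi> z = G (tr C) (ex (SL2_act B \<tau> / of_nat N))"
      using G(2)[OF \<psi> im] G(2)[of "tr C", OF _ imB] C ez by (simp add: \<Theta>_def)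
    moreover have "ex (SL2_act B \<tau> / of_nat N) \<in> cball 0 r"
    proof -
      have "- (2 * pi / real N) * Im (SL2_act B \<tau>) \<le> - (2 * pi / real N) * (1 / 5)"
        using B(2) N by (intro mult_left_mono_neg) auto
      thus ?thesis by (simp add: norm_ex r_def)
    qed
    moreover have "tr C \<in> \<Theta>" using C by (simp add: \<Theta>_def)
    ultimately show ?thesis using z0(2)[of "tr C"] le_m[of "tr C"] by (metis order_trans)
  qed
  have "G \<psi>0 constant_on ball 0 1"
  proof (rule maximum_modulus_principle[OF G(1)[OF \<psi>0(1)] open_ball _ open_ball])
    show "z0 \<psi>0 \<in> ball 0 1" using z0(1)[OF \<psi>0(1)] r by auto
    show "norm (G \<psi>0 z) \<le> norm (G \<psi>0 (z0 \<psi>0))" if "z \<in> ball 0 1" for z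
      using bound[OF \<psi>0(1) that] \<psi>0(2) by simp
  qed auto
  then obtain c where c: "\<And>z. z \<in> ball 0 1 \<Longrightarrow> G \<psi>0 z = c" by (auto simp: constant_on_def)
  from \<psi>0(1) obtain A where A: "A \<in> SL2Z" "\<psi>0 = tr A" by (auto simp: \<Theta>_def)
  show ?thesis
  proof (rule that[of c])
    fix \<tau> :: complex assume im: "Im \<tau> > 0"
    have im': "Im (SL2_act (inv2 A) \<tau>) > 0" using Im_SL2_act[OF inv2_SL2Z[OF A(1)] im] .
    have "f \<tau> = \<psi>0 (SL2_act (inv2 A) \<tau>)" using A im' SL2_act_inv'[OF A(1) im] by (simp add: tr_def)
    also have "\<dots> = G \<psi>0 (ex (SL2_act (inv2 A) \<tau> / of_nat N))" by (rule G(2)[OF \<psi>0(1) im'])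
    also have "\<dots> = c" using N im' by (intro c) (simp add: norm_ex)
    finally show "f \<tau> = c" .
  qed
qed

section \<open>Integral Laurent series\<close>

definition fls_over :: "complex set \<Rightarrow> complex fls \<Rightarrow> bool" where
  "fls_over K F \<longleftrightarrow> (\<forall>n. fls_nth F n \<in> K)"

lemma fls_over_shift [simp]: "fls_over K (fls_shift m F) \<longleftrightarrow> fls_over K F"
  unfolding fls_over_def fls_shift_nth by (metis diff_add_cancel)

lemma fls_over_fps_to_fls: "fps_over K P \<Longrightarrow> 0 \<in> K \<Longrightarrow> fls_over K (fps_to_fls P)"
  by (auto simp: fls_over_def fps_over_def)

lemma fls_over_obtain_fps:
  assumes "fls_over K F" "m \<ge> - fls_subdegree F"
  obtains P where "F = fls_shift m (fps_to_fls P)" "fps_over K P"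
proof -
  define P where "P = Abs_fps (\<lambda>n. fls_nth F (int n - m))"
  have "F = fls_shift m (fps_to_fls P)"
  proof (rule fls_eqI)
    fix n
    show "fls_nth F n = fls_nth (fls_shift m (fps_to_fls P)) n"
      using assms(2) by (cases "n + m \<ge> 0") (auto simp: P_def intro!: fls_eq0_below_subdegree)
  qed
  moreover have "fps_over K P" using assms(1) by (auto simp: fps_over_def fls_over_def P_def)
  ultimately show ?thesis using that by blast
qed

lemma fls_over_mult:
  assumes "fls_over \<int> F" "fls_over \<int> G"
  shows "fls_over \<int> (F * G)"
proof -
  obtain P where P: "F = fls_shift (- fls_subdegree F) (fps_to_fls P)" "fps_over \<int> P"
    using fls_over_obtain_fps[OF assms(1)] by blast
  obtain Q where Q: "G = fls_shift (- fls_subdegree G) (fps_to_fls Q)" "fps_over \<int> Q"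
    using fls_over_obtain_fps[OF assms(2)] by blast
  have "F * G = fls_shift (- fls_subdegree F - fls_subdegree G) (fps_to_fls (P * Q))"
    by (subst P(1), subst Q(1)) (simp add: fls_shifted_times_simps fls_times_fps_to_fls algebra_simps)
  also have "fls_over \<int> \<dots>" using P Q by (simp add: fls_over_fps_to_fls fps_over_mult)
  finally show ?thesis .
qed

lemma fls_over_add: "fls_over \<int> F \<Longrightarrow> fls_over \<int> G \<Longrightarrow> fls_over \<int> (F + G)"
  by (auto simp: fls_over_def)
lemma fls_over_const: "c \<in> \<int> \<Longrightarrow> fls_over \<int> (fls_const c)"
  by (auto simp: fls_over_def fls_const_nth)
lemma fls_over_power: "fls_over \<int> F \<Longrightarrow> fls_over \<int> (F ^ n)"
  by (induction n) (auto intro: fls_over_mult fls_over_const[of 1, simplified])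

lemma has_q_expansion_refine:
  assumes "N > 0" "d > 0" "has_q_expansion N f F"
  shows "has_q_expansion (d * N) f (fls_compose_power F d)"
proof -
  obtain P where P: "F = fls_shift (- fls_subdegree F) (fps_to_fls P)"
    using fls_over_obtain_fps[of UNIV F "- fls_subdegree F"] by (auto simp: fls_over_def)
  define n where "n = fls_subdegree F"
  have F: "F = fls_shift (- n) (fps_to_fls P)" using P by (simp add: n_def)
  have "fps_conv_radius P > 0" using assms(3) F by (metis fls_conv_radius_fps_to_fls fls_conv_radius_shift has_q_expansion_def)
  hence "eval_fps P has_fps_expansion P" by (rule eval_fps_has_fps_expansion)
  moreover have "(\<lambda>y::complex. y ^ d) has_fps_expansion fps_X ^ d" by (intro fps_expansion_intros)
  ultimately have "(eval_fps P \<circ> (\<lambda>y. y ^ d)) has_fps_expansion fps_compose P (fps_X ^ d)"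
    by (rule has_fps_expansion_compose) (use assms(2) in auto)
  hence "(\<lambda>y. eval_fps P (y ^ d)) has_laurent_expansion fps_to_fls (fps_compose P (fps_X ^ d))"
    by (simp add: o_def has_laurent_expansion_fps)
  from has_laurent_expansion_shift[OF this, of "int d * n"]
  have L: "(\<lambda>y. eval_fps P (y ^ d) * y powi (int d * n)) has_laurent_expansion fls_compose_power F d"
    using assms(2) by (subst F) (simp add: fls_compose_power_fps_to_fls)
  show ?thesis
  proof (rule has_q_expansionI[OF _ L])
    have "\<forall>\<^sub>F z in at 0. eval_fls F z = eval_fps P z * z powi n"
    proof -
      have "\<forall>\<^sub>F z in at 0. norm z < 1 \<and> z \<noteq> (0::complex)"
        by (auto simp: eventually_at intro!: exI[of _ 1])
      moreover have "\<forall>\<^sub>F z in at 0. z \<in> eball 0 (fps_conv_radius P) - {0}"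
        using \<open>fps_conv_radius P > 0\<close> by (intro eventually_at_in_open) (auto simp: zero_ereal_def)
      ultimately show ?thesis
      proof eventually_elim
        case (elim z)
        have "eval_fls (fls_shift (- n) (fps_to_fls P)) z = eval_fls (fps_to_fls P) z * z powi - (- n)"
          by (rule eval_fls_shift) (use elim in auto)
        also have "eval_fls (fps_to_fls P) z = eval_fps P z"
          by (rule eval_fps_to_fls) (use elim in auto)
        finally show ?case using F by simp
      qed
    qed
    hence "\<forall>\<^sub>F \<tau> in filtercomap Im at_top. eval_fls F (ex (\<tau> / of_nat N)) = eval_fps P (ex (\<tau> / of_nat N)) * ex (\<tau> / of_nat N) powi n"
      using eventually_ex_iff[OF assms(1), of "\<lambda>z. eval_fls F z = eval_fps P z * z powi n"] by blast
    moreover have xd: "ex (\<tau> / of_nat N) = ex (\<tau> / of_nat (d * N)) ^ d" for \<tau>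
      using assms ex_of_nat_mult[of d "\<tau> / of_nat (d * N)"] by simp
    ultimately show "\<forall>\<^sub>F \<tau> in filtercomap Im at_top. f \<tau> =
        eval_fps P (ex (\<tau> / of_nat (d * N)) ^ d) * ex (\<tau> / of_nat (d * N)) powi (int d * n)"
      using has_q_expansion_ev[OF assms(3)]
      by - (rule eventually_elim2, assumption, assumption, simp add: xd power_int_mult)
  qed (use assms in auto)
qed

lemma fls_over_compose_power: "d > 0 \<Longrightarrow> 0 \<in> K \<Longrightarrow> fls_over K F \<Longrightarrow> fls_over K (fls_compose_power F d)"
  by (auto simp: fls_over_def fls_nth_compose_power)

section \<open>Powers of Siegel functions\<close>

definition sg :: "nat \<Rightarrow> int \<Rightarrow> int \<Rightarrow> complex \<Rightarrow> complex" where
  "sg M k l = sieg (of_int k / of_nat M) (of_int l / of_nat M)"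

lemma ex_neg_half_power:
  assumes "M > 0" "2 * M dvd e"
  shows "(- exp (- of_real pi * \<i> * (of_int l / of_nat M))) ^ e = 1" "(- exp (of_real pi * \<i> * (of_int l / of_nat M))) ^ e = 1"
proof -
  obtain m where m: "e = 2 * M * m" using assms(2) by blast
  have "(exp (of_real pi * \<i> * (of_int l / of_nat M))) ^ e = ex (of_int (int m * l))"
    unfolding exp_of_nat_mult[symmetric] ex_def using assms(1) by (intro arg_cong[of _ _ exp]) (simp add: m)
  hence 1: "(exp (of_real pi * \<i> * (of_int l / of_nat M))) ^ e = 1" by (simp only: ex_of_int)
  have "even e" using m by simp
  thus "(- exp (of_real pi * \<i> * (of_int l / of_nat M))) ^ e = 1" using 1 by (simp add: power_minus_even)
  show "(- exp (- of_real pi * \<i> * (of_int l / of_nat M))) ^ e = 1" using 1 \<open>even e\<close>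
    by (simp add: power_minus_even exp_minus power_inverse)
qed

text \<open>An integral shift of the characteristic multiplies a Siegel function of level M by a
  root of unity of order dividing 2 M.\<close>

lemma sg_power_periodic:
  assumes "M > 0" "2 * M dvd e" "Im \<tau> > 0"
  shows "sg M (k + int M * i) (l + int M * j) \<tau> ^ e = sg M k l \<tau> ^ e"
proof -
  have 1: "sg M (k + int M) l \<tau> ^ e = sg M k l \<tau> ^ e" for k l
  proof -
    have "sg M (k + int M) l \<tau> = - exp (- of_real pi * \<i> * (of_int l / of_nat M)) * sg M k l \<tau>"
      using sieg_add_left[OF assms(3), of "of_int k / of_nat M" "of_int l / of_nat M"] assms(1)
      by (simp add: sg_def add_divide_distrib)
    thus ?thesis by (simp only: power_mult_distrib ex_neg_half_power[OF assms(1,2)]) simp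
  qed
  have 2: "sg M k (l + int M) \<tau> ^ e = sg M k l \<tau> ^ e" for k l
  proof -
    have "sg M k (l + int M) \<tau> = - exp (of_real pi * \<i> * (of_int k / of_nat M)) * sg M k l \<tau>"
      using sieg_add_right[OF assms(3), of "of_int k / of_nat M" "of_int l / of_nat M"] assms(1)
      by (simp add: sg_def add_divide_distrib)
    thus ?thesis by (simp only: power_mult_distrib ex_neg_half_power[OF assms(1,2)]) simp
  qed
  have 3: "sg M (k + int M * i) l \<tau> ^ e = sg M k l \<tau> ^ e" for l
  proof (induction i rule: int_induct[of _ 0])
    case (step1 i) thus ?case using 1[of "k + int M * i" l] by (simp add: algebra_simps)
  next
    case (step2 i) thus ?case using 1[of "k + int M * (i - 1)" l] by (simp add: algebra_simps)
  qed simp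
  have "sg M k (l + int M * j) \<tau> ^ e = sg M k l \<tau> ^ e"
  proof (induction j rule: int_induct[of _ 0])
    case (step1 i) thus ?case using 2[of k "l + int M * i"] by (simp add: algebra_simps)
  next
    case (step2 i) thus ?case using 2[of k "l + int M * (i - 1)"] by (simp add: algebra_simps)
  qed simp
  thus ?thesis using 3 by simp
qed

lemma sg_power_cong:
  assumes "M > 0" "2 * M dvd e" "Im \<tau> > 0" "[k = k'] (mod int M)" "[l = l'] (mod int M)"
  shows "sg M k l \<tau> ^ e = sg M k' l' \<tau> ^ e"
proof -
  obtain i where i: "k = k' + int M * i" using assms(4) by (metis cong_iff_lin cong_sym)
  obtain j where j: "l = l' + int M * j" using assms(5) by (metis cong_iff_lin cong_sym)
  show ?thesis unfolding i j by (rule sg_power_periodic[OF assms(1-3)])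
qed

lemma sg_holomorphic: "sg M k l holomorphic_on upper_half_plane"
  unfolding sg_def by (rule sieg_holomorphic)

lemma sg_nonzero:
  assumes "M > 0" "Im \<tau> > 0" "\<not> (int M dvd k \<and> int M dvd l)"
  shows "sg M k l \<tau> \<noteq> 0"
proof -
  have Ints: "(of_int k / of_nat M :: real) \<in> \<int> \<longleftrightarrow> int M dvd k" for k
  proof
    assume "(of_int k / of_nat M :: real) \<in> \<int>"
    then obtain m where "of_int k / of_nat M = (of_int m :: real)" by (auto simp: Ints_def)
    hence "(of_int k :: real) = of_int (m * int M)" using assms(1) by (simp add: field_simps)
    hence "k = m * int M" using of_int_eq_iff by blast
    thus "int M dvd k" by simp
  next
    assume "int M dvd k"
    then obtain m where "k = int M * m" by blast
    thus "(of_int k / of_nat M :: real) \<in> \<int>" using assms(1) by simp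
  qed
  show ?thesis using sieg_eq_0_iff[OF assms(2), of "of_int k / of_nat M" "of_int l / of_nat M"] assms(3)
    by (simp add: sg_def Ints)
qed

lemma sg_SL2:
  assumes "A \<in> SL2Z"
  obtains \<epsilon> where "\<epsilon> ^ 12 = 1" "\<And>M k l \<tau>. Im \<tau> > 0 \<Longrightarrow> sg M k l (SL2_act A \<tau>) =
     \<epsilon> * sg M (k * A $ 1 $ 1 + l * A $ 2 $ 1) (k * A $ 1 $ 2 + l * A $ 2 $ 2) \<tau>"
proof -
  obtain \<epsilon> where \<epsilon>: "\<epsilon> ^ 12 = 1" "\<And>r s \<tau>. Im \<tau> > 0 \<Longrightarrow> sieg r s (SL2_act A \<tau>) =
     \<epsilon> * sieg (r * of_int (A $ 1 $ 1) + s * of_int (A $ 2 $ 1)) (r * of_int (A $ 1 $ 2) + s * of_int (A $ 2 $ 2)) \<tau>"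
    using sieg_SL2[of "A $ 1 $ 1" "A $ 2 $ 2" "A $ 1 $ 2" "A $ 2 $ 1"] assms unfolding SL2Z_iff SL2_act_eq by metis
  have "sg M k l (SL2_act A \<tau>) = \<epsilon> * sg M (k * A $ 1 $ 1 + l * A $ 2 $ 1) (k * A $ 1 $ 2 + l * A $ 2 $ 2) \<tau>"
    if "Im \<tau> > 0" for M k l \<tau>
    using \<epsilon>(2)[OF that, of "of_int k / of_nat M" "of_int l / of_nat M"] by (simp add: sg_def add_divide_distrib)
  thus ?thesis using that \<epsilon>(1) by blast
qed

lemma sg_power_SL2:
  assumes "A \<in> SL2Z" "12 dvd e" "Im \<tau> > 0"
  shows "sg M k l (SL2_act A \<tau>) ^ e = sg M (k * A $ 1 $ 1 + l * A $ 2 $ 1) (k * A $ 1 $ 2 + l * A $ 2 $ 2) \<tau> ^ e"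
proof -
  obtain \<epsilon> where \<epsilon>: "\<epsilon> ^ 12 = 1" "\<And>M k l \<tau>. Im \<tau> > 0 \<Longrightarrow> sg M k l (SL2_act A \<tau>) =
     \<epsilon> * sg M (k * A $ 1 $ 1 + l * A $ 2 $ 1) (k * A $ 1 $ 2 + l * A $ 2 $ 2) \<tau>" using sg_SL2[OF assms(1)] by blast
  obtain m where "e = 12 * m" using assms(2) by blast
  hence "\<epsilon> ^ e = 1" using \<epsilon>(1) by (simp add: power_mult)
  thus ?thesis by (simp add: \<epsilon>(2)[OF assms(3)] power_mult_distrib)
qed

definition siegel_const :: "nat \<Rightarrow> nat \<Rightarrow> int \<Rightarrow> complex" where
  "siegel_const M k l = \<i> * exp (of_real pi * \<i> * ((of_nat k / of_nat M - 1) * (of_int l / of_nat M)))"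

lemma siegel_const_nonzero: "siegel_const M k l \<noteq> 0" by (simp add: siegel_const_def)

text \<open>The third assumption expresses that the exponent of the power of q^(1/M) split off from
  the e-th power is the integer n.\<close>

lemma sg_power_q_expansion:
  assumes "M > 0" "k < M" "12 * int M * n = int e * siegel_order M (int k)"
  shows "has_q_expansion M (\<lambda>\<tau>. sg M (int k) l \<tau> ^ e)
     (fls_shift (- n) (fps_to_fls (fps_const (siegel_const M k l ^ e) * siegel_series M k (ex (of_int l / of_nat M)) ^ e)))"
proof -
  define w where "w = ex (of_int l / of_nat M)"
  obtain g where g: "g has_fps_expansion siegel_series M k w"
    "\<And>\<tau>. Im \<tau> > 0 \<Longrightarrow> sieg (of_nat k / of_nat M) (of_int l / of_nat M) \<tau> =
         siegel_const M k l * ex (of_int (siegel_order M k) / (12 * of_nat M ^ 2) * \<tau>) * g (ex (\<tau> / of_nat M))"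
    using sieg_q_expansion[OF assms(1,2) w_def] unfolding siegel_const_def by blast
  have "(\<lambda>x. siegel_const M k l ^ e * g x ^ e) has_fps_expansion (fps_const (siegel_const M k l ^ e) * siegel_series M k w ^ e)"
    by (intro fps_expansion_intros g)
  from has_laurent_expansion_shift[OF has_laurent_expansion_fps[OF this], of n]
  show ?thesis unfolding w_def[symmetric]
  proof (rule has_q_expansionI[OF assms(1)], goal_cases)
    case 1
    show ?case using eventually_upper
    proof eventually_elim
      case (elim \<tau>)
      have "ex (of_int (siegel_order M k) / (12 * of_nat M ^ 2) * \<tau>) ^ e = ex (of_int n * (\<tau> / of_nat M))"
      proof -
        have "of_nat e * of_int (siegel_order M k) = (12 * of_nat M * of_int n :: complex)"
          using arg_cong[OF assms(3), of "of_int :: int \<Rightarrow> complex"] by simp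
        hence "of_nat e * (of_int (siegel_order M k) / (12 * of_nat M ^ 2) * \<tau>) = of_int n * (\<tau> / of_nat M)"
          using assms(1) by (simp add: field_simps power2_eq_square)
        thus ?thesis by (simp add: ex_of_nat_mult[symmetric])
      qed
      also have "\<dots> = ex (\<tau> / of_nat M) powi n" by (simp add: ex_def exp_power_int mult_ac)
      finally show ?case using g(2)[OF elim] by (simp add: sg_def power_mult_distrib mult_ac)
    qed
  qed
qed

lemma siegel_series_0:
  assumes "M > 0" "k < M"
  shows "fps_nth (siegel_series M k w) 0 = (if k = 0 then 1 - w else 1)"
  using assms by (simp add: siegel_series_def qseries_0)

lemma siegel_series_zpol: "M > 0 \<Longrightarrow> (\<lambda>w. fps_nth (siegel_series M k w) j) \<in> zpol"
  unfolding siegel_series_def fps_mult_nth by (intro zpol_sum zpol.mult qseries_zpol zpol_power zpol.ident)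

lemma zpol_Ints: "f \<in> zpol \<Longrightarrow> w \<in> \<int> \<Longrightarrow> f w \<in> \<int>"
  by (induction rule: zpol.induct) auto

lemma siegel_series_Ints: "M > 0 \<Longrightarrow> w \<in> \<int> \<Longrightarrow> fps_over \<int> (siegel_series M k w)"
  unfolding fps_over_def using siegel_series_zpol zpol_Ints by blast

section \<open>A Hauptmodul\<close>

text \<open>In terms of the classical invariant this is 768 - j: up to sign the three twelfth powers
  are the 24th powers of Weber's functions, with signs such that their negatives are the roots of (X
  - 16)^3 = j X.\<close>

definition Jf :: "complex \<Rightarrow> complex" where
  "Jf \<tau> = sg 2 1 0 \<tau> ^ 12 * sg 2 0 1 \<tau> ^ 12 + sg 2 1 0 \<tau> ^ 12 * sg 2 1 1 \<tau> ^ 12 + sg 2 0 1 \<tau> ^ 12 * sg 2 1 1 \<tau> ^ 12"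

lemma Jf_holomorphic: "Jf holomorphic_on upper_half_plane"
  unfolding Jf_def[abs_def] by (intro holomorphic_intros sg_holomorphic)

text \<open>The twelfth powers depend on the characteristic modulo 2 only, and an integral matrix of
  odd determinant permutes the three nonzero classes.\<close>

lemma Jf_SL2:
  assumes "A \<in> SL2Z" "Im \<tau> > 0"
  shows "Jf (SL2_act A \<tau>) = Jf \<tau>"
proof -
  define B where "B k l = sg 2 k l \<tau> ^ 12" for k l
  have B: "B k l = B (k mod 2) (l mod 2)" for k l
    unfolding B_def by (rule sg_power_cong) (use assms in \<open>auto simp: cong_def\<close>)
  let ?a = "A $ 1 $ 1" and ?b = "A $ 1 $ 2" and ?c = "A $ 2 $ 1" and ?d = "A $ 2 $ 2"
  have J: "Jf (SL2_act A \<tau>) = B ?a ?b * B ?c ?d + B ?a ?b * B (?a + ?c) (?b + ?d) + B ?c ?d * B (?a + ?c) (?b + ?d)"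
    unfolding Jf_def B_def using sg_power_SL2[OF assms(1) _ assms(2), of 12 2] by simp
  have J': "Jf \<tau> = B 1 0 * B 0 1 + B 1 0 * B 1 1 + B 0 1 * B 1 1" by (simp add: Jf_def B_def)
  have det: "odd (?a * ?d - ?b * ?c)" using assms(1) unfolding SL2Z_iff by presburger
  have p: "?a mod 2 = 0 \<or> ?a mod 2 = 1" "?b mod 2 = 0 \<or> ?b mod 2 = 1" "?c mod 2 = 0 \<or> ?c mod 2 = 1" "?d mod 2 = 0 \<or> ?d mod 2 = 1"
    by presburger+
  have e: "even x \<longleftrightarrow> x mod 2 = 0" for x :: int by presburger
  have sums: "(?a + ?c) mod 2 = (?a mod 2 + ?c mod 2) mod 2" "(?b + ?d) mod 2 = (?b mod 2 + ?d mod 2) mod 2"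
    by presburger+
  have J2: "Jf (SL2_act A \<tau>) = B (?a mod 2) (?b mod 2) * B (?c mod 2) (?d mod 2)
     + B (?a mod 2) (?b mod 2) * B ((?a mod 2 + ?c mod 2) mod 2) ((?b mod 2 + ?d mod 2) mod 2)
     + B (?c mod 2) (?d mod 2) * B ((?a mod 2 + ?c mod 2) mod 2) ((?b mod 2 + ?d mod 2) mod 2)"
    unfolding J B[of ?a ?b] B[of ?c ?d] B[of "?a + ?c" "?b + ?d"] sums ..
  have det2: "odd ((?a mod 2) * (?d mod 2) - (?b mod 2) * (?c mod 2))"
    using det by (simp add: even_mult_iff)
  show ?thesis unfolding J2 J' using p det2
    by (elim disjE) (simp_all add: algebra_simps)
qed

text \<open>The three twelfth powers have orders -N, 2N and -N in the parameter q^(1/(2N)), so one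
  of the three products dominates and gives a simple pole in q.\<close>

lemma Jf_q_expansion:
  assumes "N > 0"
  obtains F where "has_q_expansion (2 * N) Jf F" "fls_over \<int> F" "fls_subdegree F = - int (2 * N)"
proof -
  define M where "M = 2 * N"
  have M: "M > 0" "N < M" using assms by (auto simp: M_def)
  define F where "F k l n = fls_shift (- n) (fps_to_fls (fps_const (siegel_const M k l ^ 12) * siegel_series M k (ex (of_int l / of_nat M)) ^ 12))"
    for k :: nat and l n :: int
  have ord: "12 * int M * (- int N) = int 12 * siegel_order M (int N)" "12 * int M * int M = int 12 * siegel_order M (int 0)"
    unfolding siegel_order_def[OF M(1)] using M by (simp_all add: M_def power2_eq_square algebra_simps)
  have sgN: "sg M (int N * a) (int N * b) = sg 2 a b" for a b
    using assms by (simp add: sg_def M_def)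
  have q1: "has_q_expansion M (\<lambda>\<tau>. sg 2 1 0 \<tau> ^ 12) (F N 0 (- int N))"
    using sg_power_q_expansion[OF M ord(1), of 0] sgN[of 1 0] by (simp add: F_def)
  have q2: "has_q_expansion M (\<lambda>\<tau>. sg 2 0 1 \<tau> ^ 12) (F 0 (int N) (int M))"
    using sg_power_q_expansion[OF M(1) M(1) ord(2), of "int N"] sgN[of 0 1] by (simp add: F_def)
  have q3: "has_q_expansion M (\<lambda>\<tau>. sg 2 1 1 \<tau> ^ 12) (F N (int N) (- int N))"
    using sg_power_q_expansion[OF M ord(1), of "int N"] sgN[of 1 1] by (simp add: F_def)
  have w: "ex (of_int (int N) / of_nat M) = - 1" using assms ex_half by (simp add: M_def)
  have c1: "siegel_const M N 0 ^ 12 = 1" by (simp add: siegel_const_def eval_nat_numeral)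
  have i12: "\<i> ^ 12 = 1" by (simp add: eval_nat_numeral)
  have c2: "siegel_const M 0 (int N) ^ 12 = 1"
  proof -
    have "siegel_const M 0 (int N) ^ 12 = exp (of_nat 12 * (of_real pi * \<i> * ((0 - 1) * (1 / 2))))"
      using assms unfolding siegel_const_def power_mult_distrib exp_of_nat_mult i12 by (simp add: M_def)
    also have "\<dots> = ex (of_int (- 3))" unfolding ex_def by (intro arg_cong[of _ _ exp]) simp
    finally show ?thesis by (simp only: ex_of_int)
  qed
  have c3: "siegel_const M N (int N) ^ 12 = - 1"
  proof -
    have "siegel_const M N (int N) ^ 12 = exp (of_nat 12 * (of_real pi * \<i> * ((1 / 2 - 1) * (1 / 2))))"
      using assms unfolding siegel_const_def power_mult_distrib exp_of_nat_mult i12 by (simp add: M_def)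
    also have "\<dots> = ex (of_int (- 2) + 1 / 2)" unfolding ex_def by (intro arg_cong[of _ _ exp]) simp
    also have "\<dots> = - 1" by (simp only: ex_add ex_of_int ex_half) simp
    finally show ?thesis .
  qed
  have over: "fls_over \<int> (F k l n)" if "siegel_const M k l ^ 12 \<in> \<int>" "ex (of_int l / of_nat M) \<in> \<int>" for k l n
    unfolding F_def using that siegel_series_Ints[OF M(1)]
    by (auto intro!: fls_over_fps_to_fls fps_over_mult fps_over_const fps_over_power)
  have ov: "fls_over \<int> (F N 0 (- int N))" "fls_over \<int> (F 0 (int N) (int M))" "fls_over \<int> (F N (int N) (- int N))"
    by (intro over; simp add: c1 c2 c3 w[simplified])+
  have sd: "fls_subdegree (F k l n) = n" if "fps_nth (siegel_series M k (ex (of_int l / of_nat M))) 0 \<noteq> 0" for k l n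
  proof -
    let ?P = "fps_const (siegel_const M k l ^ 12) * siegel_series M k (ex (of_int l / of_nat M)) ^ 12"
    have "fps_nth ?P 0 \<noteq> 0" using that siegel_const_nonzero by (simp add: fps_power_zeroth)
    hence "subdegree ?P = 0" "?P \<noteq> 0" by auto
    thus ?thesis unfolding F_def by (subst fls_shift_subdegree) (simp_all add: fls_subdegree_fls_to_fps)
  qed
  have s1: "fls_subdegree (F N 0 (- int N)) = - int N" using M assms by (intro sd) (simp add: siegel_series_0)
  have s2: "fls_subdegree (F 0 (int N) (int M)) = int M" using M assms w by (intro sd) (simp add: siegel_series_0)
  have s3: "fls_subdegree (F N (int N) (- int N)) = - int N" using M assms by (intro sd) (simp add: siegel_series_0)
  define F1 where "F1 = F N 0 (- int N)"
  define F2 where "F2 = F 0 (int N) (int M)"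
  define F3 where "F3 = F N (int N) (- int N)"
  have nz: "F1 \<noteq> 0" "F2 \<noteq> 0" "F3 \<noteq> 0" using s1 s2 s3 assms M by (auto simp: F1_def F2_def F3_def)
  define G where "G = F1 * F2 + F1 * F3 + F2 * F3"
  have "has_q_expansion M Jf G" unfolding Jf_def[abs_def] G_def F1_def F2_def F3_def
    by (intro has_q_expansion_add has_q_expansion_mult q1 q2 q3 M)
  moreover have "fls_over \<int> G" unfolding G_def F1_def F2_def F3_def by (intro fls_over_add fls_over_mult ov)
  moreover have "fls_subdegree G = - int M"
  proof -
    have a: "fls_subdegree (F1 * F2) = int N" "fls_subdegree (F1 * F3) = - int M" "fls_subdegree (F2 * F3) = int N"
      using nz s1 s2 s3 by (simp_all add: F1_def F2_def F3_def M_def)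
    have "fls_subdegree (F1 * F3 + F1 * F2) = - int M"
      using a assms nz M by (subst fls_subdegree_add_eq1) auto
    moreover from this have "fls_subdegree (F1 * F3 + F1 * F2 + F2 * F3) = - int M"
      using a assms M by (subst fls_subdegree_add_eq1) auto
    ultimately show ?thesis by (simp add: G_def add_ac)
  qed
  ultimately show ?thesis using that unfolding M_def by blast
qed

lemma SL2_invariant_constant:
  assumes M: "M > 0" and hol: "f holomorphic_on upper_half_plane"
    and inv: "\<And>A \<tau>. A \<in> SL2Z \<Longrightarrow> Im \<tau> > 0 \<Longrightarrow> f (SL2_act A \<tau>) = f \<tau>"
    and q: "has_q_expansion M f F" "fls_subdegree F \<ge> 0"
  obtains c where "\<And>\<tau>. Im \<tau> > 0 \<Longrightarrow> f \<tau> = c"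
proof (rule modular_maximum_principle[OF M hol])
  have "(\<lambda>A. restrict (\<lambda>\<tau>. f (SL2_act A \<tau>)) upper_half_plane) ` SL2Z \<subseteq> {restrict f upper_half_plane}"
    using inv by (auto simp: restrict_def fun_eq_iff)
  thus "finite ((\<lambda>A. restrict (\<lambda>\<tau>. f (SL2_act A \<tau>)) upper_half_plane) ` SL2Z)"
    using finite_subset by blast
  show "f (SL2_act A (\<tau> + of_nat M)) = f (SL2_act A \<tau>)" if "A \<in> SL2Z" "Im \<tau> > 0" for A \<tau>
    using inv[OF that] inv[OF that(1), of "\<tau> + of_nat M"] that inv[OF translation_SL2Z that(2), of "int M"] by (simp add: SL2_act_translation)
  show "\<exists>F. has_q_expansion M (\<lambda>\<tau>. f (SL2_act A \<tau>)) F \<and> fls_subdegree F \<ge> 0" if "A \<in> SL2Z" for A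
    using has_q_expansion_cong'[OF inv[OF that, symmetric] q(1)] q(2) by blast
qed (use that in blast)

text \<open>After removal of the s-th power of the parameter, f tends to its leading coefficient;
  replacing \<tau> by \<tau> + 1 multiplies the limit by ex(-s/M), which must therefore be
  1.\<close>

lemma translation_invariant_subdegree:
  assumes M: "M > 0" and inv: "\<And>\<tau>. Im \<tau> > 0 \<Longrightarrow> f (\<tau> + 1) = f \<tau>"
    and q: "has_q_expansion M f F" "F \<noteq> 0"
  shows "int M dvd fls_subdegree F"
proof -
  define s where "s = fls_subdegree F"
  define c where "c = fls_nth F s"
  have c: "c \<noteq> 0" using q(2) by (simp add: c_def s_def)
  have "(\<lambda>z. eval_fls F z * z powi (- s)) has_laurent_expansion fls_shift s F"
    by (rule has_laurent_expansion_shift'[OF has_q_expansion_laurent[OF q(1)]])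
  hence "(\<lambda>z. eval_fls F z * z powi (- s)) \<midarrow>0\<rightarrow> fls_nth (fls_shift s F) 0"
    by (rule has_laurent_expansion_imp_tendsto_0) (use q(2) in \<open>simp add: s_def\<close>)
  hence "(\<lambda>z. eval_fls F z * z powi (- s)) \<midarrow>0\<rightarrow> c" by (simp add: c_def)
  hence "((\<lambda>\<tau>. eval_fls F (ex (\<tau> / of_nat M)) * ex (\<tau> / of_nat M) powi (- s)) \<longlongrightarrow> c) (filtercomap Im at_top)"
    unfolding filtermap_ex[OF M, symmetric] filterlim_filtermap .
  moreover have "\<forall>\<^sub>F \<tau> in filtercomap Im at_top. eval_fls F (ex (\<tau> / of_nat M)) * ex (\<tau> / of_nat M) powi (- s) =
     f \<tau> * ex (\<tau> / of_nat M) powi (- s)"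
    using has_q_expansion_ev[OF q(1)] by eventually_elim simp
  ultimately have lim: "((\<lambda>\<tau>. f \<tau> * ex (\<tau> / of_nat M) powi (- s)) \<longlongrightarrow> c) (filtercomap Im at_top)"
    by (rule Lim_transform_eventually)
  have "filterlim (\<lambda>\<tau>. \<tau> + 1) (filtercomap Im at_top) (filtercomap Im at_top)"
    unfolding filterlim_filtercomap_iff o_def by (simp add: filterlim_filtercomap)
  from filterlim_compose[OF lim this]
  have "((\<lambda>\<tau>. f (\<tau> + 1) * ex ((\<tau> + 1) / of_nat M) powi (- s)) \<longlongrightarrow> c) (filtercomap Im at_top)" .
  moreover have "\<forall>\<^sub>F \<tau> in filtercomap Im at_top. f (\<tau> + 1) * ex ((\<tau> + 1) / of_nat M) powi (- s) =
     (f \<tau> * ex (\<tau> / of_nat M) powi (- s)) * ex (1 / of_nat M) powi (- s)"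
    using eventually_upper by eventually_elim (simp add: inv add_divide_distrib ex_add power_int_mult_distrib)
  ultimately have "((\<lambda>\<tau>. (f \<tau> * ex (\<tau> / of_nat M) powi (- s)) * ex (1 / of_nat M) powi (- s)) \<longlongrightarrow> c) (filtercomap Im at_top)"
    by (rule Lim_transform_eventually)
  moreover have "((\<lambda>\<tau>. (f \<tau> * ex (\<tau> / of_nat M) powi (- s)) * ex (1 / of_nat M) powi (- s)) \<longlongrightarrow> c * ex (1 / of_nat M) powi (- s)) (filtercomap Im at_top)"
    by (intro tendsto_mult lim tendsto_const)
  moreover have "filtercomap Im at_top \<noteq> bot"
    using filtermap_ex[OF M] by (metis at_neq_bot filtermap_bot)
  ultimately have "c = c * ex (1 / of_nat M) powi (- s)" using tendsto_unique by blast
  hence "ex (1 / of_nat M) powi (- s) = 1" using c by simp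
  hence "ex (of_int (- s) / of_nat M) = 1" by (simp add: ex_def exp_power_int mult_ac del: of_int_minus)
  then obtain n where "of_int (- s) / of_nat M = (of_int n :: complex)" using ex_eq_1_iff by blast
  hence "of_int (- s) = (of_int (n * int M) :: complex)" using M by (simp add: field_simps)
  hence "- s = n * int M" using of_int_eq_iff by blast
  thus ?thesis unfolding s_def by (metis dvd_minus_iff dvd_triv_right)
qed

text \<open>Induction on the pole order at the only cusp. Invariance under \<tau> + 1 makes this
  order a multiple of 2N, hence equal to that of a power of \<open>Jf\<close>, and a multiple of
  this power removes the leading term.\<close>

theorem SL2_invariant_polynomial_Jf:
  assumes N: "N > 0" and hol: "f holomorphic_on upper_half_plane"
    and inv: "\<And>A \<tau>. A \<in> SL2Z \<Longrightarrow> Im \<tau> > 0 \<Longrightarrow> f (SL2_act A \<tau>) = f \<tau>"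
    and q: "has_q_expansion (2 * N) f F"
  shows "\<exists>p. \<forall>\<tau>. Im \<tau> > 0 \<longrightarrow> f \<tau> = poly p (Jf \<tau>)"
  using hol inv q
proof (induction "nat (- fls_subdegree F)" arbitrary: f F rule: less_induct)
  case less
  have M: "2 * N > 0" using N by simp
  show ?case
  proof (cases "fls_subdegree F \<ge> 0")
    case True
    obtain c where "\<And>\<tau>. Im \<tau> > 0 \<Longrightarrow> f \<tau> = c"
      using SL2_invariant_constant[OF M less.prems True] by blast
    thus ?thesis by (intro exI[of _ "[:c:]"]) simp
  next
    case False
    hence F0: "F \<noteq> 0" by auto
    obtain FJ where FJ: "has_q_expansion (2 * N) Jf FJ" "fls_over \<int> FJ" "fls_subdegree FJ = - int (2 * N)"
      using Jf_q_expansion[OF N] by blast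
    have FJ0: "FJ \<noteq> 0" using FJ(3) N by auto
    have "f (\<tau> + 1) = f \<tau>" if "Im \<tau> > 0" for \<tau>
      using less.prems(2)[OF translation_SL2Z that, of 1] by (simp add: SL2_act_translation)
    hence "int (2 * N) dvd fls_subdegree F" by (rule translation_invariant_subdegree[OF M _ less.prems(3) F0])
    then obtain d' where "fls_subdegree F = int (2 * N) * d'" by blast
    with False have "d' < 0" by (simp add: not_le mult_less_0_iff)
    define d where "d = nat (- d')"
    have sF: "fls_subdegree F = - int (2 * N) * int d" using \<open>fls_subdegree F = int (2 * N) * d'\<close> \<open>d' < 0\<close> by (simp add: d_def)
    have sJ: "fls_subdegree (FJ ^ d) = fls_subdegree F" using FJ(3) sF by (simp add: fls_subdegree_pow)
    define s where "s = fls_subdegree F"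
    define c where "c = fls_nth F s / fls_nth (FJ ^ d) s"
    have FJd: "FJ ^ d \<noteq> 0" using FJ0 by simp
    hence lc: "fls_nth (FJ ^ d) s \<noteq> 0" using sJ by (metis nth_fls_subdegree_zero_iff s_def)
    define g where "g \<tau> = f \<tau> + - c * Jf \<tau> ^ d" for \<tau>
    define G where "G = F + fls_const (- c) * FJ ^ d"
    have qg: "has_q_expansion (2 * N) g G" unfolding g_def[abs_def] G_def
      by (intro has_q_expansion_add has_q_expansion_mult has_q_expansion_power has_q_expansion_const less.prems FJ M)
    have G0: "fls_nth G n = 0" if "n \<le> s" for n
    proof (cases "n = s")
      case True thus ?thesis using lc by (simp add: G_def c_def)
    next
      case False
      hence "n < fls_subdegree F" "n < fls_subdegree (FJ ^ d)" using that sJ by (auto simp: s_def)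
      thus ?thesis by (simp add: G_def fls_eq0_below_subdegree)
    qed
    have "nat (- fls_subdegree G) < nat (- fls_subdegree F)"
    proof (cases "G = 0")
      case False
      have "fls_subdegree G > s" using G0[of "fls_subdegree G"] False by (metis linorder_not_less nth_fls_subdegree_zero_iff)
      thus ?thesis using \<open>\<not> fls_subdegree F \<ge> 0\<close> by (simp add: s_def)
    qed (use False in simp)
    moreover have "g holomorphic_on upper_half_plane" unfolding g_def[abs_def] by (intro holomorphic_intros less.prems Jf_holomorphic)
    moreover have "g (SL2_act A \<tau>) = g \<tau>" if "A \<in> SL2Z" "Im \<tau> > 0" for A \<tau>
      using less.prems(2)[OF that] Jf_SL2[OF that] by (simp add: g_def)
    ultimately obtain p where p: "\<And>\<tau>. Im \<tau> > 0 \<Longrightarrow> g \<tau> = poly p (Jf \<tau>)" using less.hyps[OF _ _ _ qg] by blast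
    have "f \<tau> = poly (p + Polynomial.monom c d) (Jf \<tau>)" if "Im \<tau> > 0" for \<tau>
      using p[OF that] by (simp add: g_def poly_monom algebra_simps)
    thus ?thesis by blast
  qed
qed

section \<open>Lagrange interpolation over the translates of a Siegel function\<close>

lemma q_expansion_identity:
  assumes "N > 0" "f holomorphic_on upper_half_plane" "g holomorphic_on upper_half_plane"
    "has_q_expansion N f F" "has_q_expansion N g F" "Im \<tau> > 0"
  shows "f \<tau> = g \<tau>"
proof -
  have "\<forall>\<^sub>F \<tau> in filtercomap Im at_top. f \<tau> = g \<tau>"
    using has_q_expansion_ev[OF assms(4)] has_q_expansion_ev[OF assms(5)] by eventually_elim simp
  then obtain B where B: "\<And>\<tau>. Im \<tau> > B \<Longrightarrow> f \<tau> = g \<tau>"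
    by (auto simp: eventually_filtercomap_at_top_dense)
  define S where "S = {\<tau>. Im \<tau> > max B 0}"
  show ?thesis
  proof (rule analytic_continuation_open[of S upper_half_plane f g])
    show "open S" unfolding S_def by (rule open_halfspace_Im_gt)
    have "B < \<bar>B\<bar> + 1" "0 < \<bar>B\<bar> + 1" by linarith+
    hence "Complex 0 (\<bar>B\<bar> + 1) \<in> S" by (simp add: S_def)
    thus "S \<noteq> {}" by blast
  qed (use assms B open_upper_half_plane connected_upper_half_plane in \<open>auto simp: S_def\<close>)
qed

text \<open>Level \<open>2N\<close> instead of \<open>N\<close>, because the Hauptmodul is built from Siegel functions of level 2.\<close>

definition weak_modular :: "nat \<Rightarrow> (complex \<Rightarrow> complex) \<Rightarrow> bool" where
  "weak_modular N f \<longleftrightarrow> f holomorphic_on upper_half_plane \<and>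
     (\<forall>A\<in>Gamma_up_1 N. \<forall>\<tau>. Im \<tau> > 0 \<longrightarrow> f (SL2_act A \<tau>) = f \<tau>) \<and>
     (\<forall>A\<in>SL2Z. \<exists>F. has_q_expansion (2 * N) (\<lambda>\<tau>. f (SL2_act A \<tau>)) F)"

lemma weak_modular_1: "N > 0 \<Longrightarrow> weak_modular N (\<lambda>_. 1)"
  unfolding weak_modular_def using has_q_expansion_const[of "2 * N" 1] by auto

text \<open>The first row modulo N determines the coset; the congruence for the lower right entry is
  forced by the determinant.\<close>

lemma Gamma_up_1_quotient:
  fixes A B :: "int ^ 2 ^ 2"
  assumes "A \<in> SL2Z" "B \<in> SL2Z" "[A $ 1 $ 1 = B $ 1 $ 1] (mod int N)" "[A $ 1 $ 2 = B $ 1 $ 2] (mod int N)"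
  shows "A ** inv2 B \<in> Gamma_up_1 N"
proof -
  define C where "C = A ** inv2 B"
  have C: "C \<in> SL2Z" using assms SL2Z_mult inv2_SL2Z by (simp add: C_def)
  have dB: "B $ 1 $ 1 * B $ 2 $ 2 - B $ 1 $ 2 * B $ 2 $ 1 = 1" using assms(2) by (simp add: SL2Z_iff)
  have C11: "C $ 1 $ 1 = A $ 1 $ 1 * B $ 2 $ 2 - A $ 1 $ 2 * B $ 2 $ 1" by (simp add: C_def mat_mult_nth inv2_def)
  have C12: "C $ 1 $ 2 = A $ 1 $ 2 * B $ 1 $ 1 - A $ 1 $ 1 * B $ 1 $ 2" by (simp add: C_def mat_mult_nth inv2_def)
  have 1: "[C $ 1 $ 1 = 1] (mod int N)"
    unfolding C11 dB[symmetric] by (intro cong_diff cong_mult assms(3,4) cong_refl)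
  have "[C $ 1 $ 2 = B $ 1 $ 2 * B $ 1 $ 1 - B $ 1 $ 1 * B $ 1 $ 2] (mod int N)"
    unfolding C12 by (intro cong_diff cong_mult assms(3,4) cong_refl)
  hence 2: "[C $ 1 $ 2 = 0] (mod int N)" by (simp add: mult.commute)
  have "[C $ 1 $ 1 * C $ 2 $ 2 - C $ 1 $ 2 * C $ 2 $ 1 = 1 * C $ 2 $ 2 - 0 * C $ 2 $ 1] (mod int N)"
    by (intro cong_diff cong_mult 1 2 cong_refl)
  hence "[C $ 2 $ 2 = 1] (mod int N)" using C by (simp add: SL2Z_iff cong_sym_eq)
  thus ?thesis using C 1 2 by (simp add: Gamma_up_1_def C_def)
qed

lemma weak_modular_coset:
  fixes A B :: "int ^ 2 ^ 2"
  assumes "weak_modular N f" "A \<in> SL2Z" "B \<in> SL2Z" "[A $ 1 $ 1 = B $ 1 $ 1] (mod int N)" "[A $ 1 $ 2 = B $ 1 $ 2] (mod int N)" "Im \<tau> > 0"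
  shows "f (SL2_act A \<tau>) = f (SL2_act B \<tau>)"
proof -
  have "SL2_act (A ** inv2 B) (SL2_act B \<tau>) = SL2_act A \<tau>"
    using SL2_act_mult[OF assms(2) inv2_SL2Z[OF assms(3)] Im_SL2_act[OF assms(3,6)]] SL2_act_inv[OF assms(3,6)] by simp
  thus ?thesis using assms(1) Gamma_up_1_quotient[OF assms(2-5)] Im_SL2_act[OF assms(3,6)]
    unfolding weak_modular_def by metis
qed

lemma SL2_act_uminus: "SL2_act (- A) \<tau> = SL2_act A \<tau>"
proof -
  have "SL2_act (- A) \<tau> = - (of_int (A $ 1 $ 1) * \<tau> + of_int (A $ 1 $ 2)) / - (of_int (A $ 2 $ 1) * \<tau> + of_int (A $ 2 $ 2))"
    by (simp add: SL2_act_eq)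
  thus ?thesis by (simp only: SL2_act_eq minus_divide_divide)
qed

lemma uminus_SL2Z: "A \<in> SL2Z \<Longrightarrow> - A \<in> SL2Z" by (simp add: SL2Z_iff)

text \<open>The exponent is a multiple of 12, which trivialises the multiplier of
  \<open>sieg_SL2\<close>, and of 2 N, which makes the characteristic periodic modulo N. It is also
  12 times the working level 2 N, which turns the constant of the expansion into a power of
  w.\<close>

definition phi :: "nat \<Rightarrow> int \<Rightarrow> int \<Rightarrow> complex \<Rightarrow> complex" where
  "phi N k l \<tau> = sg N k l \<tau> ^ (24 * N)"

text \<open>Written at level 2 N, hence the doubled arguments; w is meant to be the N-th root of
  unity ex(l/N).\<close>

definition phi_series :: "nat \<Rightarrow> nat \<Rightarrow> complex \<Rightarrow> complex fls" where
  "phi_series N k w = fls_shift (- siegel_order (2 * N) (2 * int k))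
     (fps_to_fls (fps_const (w ^ (12 * k)) * siegel_series (2 * N) (2 * k) w ^ (24 * N)))"

lemma phi_holomorphic: "phi N k l holomorphic_on upper_half_plane"
  unfolding phi_def[abs_def] by (intro holomorphic_intros sg_holomorphic)

lemma phi_cong:
  assumes "N > 0" "Im \<tau> > 0" "[k = k'] (mod int N)" "[l = l'] (mod int N)"
  shows "phi N k l \<tau> = phi N k' l' \<tau>"
  unfolding phi_def by (rule sg_power_cong) (use assms in auto)

lemma phi_SL2:
  assumes "A \<in> SL2Z" "Im \<tau> > 0"
  shows "phi N k l (SL2_act A \<tau>) = phi N (k * A $ 1 $ 1 + l * A $ 2 $ 1) (k * A $ 1 $ 2 + l * A $ 2 $ 2) \<tau>"
  unfolding phi_def by (rule sg_power_SL2) (use assms in auto)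

lemma phi_q_expansion:
  assumes "N > 0" "k < N"
  shows "has_q_expansion (2 * N) (phi N (int k) l) (phi_series N k (ex (of_int l / of_nat N)))"
proof -
  define M where "M = 2 * N"
  have M: "M > 0" "2 * k < M" using assms by (auto simp: M_def)
  have w: "ex (of_int (2 * l) / of_nat M) = ex (of_int l / of_nat N)" using assms by (simp add: M_def)
  have "siegel_const M (2 * k) (2 * l) ^ (12 * M) = ex (of_int (2 * l) / of_nat M) ^ (6 * (2 * k))"
    using sieg_q_expansion[OF M refl, of "2 * l"] by (auto simp: siegel_const_def)
  hence c: "siegel_const M (2 * k) (2 * l) ^ (24 * N) = ex (of_int l / of_nat N) ^ (12 * k)"
    unfolding w by (simp add: M_def)
  have "sg M (2 * int k) (2 * l) = sg N (int k) l" using assms by (simp add: sg_def M_def)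
  moreover have "12 * int M * siegel_order M (int (2 * k)) = int (24 * N) * siegel_order M (int (2 * k))" by (simp add: M_def)
  ultimately show ?thesis
    using sg_power_q_expansion[OF M, of "siegel_order M (int (2 * k))" "24 * N" "2 * l"]
    unfolding w c phi_def[abs_def] phi_series_def by (simp add: M_def)
qed

lemma phi_series_subdegree:
  assumes "N > 0" "k < N" "w \<noteq> 0" "k \<noteq> 0 \<or> w \<noteq> 1"
  shows "fls_subdegree (phi_series N k w) = siegel_order (2 * N) (2 * int k)" "phi_series N k w \<noteq> 0"
proof -
  let ?P = "fps_const (w ^ (12 * k)) * siegel_series (2 * N) (2 * k) w ^ (24 * N)"
  have "fps_nth ?P 0 \<noteq> 0" using assms siegel_series_0[of "2 * N" "2 * k" w] by (auto simp: fps_power_zeroth)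
  hence P: "subdegree ?P = 0" "?P \<noteq> 0" by auto
  thus "fls_subdegree (phi_series N k w) = siegel_order (2 * N) (2 * int k)"
    unfolding phi_series_def by (subst fls_shift_subdegree) (simp_all add: fls_subdegree_fls_to_fps)
  show "phi_series N k w \<noteq> 0"
    unfolding phi_series_def fls_shift_eq0_iff fps_to_fls_eq_0_iff by (rule P(2))
qed

lemma siegel_order_eq_1_iff:
  assumes "N > 1" "0 \<le> k" "k < int N" "siegel_order (2 * N) (2 * k) = siegel_order (2 * N) (2 * 1)"
  shows "k = 1 \<or> k = int N - 1"
proof -
  have N: "2 * N > 0" using assms(1) by simp
  have "(k - 1) * (k + 1 - int N) = 0" using assms(4) unfolding siegel_order_def[OF N] by (simp add: algebra_simps power2_eq_square)
  thus ?thesis by auto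
qed

lemma siegel_order_eq_0_iff:
  assumes "N > 1" "0 \<le> k" "k < int N" "siegel_order (2 * N) (2 * k) = siegel_order (2 * N) (2 * 0)"
  shows "k = 0"
proof -
  have N: "2 * N > 0" using assms(1) by simp
  have "k * (k - int N) = 0" using assms(4) unfolding siegel_order_def[OF N] by (simp add: algebra_simps power2_eq_square)
  thus ?thesis using assms by auto
qed

text \<open>The second assumption excludes the characteristics congruent to 0, for which the
  constant term 1 - w of the series would vanish.\<close>

lemma phi_q_expansion_subdegree':
  assumes N: "N > 1" and co: "\<not> (int N dvd k \<and> int N dvd l)" and q: "has_q_expansion (2 * N) (phi N k l) F"
  shows "fls_subdegree F = siegel_order (2 * N) (2 * (k mod int N))"
proof -
  define k' where "k' = nat (k mod int N)"
  have N': "N > 0" "2 * N > 0" using N by auto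
  have k': "k' < N" "int k' = k mod int N" using N by (auto simp: k'_def nat_less_iff)
  have "has_q_expansion (2 * N) (phi N (int k') l) (phi_series N k' (ex (of_int l / of_nat N)))"
    by (rule phi_q_expansion) (use N' k' in auto)
  hence "has_q_expansion (2 * N) (phi N k l) (phi_series N k' (ex (of_int l / of_nat N)))"
    by (rule has_q_expansion_cong'[rotated]) (use k' N in \<open>auto intro!: phi_cong simp: cong_def\<close>)
  hence F: "F = phi_series N k' (ex (of_int l / of_nat N))" using q N'(2) has_q_expansion_unique by blast
  have "k' \<noteq> 0 \<or> ex (of_int l / of_nat N) \<noteq> 1"
  proof (rule ccontr)
    assume *: "\<not> (k' \<noteq> 0 \<or> ex (of_int l / of_nat N) \<noteq> 1)"
    hence "int N dvd k" using k' by auto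
    moreover obtain m where "of_int l / of_nat N = (of_int m :: complex)" using * ex_eq_1_iff by blast
    hence "of_int l = (of_int (m * int N) :: complex)" using N by (simp add: field_simps)
    hence "l = m * int N" using of_int_eq_iff by blast
    ultimately show False using co by simp
  qed
  thus ?thesis unfolding F using phi_series_subdegree(1)[OF N'(1) k'(1), of "ex (of_int l / of_nat N)"] k' by simp
qed

lemma phi_q_expansion_subdegree:
  assumes N: "N > 1" and co: "gcd (gcd k l) (int N) = 1" and q: "has_q_expansion (2 * N) (phi N k l) F"
  shows "fls_subdegree F = siegel_order (2 * N) (2 * (k mod int N))"
proof (rule phi_q_expansion_subdegree'[OF N _ q])
  show "\<not> (int N dvd k \<and> int N dvd l)"
  proof
    assume "int N dvd k \<and> int N dvd l"
    hence "int N dvd gcd (gcd k l) (int N)" by simp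
    thus False using co N by simp
  qed
qed

lemma SL2_row_gcd: "A \<in> SL2Z \<Longrightarrow> gcd (gcd (A $ 1 $ 1) (A $ 1 $ 2)) x = 1"
proof -
  assume "A \<in> SL2Z"
  hence "A $ 1 $ 1 * A $ 2 $ 2 - A $ 1 $ 2 * A $ 2 $ 1 = 1" by (simp add: SL2Z_iff)
  hence "coprime (A $ 1 $ 1) (A $ 1 $ 2)" by (metis coprimeI dvd_diff dvd_mult2)
  thus ?thesis by simp
qed

lemma phi_q_expansion_exists:
  assumes "N > 0"
  obtains F where "has_q_expansion (2 * N) (phi N k l) F"
proof -
  have k': "nat (k mod int N) < N" "int (nat (k mod int N)) = k mod int N" using assms by (auto simp: nat_less_iff)
  have "has_q_expansion (2 * N) (phi N (int (nat (k mod int N))) l) (phi_series N (nat (k mod int N)) (ex (of_int l / of_nat N)))"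
    by (rule phi_q_expansion) (use assms k' in auto)
  hence "has_q_expansion (2 * N) (phi N k l) (phi_series N (nat (k mod int N)) (ex (of_int l / of_nat N)))"
    by (rule has_q_expansion_cong'[rotated]) (use k' assms in \<open>auto intro!: phi_cong simp: cong_def\<close>)
  thus ?thesis using that by blast
qed

text \<open>The order at \<infinity> of the function with characteristic (k, l) determines k modulo
  N up to sign. Applied directly, this gives the upper left entry of C; applied after \<tau>
  \<mapsto> -1/\<tau>, where the two entries change places, it shows that the upper right one
  vanishes modulo N.\<close>

lemma phi_stabilizer:
  assumes N: "N > 1" and C: "C \<in> SL2Z" and eq: "\<And>\<tau>. Im \<tau> > 0 \<Longrightarrow> phi N 1 0 (SL2_act C \<tau>) = phi N 1 0 \<tau>"
  shows "C \<in> Gamma_up_1 N \<or> - C \<in> Gamma_up_1 N"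
proof -
  have N0: "N > 0" using N by simp
  define S where "S = mat2 0 (- 1) 1 0"
  have S: "S \<in> SL2Z" by (simp add: S_def SL2Z_iff)
  have e1: "phi N (C $ 1 $ 1) (C $ 1 $ 2) \<tau> = phi N 1 0 \<tau>" if "Im \<tau> > 0" for \<tau>
    using eq[OF that] phi_SL2[OF C that, of N 1 0] by simp
  have e2: "phi N (C $ 1 $ 2) (- C $ 1 $ 1) \<tau> = phi N 0 (- 1) \<tau>" if "Im \<tau> > 0" for \<tau>
    using e1[OF Im_SL2_act[OF S that]] phi_SL2[OF S that, of N] by (simp add: S_def)
  obtain F where F: "has_q_expansion (2 * N) (phi N 1 0) F" using phi_q_expansion_exists[OF N0] by blast
  have "has_q_expansion (2 * N) (phi N (C $ 1 $ 1) (C $ 1 $ 2)) F"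
    by (rule has_q_expansion_cong'[OF _ F]) (simp add: e1)
  hence "siegel_order (2 * N) (2 * (C $ 1 $ 1 mod int N)) = siegel_order (2 * N) (2 * (1 mod int N))"
    using phi_q_expansion_subdegree[OF N _ F] phi_q_expansion_subdegree[OF N SL2_row_gcd[OF C]] by simp
  hence "C $ 1 $ 1 mod int N = 1 \<or> C $ 1 $ 1 mod int N = int N - 1"
    using N by (intro siegel_order_eq_1_iff) auto
  hence c11: "[C $ 1 $ 1 = 1] (mod int N) \<or> [C $ 1 $ 1 = - 1] (mod int N)"
    using N by (auto simp: cong_def zmod_minus1)
  obtain F' where F': "has_q_expansion (2 * N) (phi N 0 (- 1)) F'" using phi_q_expansion_exists[OF N0] by blast
  have "has_q_expansion (2 * N) (phi N (C $ 1 $ 2) (- C $ 1 $ 1)) F'"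
    by (rule has_q_expansion_cong'[OF _ F']) (simp add: e2)
  note q' = this
  have "gcd (C $ 1 $ 2) (- C $ 1 $ 1) = gcd (C $ 1 $ 1) (C $ 1 $ 2)" by (simp add: gcd.commute)
  hence g: "gcd (gcd (C $ 1 $ 2) (- C $ 1 $ 1)) (int N) = 1" using SL2_row_gcd[OF C, of "int N"] by (simp only:)
  have "gcd (gcd 0 (- 1)) (int N) = 1" by simp
  hence "siegel_order (2 * N) (2 * (C $ 1 $ 2 mod int N)) = siegel_order (2 * N) (2 * (0 mod int N))"
    using phi_q_expansion_subdegree[OF N _ F'] phi_q_expansion_subdegree[OF N g q'] by simp
  hence "C $ 1 $ 2 mod int N = 0" using N by (intro siegel_order_eq_0_iff) auto
  hence c12: "[C $ 1 $ 2 = 0] (mod int N)" by (simp add: cong_def)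
  show ?thesis using c11
  proof
    assume "[C $ 1 $ 1 = 1] (mod int N)"
    hence "C ** inv2 (mat 1) \<in> Gamma_up_1 N"
      by (intro Gamma_up_1_quotient C mat_1_SL2Z) (use c12 in \<open>auto simp: mat_def\<close>)
    moreover have "C ** inv2 (mat 1) = C" by (simp add: vec_eq_iff forall_2 mat_mult_nth inv2_def mat_def)
    ultimately show ?thesis by simp
  next
    assume "[C $ 1 $ 1 = - 1] (mod int N)"
    hence "[- C $ 1 $ 1 = 1] (mod int N)" using cong_minus_minus_iff[of "C $ 1 $ 1" "- 1" "int N"] by simp
    moreover have "[- C $ 1 $ 2 = 0] (mod int N)" using c12 cong_minus_minus_iff[of "C $ 1 $ 2" 0 "int N"] by simp
    ultimately have "(- C) ** inv2 (mat 1) \<in> Gamma_up_1 N"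
      by (intro Gamma_up_1_quotient uminus_SL2Z C mat_1_SL2Z) (auto simp: mat_def)
    moreover have "(- C) ** inv2 (mat 1) = - C" by (simp add: vec_eq_iff forall_2 mat_mult_nth inv2_def mat_def)
    ultimately show ?thesis by simp
  qed
qed

text \<open>A ring of functions containing f and all nodes of the interpolation. The coefficients of
  the interpolation polynomial lie in it for formal reasons, before their invariance is
  considered.\<close>

definition holq :: "nat \<Rightarrow> (complex \<Rightarrow> complex) \<Rightarrow> bool" where
  "holq M f \<longleftrightarrow> f holomorphic_on upper_half_plane \<and> (\<exists>F. has_q_expansion M f F)"

lemma holq_const: "M > 0 \<Longrightarrow> holq M (\<lambda>_. c)"
  using has_q_expansion_const by (auto simp: holq_def)
lemma holq_add: "M > 0 \<Longrightarrow> holq M f \<Longrightarrow> holq M g \<Longrightarrow> holq M (\<lambda>\<tau>. f \<tau> + g \<tau>)"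
  unfolding holq_def using has_q_expansion_add by (blast intro: holomorphic_intros)
lemma holq_mult: "M > 0 \<Longrightarrow> holq M f \<Longrightarrow> holq M g \<Longrightarrow> holq M (\<lambda>\<tau>. f \<tau> * g \<tau>)"
  unfolding holq_def using has_q_expansion_mult by (blast intro: holomorphic_intros)
lemma holq_sum: "M > 0 \<Longrightarrow> (\<And>i. i \<in> I \<Longrightarrow> holq M (f i)) \<Longrightarrow> holq M (\<lambda>\<tau>. \<Sum>i\<in>I. f i \<tau>)"
  by (induction I rule: infinite_finite_induct) (auto intro: holq_add holq_const)

lemma holq_coeff_prod:
  assumes "M > 0" "\<And>i. i \<in> I \<Longrightarrow> holq M (f i)"
  shows "holq M (\<lambda>\<tau>. Polynomial.coeff (\<Prod>i\<in>I. [:- f i \<tau>, 1:]) j)"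
  using assms(2)
proof (induction I arbitrary: j rule: infinite_finite_induct)
  case (insert x I)
  have "Polynomial.coeff (\<Prod>i\<in>insert x I. [:- f i \<tau>, 1:]) j =
      (- 1) * f x \<tau> * Polynomial.coeff (\<Prod>i\<in>I. [:- f i \<tau>, 1:]) j + (if j = 0 then 0 else Polynomial.coeff (\<Prod>i\<in>I. [:- f i \<tau>, 1:]) (j - 1))" for \<tau>
    using insert.hyps by (cases j) (simp_all add: algebra_simps)
  moreover have "holq M (\<lambda>\<tau>. (- 1) * f x \<tau> * Polynomial.coeff (\<Prod>i\<in>I. [:- f i \<tau>, 1:]) j + (if j = 0 then 0 else Polynomial.coeff (\<Prod>i\<in>I. [:- f i \<tau>, 1:]) (j - 1)))"
  proof (rule holq_add[OF assms(1)])
    have ih: "holq M (\<lambda>\<tau>. Polynomial.coeff (\<Prod>i\<in>I. [:- f i \<tau>, 1:]) j)" for j using insert by blast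
    have fx: "holq M (f x)" using insert.prems by blast
    show "holq M (\<lambda>\<tau>. (- 1) * f x \<tau> * Polynomial.coeff (\<Prod>i\<in>I. [:- f i \<tau>, 1:]) j)"
      by (rule holq_mult[OF assms(1) holq_mult[OF assms(1) holq_const[OF assms(1)] fx] ih])
    show "holq M (\<lambda>\<tau>. if j = 0 then 0 else Polynomial.coeff (\<Prod>i\<in>I. [:- f i \<tau>, 1:]) (j - 1))"
      using ih holq_const[OF assms(1), of 0] by (cases "j = 0") simp_all
  qed
  ultimately show ?case by simp
qed (use assms(1) in \<open>auto simp: Polynomial.coeff_1 intro: holq_const\<close>)

context
  fixes N :: nat
  assumes N: "N > 1"
begin

definition phi_translate :: "int ^ 2 ^ 2 \<Rightarrow> complex \<Rightarrow> complex" where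
  "phi_translate A = restrict (\<lambda>\<tau>. phi N 1 0 (SL2_act A \<tau>)) upper_half_plane"

text \<open>The nodes are functions rather than cosets, so that different nodes are different
  functions and their differences have nonzero expansions.\<close>

definition Phi :: "(complex \<Rightarrow> complex) set" where "Phi = phi_translate ` SL2Z"

definition translate_rep :: "(complex \<Rightarrow> complex) \<Rightarrow> int ^ 2 ^ 2" where
  "translate_rep \<psi> = (SOME A. A \<in> SL2Z \<and> phi_translate A = \<psi>)"

lemma translate_rep: "\<psi> \<in> Phi \<Longrightarrow> translate_rep \<psi> \<in> SL2Z" "\<psi> \<in> Phi \<Longrightarrow> phi_translate (translate_rep \<psi>) = \<psi>"
  unfolding Phi_def translate_rep_def by (metis (mono_tags, lifting) imageE someI_ex)+

lemma phi_translate_eq: "A \<in> SL2Z \<Longrightarrow> Im \<tau> > 0 \<Longrightarrow> phi_translate A \<tau> = phi N (A $ 1 $ 1) (A $ 1 $ 2) \<tau>"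
  using phi_SL2[of A \<tau> N 1 0] by (simp add: phi_translate_def)

lemma finite_Phi: "finite Phi"
proof -
  have "Phi \<subseteq> (\<lambda>(k, l). restrict (phi N k l) upper_half_plane) ` ({0..<int N} \<times> {0..<int N})"
  proof
    fix \<psi> assume "\<psi> \<in> Phi"
    then obtain A where A: "A \<in> SL2Z" "\<psi> = phi_translate A" by (auto simp: Phi_def)
    let ?k = "A $ 1 $ 1 mod int N" and ?l = "A $ 1 $ 2 mod int N"
    have "\<psi> = restrict (phi N ?k ?l) upper_half_plane"
    proof
      fix \<tau> show "\<psi> \<tau> = restrict (phi N ?k ?l) upper_half_plane \<tau>"
      proof (cases "Im \<tau> > 0")
        case True
        thus ?thesis using phi_translate_eq[OF A(1) True] phi_cong[of N \<tau> "A $ 1 $ 1" ?k "A $ 1 $ 2" ?l] N A(2) by (simp add: cong_def)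
      qed (simp add: A(2) phi_translate_def)
    qed
    moreover have "(?k, ?l) \<in> {0..<int N} \<times> {0..<int N}" using N by simp
    ultimately show "\<psi> \<in> (\<lambda>(k, l). restrict (phi N k l) upper_half_plane) ` ({0..<int N} \<times> {0..<int N})" by (auto intro!: image_eqI[of _ _ "(?k, ?l)"])
  qed
  thus ?thesis by (rule finite_subset) auto
qed

text \<open>By \<open>phi_stabilizer\<close> a translate of \<open>phi\<close> determines the coset
  up to sign, and the sign acts trivially on \<tau>. Hence the translates of f can be indexed by
  \<open>Phi\<close>.\<close>

lemma phi_translate_eq_imp:
  assumes f: "weak_modular N f" and A: "A \<in> SL2Z" and B: "B \<in> SL2Z" and eq: "phi_translate A = phi_translate B" and \<tau>: "Im \<tau> > 0"
  shows "f (SL2_act A \<tau>) = f (SL2_act B \<tau>)"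
proof -
  define C where "C = A ** inv2 B"
  have C: "C \<in> SL2Z" using A B SL2Z_mult inv2_SL2Z by (simp add: C_def)
  have CB: "SL2_act C \<tau> = SL2_act A (SL2_act (inv2 B) \<tau>)" if "Im \<tau> > 0" for \<tau>
    unfolding C_def by (rule SL2_act_mult[OF A inv2_SL2Z[OF B] that])
  have "phi N 1 0 (SL2_act C \<tau>) = phi N 1 0 \<tau>" if \<tau>: "Im \<tau> > 0" for \<tau>
  proof -
    have im: "Im (SL2_act (inv2 B) \<tau>) > 0" using Im_SL2_act inv2_SL2Z B \<tau> by blast
    have "phi N 1 0 (SL2_act C \<tau>) = phi_translate A (SL2_act (inv2 B) \<tau>)" using CB[OF \<tau>] im by (simp add: phi_translate_def)
    also have "\<dots> = phi N 1 0 (SL2_act B (SL2_act (inv2 B) \<tau>))" using eq im by (simp add: phi_translate_def)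
    also have "\<dots> = phi N 1 0 \<tau>" using SL2_act_inv'[OF B \<tau>] by simp
    finally show ?thesis .
  qed
  hence "C \<in> Gamma_up_1 N \<or> - C \<in> Gamma_up_1 N" by (intro phi_stabilizer N C)
  hence fC: "f (SL2_act C \<tau>) = f \<tau>" if "Im \<tau> > 0" for \<tau>
    using f that unfolding weak_modular_def by (metis SL2_act_uminus)
  have im: "Im (SL2_act B \<tau>) > 0" using Im_SL2_act B \<tau> by blast
  have "f (SL2_act A \<tau>) = f (SL2_act C (SL2_act B \<tau>))" using CB[OF im] SL2_act_inv[OF B \<tau>] by simp
  thus ?thesis using fC[OF im] by simp
qed

definition shift :: "int ^ 2 ^ 2 \<Rightarrow> (complex \<Rightarrow> complex) \<Rightarrow> complex \<Rightarrow> complex" where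
  "shift B \<psi> = restrict (\<lambda>\<tau>. \<psi> (SL2_act B \<tau>)) upper_half_plane"

lemma shift_phi_translate: "A \<in> SL2Z \<Longrightarrow> B \<in> SL2Z \<Longrightarrow> shift B (phi_translate A) = phi_translate (A ** B)"
  using Im_SL2_act[of B] SL2_act_mult[of A B] by (auto simp: shift_def phi_translate_def fun_eq_iff restrict_def)

lemma bij_shift: assumes "B \<in> SL2Z" shows "bij_betw (shift B) Phi Phi"
proof -
  have in': "shift B \<psi> \<in> Phi" if "\<psi> \<in> Phi" "B \<in> SL2Z" for B \<psi>
    using that shift_phi_translate SL2Z_mult by (auto simp: Phi_def)
  have mm: "A ** B ** inv2 B = A" "A ** inv2 B ** B = A" for A
    using assms inv2_right inv2_left by (metis matrix_mul_assoc matrix_mul_rid)+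
  show ?thesis
  proof (rule bij_betw_byWitness[where f' = "shift (inv2 B)"])
    show "\<forall>\<psi>\<in>Phi. shift (inv2 B) (shift B \<psi>) = \<psi>"
      using assms inv2_SL2Z SL2Z_mult by (auto simp: Phi_def shift_phi_translate mm)
    show "\<forall>\<psi>\<in>Phi. shift B (shift (inv2 B) \<psi>) = \<psi>"
      using assms inv2_SL2Z SL2Z_mult by (auto simp: Phi_def shift_phi_translate mm)
  qed (use in' assms inv2_SL2Z in auto)
qed

text \<open>The numerator of Lagrange's formula: at a node it takes the value of the corresponding
  translate of f, times the product of the differences to the other nodes.\<close>

definition interp :: "(complex \<Rightarrow> complex) \<Rightarrow> complex \<Rightarrow> complex poly" where
  "interp f \<tau> = (\<Sum>\<psi>\<in>Phi. Polynomial.smult (f (SL2_act (translate_rep \<psi>) \<tau>)) (\<Prod>\<psi>'\<in>Phi - {\<psi>}. [:- \<psi>' \<tau>, 1:]))"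

text \<open>Composition with B permutes the nodes and, in the same way, the values prescribed at
  them.\<close>

lemma interp_SL2:
  assumes f: "weak_modular N f" and B: "B \<in> SL2Z" and \<tau>: "Im \<tau> > 0"
  shows "interp f (SL2_act B \<tau>) = interp f \<tau>"
proof -
  have bij: "bij_betw (shift B) Phi Phi" by (rule bij_shift[OF B])
  have ev: "\<psi> (SL2_act B \<tau>) = shift B \<psi> \<tau>" for \<psi> using \<tau> by (simp add: shift_def)
  have fev: "f (SL2_act (translate_rep \<psi>) (SL2_act B \<tau>)) = f (SL2_act (translate_rep (shift B \<psi>)) \<tau>)" if \<psi>: "\<psi> \<in> Phi" for \<psi>
  proof -
    have s: "shift B \<psi> \<in> Phi" using bij \<psi> by (auto simp: bij_betw_def)
    have "phi_translate (translate_rep \<psi> ** B) = shift B \<psi>" using shift_phi_translate[OF translate_rep(1)[OF \<psi>] B] translate_rep(2)[OF \<psi>] by simp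
    hence "f (SL2_act (translate_rep \<psi> ** B) \<tau>) = f (SL2_act (translate_rep (shift B \<psi>)) \<tau>)"
      using translate_rep[OF s] by (intro phi_translate_eq_imp[OF f _ _ _ \<tau>] SL2Z_mult translate_rep(1)[OF \<psi>] B) auto
    thus ?thesis using SL2_act_mult[OF translate_rep(1)[OF \<psi>] B \<tau>] by simp
  qed
  have "interp f (SL2_act B \<tau>) = (\<Sum>\<psi>\<in>Phi. Polynomial.smult (f (SL2_act (translate_rep (shift B \<psi>)) \<tau>)) (\<Prod>\<psi>'\<in>Phi - {\<psi>}. [:- shift B \<psi>' \<tau>, 1:]))"
    unfolding interp_def by (intro sum.cong refl arg_cong2[of _ _ _ _ Polynomial.smult] fev prod.cong) (auto simp: ev)
  also have "\<dots> = (\<Sum>\<psi>\<in>Phi. Polynomial.smult (f (SL2_act (translate_rep (shift B \<psi>)) \<tau>)) (\<Prod>\<psi>'\<in>Phi - {shift B \<psi>}. [:- \<psi>' \<tau>, 1:]))"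
  proof (intro sum.cong refl arg_cong2[of _ _ _ _ Polynomial.smult])
    fix \<psi> assume "\<psi> \<in> Phi"
    hence "bij_betw (shift B) (Phi - {\<psi>}) (Phi - {shift B \<psi>})"
      using bij by (intro bij_betw_DiffI) (auto simp: bij_betw_def)
    from prod.reindex_bij_betw[OF this, of "\<lambda>\<psi>'. [:- \<psi>' \<tau>, 1:]"]
    show "(\<Prod>\<psi>'\<in>Phi - {\<psi>}. [:- shift B \<psi>' \<tau>, 1:]) = (\<Prod>\<psi>'\<in>Phi - {shift B \<psi>}. [:- \<psi>' \<tau>, 1:])" .
  qed
  also have "\<dots> = interp f \<tau>"
    unfolding interp_def by (rule sum.reindex_bij_betw[OF bij, of "\<lambda>\<psi>. Polynomial.smult (f (SL2_act (translate_rep \<psi>) \<tau>)) (\<Prod>\<psi>'\<in>Phi - {\<psi>}. [:- \<psi>' \<tau>, 1:])"])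
  finally show ?thesis .
qed

lemma M_pos: "2 * N > 0" using N by simp

lemma holq_Phi: "\<psi> \<in> Phi \<Longrightarrow> holq (2 * N) \<psi>"
proof -
  assume "\<psi> \<in> Phi"
  then obtain A where A: "A \<in> SL2Z" "\<psi> = phi_translate A" by (auto simp: Phi_def)
  have N0: "N > 0" using N by simp
  obtain F where F: "has_q_expansion (2 * N) (phi N (A $ 1 $ 1) (A $ 1 $ 2)) F" using phi_q_expansion_exists[OF N0] by blast
  have "has_q_expansion (2 * N) \<psi> F" by (rule has_q_expansion_cong'[OF _ F]) (simp add: phi_translate_eq A)
  moreover have "\<psi> holomorphic_on upper_half_plane"
    by (rule holomorphic_transform[OF phi_holomorphic[of N "A $ 1 $ 1" "A $ 1 $ 2"]]) (simp add: phi_translate_eq A)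
  ultimately show ?thesis by (auto simp: holq_def)
qed

lemma interp_coeff:
  assumes f: "weak_modular N f"
  shows "\<exists>p. \<forall>\<tau>. Im \<tau> > 0 \<longrightarrow> Polynomial.coeff (interp f \<tau>) j = poly p (Jf \<tau>)"
proof -
  have "holq (2 * N) (\<lambda>\<tau>. f (SL2_act A \<tau>))" if "A \<in> SL2Z" for A
    using f that holomorphic_SL2_act by (auto simp: weak_modular_def holq_def)
  hence "holq (2 * N) (\<lambda>\<tau>. \<Sum>\<psi>\<in>Phi. f (SL2_act (translate_rep \<psi>) \<tau>) * Polynomial.coeff (\<Prod>\<psi>'\<in>Phi - {\<psi>}. [:- \<psi>' \<tau>, 1:]) j)"
    using translate_rep(1) holq_Phi by (intro holq_sum holq_mult holq_coeff_prod M_pos) auto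
  hence hq: "holq (2 * N) (\<lambda>\<tau>. Polynomial.coeff (interp f \<tau>) j)" by (simp add: interp_def coeff_sum)
  then obtain F where F: "has_q_expansion (2 * N) (\<lambda>\<tau>. Polynomial.coeff (interp f \<tau>) j) F" by (auto simp: holq_def)
  show ?thesis
    by (rule SL2_invariant_polynomial_Jf[OF _ _ _ F]) (use N hq interp_SL2[OF f] in \<open>auto simp: holq_def\<close>)
qed

lemma interp_degree: "degree (interp f \<tau>) \<le> card Phi"
  unfolding interp_def
proof (rule degree_sum_le[OF finite_Phi])
  fix \<psi> assume "\<psi> \<in> Phi"
  have "degree (\<Prod>\<psi>'\<in>Phi - {\<psi>}. [:- \<psi>' \<tau>, 1:]) \<le> (\<Sum>\<psi>'\<in>Phi - {\<psi>}. degree [:- \<psi>' \<tau>, 1:])"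
    using finite_Phi by (intro degree_prod_sum_le[unfolded o_def]) auto
  also have "\<dots> = card (Phi - {\<psi>})" by simp
  also have "\<dots> \<le> card Phi" using finite_Phi by (intro card_mono) auto
  finally show "degree (Polynomial.smult (f (SL2_act (translate_rep \<psi>) \<tau>)) (\<Prod>\<psi>'\<in>Phi - {\<psi>}. [:- \<psi>' \<tau>, 1:])) \<le> card Phi"
    by (meson degree_smult_le order_trans)
qed

text \<open>The derivative of the monic polynomial with roots \<open>Phi\<close>, taken at the root
  \<open>phi N 1 0\<close>.\<close>

definition discr :: "complex \<Rightarrow> complex" where
  "discr \<tau> = (\<Prod>\<psi>\<in>Phi - {phi_translate (mat 1)}. phi N 1 0 \<tau> - \<psi> \<tau>)"

lemma interp_eval:
  assumes f: "weak_modular N f" and \<tau>: "Im \<tau> > 0"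
  shows "poly (interp f \<tau>) (phi N 1 0 \<tau>) = f \<tau> * discr \<tau>"
proof -
  define \<psi>0 where "\<psi>0 = phi_translate (mat 1)"
  have "\<psi>0 \<in> Phi" unfolding \<psi>0_def Phi_def by (rule imageI[OF mat_1_SL2Z])
  moreover have "\<psi>0 \<tau> = phi N 1 0 \<tau>" using \<tau> by (simp add: \<psi>0_def phi_translate_def SL2_act_1)
  ultimately have \<psi>0: "\<psi>0 \<in> Phi" "\<psi>0 \<tau> = phi N 1 0 \<tau>" .
  have "poly (interp f \<tau>) (phi N 1 0 \<tau>) = (\<Sum>\<psi>\<in>Phi. f (SL2_act (translate_rep \<psi>) \<tau>) * (\<Prod>\<psi>'\<in>Phi - {\<psi>}. \<psi>0 \<tau> - \<psi>' \<tau>))"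
    by (simp add: interp_def poly_sum poly_prod \<psi>0(2))
  also have "\<dots> = (\<Sum>\<psi>\<in>{\<psi>0}. f (SL2_act (translate_rep \<psi>) \<tau>) * (\<Prod>\<psi>'\<in>Phi - {\<psi>}. \<psi>0 \<tau> - \<psi>' \<tau>))"
  proof (rule sum.mono_neutral_right)
    show "\<forall>\<psi>\<in>Phi - {\<psi>0}. f (SL2_act (translate_rep \<psi>) \<tau>) * (\<Prod>\<psi>'\<in>Phi - {\<psi>}. \<psi>0 \<tau> - \<psi>' \<tau>) = 0"
      using finite_Phi \<psi>0(1) by (auto simp: prod_zero_iff)
  qed (use finite_Phi \<psi>0 in auto)
  also have "\<dots> = f (SL2_act (translate_rep \<psi>0) \<tau>) * discr \<tau>" by (simp add: discr_def \<psi>0_def[symmetric] \<psi>0(2))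
  also have "f (SL2_act (translate_rep \<psi>0) \<tau>) = f (SL2_act (mat 1) \<tau>)"
    using translate_rep[OF \<psi>0(1)] by (intro phi_translate_eq_imp[OF f _ mat_1_SL2Z _ \<tau>]) (auto simp: \<psi>0_def)
  finally show ?thesis by (simp add: SL2_act_1)
qed

lemma discr_q_expansion: "\<exists>F. has_q_expansion (2 * N) discr F \<and> F \<noteq> 0"
proof -
  have h0: "holq (2 * N) (phi N 1 0)"
    using phi_q_expansion_exists[of N 1 0] N phi_holomorphic unfolding holq_def by (metis (no_types) less_trans zero_less_one)
  obtain F0 where F0: "has_q_expansion (2 * N) (phi N 1 0) F0" using h0 by (auto simp: holq_def)
  have "\<exists>F. has_q_expansion (2 * N) \<psi> F" if "\<psi> \<in> Phi" for \<psi> using holq_Phi[OF that] by (auto simp: holq_def)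
  then obtain F where F: "\<And>\<psi>. \<psi> \<in> Phi \<Longrightarrow> has_q_expansion (2 * N) \<psi> (F \<psi>)" by metis
  have "has_q_expansion (2 * N) discr (\<Prod>\<psi>\<in>Phi - {phi_translate (mat 1)}. F0 + fls_const (- 1) * F \<psi>)"
  proof -
    have "has_q_expansion (2 * N) (\<lambda>\<tau>. \<Prod>\<psi>\<in>Phi - {phi_translate (mat 1)}. phi N 1 0 \<tau> + (- 1) * \<psi> \<tau>) (\<Prod>\<psi>\<in>Phi - {phi_translate (mat 1)}. F0 + fls_const (- 1) * F \<psi>)"
      by (intro has_q_expansion_prod has_q_expansion_add has_q_expansion_mult has_q_expansion_const M_pos F0 F) auto
    thus ?thesis by (simp add: discr_def[abs_def])
  qed
  moreover have "F0 + fls_const (- 1) * F \<psi> \<noteq> 0" if \<psi>: "\<psi> \<in> Phi - {phi_translate (mat 1)}" for \<psi>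
  proof
    assume "F0 + fls_const (- 1) * F \<psi> = 0"
    hence "fls_nth (F0 + fls_const (- 1) * F \<psi>) n = 0" for n by simp
    hence FF: "F0 = F \<psi>" by (intro fls_eqI) (simp del: fls_const_uminus)
    have "\<psi> \<tau> = phi N 1 0 \<tau>" if "Im \<tau> > 0" for \<tau>
      using q_expansion_identity[OF M_pos _ _ F _ that, of \<psi> "phi N 1 0"] holq_Phi[of \<psi>] phi_holomorphic F0 \<psi>
      unfolding holq_def FF by auto
    moreover obtain A where "\<psi> = phi_translate A" using \<psi> by (auto simp: Phi_def)
    ultimately have "\<psi> = phi_translate (mat 1)" by (auto simp: phi_translate_def fun_eq_iff restrict_def SL2_act_1)
    thus False using \<psi> by simp
  qed
  ultimately show ?thesis using finite_Phi by (intro exI conjI) (auto simp: prod_zero_iff)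
qed

text \<open>Stated for all sufficiently large n, in order that f and the constant 1 can later be
  expanded with the same n.\<close>

lemma interp_polynomial:
  assumes f: "weak_modular N f"
  obtains D c where "\<And>\<tau> n. Im \<tau> > 0 \<Longrightarrow> n \<ge> D \<Longrightarrow> f \<tau> * discr \<tau> = (\<Sum>i<n. \<Sum>j<n. c i j * Jf \<tau> ^ i * phi N 1 0 \<tau> ^ j)"
proof -
  obtain p where p: "\<And>j \<tau>. Im \<tau> > 0 \<Longrightarrow> Polynomial.coeff (interp f \<tau>) j = poly (p j) (Jf \<tau>)" using interp_coeff[OF f] by metis
  define c where "c i j = (if j \<le> card Phi then Polynomial.coeff (p j) i else 0)" for i j
  define D where "D = Suc (card Phi) + Suc (\<Sum>j\<le>card Phi. degree (p j))"
  have deg: "degree (p j) < D" if "j \<le> card Phi" for j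
  proof -
    have "degree (p j) \<le> (\<Sum>j\<le>card Phi. degree (p j))" using that by (intro member_le_sum) auto
    thus ?thesis by (simp add: D_def)
  qed
  show ?thesis
  proof (rule that[of D c])
    fix \<tau> :: complex and n assume \<tau>: "Im \<tau> > 0" and n: "n \<ge> D"
    have cn: "card Phi < n" using n by (simp add: D_def)
    have "f \<tau> * discr \<tau> = poly (interp f \<tau>) (phi N 1 0 \<tau>)" using interp_eval[OF f \<tau>] by simp
    also have "\<dots> = (\<Sum>j<n. Polynomial.coeff (interp f \<tau>) j * phi N 1 0 \<tau> ^ j)"
    proof -
      have "degree (interp f \<tau>) < n" using interp_degree[of f \<tau>] cn by linarith
      thus ?thesis unfolding poly_altdef by (intro sum.mono_neutral_left) (auto simp: Polynomial.coeff_eq_0)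
    qed
    also have "\<dots> = (\<Sum>j<n. (\<Sum>i<n. c i j * Jf \<tau> ^ i) * phi N 1 0 \<tau> ^ j)"
    proof (intro sum.cong refl arg_cong2[of _ _ _ _ "(*)"])
      fix j
      show "Polynomial.coeff (interp f \<tau>) j = (\<Sum>i<n. c i j * Jf \<tau> ^ i)"
      proof (cases "j \<le> card Phi")
        case True
        have "degree (p j) < n" using deg[OF True] n by simp
        hence "poly (p j) (Jf \<tau>) = (\<Sum>i<n. Polynomial.coeff (p j) i * Jf \<tau> ^ i)"
          unfolding poly_altdef by (intro sum.mono_neutral_left) (auto simp: Polynomial.coeff_eq_0)
        thus ?thesis using p[OF \<tau>] True by (simp add: c_def)
      next
        case False
        hence "Polynomial.coeff (interp f \<tau>) j = 0" using interp_degree[of f \<tau>] by (intro Polynomial.coeff_eq_0) linarith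
        thus ?thesis using False by (simp add: c_def)
      qed
    qed
    also have "\<dots> = (\<Sum>i<n. \<Sum>j<n. c i j * Jf \<tau> ^ i * phi N 1 0 \<tau> ^ j)"
      unfolding sum_distrib_right by (rule sum.swap)
    finally show "f \<tau> * discr \<tau> = (\<Sum>i<n. \<Sum>j<n. c i j * Jf \<tau> ^ i * phi N 1 0 \<tau> ^ j)" .
  qed
qed

end

lemma fls_over_mult_Rats: "fls_over \<rat> F \<Longrightarrow> fls_over \<rat> G \<Longrightarrow> fls_over \<rat> (F * G)"
  unfolding fls_over_def fls_times_nth by (auto intro!: Rats_sum)

lemma Ints_subset_Rats': "x \<in> \<int> \<Longrightarrow> (x :: complex) \<in> \<rat>"
  by (auto simp: Ints_def)

lemma fls_nth_sum: "fls_nth (\<Sum>i\<in>I. f i) n = (\<Sum>i\<in>I. fls_nth (f i) n)"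
  by (induction I rule: infinite_finite_induct) auto

text \<open>A \<open>\<rat>\<close>-linear functional on \<open>\<complex>\<close> makes the coefficients of a linear relation rational.\<close>

lemma integral_relation:
  fixes E :: "'i \<Rightarrow> complex fls"
  assumes fin: "finite I" and F: "fls_over \<rat> F" and E: "\<And>i. i \<in> I \<Longrightarrow> fls_over \<int> (E i)"
    and rel: "F * (\<Sum>i\<in>I. fls_const (a i) * E i) = (\<Sum>i\<in>I. fls_const (b i) * E i)"
    and nz: "(\<Sum>i\<in>I. fls_const (a i) * E i) \<noteq> 0"
  obtains a' b' :: "'i \<Rightarrow> int"
  where "F * (\<Sum>i\<in>I. fls_const (of_int (a' i)) * E i) = (\<Sum>i\<in>I. fls_const (of_int (b' i)) * E i)"
    "(\<Sum>i\<in>I. fls_const (of_int (a' i)) * E i) \<noteq> 0"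
proof -
  have EQ: "fls_over \<rat> (E i)" if "i \<in> I" for i using E[OF that] Ints_subset_Rats' by (auto simp: fls_over_def)
  define u where "u i n = inv_into UNIV of_rat (fls_nth (F * E i) n)" for i n
  define v where "v i n = inv_into UNIV of_rat (fls_nth (E i) n)" for i n
  have ri: "of_rat (inv_into UNIV of_rat x) = (x :: complex)" if "x \<in> \<rat>" for x
    using that by (metis f_inv_into_f Rats_def)
  have u: "fls_nth (F * E i) n = of_rat (u i n)" if "i \<in> I" for i n
    using fls_over_mult_Rats[OF F EQ[OF that]] ri by (simp add: u_def fls_over_def)
  have v: "fls_nth (E i) n = of_rat (v i n)" if "i \<in> I" for i n
    using EQ[OF that] ri by (simp add: v_def fls_over_def)
  have FS: "F * (\<Sum>i\<in>I. fls_const (a i) * E i) = (\<Sum>i\<in>I. fls_const (a i) * (F * E i))" for a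
    by (simp add: sum_distrib_left mult_ac)
  have nthE: "fls_nth (\<Sum>i\<in>I. fls_const (a i) * E i) n = (\<Sum>i\<in>I. of_rat (v i n) * a i)" for a n
    by (simp add: fls_nth_sum v mult.commute cong: sum.cong)
  have nthF: "fls_nth (F * (\<Sum>i\<in>I. fls_const (a i) * E i)) n = (\<Sum>i\<in>I. of_rat (u i n) * a i)" for a n
    unfolding FS by (simp add: fls_nth_sum u mult.commute cong: sum.cong)
  have relc: "(\<Sum>i\<in>I. of_rat (u i n) * a i) = (\<Sum>i\<in>I. of_rat (v i n) * b i)" for n
    using nthF[of a n] nthE[of b n] rel by simp
  obtain n0 where n0: "(\<Sum>i\<in>I. of_rat (v i n0) * a i) \<noteq> 0"
    using nz nthE[of a] by (metis fls_eq_iff fls_zero_nth)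
  \<comment> \<open>Normalising the functional at the coefficient \<open>n0\<close> keeps the
    denominator of the new relation nonzero.\<close>
  obtain lam :: "complex \<Rightarrow> rat" where lam: "lam (\<Sum>i\<in>I. of_rat (v i n0) * a i) = 1" "\<And>x y. lam (x + y) = lam x + lam y"
    "\<And>r x. lam (of_rat r * x) = r * lam x"
    using exists_rat_functional[OF n0] by blast
  note lsum = functional_sum[of lam, OF lam(2)]
  define D where "D = (\<Prod>i\<in>I. snd (quotient_of (lam (a i))) * snd (quotient_of (lam (b i))))"
  have D0: "D \<noteq> 0" unfolding D_def using fin quotient_of_denom_pos' by (auto simp: prod_zero_iff less_le)
  have DI: "\<exists>z::int. of_int D * x = of_int z" if x: "x = lam (a i) \<or> x = lam (b i)" and i: "i \<in> I" for i x
  proof -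
    have "snd (quotient_of x) dvd snd (quotient_of (lam (a i))) * snd (quotient_of (lam (b i)))" using x by auto
    also have "\<dots> dvd D" unfolding D_def using fin i by (intro dvd_prodI) auto
    finally obtain k where k: "D = snd (quotient_of x) * k" by blast
    have "x = of_int (fst (quotient_of x)) / of_int (snd (quotient_of x))" by (metis quotient_of_div prod.collapse)
    hence "of_int D * x = of_int (k * fst (quotient_of x))" using quotient_of_denom_pos'[of x] k by (simp add: field_simps)
    thus ?thesis by blast
  qed
  have "\<forall>i\<in>I. \<exists>z::int. of_int D * lam (a i) = of_int z" "\<forall>i\<in>I. \<exists>z::int. of_int D * lam (b i) = of_int z" using DI by blast+
  then obtain a' b' :: "'i \<Rightarrow> int" where a': "\<And>i. i \<in> I \<Longrightarrow> of_int D * lam (a i) = of_int (a' i)"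
     and b': "\<And>i. i \<in> I \<Longrightarrow> of_int D * lam (b i) = of_int (b' i)" by metis
  have conv: "(\<Sum>i\<in>I. of_rat (t i) * of_int (e' i)) = (of_rat (of_int D * lam (\<Sum>i\<in>I. of_rat (t i) * e i)) :: complex)"
    if "\<And>i. i \<in> I \<Longrightarrow> of_int D * lam (e i) = of_int (e' i)" for t e and e' :: "'i \<Rightarrow> int"
  proof -
    have "of_int D * lam (\<Sum>i\<in>I. of_rat (t i) * e i) = (\<Sum>i\<in>I. t i * (of_int D * lam (e i)))"
      unfolding lsum lam(3) by (simp add: sum_distrib_left mult_ac)
    also have "\<dots> = (\<Sum>i\<in>I. t i * of_int (e' i))" using that by simp
    finally show ?thesis by (simp add: of_rat_sum of_rat_mult)
  qed
  have conva: "(\<Sum>i\<in>I. of_rat (t i) * of_int (a' i)) = (of_rat (of_int D * lam (\<Sum>i\<in>I. of_rat (t i) * a i)) :: complex)" for t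
    by (rule conv) (rule a')
  have convb: "(\<Sum>i\<in>I. of_rat (t i) * of_int (b' i)) = (of_rat (of_int D * lam (\<Sum>i\<in>I. of_rat (t i) * b i)) :: complex)" for t
    by (rule conv) (rule b')
  show ?thesis
  proof (rule that[of a' b'])
    show "F * (\<Sum>i\<in>I. fls_const (of_int (a' i)) * E i) = (\<Sum>i\<in>I. fls_const (of_int (b' i)) * E i)"
    proof (rule fls_eqI)
      fix n
      show "fls_nth (F * (\<Sum>i\<in>I. fls_const (of_int (a' i)) * E i)) n = fls_nth (\<Sum>i\<in>I. fls_const (of_int (b' i)) * E i) n"
        unfolding nthF nthE conva convb relc ..
    qed
    have "fls_nth (\<Sum>i\<in>I. fls_const (of_int (a' i)) * E i) n0 = of_int D"
      unfolding nthE conva lam(1) by simp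
    thus "(\<Sum>i\<in>I. fls_const (of_int (a' i)) * E i) \<noteq> 0" using D0 by auto
  qed
qed

definition bipoly :: "nat \<Rightarrow> (nat \<times> nat \<Rightarrow> complex) \<Rightarrow> complex \<Rightarrow> complex \<Rightarrow> complex" where
  "bipoly n a x y = (\<Sum>p\<in>{..<n} \<times> {..<n}. a p * (x ^ fst p * y ^ snd p))"

lemma has_q_expansion_bipoly:
  assumes "M > 0" "has_q_expansion M f F" "has_q_expansion M g G"
  shows "has_q_expansion M (\<lambda>\<tau>. bipoly n a (f \<tau>) (g \<tau>)) (\<Sum>p\<in>{..<n} \<times> {..<n}. fls_const (a p) * (F ^ fst p * G ^ snd p))"
  unfolding bipoly_def by (intro has_q_expansion_sum has_q_expansion_mult has_q_expansion_power has_q_expansion_const assms)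

lemma bipoly_holomorphic: "f holomorphic_on S \<Longrightarrow> g holomorphic_on S \<Longrightarrow> (\<lambda>\<tau>. bipoly n a (f \<tau>) (g \<tau>)) holomorphic_on S"
  unfolding bipoly_def by (intro holomorphic_intros)

text \<open>Interpolating the constant 1 expresses \<open>discr\<close> itself as a polynomial in
  \<open>Jf\<close> and \<open>phi\<close>, so that f becomes a quotient of two such polynomials.
  Their complex coefficients can be replaced by integers because the expansion of f at \<infinity>
  is rational and those of \<open>Jf\<close> and \<open>phi\<close> are integral.\<close>

theorem weak_modular_relation:
  assumes N: "N > 1" and f: "weak_modular N f" and q: "has_q_expansion (2 * N) f F" "fls_over \<rat> F"
  obtains n and a b :: "nat \<times> nat \<Rightarrow> int"
  where "\<And>\<tau>. Im \<tau> > 0 \<Longrightarrow> f \<tau> * bipoly n (\<lambda>p. of_int (a p)) (Jf \<tau>) (phi N 1 0 \<tau>) = bipoly n (\<lambda>p. of_int (b p)) (Jf \<tau>) (phi N 1 0 \<tau>)"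
    "\<exists>\<tau>. Im \<tau> > 0 \<and> bipoly n (\<lambda>p. of_int (a p)) (Jf \<tau>) (phi N 1 0 \<tau>) \<noteq> 0"
proof -
  have N0: "N > 0" and M: "2 * N > 0" using N by auto
  obtain D1 c1 where c1: "\<And>\<tau> n. Im \<tau> > 0 \<Longrightarrow> n \<ge> D1 \<Longrightarrow> f \<tau> * discr N \<tau> = (\<Sum>i<n. \<Sum>j<n. c1 i j * Jf \<tau> ^ i * phi N 1 0 \<tau> ^ j)"
    using interp_polynomial[OF N f] by blast
  obtain D2 c2 where c2: "\<And>\<tau> n. Im \<tau> > 0 \<Longrightarrow> n \<ge> D2 \<Longrightarrow> 1 * discr N \<tau> = (\<Sum>i<n. \<Sum>j<n. c2 i j * Jf \<tau> ^ i * phi N 1 0 \<tau> ^ j)"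
    using interp_polynomial[OF N weak_modular_1[OF N0]] by blast
  define n where "n = max D1 D2"
  have conv: "(\<Sum>i<n. \<Sum>j<n. c i j * x ^ i * y ^ j) = bipoly n (\<lambda>p. c (fst p) (snd p)) x y" for c x y
    unfolding bipoly_def sum.cartesian_product by (simp add: case_prod_beta mult.assoc)
  define a b where "a p = c2 (fst p) (snd p)" and "b p = c1 (fst p) (snd p)" for p :: "nat \<times> nat"
  have A: "bipoly n a (Jf \<tau>) (phi N 1 0 \<tau>) = discr N \<tau>" if "Im \<tau> > 0" for \<tau>
    using c2[OF that, of n] by (simp add: conv a_def[abs_def] n_def[symmetric]) (simp add: n_def)
  have B: "bipoly n b (Jf \<tau>) (phi N 1 0 \<tau>) = f \<tau> * discr N \<tau>" if "Im \<tau> > 0" for \<tau>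
    using c1[OF that, of n] by (simp add: conv b_def[abs_def] n_def[symmetric]) (simp add: n_def)
  obtain FJ where FJ: "has_q_expansion (2 * N) Jf FJ" "fls_over \<int> FJ" by (rule Jf_q_expansion[OF N0])
  define Fp where "Fp = phi_series N 1 1"
  have Fp: "has_q_expansion (2 * N) (phi N 1 0) Fp" using phi_q_expansion[OF N0 N, of 0] by (simp add: Fp_def)
  have "fls_over \<int> Fp" unfolding Fp_def phi_series_def using siegel_series_Ints[of "2 * N" 1 "2 * 1"] N0
    by (auto intro!: fls_over_fps_to_fls fps_over_mult fps_over_const fps_over_power)
  define E where "E p = FJ ^ fst p * Fp ^ snd p" for p :: "nat \<times> nat"
  have E: "fls_over \<int> (E p)" for p unfolding E_def by (intro fls_over_mult fls_over_power FJ \<open>fls_over \<int> Fp\<close>)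
  have qe: "has_q_expansion (2 * N) (\<lambda>\<tau>. bipoly n c (Jf \<tau>) (phi N 1 0 \<tau>)) (\<Sum>p\<in>{..<n} \<times> {..<n}. fls_const (c p) * E p)" for c
    unfolding E_def by (rule has_q_expansion_bipoly[OF M FJ(1) Fp])
  obtain FD where FD: "has_q_expansion (2 * N) (discr N) FD" "FD \<noteq> 0" using discr_q_expansion[OF N] by blast
  have "has_q_expansion (2 * N) (discr N) (\<Sum>p\<in>{..<n} \<times> {..<n}. fls_const (a p) * E p)"
    by (rule has_q_expansion_cong'[OF _ qe[of a]]) (rule A)
  hence SA: "(\<Sum>p\<in>{..<n} \<times> {..<n}. fls_const (a p) * E p) = FD" using FD(1) has_q_expansion_unique[OF M] by blast
  have "has_q_expansion (2 * N) (\<lambda>\<tau>. f \<tau> * discr N \<tau>) (\<Sum>p\<in>{..<n} \<times> {..<n}. fls_const (b p) * E p)"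
    by (rule has_q_expansion_cong'[OF _ qe[of b]]) (rule B)
  hence SB: "F * FD = (\<Sum>p\<in>{..<n} \<times> {..<n}. fls_const (b p) * E p)"
    using has_q_expansion_mult[OF M q(1) FD(1)] has_q_expansion_unique[OF M] by blast
  obtain a' b' :: "nat \<times> nat \<Rightarrow> int" where
    ab: "F * (\<Sum>p\<in>{..<n} \<times> {..<n}. fls_const (of_int (a' p)) * E p) = (\<Sum>p\<in>{..<n} \<times> {..<n}. fls_const (of_int (b' p)) * E p)"
    "(\<Sum>p\<in>{..<n} \<times> {..<n}. fls_const (of_int (a' p)) * E p) \<noteq> 0"
  proof (rule integral_relation[of "{..<n} \<times> {..<n}" F E a b])
    show "F * (\<Sum>i\<in>{..<n} \<times> {..<n}. fls_const (a i) * E i) = (\<Sum>i\<in>{..<n} \<times> {..<n}. fls_const (b i) * E i)" using SA SB by simp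
  qed (use SA FD E q in auto)
  have hol: "(\<lambda>\<tau>. bipoly n c (Jf \<tau>) (phi N 1 0 \<tau>)) holomorphic_on upper_half_plane" for c
    by (intro bipoly_holomorphic Jf_holomorphic phi_holomorphic)
  have fh: "f holomorphic_on upper_half_plane" using f by (simp add: weak_modular_def)
  show ?thesis
  proof (rule that[of n a' b'])
    fix \<tau> :: complex assume \<tau>: "Im \<tau> > 0"
    show "f \<tau> * bipoly n (\<lambda>p. of_int (a' p)) (Jf \<tau>) (phi N 1 0 \<tau>) = bipoly n (\<lambda>p. of_int (b' p)) (Jf \<tau>) (phi N 1 0 \<tau>)"
      by (rule q_expansion_identity[OF M holomorphic_on_mult[OF fh hol] hol
            has_q_expansion_mult[OF M q(1) qe[of "\<lambda>p. of_int (a' p)"]] qe[of "\<lambda>p. of_int (b' p)", folded ab(1)] \<tau>])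
  next
    show "\<exists>\<tau>. Im \<tau> > 0 \<and> bipoly n (\<lambda>p. of_int (a' p)) (Jf \<tau>) (phi N 1 0 \<tau>) \<noteq> 0"
    proof (rule ccontr)
      assume "\<not> ?thesis"
      hence "has_q_expansion (2 * N) (\<lambda>\<tau>. bipoly n (\<lambda>p. of_int (a' p)) (Jf \<tau>) (phi N 1 0 \<tau>)) (fls_const 0)"
        using has_q_expansion_cong'[OF _ has_q_expansion_const[OF M, of 0]] by (metis (no_types, lifting))
      hence "(\<Sum>p\<in>{..<n} \<times> {..<n}. fls_const (of_int (a' p)) * E p) = fls_const 0"
        using qe has_q_expansion_unique[OF M] by blast
      thus False using ab(2) by simp
    qed
  qed
qed

section \<open>Galois conjugation of the expansions at the cusps\<close>

text \<open>Families of Laurent series whose coefficients are polynomials over \<open>\<int>\<close> in \<open>w\<close>: for a root of unity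
  \<open>w\<close>, replacing \<open>w\<close> by \<open>w\<^sup>s\<close> is Galois conjugation.\<close>

definition galois_family :: "(complex \<Rightarrow> complex fls) \<Rightarrow> bool" where
  "galois_family Q \<longleftrightarrow> (\<exists>m R. (\<forall>w. Q w = fls_shift m (fps_to_fls (R w))) \<and> (\<forall>j. (\<lambda>w. fps_nth (R w) j) \<in> zpol))"

lemma zpol_fps_mult:
  assumes "\<And>j. (\<lambda>w. fps_nth (R w) j) \<in> zpol" "\<And>j. (\<lambda>w. fps_nth (R' w) j) \<in> zpol"
  shows "(\<lambda>w. fps_nth (R w * R' w) j) \<in> zpol"
  unfolding fps_mult_nth by (intro zpol_sum zpol.mult assms)

lemma galois_family_mult: assumes "galois_family Q" "galois_family Q'" shows "galois_family (\<lambda>w. Q w * Q' w)"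
proof -
  obtain m R m' R' where *: "\<And>w. Q w = fls_shift m (fps_to_fls (R w))" "\<And>j. (\<lambda>w. fps_nth (R w) j) \<in> zpol"
    "\<And>w. Q' w = fls_shift m' (fps_to_fls (R' w))" "\<And>j. (\<lambda>w. fps_nth (R' w) j) \<in> zpol"
    using assms unfolding galois_family_def by metis
  show ?thesis unfolding galois_family_def
    by (rule exI[of _ "m + m'"], rule exI[of _ "\<lambda>w. R w * R' w"])
       (use zpol_fps_mult[OF *(2,4)] in \<open>simp add: *(1,3) fls_times_both_shifted_simp fls_times_fps_to_fls\<close>)
qed

lemma galois_family_shift_up:
  assumes "\<And>w. Q w = fls_shift m (fps_to_fls (R w))" "\<And>j. (\<lambda>w. fps_nth (R w) j) \<in> zpol" "m \<le> m'"
  obtains R' where "\<And>w. Q w = fls_shift m' (fps_to_fls (R' w))" "\<And>j. (\<lambda>w. fps_nth (R' w) j) \<in> zpol"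
proof (rule that[of "\<lambda>w. fps_X ^ nat (m' - m) * R w"])
  fix w show "Q w = fls_shift m' (fps_to_fls (fps_X ^ nat (m' - m) * R w))"
  proof (rule fls_eqI)
    fix n show "fls_nth (Q w) n = fls_nth (fls_shift m' (fps_to_fls (fps_X ^ nat (m' - m) * R w))) n"
      using assms(3) by (auto simp: assms(1) fps_X_power_mult_nth nat_diff_distrib intro!: arg_cong2[of _ _ _ _ fps_nth])
  qed
next
  fix j show "(\<lambda>w. fps_nth (fps_X ^ nat (m' - m) * R w) j) \<in> zpol"
    using assms(2) zpol_0 by (cases "j < nat (m' - m)") (auto simp: fps_X_power_mult_nth)
qed

lemma galois_family_add: assumes "galois_family Q" "galois_family Q'" shows "galois_family (\<lambda>w. Q w + Q' w)"
proof -
  obtain m R m' R' where *: "\<And>w. Q w = fls_shift m (fps_to_fls (R w))" "\<And>j. (\<lambda>w. fps_nth (R w) j) \<in> zpol"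
    "\<And>w. Q' w = fls_shift m' (fps_to_fls (R' w))" "\<And>j. (\<lambda>w. fps_nth (R' w) j) \<in> zpol"
    using assms unfolding galois_family_def by metis
  define M where "M = max m m'"
  obtain S where S: "\<And>w. Q w = fls_shift M (fps_to_fls (S w))" "\<And>j. (\<lambda>w. fps_nth (S w) j) \<in> zpol"
    using galois_family_shift_up[OF *(1,2), of M] by (auto simp: M_def)
  obtain S' where S': "\<And>w. Q' w = fls_shift M (fps_to_fls (S' w))" "\<And>j. (\<lambda>w. fps_nth (S' w) j) \<in> zpol"
    using galois_family_shift_up[OF *(3,4), of M] by (auto simp: M_def)
  show ?thesis unfolding galois_family_def
    by (rule exI[of _ M], rule exI[of _ "\<lambda>w. S w + S' w"]) (use S S' in \<open>auto intro: zpol.add\<close>)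
qed

lemma galois_family_of_Ints: assumes "fls_over \<int> F" shows "galois_family (\<lambda>_. F)"
proof -
  obtain P where P: "F = fls_shift (- fls_subdegree F) (fps_to_fls P)" "fps_over \<int> P"
    using fls_over_obtain_fps[OF assms] by blast
  have "(\<lambda>_. fps_nth P j) \<in> zpol" for j
  proof -
    obtain c where "fps_nth P j = of_int c" using P(2) by (auto simp: fps_over_def Ints_def)
    thus ?thesis using zpol.const[of c] by simp
  qed
  thus ?thesis unfolding galois_family_def using P(1) by (intro exI[of _ "- fls_subdegree F"] exI[of _ "\<lambda>_. P"]) auto
qed

lemma galois_family_power: "galois_family Q \<Longrightarrow> galois_family (\<lambda>w. Q w ^ n)"
  by (induction n) (auto intro: galois_family_mult galois_family_of_Ints[OF fls_over_const[of 1, simplified]])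

lemma galois_family_sum: "(\<And>i. i \<in> I \<Longrightarrow> galois_family (Q i)) \<Longrightarrow> galois_family (\<lambda>w. \<Sum>i\<in>I. Q i w)"
  by (induction I rule: infinite_finite_induct) (auto intro: galois_family_add galois_family_of_Ints[OF fls_over_const[of 0, simplified]])

lemma galois_family_phi: "N > 0 \<Longrightarrow> galois_family (phi_series N k)"
proof -
  assume N: "N > 0"
  have 1: "(\<lambda>w. fps_nth (siegel_series (2 * N) (2 * k) w ^ e) j) \<in> zpol" for e j
  proof (induction e arbitrary: j)
    case 0 thus ?case using zpol.const[of 0] zpol.const[of 1] by (cases "j = 0") auto
  next
    case (Suc e)
    show ?case unfolding power_Suc by (rule zpol_fps_mult[OF siegel_series_zpol Suc]) (use N in auto)
  qed
  have "(\<lambda>w. fps_nth (fps_const (w ^ (12 * k)) * siegel_series (2 * N) (2 * k) w ^ (24 * N)) j) \<in> zpol" for j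
    unfolding fps_mult_left_const_nth by (intro zpol.mult zpol_power zpol.ident 1)
  thus ?thesis unfolding galois_family_def phi_series_def
    by (intro exI[of _ "- siegel_order (2 * N) (2 * int k)"] exI[of _ "\<lambda>w. fps_const (w ^ (12 * k)) * siegel_series (2 * N) (2 * k) w ^ (24 * N)"]) auto
qed

text \<open>Each coefficient vanishes at w if and only if it vanishes at \<open>w ^ s\<close>: one
  direction is \<open>zpol_galois\<close> for s, the other is the same for an inverse of s modulo
  N.\<close>

lemma galois_family_galois:
  assumes Q: "galois_family Q" and w: "w ^ N = 1" "N > 0" "coprime s N"
  shows "fls_subdegree (Q (w ^ s)) = fls_subdegree (Q w)" "Q (w ^ s) = 0 \<longleftrightarrow> Q w = 0"
proof -
  obtain m R where R: "\<And>w. Q w = fls_shift m (fps_to_fls (R w))" "\<And>j. (\<lambda>w. fps_nth (R w) j) \<in> zpol"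
    using Q unfolding galois_family_def by metis
  have imp: "fls_nth (Q (w ^ s)) n = 0" if "fls_nth (Q w) n = 0" "w ^ N = 1" "coprime s N" for w s n
    using that zpol_galois[OF that(2) w(2) that(3) R(2)] by (auto simp: R(1) split: if_splits)
  obtain t where t: "[s * t = 1] (mod N)" using cong_solve_coprime_nat[OF w(3)] by auto
  have ct: "coprime t N" using t by (metis coprime_mult_left_iff coprime_1_left cong_imp_coprime cong_sym)
  have wst: "(w ^ s) ^ t = w"
  proof -
    have "(s * t) mod N = 1 mod N" using t by (simp add: cong_def)
    moreover have "w ^ x = w ^ (x mod N)" for x
      by (metis w(1) mod_mult_div_eq power_add power_mult power_one mult_1_right)
    ultimately have "w ^ (s * t) = w ^ 1" by metis
    thus ?thesis by (simp add: power_mult)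
  qed
  have ws1: "(w ^ s) ^ N = 1" using w(1) by (metis power_commutes power_mult mult.commute power_one)
  have iff: "fls_nth (Q (w ^ s)) n = 0 \<longleftrightarrow> fls_nth (Q w) n = 0" for n
    using imp[of w n s] imp[of "w ^ s" n t] w ws1 ct wst by auto
  show z: "Q (w ^ s) = 0 \<longleftrightarrow> Q w = 0" unfolding fls_eq_iff using iff by simp
  show "fls_subdegree (Q (w ^ s)) = fls_subdegree (Q w)"
  proof (cases "Q w = 0")
    case False
    show ?thesis
    proof (rule fls_subdegree_eqI)
      show "fls_nth (Q (w ^ s)) (fls_subdegree (Q w)) \<noteq> 0" using False by (simp add: iff)
      fix k assume "k < fls_subdegree (Q w)"
      hence "fls_nth (Q w) k = 0" by (rule fls_eq0_below_subdegree)
      thus "fls_nth (Q (w ^ s)) k = 0" using iff by simp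
    qed
  qed (use z in simp)
qed

lemma has_q_expansion_translate:
  assumes "M > 0" "has_q_expansion M f F"
  obtains F' where "has_q_expansion M (\<lambda>\<tau>. f (\<tau> + of_int t)) F'" "fls_subdegree F' = fls_subdegree F"
proof -
  define c where "c = ex (of_int t / of_nat M)"
  have c: "c \<noteq> 0" by (simp add: c_def ex_def)
  define F' where "F' = fls_compose_fps F (fps_const c * fps_X)"
  have "(\<lambda>z. c * z) has_fps_expansion fps_const c * fps_X" by (intro fps_expansion_intros)
  hence "(\<lambda>z. c * z) has_laurent_expansion fps_to_fls (fps_const c * fps_X)" by (rule has_laurent_expansion_fps)
  from has_laurent_expansion_compose[OF has_q_expansion_laurent[OF assms(2)] this]
  have L: "(eval_fls F \<circ> (\<lambda>z. c * z)) has_laurent_expansion F'" using c by (simp add: F'_def)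
  have lim: "filterlim (\<lambda>\<tau>. \<tau> + of_int t) (filtercomap Im at_top) (filtercomap Im at_top)"
    unfolding filterlim_filtercomap_iff o_def by (simp add: filterlim_filtercomap)
  have "\<forall>\<^sub>F \<tau> in filtercomap Im at_top. f (\<tau> + of_int t) = eval_fls F (ex ((\<tau> + of_int t) / of_nat M))"
    using eventually_compose_filterlim[OF has_q_expansion_ev[OF assms(2)] lim] .
  hence "\<forall>\<^sub>F \<tau> in filtercomap Im at_top. f (\<tau> + of_int t) = (eval_fls F \<circ> (\<lambda>z. c * z)) (ex (\<tau> / of_nat M))"
    by eventually_elim (simp add: add_divide_distrib ex_add c_def mult.commute)
  from has_q_expansionI[OF assms(1) L this] show ?thesis
    by (rule that) (use c in \<open>simp add: F'_def\<close>)
qed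

text \<open>Composing the relation with A fixes \<open>Jf\<close> and turns \<open>phi\<close> into
  the function whose characteristic is the first row of A. So the expansions of all translates of f
  come from the same two integer polynomials, and enter only through the class k and the root of
  unity w given by that row.\<close>

theorem weak_modular_conjugate:
  assumes N: "N > 1" and f: "weak_modular N f" and q: "has_q_expansion (2 * N) f F" "fls_over \<rat> F"
  obtains QA QB :: "nat \<Rightarrow> complex \<Rightarrow> complex fls"
  where "\<And>k. galois_family (QA k)" "\<And>k. galois_family (QB k)"
    "\<And>(A :: int ^ 2 ^ 2) G k w. A \<in> SL2Z \<Longrightarrow> has_q_expansion (2 * N) (\<lambda>\<tau>. f (SL2_act A \<tau>)) G \<Longrightarrow> k = nat (A $ 1 $ 1 mod int N) \<Longrightarrow>
       w = ex (of_int (A $ 1 $ 2) / of_nat N) \<Longrightarrow> QA k w \<noteq> 0 \<and> G * QA k w = QB k w"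
proof -
  have N0: "N > 0" and M: "2 * N > 0" using N by auto
  obtain n and a b :: "nat \<times> nat \<Rightarrow> int" where
    rel: "\<And>\<tau>. Im \<tau> > 0 \<Longrightarrow> f \<tau> * bipoly n (\<lambda>p. of_int (a p)) (Jf \<tau>) (phi N 1 0 \<tau>) = bipoly n (\<lambda>p. of_int (b p)) (Jf \<tau>) (phi N 1 0 \<tau>)"
    and nz: "\<exists>\<tau>. Im \<tau> > 0 \<and> bipoly n (\<lambda>p. of_int (a p)) (Jf \<tau>) (phi N 1 0 \<tau>) \<noteq> 0"
    using weak_modular_relation[OF N f q] by blast
  obtain FJ where FJ: "has_q_expansion (2 * N) Jf FJ" "fls_over \<int> FJ" by (rule Jf_q_expansion[OF N0])
  define Q where "Q c k w = (\<Sum>p\<in>{..<n} \<times> {..<n}. fls_const (of_int (c p)) * (FJ ^ fst p * phi_series N k w ^ snd p))"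
    for c :: "nat \<times> nat \<Rightarrow> int" and k w
  have galois_family: "galois_family (Q c k)" for c k
    unfolding Q_def by (intro galois_family_sum galois_family_mult galois_family_power galois_family_phi galois_family_of_Ints fls_over_const FJ N0 Ints_of_int)
  have qe: "has_q_expansion (2 * N) (\<lambda>\<tau>. bipoly n (\<lambda>p. of_int (c p)) (Jf \<tau>) (phi N k l \<tau>)) (Q c (nat (k mod int N)) (ex (of_int l / of_nat N)))" for c k l
  proof -
    have k: "nat (k mod int N) < N" "int (nat (k mod int N)) = k mod int N" using N0 by (auto simp: nat_less_iff)
    have "has_q_expansion (2 * N) (phi N (int (nat (k mod int N))) l) (phi_series N (nat (k mod int N)) (ex (of_int l / of_nat N)))"
      by (rule phi_q_expansion[OF N0 k(1)])
    hence "has_q_expansion (2 * N) (phi N k l) (phi_series N (nat (k mod int N)) (ex (of_int l / of_nat N)))"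
      by (rule has_q_expansion_cong'[rotated]) (use k N0 in \<open>auto intro!: phi_cong simp: cong_def\<close>)
    thus ?thesis unfolding Q_def by (intro has_q_expansion_bipoly M FJ)
  qed
  show ?thesis
  proof (rule that[of "Q a" "Q b"])
    fix A :: "int ^ 2 ^ 2" and G k w
    assume A: "A \<in> SL2Z" and G: "has_q_expansion (2 * N) (\<lambda>\<tau>. f (SL2_act A \<tau>)) G" and k: "k = nat (A $ 1 $ 1 mod int N)"
      and w: "w = ex (of_int (A $ 1 $ 2) / of_nat N)"
    let ?p = "\<lambda>c \<tau>. bipoly n (\<lambda>p. of_int (c p)) (Jf \<tau>) (phi N (A $ 1 $ 1) (A $ 1 $ 2) \<tau>)"
    have act: "bipoly n (\<lambda>p. of_int (c p)) (Jf (SL2_act A \<tau>)) (phi N 1 0 (SL2_act A \<tau>)) = ?p c \<tau>" if "Im \<tau> > 0" for c :: "nat \<times> nat \<Rightarrow> int" and \<tau>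
      using phi_SL2[OF A that, of N 1 0] Jf_SL2[OF A that] by simp
    have fab: "f (SL2_act A \<tau>) * ?p a \<tau> = ?p b \<tau>" if "Im \<tau> > 0" for \<tau>
      using rel[OF Im_SL2_act[OF A that]] act[OF that] by simp
    have qe': "has_q_expansion (2 * N) (?p c) (Q c k w)" for c unfolding k w by (rule qe)
    have "has_q_expansion (2 * N) (?p b) (G * Q a k w)"
      by (rule has_q_expansion_cong'[OF fab has_q_expansion_mult[OF M G qe']])
    hence 1: "G * Q a k w = Q b k w" by (rule has_q_expansion_unique[OF M _ qe'])
    \<comment> \<open>If the denominator vanished for A, it would do so identically, and composition
      with the inverse of A would annihilate the original denominator.\<close>
    have "Q a k w \<noteq> 0"
    proof
      assume *: "Q a k w = 0"
      have q0: "has_q_expansion (2 * N) (?p a) 0" using qe'[of a] * by simp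
      have z: "?p a \<tau> = 0" if "Im \<tau> > 0" for \<tau>
        by (rule q_expansion_identity[OF M _ holomorphic_on_const q0 has_q_expansion_const[OF M, of 0, simplified] that])
           (intro bipoly_holomorphic Jf_holomorphic phi_holomorphic)
      obtain \<tau> where \<tau>: "Im \<tau> > 0" "bipoly n (\<lambda>p. of_int (a p)) (Jf \<tau>) (phi N 1 0 \<tau>) \<noteq> 0" using nz by blast
      have im: "Im (SL2_act (inv2 A) \<tau>) > 0" using Im_SL2_act inv2_SL2Z A \<tau>(1) by blast
      show False using act[OF im, of a] z[OF im] \<tau> SL2_act_inv'[OF A \<tau>(1)] by simp
    qed
    thus "Q a k w \<noteq> 0 \<and> G * Q a k w = Q b k w" using 1 by blast
  qed (rule galois_family galois_family)+
qed

lemma ex_cong: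
  assumes "N > 0" "[l' = int s * l] (mod int N)"
  shows "ex (of_int l' / of_nat N) = ex (of_int l / of_nat N) ^ s"
proof -
  obtain m where m: "l' = int s * l + int N * m" using cong_iff_lin[of "int s * l" l' "int N"] cong_sym[OF assms(2)] by blast
  have "of_int l' / of_nat N = of_nat s * (of_int l / of_nat N) + (of_int m :: complex)" using assms(1) by (simp add: m field_simps)
  thus ?thesis by (simp only: ex_add ex_of_int ex_of_nat_mult mult_1_right)
qed

text \<open>Both l and l' are units modulo d = gcd(k, N), so l' \<equiv> s l modulo d for a unit s,
  which \<open>coprime_shift\<close> lifts to a unit modulo N. The remaining multiple of d is a
  multiple of k modulo N.\<close>

lemma unit_multiple_mod_gcd:
  fixes k l l' :: int
  assumes N: "N > 1" and g: "gcd (gcd k l) (int N) = 1" "gcd (gcd k l') (int N) = 1"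
  obtains s t where "coprime s N" "[l' - k * t = int s * l] (mod int N)"
proof -
  define d where "d = gcd k (int N)"
  have cl: "coprime l d" "coprime l' d" using g unfolding d_def coprime_iff_gcd_eq_1 by (metis gcd.assoc gcd.commute)+
  obtain u where u: "[l * u = 1] (mod d)" using cong_solve_coprime_int[OF cl(1)] by blast
  have "coprime u d" using u by (metis coprime_1_left coprime_mult_left_iff cong_imp_coprime cong_sym)
  hence "coprime (u * l') d" using cl(2) by simp
  hence "gcd (u * l') (gcd d (int N)) = 1" by (simp add: d_def gcd.assoc coprime_iff_gcd_eq_1)
  then obtain j where j: "coprime (u * l' + j * d) (int N)" using coprime_shift[of "u * l'" d "int N"] N by auto
  define s1 where "s1 = u * l' + j * d"
  define s where "s = nat (s1 mod int N)"
  have s: "int s = s1 mod int N" using N by (simp add: s_def)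
  have "coprime (int s) (int N)" unfolding s using j by (metis s1_def coprime_iff_gcd_eq_1 gcd.commute gcd_red_int)
  hence cs: "coprime s N" by simp
  have "[s1 * l = (u * l' + 0) * l] (mod d)" unfolding s1_def by (intro cong_mult cong_add cong_refl) (simp add: cong_def)
  also have "(u * l' + 0) * l = (l * u) * l'" by (simp add: mult_ac)
  also have "[(l * u) * l' = 1 * l'] (mod d)" by (intro cong_mult u cong_refl)
  finally have "d dvd l' - s1 * l" by (simp add: cong_iff_dvd_diff cong_sym_eq dvd_diff_commute)
  then obtain v where v: "l' - s1 * l = d * v" by blast
  obtain x where x: "[k * x = d] (mod int N)" using cong_solve_int[of k "int N"] unfolding d_def by blast
  have "[k * (x * v) = l' - s1 * l] (mod int N)" unfolding v using cong_mult[OF x cong_refl[of v]] by (simp add: mult_ac)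
  hence "[l' - k * (x * v) = l' - (l' - s1 * l)] (mod int N)" by (intro cong_diff cong_refl)
  also have "l' - (l' - s1 * l) = s1 * l" by simp
  also have "[s1 * l = int s * l] (mod int N)" unfolding s by (intro cong_mult cong_refl) (simp add: cong_def)
  finally show ?thesis using that cs by blast
qed

text \<open>For a fixed upper left entry a modulo N, a translation of \<tau> changes the upper right
  entry by multiples of a without affecting the order. What is left is multiplication of that entry
  by a unit s, and this is the conjugation w \<mapsto> w^s.\<close>

theorem weak_modular_cusp_order:
  fixes A B :: "int ^ 2 ^ 2"
  assumes N: "N > 1" and f: "weak_modular N f" and q: "has_q_expansion (2 * N) f F" "fls_over \<rat> F"
    and A: "A \<in> SL2Z" "has_q_expansion (2 * N) (\<lambda>\<tau>. f (SL2_act A \<tau>)) G"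
    and B: "B \<in> SL2Z" "has_q_expansion (2 * N) (\<lambda>\<tau>. f (SL2_act B \<tau>)) H"
    and AB: "[A $ 1 $ 1 = B $ 1 $ 1] (mod int N)"
  shows "fls_subdegree G = fls_subdegree H"
proof -
  have N0: "N > 0" and M: "2 * N > 0" using N by auto
  obtain QA QB :: "nat \<Rightarrow> complex \<Rightarrow> complex fls" where galois_family: "\<And>k. galois_family (QA k)" "\<And>k. galois_family (QB k)"
    and rel: "\<And>(A :: int ^ 2 ^ 2) G k w. A \<in> SL2Z \<Longrightarrow> has_q_expansion (2 * N) (\<lambda>\<tau>. f (SL2_act A \<tau>)) G \<Longrightarrow> k = nat (A $ 1 $ 1 mod int N) \<Longrightarrow>
       w = ex (of_int (A $ 1 $ 2) / of_nat N) \<Longrightarrow> QA k w \<noteq> 0 \<and> G * QA k w = QB k w"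
    using weak_modular_conjugate[OF N f q] by blast
  obtain s t where st: "coprime s N" "[B $ 1 $ 2 - B $ 1 $ 1 * t = int s * A $ 1 $ 2] (mod int N)"
  proof (rule unit_multiple_mod_gcd[OF N, of "B $ 1 $ 1" "A $ 1 $ 2" "B $ 1 $ 2"])
    show "gcd (gcd (B $ 1 $ 1) (B $ 1 $ 2)) (int N) = 1" by (rule SL2_row_gcd[OF B(1)])
    have "gcd (gcd (A $ 1 $ 1) (A $ 1 $ 2)) (int N) = 1" by (rule SL2_row_gcd[OF A(1)])
    moreover have "gcd (A $ 1 $ 1) (int N) = gcd (B $ 1 $ 1) (int N)" using AB by (metis cong_gcd_eq)
    ultimately show "gcd (gcd (B $ 1 $ 1) (A $ 1 $ 2)) (int N) = 1" by (metis gcd.assoc gcd.commute)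
  qed
  define C where "C = B ** mat2 1 (- t) 0 1"
  have C: "C \<in> SL2Z" unfolding C_def by (intro SL2Z_mult B translation_SL2Z)
  have C1: "C $ 1 $ 1 = B $ 1 $ 1" "C $ 1 $ 2 = B $ 1 $ 2 - B $ 1 $ 1 * t" by (simp_all add: C_def mat_mult_nth)
  obtain H' where H': "has_q_expansion (2 * N) (\<lambda>\<tau>. f (SL2_act B (\<tau> + of_int (- t)))) H'" "fls_subdegree H' = fls_subdegree H"
    by (rule has_q_expansion_translate[OF M B(2), of "- t"])
  have "f (SL2_act B (\<tau> + of_int (- t))) = f (SL2_act C \<tau>)" if "Im \<tau> > 0" for \<tau>
    unfolding C_def using SL2_act_mult[OF B(1) translation_SL2Z that, of "- t"] by (simp only: SL2_act_translation)
  from has_q_expansion_cong'[OF this H'(1)] have qC: "has_q_expansion (2 * N) (\<lambda>\<tau>. f (SL2_act C \<tau>)) H'" .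
  define k where "k = nat (A $ 1 $ 1 mod int N)"
  define w where "w = ex (of_int (A $ 1 $ 2) / of_nat N)"
  have kC: "k = nat (C $ 1 $ 1 mod int N)" using AB by (simp add: k_def C1 cong_def)
  have wC: "w ^ s = ex (of_int (C $ 1 $ 2) / of_nat N)" unfolding C1 w_def by (rule ex_cong[OF N0 st(2), symmetric])
  have w1: "w ^ N = 1" unfolding w_def ex_of_nat_mult[symmetric] using N0 by (simp add: ex_of_int)
  have r1: "QA k w \<noteq> 0 \<and> G * QA k w = QB k w" by (rule rel[OF A k_def w_def])
  have r2: "QA k (w ^ s) \<noteq> 0 \<and> H' * QA k (w ^ s) = QB k (w ^ s)" by (rule rel[OF C qC kC wC])
  note g1 = galois_family_galois[OF galois_family(1)[of k] w1 N0 st(1)] and g2 = galois_family_galois[OF galois_family(2)[of k] w1 N0 st(1)]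
  show ?thesis
  proof (cases "G = 0")
    case True
    hence "QB k (w ^ s) = 0" using r1 g2 by auto
    hence "H' = 0" using r2 by auto
    thus ?thesis using True H'(2) by simp
  next
    case False
    hence "QB k (w ^ s) \<noteq> 0" using r1 g2 by auto
    hence "H' \<noteq> 0" using r2 by auto
    hence "fls_subdegree H' + fls_subdegree (QA k (w ^ s)) = fls_subdegree (QB k (w ^ s))" using r2 fls_subdegree_mult by metis
    moreover have "fls_subdegree G + fls_subdegree (QA k w) = fls_subdegree (QB k w)" using False r1 fls_subdegree_mult by metis
    ultimately show ?thesis using H'(2) g1 g2 by simp
  qed
qed

theorem weak_modular_cusp_order':
  fixes A B :: "int ^ 2 ^ 2"
  assumes N: "N > 1" and f: "weak_modular N f" and q: "has_q_expansion (2 * N) f F" "fls_over \<rat> F"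
    and A: "A \<in> SL2Z" "has_q_expansion (2 * N) (\<lambda>\<tau>. f (SL2_act A \<tau>)) G"
    and B: "B \<in> SL2Z" "has_q_expansion (2 * N) (\<lambda>\<tau>. f (SL2_act B \<tau>)) H"
    and AB: "[A $ 1 $ 1 = B $ 1 $ 1] (mod int N) \<or> [A $ 1 $ 1 = - B $ 1 $ 1] (mod int N)"
  shows "fls_subdegree G = fls_subdegree H"
  using AB
proof
  assume "[A $ 1 $ 1 = - B $ 1 $ 1] (mod int N)"
  thus ?thesis
    by (intro weak_modular_cusp_order[OF N f q A uminus_SL2Z[OF B(1)]]) (simp_all add: SL2_act_uminus B)
qed (rule weak_modular_cusp_order[OF N f q A B])

section \<open>Modular units as products of Siegel functions up to a power\<close>

lemma weak_modular_phi: assumes N: "N > 0" shows "weak_modular N (phi N k 0)"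
  unfolding weak_modular_def
proof (intro conjI ballI allI impI phi_holomorphic)
  fix A :: "int ^ 2 ^ 2" and \<tau> :: complex assume A: "A \<in> Gamma_up_1 N" and \<tau>: "Im \<tau> > 0"
  hence SA: "A \<in> SL2Z" and c: "[A $ 1 $ 1 = 1] (mod int N)" "[A $ 1 $ 2 = 0] (mod int N)" by (auto simp: Gamma_up_1_def)
  have "phi N k 0 (SL2_act A \<tau>) = phi N (k * A $ 1 $ 1) (k * A $ 1 $ 2) \<tau>" using phi_SL2[OF SA \<tau>, of N k 0] by simp
  also have "\<dots> = phi N k 0 \<tau>"
    using cong_mult[OF cong_refl c(1), of k] cong_mult[OF cong_refl c(2), of k] by (intro phi_cong N \<tau>) auto
  finally show "phi N k 0 (SL2_act A \<tau>) = phi N k 0 \<tau>" .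
next
  fix A :: "int ^ 2 ^ 2" assume A: "A \<in> SL2Z"
  obtain F where F: "has_q_expansion (2 * N) (phi N (k * A $ 1 $ 1) (k * A $ 1 $ 2)) F" using phi_q_expansion_exists[OF N] by blast
  have "has_q_expansion (2 * N) (\<lambda>\<tau>. phi N k 0 (SL2_act A \<tau>)) F"
    by (rule has_q_expansion_cong'[OF _ F]) (use phi_SL2[OF A, of _ N k 0] in simp)
  thus "\<exists>F. has_q_expansion (2 * N) (\<lambda>\<tau>. phi N k 0 (SL2_act A \<tau>)) F" by blast
qed

lemma phi_SL2_subdegree:
  fixes A :: "int ^ 2 ^ 2"
  assumes N: "N > 1" and A: "A \<in> SL2Z" and k: "\<not> int N dvd k" and G: "has_q_expansion (2 * N) (\<lambda>\<tau>. phi N k 0 (SL2_act A \<tau>)) G"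
  shows "fls_subdegree G = siegel_order (2 * N) (2 * ((k * A $ 1 $ 1) mod int N))"
proof (rule phi_q_expansion_subdegree'[OF N])
  show "has_q_expansion (2 * N) (phi N (k * A $ 1 $ 1) (k * A $ 1 $ 2)) G"
    by (rule has_q_expansion_cong'[OF _ G]) (use phi_SL2[OF A, of _ N k 0] in simp)
  show "\<not> (int N dvd k * A $ 1 $ 1 \<and> int N dvd k * A $ 1 $ 2)"
  proof
    assume "int N dvd k * A $ 1 $ 1 \<and> int N dvd k * A $ 1 $ 2"
    hence "int N dvd (k * A $ 1 $ 1) * A $ 2 $ 2 - (k * A $ 1 $ 2) * A $ 2 $ 1" by (metis dvd_diff dvd_mult2)
    also have "\<dots> = k * (A $ 1 $ 1 * A $ 2 $ 2 - A $ 1 $ 2 * A $ 2 $ 1)" by (simp add: algebra_simps)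
    also have "\<dots> = k" using A by (simp add: SL2Z_iff)
    finally show False using k by simp
  qed
qed

lemma phi_nonzero: "N > 0 \<Longrightarrow> Im \<tau> > 0 \<Longrightarrow> \<not> int N dvd k \<Longrightarrow> phi N k l \<tau> \<noteq> 0"
  using sg_nonzero[of N \<tau> k l] by (simp add: phi_def)

lemma weak_modular_mult:
  assumes N: "N > 0" and f: "weak_modular N f" and g: "weak_modular N g" shows "weak_modular N (\<lambda>\<tau>. f \<tau> * g \<tau>)"
  unfolding weak_modular_def
proof (intro conjI ballI allI impI)
  show "(\<lambda>\<tau>. f \<tau> * g \<tau>) holomorphic_on upper_half_plane" using f g by (intro holomorphic_on_mult) (auto simp: weak_modular_def)
next
  fix A :: "int ^ 2 ^ 2" assume "A \<in> SL2Z"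
  then obtain F G where "has_q_expansion (2 * N) (\<lambda>\<tau>. f (SL2_act A \<tau>)) F" "has_q_expansion (2 * N) (\<lambda>\<tau>. g (SL2_act A \<tau>)) G"
    using f g unfolding weak_modular_def by blast
  moreover have "2 * N > 0" using N by simp
  ultimately show "\<exists>F. has_q_expansion (2 * N) (\<lambda>\<tau>. f (SL2_act A \<tau>) * g (SL2_act A \<tau>)) F"
    using has_q_expansion_mult by blast
next
  fix A :: "int ^ 2 ^ 2" and \<tau> :: complex assume "A \<in> Gamma_up_1 N" "Im \<tau> > 0"
  thus "f (SL2_act A \<tau>) * g (SL2_act A \<tau>) = f \<tau> * g \<tau>" using f g unfolding weak_modular_def by metis
qed

lemma holomorphic_powi: "f holomorphic_on S \<Longrightarrow> (\<And>z. z \<in> S \<Longrightarrow> f z \<noteq> 0) \<Longrightarrow> (\<lambda>z. f z powi n) holomorphic_on S"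
  unfolding power_int_def by (cases "n \<ge> 0") (auto intro!: holomorphic_intros)

lemma weak_modular_powi:
  assumes "N > 0" "weak_modular N f" "\<And>\<tau>. Im \<tau> > 0 \<Longrightarrow> f \<tau> \<noteq> 0" shows "weak_modular N (\<lambda>\<tau>. f \<tau> powi n)"
  unfolding weak_modular_def
proof (intro conjI ballI allI impI)
  show "(\<lambda>\<tau>. f \<tau> powi n) holomorphic_on upper_half_plane" using assms by (intro holomorphic_powi) (auto simp: weak_modular_def)
next
  fix A :: "int ^ 2 ^ 2" assume "A \<in> SL2Z"
  then obtain F where "has_q_expansion (2 * N) (\<lambda>\<tau>. f (SL2_act A \<tau>)) F" using assms(2) by (auto simp: weak_modular_def)
  hence "has_q_expansion (2 * N) (\<lambda>\<tau>. f (SL2_act A \<tau>) powi n) (F powi n)" using assms(1) by (intro has_q_expansion_power_int) auto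
  thus "\<exists>F. has_q_expansion (2 * N) (\<lambda>\<tau>. f (SL2_act A \<tau>) powi n) F" by blast
qed (use assms in \<open>auto simp: weak_modular_def\<close>)

lemma weak_modular_prod: "N > 0 \<Longrightarrow> (\<And>i. i \<in> I \<Longrightarrow> weak_modular N (f i)) \<Longrightarrow> weak_modular N (\<lambda>\<tau>. \<Prod>i\<in>I. f i \<tau>)"
  by (induction I rule: infinite_finite_induct) (auto intro: weak_modular_mult weak_modular_1)

text \<open>A translate of f depends only on the first row of the matrix modulo N, so there are
  finitely many and the maximum principle applies.\<close>

lemma weak_modular_regular_constant:
  assumes N: "N > 0" and f: "weak_modular N f"
    and reg: "\<And>A F. A \<in> SL2Z \<Longrightarrow> has_q_expansion (2 * N) (\<lambda>\<tau>. f (SL2_act A \<tau>)) F \<Longrightarrow> fls_subdegree F \<ge> 0"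
  obtains c where "\<And>\<tau>. Im \<tau> > 0 \<Longrightarrow> f \<tau> = c"
proof (rule modular_maximum_principle[of "2 * N" f])
  let ?r = "\<lambda>A :: int ^ 2 ^ 2. restrict (\<lambda>\<tau>. f (SL2_act A \<tau>)) upper_half_plane"
  have eq: "?r A = ?r B" if "A \<in> SL2Z" "B \<in> SL2Z" "A $ 1 $ 1 mod int N = B $ 1 $ 1 mod int N" "A $ 1 $ 2 mod int N = B $ 1 $ 2 mod int N" for A B :: "int ^ 2 ^ 2"
    using weak_modular_coset[OF f that(1,2)] that(3,4) by (intro restrict_ext) (simp add: cong_def)
  define key where "key A = (A $ 1 $ 1 mod int N, A $ 1 $ 2 mod int N)" for A :: "int ^ 2 ^ 2"
  have "?r ` SL2Z \<subseteq> (\<lambda>p. ?r (SOME A. A \<in> SL2Z \<and> key A = p)) ` ({0..<int N} \<times> {0..<int N})"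
  proof
    fix g assume "g \<in> ?r ` SL2Z"
    then obtain A where A: "A \<in> SL2Z" "g = ?r A" by blast
    define B where "B = (SOME B. B \<in> SL2Z \<and> key B = key A)"
    have B: "B \<in> SL2Z \<and> key B = key A" unfolding B_def by (rule someI[of _ A]) (simp add: A)
    have "g = ?r B" unfolding A(2) using A B by (intro eq) (auto simp: key_def)
    moreover have "key A \<in> {0..<int N} \<times> {0..<int N}" using N by (simp add: key_def)
    ultimately show "g \<in> (\<lambda>p. ?r (SOME A. A \<in> SL2Z \<and> key A = p)) ` ({0..<int N} \<times> {0..<int N})" unfolding B_def by (rule image_eqI)
  qed
  thus "finite (?r ` SL2Z)" by (rule finite_subset) auto
  fix A :: "int ^ 2 ^ 2" assume A: "A \<in> SL2Z"
  show "f (SL2_act A (\<tau> + of_nat (2 * N))) = f (SL2_act A \<tau>)" if \<tau>: "Im \<tau> > 0" for \<tau>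
  proof -
    have "SL2_act A (\<tau> + of_nat (2 * N)) = SL2_act (A ** mat2 1 (2 * int N) 0 1) \<tau>"
      using SL2_act_mult[OF A translation_SL2Z \<tau>, of "2 * int N"] by (simp add: SL2_act_translation)
    moreover have "f (SL2_act (A ** mat2 1 (2 * int N) 0 1) \<tau>) = f (SL2_act A \<tau>)"
    proof (rule weak_modular_coset[OF f SL2Z_mult[OF A translation_SL2Z] A _ _ \<tau>])
      have "[A $ 1 $ 1 * (2 * int N) + A $ 1 $ 2 = 0 + A $ 1 $ 2] (mod int N)" by (intro cong_add cong_refl) (simp add: cong_0_iff)
      thus "[(A ** mat2 1 (2 * int N) 0 1) $ 1 $ 2 = A $ 1 $ 2] (mod int N)" by (simp add: mat_mult_nth)
    qed (simp add: mat_mult_nth)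
    ultimately show ?thesis by simp
  qed
  show "\<exists>F. has_q_expansion (2 * N) (\<lambda>\<tau>. f (SL2_act A \<tau>)) F \<and> fls_subdegree F \<ge> 0"
    using f A reg by (metis weak_modular_def)
qed (use N f that in \<open>auto simp: weak_modular_def\<close>)

lemma siegel_order_sym:
  assumes N: "N > 0" and ab: "[a = b] (mod int N) \<or> [a = - b] (mod int N)"
  shows "siegel_order (2 * N) (2 * (a mod int N)) = siegel_order (2 * N) (2 * (b mod int N))"
proof -
  have "a mod int N = b mod int N \<or> a mod int N = (- b) mod int N" using ab by (auto simp: cong_def)
  moreover have "siegel_order (2 * N) (2 * ((- b) mod int N)) = siegel_order (2 * N) (2 * (b mod int N))"
  proof (cases "b mod int N = 0")
    case False
    hence *: "(- b) mod int N = int N - b mod int N" by (simp add: zmod_zminus1_eq_if)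
    have M: "2 * N > 0" using N by simp
    show ?thesis unfolding * siegel_order_def[OF M] by (simp add: algebra_simps power2_eq_square)
  qed (simp add: zmod_zminus1_eq_if)
  ultimately show ?thesis by auto
qed

text \<open>Accounts for the \<lfloor>N/2\<rfloor> + 1 classes of upper left entries up to
  sign.\<close>

lemma cusp_representative:
  assumes "N > 0"
  obtains a where "a \<le> N div 2" "[x = int a] (mod int N) \<or> [x = - int a] (mod int N)"
proof (cases "nat (x mod int N) \<le> N div 2")
  case True
  show ?thesis by (rule that[OF True]) (use assms in \<open>simp add: cong_def\<close>)
next
  case False
  define y where "y = x mod int N"
  have y: "0 \<le> y" "y < int N" using assms by (auto simp: y_def)
  define a where "a = nat (int N - y)"
  have "a \<le> N div 2" using False y by (simp add: a_def y_def[symmetric])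
  moreover have "[x = - int a] (mod int N)" using y by (simp add: a_def cong_def) (simp add: y_def mod_diff_right_eq)
  ultimately show ?thesis using that by blast
qed

lemma has_q_expansion_nonzero:
  assumes "has_q_expansion M f F" "M > 0" "\<And>\<tau>. Im \<tau> > 0 \<Longrightarrow> f \<tau> \<noteq> 0"
  shows "F \<noteq> 0"
proof
  assume "F = 0"
  hence "\<forall>\<^sub>F \<tau> in filtercomap Im at_top. f \<tau> = 0" using has_q_expansion_ev[OF assms(1)] by simp
  hence "\<forall>\<^sub>F \<tau> in filtercomap Im at_top. False" using eventually_upper by eventually_elim (use assms(3) in auto)
  moreover have "filtercomap Im at_top \<noteq> bot"
    using filtermap_ex[OF assms(2)] by (metis at_neq_bot filtermap_bot)
  ultimately show False by simp
qed

theorem unit_relation: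
  assumes N: "N > 1" and f: "weak_modular N f" and nz: "\<And>\<tau>. Im \<tau> > 0 \<Longrightarrow> f \<tau> \<noteq> 0"
    and q: "has_q_expansion (2 * N) f F" "fls_over \<rat> F"
  obtains c0 :: int and c :: "nat \<Rightarrow> int" and C where "c0 \<noteq> 0 \<or> (\<exists>k\<in>{1..N div 2}. c k \<noteq> 0)" "C \<noteq> 0"
    "\<And>\<tau>. Im \<tau> > 0 \<Longrightarrow> f \<tau> powi c0 * (\<Prod>k=1..N div 2. phi N (int k) 0 \<tau> powi c k) = C"
proof -
  have N0: "N > 0" and M: "2 * N > 0" using N by auto
  define n where "n = N div 2"
  define G where "G A = (SOME G. has_q_expansion (2 * N) (\<lambda>\<tau>. f (SL2_act A \<tau>)) G)" for A
  have G: "has_q_expansion (2 * N) (\<lambda>\<tau>. f (SL2_act A \<tau>)) (G A)" if "A \<in> SL2Z" for A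
    unfolding G_def by (rule someI_ex) (use f that in \<open>auto simp: weak_modular_def\<close>)
  \<comment> \<open>One matrix with upper left entry a for each class of cusps.\<close>
  define \<gamma> where "\<gamma> a = mat2 (int a) 1 (- 1) 0" for a
  have \<gamma>: "\<gamma> a \<in> SL2Z" for a by (simp add: \<gamma>_def SL2Z_iff)
  define so where "so k a = siegel_order (2 * N) (2 * ((int k * a) mod int N))" for k a
  \<comment> \<open>Index 0 belongs to f, the indices 1 to n to the Siegel functions, and n + 1 to
    the common order: n + 2 unknowns for n + 1 equations.\<close>
  define m where "m a j = (if j = 0 then fls_subdegree (G (\<gamma> a)) else if j \<le> n then so j (int a) else 1)" for a j
  obtain c' where c': "\<exists>j\<in>{..n+1}. c' j \<noteq> 0" "\<And>a. a \<in> {..n} \<Longrightarrow> (\<Sum>j\<in>{..n+1}. c' j * m a j) = 0"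
    by (rule int_linear_system[of "{..n}" "{..n+1}" m]) auto
  \<comment> \<open>The overall sign makes the common order \<open>- c (n + 1)\<close> nonnegative,
    so that the product is regular at every cusp.\<close>
  define c where "c j = (if c' (n + 1) > 0 then - c' j else c' j)" for j
  have c: "\<exists>j\<in>{..n+1}. c j \<noteq> 0" "c (n + 1) \<le> 0" using c'(1) by (auto simp: c_def)
  have ceq: "c 0 * fls_subdegree (G (\<gamma> a)) + (\<Sum>k=1..n. c k * so k (int a)) = - c (n + 1)" if "a \<le> n" for a
  proof -
    have "(\<Sum>j\<in>{..n+1}. c j * m a j) = (if c' (n + 1) > 0 then - 1 else 1) * (\<Sum>j\<in>{..n+1}. c' j * m a j)"
      unfolding sum_distrib_left by (intro sum.cong) (auto simp: c_def)
    also have "\<dots> = 0" using c'(2)[of a] that by simp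
    also have "{..n+1} = insert 0 (insert (n + 1) {1..n})" by auto
    finally have "c 0 * m a 0 + (c (n + 1) * m a (n + 1) + (\<Sum>k=1..n. c k * m a k)) = 0" by simp
    moreover have "(\<Sum>k=1..n. c k * m a k) = (\<Sum>k=1..n. c k * so k (int a))" by (intro sum.cong) (auto simp: m_def)
    ultimately show ?thesis by (simp add: m_def)
  qed
  \<comment> \<open>If the exponents were all 0, the equations would force the common order to be 0
    as well.\<close>
  have nontriv: "c 0 \<noteq> 0 \<or> (\<exists>k\<in>{1..n}. c k \<noteq> 0)"
  proof (rule ccontr)
    assume *: "\<not> ?thesis"
    hence "c (n + 1) = 0" using ceq[of 0] by simp
    moreover obtain j where "j \<le> n + 1" "c j \<noteq> 0" using c(1) by auto
    moreover have "j = 0 \<or> j = n + 1 \<or> j \<in> {1..n}" using \<open>j \<le> n + 1\<close> by auto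
    ultimately show False using * by auto
  qed
  have kd: "\<not> int N dvd int k" if "k \<in> {1..n}" for k
    using that N by (auto simp: n_def dest!: dvd_imp_le)
  define \<Psi> where "\<Psi> \<tau> = f \<tau> powi c 0 * (\<Prod>k=1..n. phi N (int k) 0 \<tau> powi c k)" for \<tau>
  have h\<Psi>: "weak_modular N \<Psi>" unfolding \<Psi>_def[abs_def]
    by (intro weak_modular_mult weak_modular_prod weak_modular_powi weak_modular_phi f N0 nz phi_nonzero kd) auto
  have reg: "fls_subdegree P \<ge> 0" if A: "A \<in> SL2Z" and P: "has_q_expansion (2 * N) (\<lambda>\<tau>. \<Psi> (SL2_act A \<tau>)) P" for A P
  proof -
    have "\<exists>G. has_q_expansion (2 * N) (\<lambda>\<tau>. phi N (int k) 0 (SL2_act A \<tau>)) G" for k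
      using weak_modular_phi[OF N0, of "int k"] A by (auto simp: weak_modular_def)
    then obtain H where H: "\<And>k. has_q_expansion (2 * N) (\<lambda>\<tau>. phi N (int k) 0 (SL2_act A \<tau>)) (H k)" by metis
    have "has_q_expansion (2 * N) (\<lambda>\<tau>. \<Psi> (SL2_act A \<tau>)) (G A powi c 0 * (\<Prod>k=1..n. H k powi c k))"
      unfolding \<Psi>_def by (intro has_q_expansion_mult has_q_expansion_prod has_q_expansion_power_int M H G A)
    hence P: "P = G A powi c 0 * (\<Prod>k=1..n. H k powi c k)" using P has_q_expansion_unique[OF M] by blast
    have G0: "G A \<noteq> 0" by (rule has_q_expansion_nonzero[OF G[OF A] M]) (use nz Im_SL2_act[OF A] in auto)
    have H0: "H k \<noteq> 0" if "k \<in> {1..n}" for k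
      by (rule has_q_expansion_nonzero[OF H M]) (use phi_nonzero[OF N0 Im_SL2_act[OF A] kd[OF that]] in auto)
    obtain a where a: "a \<le> n" "[A $ 1 $ 1 = int a] (mod int N) \<or> [A $ 1 $ 1 = - int a] (mod int N)"
      using cusp_representative[OF N0, of "A $ 1 $ 1"] unfolding n_def by blast
    have "fls_subdegree P = c 0 * fls_subdegree (G A) + (\<Sum>k=1..n. c k * fls_subdegree (H k))"
    proof -
      have H1: "H k powi c k \<noteq> 0" if "k \<in> {1..n}" for k using H0[OF that] by simp
      hence "(\<Prod>k=1..n. H k powi c k) \<noteq> 0" by (simp add: prod_zero_iff)
      thus ?thesis unfolding P using G0 fls_subdegree_prod[of "{1..n}" "\<lambda>k. H k powi c k", OF H1] by (subst fls_subdegree_mult) auto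
    qed
    also have "fls_subdegree (G A) = fls_subdegree (G (\<gamma> a))"
      by (rule weak_modular_cusp_order'[OF N f q A G[OF A] \<gamma> G[OF \<gamma>]]) (use a in \<open>simp add: \<gamma>_def\<close>)
    also have "(\<Sum>k=1..n. c k * fls_subdegree (H k)) = (\<Sum>k=1..n. c k * so k (int a))"
    proof (intro sum.cong refl arg_cong2[of _ _ _ _ "(*)"])
      fix k assume k: "k \<in> {1..n}"
      have "fls_subdegree (H k) = siegel_order (2 * N) (2 * ((int k * A $ 1 $ 1) mod int N))"
        by (rule phi_SL2_subdegree[OF N A kd[OF k] H])
      also have "\<dots> = so k (int a)" unfolding so_def
      proof (rule siegel_order_sym[OF N0])
        show "[int k * A $ 1 $ 1 = int k * int a] (mod int N) \<or> [int k * A $ 1 $ 1 = - (int k * int a)] (mod int N)"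
          using a(2) cong_mult[OF cong_refl[of "int k" "int N"], of "A $ 1 $ 1" "int a"] cong_mult[OF cong_refl[of "int k" "int N"], of "A $ 1 $ 1" "- int a"] by auto
      qed
      finally show "fls_subdegree (H k) = so k (int a)" .
    qed
    finally show ?thesis using ceq[OF a(1)] c(2) by simp
  qed
  have "\<exists>C. \<forall>\<tau>. Im \<tau> > 0 \<longrightarrow> \<Psi> \<tau> = C" by (rule weak_modular_regular_constant[OF N0 h\<Psi> reg]) blast+
  then obtain C where C: "\<And>\<tau>. Im \<tau> > 0 \<Longrightarrow> \<Psi> \<tau> = C" by blast
  have i: "Im \<i> > 0" by simp
  have "phi N (int k) 0 \<i> \<noteq> 0" if "k \<in> {1..n}" for k by (rule phi_nonzero[OF N0 i kd[OF that]])
  hence "(\<Prod>k=1..n. phi N (int k) 0 \<i> powi c k) \<noteq> 0" unfolding prod_zero_iff[OF finite_atLeastAtMost] by simp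
  hence "\<Psi> \<i> \<noteq> 0" using nz[OF i] unfolding \<Psi>_def by simp
  hence C0: "C \<noteq> 0" using C[OF i] by simp
  show ?thesis
    by (rule that[OF nontriv[unfolded n_def] C0]) (use C in \<open>simp only: \<Psi>_def n_def\<close>)
qed

section \<open>Principal units among the Laurent series\<close>

text \<open>The principal units of \<int>[[x]], placed in the field of Laurent series so that
  integer powers and inverses are available.\<close>

definition integral_unit :: "complex fls \<Rightarrow> bool" where
  "integral_unit F \<longleftrightarrow> (\<exists>P. fps_over \<int> P \<and> fps_nth P 0 = 1 \<and> F = fps_to_fls P)"

text \<open>F = 1 + c x^r + higher terms, where c = 0 is allowed. For fixed r > 0 the map from F to
  c is then a homomorphism from multiplication to addition.\<close>

definition unit_lead :: "nat \<Rightarrow> complex \<Rightarrow> complex fls \<Rightarrow> bool" where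
  "unit_lead r c F \<longleftrightarrow> (\<exists>A. F = fps_to_fls (1 + fps_X ^ r * A) \<and> fps_nth A 0 = c)"

lemma integral_unit_1: "integral_unit 1"
  unfolding integral_unit_def using fps_over_1 by (intro exI[of _ 1]) auto

lemma integral_unit_mult: "integral_unit F \<Longrightarrow> integral_unit G \<Longrightarrow> integral_unit (F * G)"
  unfolding integral_unit_def by (metis fls_times_fps_to_fls fps_mult_nth_0 fps_over_mult mult_1)

lemma integral_unit_inverse: "integral_unit F \<Longrightarrow> integral_unit (inverse F)"
proof -
  assume "integral_unit F"
  then obtain P where P: "fps_over \<int> P" "fps_nth P 0 = 1" "F = fps_to_fls P" by (auto simp: integral_unit_def)
  have "inverse F = fps_to_fls (inverse P)" using P by (simp add: fls_inverse_fps_to_fls)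
  thus ?thesis unfolding integral_unit_def using P fps_over_inverse[OF P(1,2)] by (intro exI[of _ "inverse P"]) auto
qed

lemma integral_unit_power: "integral_unit F \<Longrightarrow> integral_unit (F ^ n)"
  by (induction n) (auto intro: integral_unit_1 integral_unit_mult)

lemma integral_unit_powi: "integral_unit F \<Longrightarrow> integral_unit (F powi n)"
  unfolding power_int_def by (auto intro: integral_unit_power integral_unit_inverse)

lemma integral_unit_prod: "(\<And>i. i \<in> I \<Longrightarrow> integral_unit (F i)) \<Longrightarrow> integral_unit (\<Prod>i\<in>I. F i)"
  by (induction I rule: infinite_finite_induct) (auto intro: integral_unit_1 integral_unit_mult)

lemma unit_lead_1: "unit_lead r 0 1"
  unfolding unit_lead_def by (intro exI[of _ 0]) simp

lemma unit_lead_mult: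
  assumes "unit_lead r c F" "unit_lead r d G" "r > 0" shows "unit_lead r (c + d) (F * G)"
proof -
  obtain A B where A: "F = fps_to_fls (1 + fps_X ^ r * A)" "fps_nth A 0 = c" and B: "G = fps_to_fls (1 + fps_X ^ r * B)" "fps_nth B 0 = d"
    using assms by (auto simp: unit_lead_def)
  have "F * G = fps_to_fls (1 + fps_X ^ r * (A + B + fps_X ^ r * A * B))"
    unfolding A B fls_times_fps_to_fls[symmetric] by (simp add: algebra_simps)
  thus ?thesis unfolding unit_lead_def using A B assms(3) by (intro exI[of _ "A + B + fps_X ^ r * A * B"]) (auto simp: power_0_left)
qed

lemma unit_lead_inverse:
  assumes "unit_lead r c F" "r > 0" shows "unit_lead r (- c) (inverse F)"
proof -
  obtain A where A: "F = fps_to_fls (1 + fps_X ^ r * A)" "fps_nth A 0 = c" using assms by (auto simp: unit_lead_def)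
  define P where "P = 1 + fps_X ^ r * A"
  have P0: "fps_nth P 0 = 1" using assms(2) by (simp add: P_def power_0_left)
  have inv: "inverse F = fps_to_fls (inverse P)" unfolding A(1) P_def[symmetric] using P0 by (simp add: fls_inverse_fps_to_fls)
  have "P * inverse P = 1" using P0 by (simp add: inverse_mult_eq_1')
  hence "inverse P = 1 + fps_X ^ r * (- A * inverse P)" by (simp add: P_def algebra_simps)
  thus ?thesis unfolding unit_lead_def inv using A P0 by (intro exI[of _ "- A * inverse P"]) auto
qed

lemma unit_lead_power: "unit_lead r c F \<Longrightarrow> r > 0 \<Longrightarrow> unit_lead r (of_nat n * c) (F ^ n)"
proof (induction n)
  case 0 thus ?case using unit_lead_1 by simp
next
  case (Suc n) thus ?case using unit_lead_mult[OF Suc.prems(1) Suc.IH[OF Suc.prems]] by (simp add: algebra_simps)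
qed

lemma unit_lead_powi: "unit_lead r c F \<Longrightarrow> r > 0 \<Longrightarrow> unit_lead r (of_int n * c) (F powi n)"
  using unit_lead_power[of r c F "nat n"] unit_lead_power[OF unit_lead_inverse, of r c F "nat (- n)"]
  by (auto simp: power_int_def)

lemma unit_lead_prod:
  "r > 0 \<Longrightarrow> (\<And>i. i \<in> I \<Longrightarrow> unit_lead r (c i) (F i)) \<Longrightarrow> unit_lead r (\<Sum>i\<in>I. c i) (\<Prod>i\<in>I. F i)"
  by (induction I rule: infinite_finite_induct) (auto intro: unit_lead_1 unit_lead_mult)

lemma unit_lead_weaken: assumes "unit_lead r c F" "r' < r" shows "unit_lead r' 0 F"
proof -
  obtain A where A: "F = fps_to_fls (1 + fps_X ^ r * A)" "fps_nth A 0 = c" using assms by (auto simp: unit_lead_def)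
  have "fps_X ^ r = fps_X ^ r' * (fps_X ^ (r - r') :: complex fps)" using assms(2) by (simp flip: power_add)
  thus ?thesis unfolding unit_lead_def A using assms(2)
    by (intro exI[of _ "fps_X ^ (r - r') * A"]) (auto simp: mult.assoc power_0_left)
qed

lemma unit_lead_unique: assumes "unit_lead r c F" "unit_lead r d F" shows "c = d"
proof -
  obtain A where A: "F = fps_to_fls (1 + fps_X ^ r * A)" "fps_nth A 0 = c" using assms(1) unfolding unit_lead_def by blast
  obtain B where B: "F = fps_to_fls (1 + fps_X ^ r * B)" "fps_nth B 0 = d" using assms(2) unfolding unit_lead_def by blast
  have "fps_to_fls (1 + fps_X ^ r * A) = fps_to_fls (1 + fps_X ^ r * B)" using A(1) B(1) by (rule subst)
  hence "1 + fps_X ^ r * A = 1 + fps_X ^ r * B" by (simp only: fps_to_fls_eq_iff)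
  hence "A = B" by simp
  thus ?thesis using A B by simp
qed

lemma leadI:
  assumes "fps_nth P 0 = 1" "\<And>j. 0 < j \<Longrightarrow> j < r \<Longrightarrow> fps_nth P j = 0" "fps_nth P r = c" "r > 0"
  shows "unit_lead r c (fps_to_fls P)"
proof -
  have "P = 1 + fps_X ^ r * fps_shift r P"
    by (rule fps_ext) (use assms in \<open>auto simp: fps_X_power_mult_nth\<close>)
  thus ?thesis unfolding unit_lead_def using assms by (intro exI[of _ "fps_shift r P"]) auto
qed

lemma unit_lead_nontrivial:
  assumes "fps_nth P 0 = 1" "fps_to_fls P \<noteq> 1"
  obtains r c where "unit_lead r c (fps_to_fls P)" "r > 0" "c \<noteq> 0" "c = fps_nth P r"
proof -
  define r where "r = subdegree (P - 1)"
  have ne: "P - 1 \<noteq> 0" using assms(2) by auto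
  have r0: "r > 0" using assms(1) ne unfolding r_def by (metis fps_one_nth fps_sub_nth diff_self gr0I nth_subdegree_nonzero)
  have "fps_nth P j = 0" if "0 < j" "j < r" for j
    using nth_less_subdegree_zero[of j "P - 1"] that by (simp add: r_def)
  moreover have "fps_nth P r \<noteq> 0" using nth_subdegree_nonzero[OF ne] r0 by (simp add: r_def)
  ultimately show ?thesis using that[of r "fps_nth P r"] leadI[OF assms(1)] r0 by blast
qed

text \<open>Comparing the first nontrivial coefficients on both sides, after dividing by the \<open>d\<close>-th power
  of the earlier factors.\<close>

lemma principal_unit_exponents:
  fixes E m :: "nat \<Rightarrow> int" and r :: "nat \<Rightarrow> nat"
  assumes G: "\<And>k. k \<in> {1..n} \<Longrightarrow> integral_unit (G k)" "\<And>k. k \<in> {1..n} \<Longrightarrow> unit_lead (r k) (- of_int (m k)) (G k)"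
    and r: "\<And>j k. 1 \<le> j \<Longrightarrow> j < k \<Longrightarrow> k \<le> n \<Longrightarrow> r j < r k" "\<And>k. k \<in> {1..n} \<Longrightarrow> r k > 0"
    and g: "integral_unit g" "(\<Prod>k=1..n. G k powi E k) = g ^ d" and d: "d > 0"
    and k: "k \<in> {1..n}" "\<And>j. 1 \<le> j \<Longrightarrow> j < k \<Longrightarrow> int d dvd E j"
  shows "int d dvd m k * E k"
proof -
  have G0: "G j \<noteq> 0" if "j \<in> {1..n}" for j using G(1)[OF that] by (auto simp: integral_unit_def)
  \<comment> \<open>\<open>h\<close> is \<open>g\<close> divided by the factors of index below k,
    whose exponents are already multiples of d; its d-th power starts with the k-th factor.\<close>
  define h where "h = g * (\<Prod>j=1..<k. G j powi (- (E j div int d)))"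
  have kn: "{1..n} = {1..<k} \<union> {k..n}" "{1..<k} \<inter> {k..n} = {}" using k(1) by auto
  have "h ^ d = g ^ d * (\<Prod>j=1..<k. G j powi (- E j))"
  proof -
    have "(G j powi (- (E j div int d))) ^ d = G j powi (- E j)" if "j \<in> {1..<k}" for j
    proof -
      have "E j div int d * int d = E j" using k(2)[of j] that by simp
      thus ?thesis by (simp add: power_int_mult[symmetric] flip: power_int_of_nat)
    qed
    thus ?thesis unfolding h_def power_mult_distrib prod_power_distrib by simp
  qed
  also have "\<dots> = (\<Prod>j=1..<k. G j powi E j * G j powi (- E j)) * (\<Prod>j=k..n. G j powi E j)"
    unfolding g(2)[symmetric] kn(1) by (subst prod.union_disjoint) (use kn in \<open>auto simp: prod.distrib mult_ac\<close>)
  also have "(\<Prod>j=1..<k. G j powi E j * G j powi (- E j)) = (\<Prod>j=1..<k. 1)"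
    by (intro prod.cong) (use G0 k(1) in \<open>auto simp: power_int_minus\<close>)
  also have "{k..n} = insert k {k<..n}" using k(1) by auto
  finally have hd: "h ^ d = G k powi E k * (\<Prod>j\<in>{k<..n}. G j powi E j)" by simp
  have ih: "integral_unit h" unfolding h_def by (intro integral_unit_mult g integral_unit_prod integral_unit_powi G) (use k(1) in auto)
  have rk: "r k > 0" using r k by blast
  have "unit_lead (r k) 0 (G j powi E j)" if "j \<in> {k<..n}" for j
    using unit_lead_powi[OF unit_lead_weaken[OF G(2)[of j]], of "r k" "E j"] r(1)[of k j] that k(1) rk by auto
  hence "unit_lead (r k) (of_int (E k) * (- of_int (m k)) + (\<Sum>j\<in>{k<..n}. 0)) (h ^ d)"
    unfolding hd by (intro unit_lead_mult unit_lead_powi unit_lead_prod G k rk)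
  hence L: "unit_lead (r k) (- of_int (m k * E k)) (h ^ d)" by (simp add: mult.commute)
  show ?thesis
  proof (cases "h = 1")
    case True
    hence "unit_lead (r k) 0 (h ^ d)" using unit_lead_1 by simp
    from unit_lead_unique[OF L this] have "- of_int (m k * E k) = (0 :: complex)" .
    hence "m k * E k = 0" by (metis neg_0_equal_iff_equal of_int_0 of_int_eq_iff minus_equation_iff)
    thus ?thesis by (simp only: dvd_0_right)
  next
    case False
    obtain P where P: "fps_over \<int> P" "fps_nth P 0 = 1" "h = fps_to_fls P" using ih by (auto simp: integral_unit_def)
    obtain s c where sc: "unit_lead s c h" "s > 0" "c \<noteq> 0" "c = fps_nth P s" using unit_lead_nontrivial[OF P(2)] False P(3) by blast
    have L2: "unit_lead s (of_nat d * c) (h ^ d)" by (rule unit_lead_power[OF sc(1,2)])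
    \<comment> \<open>As d c \<noteq> 0, the first nontrivial degree s of \<open>h\<close> cannot
      lie below \<open>r k\<close>. If it lies above, \<open>m k * E k\<close> is 0; if it equals
      \<open>r k\<close>, this number is d times an integer.\<close>
    consider "s < r k" | "s > r k" | "s = r k" by linarith
    thus ?thesis
    proof cases
      case 1
      from unit_lead_unique[OF L2 unit_lead_weaken[OF L this]] have "of_nat d * c = 0" .
      thus ?thesis using d sc by simp
    next
      case 2
      from unit_lead_unique[OF L unit_lead_weaken[OF L2 this]] have "- of_int (m k * E k) = (0 :: complex)" .
      hence "m k * E k = 0" by (metis neg_0_equal_iff_equal of_int_0 of_int_eq_iff minus_equation_iff)
      thus ?thesis by (simp only: dvd_0_right)
    next
      case 3
      obtain z where z: "c = of_int z" using P(1) sc(4) by (auto simp: fps_over_def Ints_def)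
      have "- of_int (m k * E k) = (of_nat d * c :: complex)" using unit_lead_unique[OF L] L2 3 by blast
      hence "of_int (m k * E k) = (of_int (int d * (- z)) :: complex)" unfolding z by (simp add: minus_equation_iff)
      hence "m k * E k = int d * (- z)" using of_int_eq_iff by blast
      thus ?thesis by simp
    qed
  qed
qed

text \<open>U has order 0 and constant term 1, so comparing orders and then leading coefficients
  separates the three factors.\<close>

lemma unit_lead_const:
  assumes "unit_lead 1 c U" "p \<noteq> 0" "fls_const p * fls_X_intpow a * U = fls_const q"
  shows "U = 1" "p = q" "a = 0"
proof -
  obtain A where A: "U = fps_to_fls (1 + fps_X * A)" using assms(1) by (auto simp: unit_lead_def)
  have U0: "fls_nth U 0 = 1" by (simp add: A)
  have sU: "fls_subdegree U = 0" by (rule fls_subdegree_eqI) (auto simp: A)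
  have Un: "U \<noteq> 0" using U0 by auto
  have pa: "fls_const p * fls_X_intpow a \<noteq> 0" using assms(2) by (simp add: fls_shift_eq0_iff fls_const_nonzero)
  have "fls_subdegree (fls_const p * fls_X_intpow a * U) = a"
    using Un pa assms(2) sU by (simp add: fls_X_intpow_times_conv_shift(2) fls_shift_eq0_iff fls_const_nonzero)
  thus a: "a = 0" using assms(3) by simp
  have "fls_const p * U = fls_const q" using assms(3) a by simp
  hence "fls_nth (fls_const p * U) 0 = fls_nth (fls_const q) 0" by simp
  thus pq: "p = q" using U0 by simp
  have "fls_const p * U = fls_const p * 1" using \<open>fls_const p * U = fls_const q\<close> pq by simp
  thus "U = 1" using assms(2) by (metis fls_const_nonzero mult_cancel_left)
qed

text \<open>P^d is integral and A clears the denominators of P, so A^d clears those of P^r for r <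
  d, and hence of every power of P.\<close>

lemma fps_integral_root:
  assumes A: "fps_over \<int> A" "A \<noteq> 0" "fps_over \<int> (A * P)" and P: "fps_over \<rat> P" "fps_over \<int> (P ^ d)" and d: "d > 0"
  shows "fps_over \<int> P"
proof (rule fps_completely_integrally_closed[OF fps_over_power[OF A(1), of d] _ P(1)])
  fix n
  define r where "r = n mod d"
  have r: "r < d" using d by (simp add: r_def)
  have "P ^ n = (P ^ d) ^ (n div d) * P ^ r" unfolding r_def power_mult[symmetric] power_add[symmetric] by simp
  moreover have "A ^ d = A ^ (d - r) * A ^ r" using r by (simp flip: power_add)
  ultimately have "A ^ d * P ^ n = (P ^ d) ^ (n div d) * (A ^ (d - r) * (A * P) ^ r)" by (simp add: power_mult_distrib mult_ac)
  also have "fps_over \<int> \<dots>" by (intro fps_over_mult fps_over_power A P)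
  finally show "fps_over \<int> (A ^ d * P ^ n)" .
qed (use A in simp)

section \<open>Expansions of products of Siegel functions\<close>

text \<open>The expansion for w = 1, that is for the characteristic (k/M, 0), without the constant
  and the leading power of the parameter.\<close>

definition sser :: "nat \<Rightarrow> nat \<Rightarrow> complex fls" where
  "sser M k = fps_to_fls (siegel_series M k 1)"

lemma sser_integral_unit: "M > 0 \<Longrightarrow> 0 < k \<Longrightarrow> k < M \<Longrightarrow> integral_unit (sser M k)"
  unfolding integral_unit_def sser_def using siegel_series_Ints[of M 1 k] siegel_series_0[of M k 1] by auto

lemma qseries_unit_lead: "M > 0 \<Longrightarrow> a > 0 \<Longrightarrow> unit_lead a (- 1) (fps_to_fls (qseries M 1 a))"
  by (rule leadI) (auto simp: qseries_low qseries_0)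

text \<open>The two products start with 1 - x^k and 1 - x^(M-k). For 2 k = M they coincide, which is
  the origin of the exceptional factor 2.\<close>

lemma sser_unit_lead:
  assumes "0 < k" "2 * k \<le> M"
  shows "unit_lead k (- of_int (if 2 * k = M then 2 else 1)) (sser M k)"
proof -
  have M: "M > 0" "M - k > 0" using assms by auto
  have eq: "sser M k = fps_to_fls (qseries M 1 k) * fps_to_fls (qseries M 1 (M - k))"
    unfolding sser_def siegel_series_def[OF M(1)] by (simp add: fls_times_fps_to_fls)
  show ?thesis
  proof (cases "2 * k = M")
    case True
    hence "M - k = k" by auto
    thus ?thesis using unit_lead_mult[OF qseries_unit_lead[OF M(1) assms(1)] qseries_unit_lead[OF M(1) assms(1)] assms(1)] True by (simp add: eq)
  next
    case False
    hence "unit_lead k 0 (fps_to_fls (qseries M 1 (M - k)))" using assms by (intro unit_lead_weaken[OF qseries_unit_lead[OF M]]) auto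
    thus ?thesis using unit_lead_mult[OF qseries_unit_lead[OF M(1) assms(1)] _ assms(1)] False by (fastforce simp: eq)
  qed
qed

text \<open>A product equal to 1 is a d-th power for every d, so
  \<open>principal_unit_exponents\<close> with g = 1 makes \<open>m k * E k\<close> divisible by
  every d > 0; the choice d = 2 |E k| + 1 exceeds its absolute value. The scaling c serves the
  levels N and 2 N at once.\<close>

lemma sser_independent:
  fixes E :: "nat \<Rightarrow> int"
  assumes c: "c > 0" and eq: "(\<Prod>k=1..N div 2. sser (c * N) (c * k) powi E k) = 1" and k: "k \<in> {1..N div 2}"
  shows "E k = 0"
  using k
proof (induction k rule: less_induct)
  case (less k)
  define m where "m k = (if 2 * (c * k) = c * N then 2 else 1 :: int)" for k
  define d where "d = nat (2 * \<bar>E k\<bar> + 1)"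
  have d: "d > 0" "int d = 2 * \<bar>E k\<bar> + 1" by (auto simp: d_def)
  have le: "2 * (c * k) \<le> c * N" if "k \<in> {1..N div 2}" for k
    using mult_le_mono2[of "2 * k" N c] that by (auto simp: mult_ac)
  have lt: "c * k < c * N" if "k \<in> {1..N div 2}" for k using that c by auto
  have "int d dvd m k * E k"
  proof (rule principal_unit_exponents[of "N div 2" "\<lambda>k. sser (c * N) (c * k)" "\<lambda>k. c * k" m 1 E d k])
    fix k assume k: "k \<in> {1..N div 2}"
    show "integral_unit (sser (c * N) (c * k))" using lt[OF k] k c by (intro sser_integral_unit) auto
    show "unit_lead (c * k) (- of_int (m k)) (sser (c * N) (c * k))" unfolding m_def using le[OF k] k c by (intro sser_unit_lead) auto
  next
    fix j assume "1 \<le> j" "j < k"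
    thus "int d dvd E j" using less by auto
  qed (use c less.prems eq d integral_unit_1 in auto)
  moreover have "\<bar>m k * E k\<bar> < int d" using d(2) by (auto simp: m_def abs_mult)
  ultimately have "m k * E k = 0" by (metis abs_0 abs_of_nonneg dvd_imp_le_int not_le of_nat_0_le_iff)
  thus ?case by (auto simp: m_def split: if_splits)
qed

section \<open>Every modular unit is a product of Siegel functions\<close>

lemma prod_powi: "a \<noteq> 0 \<Longrightarrow> (\<Prod>k\<in>I. a powi x k) = (a :: 'a :: field) powi (\<Sum>k\<in>I. x k)"
  by (induction I rule: infinite_finite_induct) (auto simp: power_int_add)

lemma ex_powi: "ex z powi n = ex (of_int n * z)"
  unfolding power_int_def by (auto simp: ex_of_nat_mult[symmetric] ex_uminus[symmetric])

lemma ex_sum: "(\<Prod>k\<in>I. ex (x k)) = ex (\<Sum>k\<in>I. x k)"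
  by (induction I rule: infinite_finite_induct) (auto simp: ex_add)

lemma galois_family_Ints: "galois_family Q \<Longrightarrow> w \<in> \<int> \<Longrightarrow> fls_over \<int> (Q w)"
proof -
  assume "galois_family Q" and w: "w \<in> \<int>"
  then obtain m R where R: "\<And>w. Q w = fls_shift m (fps_to_fls (R w))" "\<And>j. (\<lambda>w. fps_nth (R w) j) \<in> zpol" unfolding galois_family_def by metis
  have "fps_over \<int> (R w)" unfolding fps_over_def using zpol_Ints[OF R(2) w] by blast
  thus ?thesis unfolding R(1) by (simp add: fls_over_fps_to_fls)
qed

lemma constant_power:
  assumes "connected S" "g holomorphic_on S" "\<And>z. z \<in> S \<Longrightarrow> g z ^ d = (C :: complex)" "d > 0"
  obtains c where "\<And>z. z \<in> S \<Longrightarrow> g z = c"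
proof -
  have "g ` S \<subseteq> {z. z ^ d = C}" using assms(3) by auto
  hence "finite (g ` S)" by (rule finite_subset) (use assms(4) in auto)
  hence "g constant_on S" by (intro continuous_finite_range_constant assms(1) holomorphic_on_imp_continuous_on assms(2))
  thus ?thesis using that unfolding constant_on_def by blast
qed

lemma not_dvd_half: "N > 1 \<Longrightarrow> k \<in> {1..N div 2} \<Longrightarrow> \<not> int N dvd int k"
  by (auto dest!: dvd_imp_le)

text \<open>On expansions at \<infinity> constants and powers of the parameter split off from the
  multiplicative relation, which leaves an identity between principal units. The exponent of f in it
  is nonzero because the Siegel series are independent, and integrality of the normalised expansion
  of f gives the divisibility of the exponents.\<close>

theorem unit_power:
  assumes N: "N > 1" and f: "weak_modular N f" and nz: "\<And>\<tau>. Im \<tau> > 0 \<Longrightarrow> f \<tau> \<noteq> 0"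
    and q: "has_q_expansion (2 * N) f F" "fls_over \<rat> F"
  obtains d C and E :: "nat \<Rightarrow> int" where "d > 0" "C \<noteq> 0"
    "\<And>\<tau>. Im \<tau> > 0 \<Longrightarrow> f \<tau> ^ d = C * (\<Prod>k=1..N div 2. sg N (int k) 0 \<tau> powi E k)"
    "\<And>k. k \<in> {1..N div 2} \<Longrightarrow> int d dvd (if 2 * k = N then 2 else 1) * E k"
proof -
  have N0: "N > 0" and M: "2 * N > 0" using N by auto
  define n where "n = N div 2"
  obtain c0 :: int and c :: "nat \<Rightarrow> int" and C where cC: "c0 \<noteq> 0 \<or> (\<exists>k\<in>{1..n}. c k \<noteq> 0)" "C \<noteq> 0"
    "\<And>\<tau>. Im \<tau> > 0 \<Longrightarrow> f \<tau> powi c0 * (\<Prod>k=1..n. phi N (int k) 0 \<tau> powi c k) = C"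
    using unit_relation[OF N f nz q] unfolding n_def by blast
  have F0: "F \<noteq> 0" by (rule has_q_expansion_nonzero[OF q(1) M nz])
  define s where "s = fls_subdegree F"
  define p0 where "p0 = fls_nth F s"
  have p0: "p0 \<noteq> 0" "p0 \<in> \<rat>" using F0 q(2) by (auto simp: p0_def s_def fls_over_def)
  obtain P where P: "F = fls_shift (- s) (fps_to_fls P)" "fps_over \<rat> P"
    using fls_over_obtain_fps[OF q(2), of "- s"] by (auto simp: s_def)
  have Pnth: "fps_nth P 0 = p0" by (simp add: p0_def P(1))
  define P1 where "P1 = fps_const (inverse p0) * P"
  have P1: "fps_over \<rat> P1" "fps_nth P1 0 = 1" using P(2) p0 Pnth by (auto simp: P1_def fps_over_def)
  define f1 where "f1 = fps_to_fls P1"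
  have "P = fps_const p0 * P1" using p0 by (simp add: P1_def mult.assoc[symmetric] fps_const_mult[symmetric] del: fps_const_mult)
  hence F: "F = fls_const p0 * fls_X powi s * f1"
    by (simp add: P(1) f1_def fls_times_fps_to_fls fls_X_intpow_times_conv_shift fls_shifted_times_simps)
  define S where "S k = sser (2 * N) (2 * k)" for k
  have Sipr: "integral_unit (S k)" if "k \<in> {1..n}" for k unfolding S_def using that N by (intro sser_integral_unit) (auto simp: n_def)
  define m where "m k = (if 2 * k = N then 2 else 1 :: int)" for k
  have Slead: "unit_lead (2 * k) (- of_int (m k)) (S k)" if "k \<in> {1..n}" for k
    using sser_unit_lead[of "2 * k" "2 * N"] that by (auto simp: S_def m_def n_def)
  have S0: "S k \<noteq> 0" if "k \<in> {1..n}" for k using Sipr[OF that] by (auto simp: integral_unit_def)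
  have f10: "f1 \<noteq> 0" using P1(2) by (auto simp: f1_def)
  define od where "od k = siegel_order (2 * N) (2 * int k)" for k
  have ph: "phi_series N k 1 = fls_X powi od k * S k ^ (24 * N)" for k
    by (simp add: phi_series_def S_def sser_def od_def fls_X_intpow_times_conv_shift fps_to_fls_power)
  define W where "W = (\<Prod>k=1..n. S k powi (int (24 * N) * c k))"
  have "has_q_expansion (2 * N) (\<lambda>\<tau>. f \<tau> powi c0 * (\<Prod>k=1..n. phi N (int k) 0 \<tau> powi c k))
      (F powi c0 * (\<Prod>k=1..n. phi_series N k (ex (of_int 0 / of_nat N)) powi c k))"
    by (intro has_q_expansion_mult has_q_expansion_prod has_q_expansion_power_int phi_q_expansion M N0 q) (use N in \<open>auto simp: n_def\<close>)
  from has_q_expansion_cong'[OF cC(3) this]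
  have "F powi c0 * (\<Prod>k=1..n. phi_series N k 1 powi c k) = fls_const C"
    using has_q_expansion_unique[OF M _ has_q_expansion_const[OF M, of C]] by simp
  also have "(\<Prod>k=1..n. phi_series N k 1 powi c k) = (\<Prod>k=1..n. fls_X powi (od k * c k) * S k powi (int (24 * N) * c k))"
    unfolding ph by (intro prod.cong refl) (simp only: power_int_mult_distrib power_int_mult power_int_of_nat)
  also have "\<dots> = fls_X powi (\<Sum>k=1..n. od k * c k) * W" unfolding prod.distrib W_def by (subst prod_powi) auto
  also have "F powi c0 = fls_const (p0 powi c0) * fls_X powi (s * c0) * f1 powi c0"
    unfolding F by (simp add: power_int_mult_distrib power_int_mult fls_const_power_int del: fls_X_power_int)
  finally have "fls_const (p0 powi c0) * (fls_X powi (s * c0) * fls_X powi (\<Sum>k=1..n. od k * c k)) * (f1 powi c0 * W) = fls_const C"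
    by (simp only: mult_ac)
  also have "(fls_X powi (s * c0) * fls_X powi (\<Sum>k=1..n. od k * c k) :: complex fls) = fls_X_intpow (s * c0 + (\<Sum>k=1..n. od k * c k))"
    by (simp only: fls_X_power_int fls_X_intpow_times_fls_X_intpow)
  finally have rel: "fls_const (p0 powi c0) * fls_X_intpow (s * c0 + (\<Sum>k=1..n. od k * c k)) * (f1 powi c0 * W) = fls_const C" .
  have l1: "unit_lead 1 (fps_nth P1 1) f1" unfolding f1_def by (rule leadI) (use P1 in auto)
  have "unit_lead 1 0 (S k)" if "k \<in> {1..n}" for k by (rule unit_lead_weaken[OF Slead[OF that]]) (use that in auto)
  hence "unit_lead 1 (\<Sum>k=1..n. of_int (int (24 * N) * c k) * 0) W" unfolding W_def
    by (intro unit_lead_prod unit_lead_powi) auto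
  hence "unit_lead 1 (of_int c0 * fps_nth P1 1 + (\<Sum>k=1..n. of_int (int (24 * N) * c k) * 0)) (f1 powi c0 * W)"
    by (intro unit_lead_mult unit_lead_powi l1) auto
  hence f1W: "f1 powi c0 * W = 1" by (rule unit_lead_const(1)[OF _ _ rel]) (use p0 in simp)
  \<comment> \<open>Otherwise a nontrivial product of the Siegel series alone would be 1, against
    \<open>sser_independent\<close>.\<close>
  have c0: "c0 \<noteq> 0"
  proof
    assume *: "c0 = 0"
    have "(\<Prod>k=1..N div 2. sser (2 * N) (2 * k) powi (int (24 * N) * c k)) = 1" using f1W * by (simp add: W_def S_def n_def)
    hence "int (24 * N) * c k = 0" if "k \<in> {1..N div 2}" for k using sser_independent[of 2 N "\<lambda>k. int (24 * N) * c k" k] that by simp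
    thus False using cC(1) * N0 by (auto simp: n_def)
  qed
  define d where "d = nat \<bar>c0\<bar>"
  \<comment> \<open>The sign accounts for moving the Siegel functions to the other side and for
    taking |c0| in place of c0.\<close>
  define E where "E k = - sgn c0 * (int (24 * N) * c k)" for k
  have d: "d > 0" "int d = \<bar>c0\<bar>" using c0 by (auto simp: d_def)
  have root: "f1' ^ d = K powi sgn c0 * (\<Prod>k=1..n. S' k powi E k)"
    if "f1' powi c0 * (\<Prod>k=1..n. S' k powi (int (24 * N) * c k)) = K" "f1' \<noteq> 0" "\<And>k. k \<in> {1..n} \<Longrightarrow> S' k \<noteq> 0"
    for f1' K :: "'a :: field" and S'
  proof (cases "c0 > 0")
    case True
    have W0: "(\<Prod>k=1..n. S' k powi (int (24 * N) * c k)) \<noteq> 0" using that(3) by (auto simp: prod_zero_iff)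
    have "(\<Prod>k=1..n. S' k powi E k) = inverse (\<Prod>k=1..n. S' k powi (int (24 * N) * c k))"
      using True by (simp add: E_def power_int_minus prod_inversef[symmetric] o_def)
    moreover have "f1' ^ d = f1' powi c0" using True by (simp add: power_int_def d_def)
    ultimately show ?thesis using that(1) True W0 by (auto simp: field_simps)
  next
    case False
    have "(\<Prod>k=1..n. S' k powi E k) = (\<Prod>k=1..n. S' k powi (int (24 * N) * c k))"
      using False c0 by (simp add: E_def)
    moreover have "f1' powi c0 = inverse (f1' ^ d)" using False c0 by (simp add: power_int_def d_def power_inverse)
    moreover have "K \<noteq> 0" using that by (auto simp: prod_zero_iff)
    ultimately show ?thesis using that(1,2) False c0 by (auto simp: field_simps power_int_minus)
  qed
  have fd: "f1 ^ d = (\<Prod>k=1..n. S k powi E k)" using root[of f1 S 1] f1W f10 S0 by (simp add: W_def)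
  have fdf: "f \<tau> ^ d = C powi sgn c0 * (\<Prod>k=1..N div 2. sg N (int k) 0 \<tau> powi E k)" if \<tau>: "Im \<tau> > 0" for \<tau>
    unfolding n_def[symmetric]
  proof (rule root)
    show "f \<tau> powi c0 * (\<Prod>k=1..n. sg N (int k) 0 \<tau> powi (int (24 * N) * c k)) = C"
      using cC(3)[OF \<tau>] unfolding phi_def power_int_mult power_int_of_nat .
    show "sg N (int k) 0 \<tau> \<noteq> 0" if "k \<in> {1..n}" for k
      by (rule sg_nonzero[OF N0 \<tau>]) (use not_dvd_half[OF N] that in \<open>auto simp: n_def\<close>)
  qed (rule nz[OF \<tau>])
  have P1d: "fps_over \<int> (P1 ^ d)"
  proof -
    have "integral_unit (f1 ^ d)" unfolding fd by (intro integral_unit_prod integral_unit_powi Sipr)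
    then obtain R where "fps_over \<int> R" "f1 ^ d = fps_to_fls R" by (auto simp: integral_unit_def)
    thus ?thesis unfolding f1_def fps_to_fls_power[symmetric] by simp
  qed
  \<comment> \<open>For the identity matrix the root of unity is w = 1, so \<open>QA 1 1\<close> and
    \<open>QB 1 1\<close> have integral coefficients. With p0 = u/v, their relation shows that u
    times the denominator, shifted to a power series A', makes A' P1 integral.\<close>
  have "fps_over \<int> P1"
  proof -
    obtain QA QB :: "nat \<Rightarrow> complex \<Rightarrow> complex fls" where galois_family: "\<And>k. galois_family (QA k)" "\<And>k. galois_family (QB k)"
      and rel: "\<And>(A :: int ^ 2 ^ 2) G k w. A \<in> SL2Z \<Longrightarrow> has_q_expansion (2 * N) (\<lambda>\<tau>. f (SL2_act A \<tau>)) G \<Longrightarrow> k = nat (A $ 1 $ 1 mod int N) \<Longrightarrow>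
         w = ex (of_int (A $ 1 $ 2) / of_nat N) \<Longrightarrow> QA k w \<noteq> 0 \<and> G * QA k w = QB k w"
      using weak_modular_conjugate[OF N f q] by blast
    have "QA 1 1 \<noteq> 0 \<and> F * QA 1 1 = QB 1 1"
    proof (rule rel[OF mat_1_SL2Z])
      show "has_q_expansion (2 * N) (\<lambda>\<tau>. f (SL2_act (mat 1) \<tau>)) F" using q(1) by (simp only: SL2_act_1)
    qed (use N in \<open>simp_all add: mat_def\<close>)
    hence AB: "QA 1 1 \<noteq> 0" "F * QA 1 1 = QB 1 1" by blast+
    obtain u v where uv: "p0 = of_int u / of_int v" "v \<noteq> 0" using Rats_cases'[OF p0(2)] by (metis less_irrefl)
    have u0: "u \<noteq> 0" using uv p0 by auto
    have oA: "fls_over \<int> (fls_const (of_int u) * QA 1 1)" and oB: "fls_over \<int> (fls_const (of_int v) * QB 1 1)"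
      by (intro fls_over_mult fls_over_const galois_family_Ints galois_family; simp)+
    obtain A' where A': "fls_const (of_int u) * QA 1 1 = fls_shift (- fls_subdegree (fls_const (of_int u) * QA 1 1)) (fps_to_fls A')" "fps_over \<int> A'"
      using fls_over_obtain_fps[OF oA] by blast
    define a where "a = fls_subdegree (fls_const (of_int u) * QA 1 1)"
    have A'': "fls_const (of_int u) * QA 1 1 = fls_shift (- a) (fps_to_fls A')" using A'(1) by (simp add: a_def)
    have A0: "A' \<noteq> 0" using A'' AB(1) u0 by auto
    have "fls_const (of_int v) * QB 1 1 = fls_const (of_int v * p0) * fls_X_intpow s * f1 * QA 1 1"
      unfolding AB(2)[symmetric] F by (simp add: mult_ac fls_const_mult_const[symmetric] del: fls_const_mult_const)
    also have "of_int v * p0 = of_int u" using uv by simp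
    also have "fls_const (of_int u) * fls_X_intpow s * f1 * QA 1 1 = fls_X_intpow s * f1 * (fls_const (of_int u) * QA 1 1)" by (simp only: mult_ac)
    also have "\<dots> = fls_shift (- a - s) (fps_to_fls (A' * P1))"
      unfolding A'' by (simp add: fls_X_intpow_times_conv_shift f1_def fls_times_fps_to_fls fls_shifted_times_simps mult.commute)
    finally have "fls_over \<int> (fps_to_fls (A' * P1))" using oB by (metis fls_over_shift)
    hence "fls_nth (fps_to_fls (A' * P1)) (int j) \<in> \<int>" for j unfolding fls_over_def by blast
    hence "fps_over \<int> (A' * P1)" unfolding fps_over_def by simp
    thus ?thesis by (rule fps_integral_root[OF A'(2) A0 _ P1(1) P1d d(1)])
  qed
  hence f1i: "integral_unit f1" unfolding integral_unit_def f1_def using P1(2) by blast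
  have div: "int d dvd m k * E k" if "k \<in> {1..n}" for k
    using that
  proof (induction k rule: less_induct)
    case (less k)
    show ?case
    proof (rule principal_unit_exponents[of n S "\<lambda>k. 2 * k" m f1 E d k, OF Sipr Slead])
      \<comment> \<open>An index below k is different from N/2, so \<open>m j\<close> is 1 and the
        induction hypothesis gives divisibility of \<open>E j\<close> itself.\<close>
      fix j assume j: "1 \<le> j" "j < k"
      hence "j \<in> {1..n}" "2 * j \<noteq> N" using less.prems by (auto simp: n_def)
      thus "int d dvd E j" using less.IH[OF j(2)] by (simp add: m_def)
    qed (use less.prems f1i fd d in auto)
  qed
  show ?thesis
    by (rule that[of d "C powi sgn c0" E]) (use d cC(2) fdf div in \<open>auto simp: m_def n_def\<close>)
qed

section \<open>The congruences on the exponents\<close>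

lemma sg_translation:
  assumes "0 < k" "k < N" "Im \<tau> > 0"
  shows "sg N (int k) 0 (\<tau> + of_nat N) = ex (of_int (siegel_order N (int k)) / (12 * of_nat N)) * sg N (int k) 0 \<tau>"
proof -
  have N: "N > 0" using assms by simp
  obtain C g where g: "\<And>\<tau>. Im \<tau> > 0 \<Longrightarrow> sieg (of_nat k / of_nat N) (of_int 0 / of_nat N) \<tau> =
         C * ex (of_int (siegel_order N (int k)) / (12 * of_nat N ^ 2) * \<tau>) * g (ex (\<tau> / of_nat N))"
    using sieg_q_expansion[OF N assms(2) refl, of 0] by metis
  have e1: "ex ((\<tau> + of_nat N) / of_nat N) = ex (\<tau> / of_nat N)" using N by (simp add: add_divide_distrib ex_add)
  have e2: "ex (of_int x / (12 * of_nat N ^ 2) * (\<tau> + of_nat N)) = ex (of_int x / (12 * of_nat N ^ 2) * \<tau>) * ex (of_int x / (12 * of_nat N))" for x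
    unfolding distrib_left ex_add using N by (simp add: power2_eq_square)
  have im: "Im (\<tau> + of_nat N) > 0" using assms(3) by simp
  show ?thesis using g[OF im] g[OF assms(3)] unfolding e1 e2 sg_def by simp
qed

lemma sg_lower_unipotent:
  "Im \<tau> > 0 \<Longrightarrow> sg N k 0 (\<tau> / (\<tau> + 1)) = ex (- 1 / 12) * sg N k 0 \<tau>"
  using sieg_lower_unipotent[of \<tau> "of_int k / of_nat N" 0] by (simp add: sg_def ex_def mult_ac)

lemma ex_eq_1_dvd: "ex (of_int a / of_int b) = 1 \<Longrightarrow> b \<noteq> 0 \<Longrightarrow> b dvd a"
proof -
  assume "ex (of_int a / of_int b) = 1" and b: "b \<noteq> 0"
  then obtain m where "of_int a / of_int b = (of_int m :: complex)" using ex_eq_1_iff by blast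
  hence "of_int a = (of_int (m * b) :: complex)" using b by (simp add: field_simps)
  hence "a = m * b" using of_int_eq_iff by blast
  thus ?thesis by simp
qed

text \<open>\<tau> + N and \<tau>/(\<tau> + 1) multiply every Siegel function by an explicit root of
  unity, the second one by the same for all k. Comparing values at the single point \<tau> = i shows
  that the total multiplier is 1.\<close>

lemma siegel_product_congruences:
  assumes N: "N > 1" and c: "c \<noteq> 0" and g: "\<And>\<tau>. Im \<tau> > 0 \<Longrightarrow> g \<tau> = c * (\<Prod>k=1..N div 2. sg N (int k) 0 \<tau> powi e k)"
    and inv: "\<And>A \<tau>. A \<in> Gamma_up_1 N \<Longrightarrow> Im \<tau> > 0 \<Longrightarrow> g (SL2_act A \<tau>) = g \<tau>"
  shows "12 dvd (\<Sum>k=1..N div 2. e k)" "12 * int N dvd (\<Sum>k=1..N div 2. e k * siegel_order N (int k))"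
proof -
  have N0: "N > 0" using N by simp
  have i: "Im \<i> > 0" by simp
  have nz: "(\<Prod>k=1..N div 2. sg N (int k) 0 \<i> powi e k) \<noteq> 0"
    using sg_nonzero[OF N0 i] not_dvd_half[OF N] by (auto simp: prod_zero_iff)
  have cancel: "x = 1" if "p' = x * p" "c * p' = c * p" "p \<noteq> 0" for x p p'
    using that c by (metis mult_cancel_left mult_cancel_right1)
  have 1: "g (SL2_act (mat2 1 (int N) 0 1) \<i>) = g \<i>" "g (SL2_act (mat2 1 0 1 1) \<i>) = g \<i>"
    by (rule inv; simp add: Gamma_up_1_def SL2Z_iff cong_def)+
  have a: "SL2_act (mat2 1 (int N) 0 1) \<i> = \<i> + of_nat N" "SL2_act (mat2 1 0 1 1) \<i> = \<i> / (\<i> + 1)"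
    by (simp_all add: SL2_act_eq)
  have im: "Im (\<i> + of_nat N) > 0" "Im (\<i> / (\<i> + 1)) > 0"
    using Im_SL2_act[of "mat2 1 0 1 1" \<i>] unfolding a(2) by (simp_all add: SL2Z_iff)
  have "(\<Prod>k=1..N div 2. sg N (int k) 0 (\<i> + of_nat N) powi e k) =
     (\<Prod>k=1..N div 2. ex (of_int (e k) * (of_int (siegel_order N (int k)) / (12 * of_nat N))) * sg N (int k) 0 \<i> powi e k)"
  proof (intro prod.cong refl)
    fix k assume k: "k \<in> {1..N div 2}"
    hence k: "0 < k" "k < N" using N by auto
    show "sg N (int k) 0 (\<i> + of_nat N) powi e k = ex (of_int (e k) * (of_int (siegel_order N (int k)) / (12 * of_nat N))) * sg N (int k) 0 \<i> powi e k"
      unfolding sg_translation[OF k i] power_int_mult_distrib ex_powi ..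
  qed
  also have "\<dots> = ex (\<Sum>k=1..N div 2. of_int (e k) * (of_int (siegel_order N (int k)) / (12 * of_nat N))) * (\<Prod>k=1..N div 2. sg N (int k) 0 \<i> powi e k)"
    unfolding prod.distrib ex_sum ..
  also have "(\<Sum>k=1..N div 2. of_int (e k) * (of_int (siegel_order N (int k)) / (12 * of_nat N))) =
      of_int (\<Sum>k=1..N div 2. e k * siegel_order N (int k)) / (of_int (12 * int N) :: complex)"
    by (simp add: sum_divide_distrib)
  finally have "(\<Prod>k=1..N div 2. sg N (int k) 0 (\<i> + of_nat N) powi e k) =
     ex (of_int (\<Sum>k=1..N div 2. e k * siegel_order N (int k)) / of_int (12 * int N)) * (\<Prod>k=1..N div 2. sg N (int k) 0 \<i> powi e k)" .
  hence "ex (of_int (\<Sum>k=1..N div 2. e k * siegel_order N (int k)) / of_int (12 * int N)) = 1"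
    by (rule cancel[OF _ 1(1)[unfolded a(1) g[OF im(1)] g[OF i]] nz])
  thus "12 * int N dvd (\<Sum>k=1..N div 2. e k * siegel_order N (int k))" by (rule ex_eq_1_dvd) (use N in simp)
  have "(\<Prod>k=1..N div 2. sg N (int k) 0 (\<i> / (\<i> + 1)) powi e k) = (\<Prod>k=1..N div 2. ex (of_int (e k) * (- 1 / 12)) * sg N (int k) 0 \<i> powi e k)"
    unfolding sg_lower_unipotent[OF i] power_int_mult_distrib ex_powi ..
  also have "\<dots> = ex (\<Sum>k=1..N div 2. of_int (e k) * (- 1 / 12)) * (\<Prod>k=1..N div 2. sg N (int k) 0 \<i> powi e k)"
    unfolding prod.distrib ex_sum ..
  also have "(\<Sum>k=1..N div 2. of_int (e k) * (- 1 / 12)) = (of_int (- (\<Sum>k=1..N div 2. e k)) / of_int 12 :: complex)"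
    by (simp add: sum_distrib_right[symmetric] sum_negf sum_divide_distrib)
  finally have "(\<Prod>k=1..N div 2. sg N (int k) 0 (\<i> / (\<i> + 1)) powi e k) =
     ex (of_int (- (\<Sum>k=1..N div 2. e k)) / of_int 12) * (\<Prod>k=1..N div 2. sg N (int k) 0 \<i> powi e k)" .
  hence "ex (of_int (- (\<Sum>k=1..N div 2. e k)) / of_int 12) = 1"
    by (rule cancel[OF _ 1(2)[unfolded a(2) g[OF im(2)] g[OF i]] nz])
  hence "12 dvd - (\<Sum>k=1..N div 2. e k)" by (rule ex_eq_1_dvd) simp
  thus "12 dvd (\<Sum>k=1..N div 2. e k)" by simp
qed

text \<open>With A and B the sums of k^2 e(k) and of k e(k), the left-hand condition reduces to 2 N
  dividing A - N B. As k^2 \<equiv> k modulo 2, A and B have the same parity: for even N the term N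
  B is divisible by 2 N once A is even, for odd N the difference is always even. This is the origin
  of gcd(N, 2).\<close>

lemma siegel_congruences_iff:
  fixes e :: "nat \<Rightarrow> int"
  assumes N: "N > 0" and 12: "12 dvd (\<Sum>k=1..N div 2. e k)"
  shows "12 * int N dvd (\<Sum>k=1..N div 2. e k * siegel_order N (int k)) \<longleftrightarrow> int (gcd N 2 * N) dvd (\<Sum>k=1..N div 2. int k ^ 2 * e k)"
proof -
  define A where "A = (\<Sum>k=1..N div 2. int k ^ 2 * e k)"
  define B where "B = (\<Sum>k=1..N div 2. int k * e k)"
  obtain z where z: "(\<Sum>k=1..N div 2. e k) = 12 * z" using 12 by blast
  have "(\<Sum>k=1..N div 2. e k * siegel_order N (int k)) = 6 * A - 6 * int N * B + (int N)\<^sup>2 * (\<Sum>k=1..N div 2. e k)"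
    unfolding A_def B_def siegel_order_def[OF N] sum_distrib_left sum_subtractf[symmetric] sum.distrib[symmetric]
    by (intro sum.cong) (auto simp: algebra_simps)
  also have "\<dots> = 6 * (A - int N * B) + 12 * int N * (int N * z)" unfolding z by (simp add: algebra_simps power2_eq_square)
  finally have "12 * int N dvd (\<Sum>k=1..N div 2. e k * siegel_order N (int k)) \<longleftrightarrow> 6 * (2 * int N) dvd 6 * (A - int N * B)"
    by (simp add: dvd_add_left_iff)
  also have "\<dots> \<longleftrightarrow> 2 * int N dvd A - int N * B" by (subst dvd_mult_cancel_left) simp
  finally have 1: "12 * int N dvd (\<Sum>k=1..N div 2. e k * siegel_order N (int k)) \<longleftrightarrow> 2 * int N dvd A - int N * B" .
  have "A - B = (\<Sum>k=1..N div 2. int k * (int k - 1) * e k)"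
    unfolding A_def B_def sum_subtractf[symmetric] by (intro sum.cong) (auto simp: algebra_simps power2_eq_square)
  also have "2 dvd \<dots>" by (intro dvd_sum) auto
  finally have par: "even A \<longleftrightarrow> even B" by simp
  show ?thesis
  proof (cases "even N")
    case True
    have "gcd N 2 = 2" using True by (simp add: gcd_nat.absorb2)
    moreover have "2 * int N dvd A - int N * B \<longleftrightarrow> 2 * int N dvd A"
    proof
      assume *: "2 * int N dvd A - int N * B"
      hence "even (A - int N * B)" by (metis dvd_mult_left)
      hence "even A" using True by simp
      hence "2 * int N dvd int N * B" using par by auto
      thus "2 * int N dvd A" using * by (metis dvd_add diff_add_cancel)
    next
      assume *: "2 * int N dvd A"
      hence "even A" by (metis dvd_mult_left)
      hence "2 * int N dvd int N * B" using par by auto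
      thus "2 * int N dvd A - int N * B" using * by simp
    qed
    ultimately show ?thesis unfolding 1 A_def by simp
  next
    case False
    have "coprime N 2" using False by simp
    hence "gcd N 2 = 1" by simp
    moreover have "2 * int N dvd A - int N * B \<longleftrightarrow> int N dvd A"
    proof
      assume "2 * int N dvd A - int N * B"
      hence "int N dvd A - int N * B" by (metis dvd_mult_right)
      thus "int N dvd A" using dvd_diff_commute by (metis dvd_add_times_triv_right_iff diff_add_cancel mult.commute)
    next
      assume "int N dvd A"
      hence "int N dvd A - int N * B" by simp
      moreover have "even (A - int N * B)" using par False by simp
      moreover have "coprime 2 (int N)" using False by simp
      ultimately show "2 * int N dvd A - int N * B" using divides_mult by blast
    qed
    ultimately show ?thesis unfolding 1 A_def by simp
  qed
qed

text \<open>The exceptional factor 2 at k = N/2 allows at first only a formula for f^2. The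
  exponents of f^2 have a sum divisible by 12, hence even, and those with k \<noteq> N/2 are even;
  so the remaining one is even too, and a square root can be taken.\<close>

theorem unit_product:
  assumes N: "N > 1" and f: "weak_modular N f" and nz: "\<And>\<tau>. Im \<tau> > 0 \<Longrightarrow> f \<tau> \<noteq> 0"
    and q: "has_q_expansion (2 * N) f F" "fls_over \<rat> F"
  obtains c and e :: "nat \<Rightarrow> int" where "c \<noteq> 0"
    "\<And>\<tau>. Im \<tau> > 0 \<Longrightarrow> f \<tau> = c * (\<Prod>k=1..N div 2. sg N (int k) 0 \<tau> powi e k)"
    "12 dvd (\<Sum>k=1..N div 2. e k)" "int (gcd N 2 * N) dvd (\<Sum>k=1..N div 2. int k ^ 2 * e k)"
proof -
  have N0: "N > 0" using N by simp
  obtain d C and E :: "nat \<Rightarrow> int" where d: "d > 0" "C \<noteq> 0"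
    "\<And>\<tau>. Im \<tau> > 0 \<Longrightarrow> f \<tau> ^ d = C * (\<Prod>k=1..N div 2. sg N (int k) 0 \<tau> powi E k)"
    "\<And>k. k \<in> {1..N div 2} \<Longrightarrow> int d dvd (if 2 * k = N then 2 else 1) * E k"
    using unit_power[OF N f nz q] by blast
  have hol: "(\<lambda>\<tau>. f \<tau> ^ j * (\<Prod>k=1..N div 2. sg N (int k) 0 \<tau> powi x k)) holomorphic_on upper_half_plane" for j x
    using f sg_nonzero[OF N0] not_dvd_half[OF N]
    by (intro holomorphic_intros holomorphic_powi sg_holomorphic) (auto simp: weak_modular_def)
  have snz: "sg N (int k) 0 \<tau> \<noteq> 0" if "k \<in> {1..N div 2}" "Im \<tau> > 0" for k \<tau>
    using sg_nonzero[OF N0 that(2)] not_dvd_half[OF N that(1)] by blast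
  \<comment> \<open>Integral also at k = N/2, where d is only known to divide 2 E k.\<close>
  define e2 where "e2 k = 2 * E k div int d" for k
  have e2: "int d * e2 k = 2 * E k" if "k \<in> {1..N div 2}" for k
  proof -
    have "int d dvd 2 * E k" using d(4)[OF that] by (auto split: if_splits)
    thus ?thesis by (simp add: e2_def)
  qed
  obtain c2 where c2: "\<And>\<tau>. \<tau> \<in> upper_half_plane \<Longrightarrow> f \<tau> ^ 2 * (\<Prod>k=1..N div 2. sg N (int k) 0 \<tau> powi (- e2 k)) = c2"
  proof (rule constant_power[OF connected_upper_half_plane hol[of 2 "\<lambda>k. - e2 k"] _ d(1)])
    fix \<tau> assume "\<tau> \<in> upper_half_plane"
    hence \<tau>: "Im \<tau> > 0" by simp
    have "(f \<tau> ^ 2 * (\<Prod>k=1..N div 2. sg N (int k) 0 \<tau> powi (- e2 k))) ^ d = (f \<tau> ^ d) ^ 2 * (\<Prod>k=1..N div 2. (sg N (int k) 0 \<tau> powi (- e2 k)) ^ d)"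
      by (simp add: power_mult_distrib prod_power_distrib flip: power_mult) (simp add: mult.commute)
    also have "(\<Prod>k=1..N div 2. (sg N (int k) 0 \<tau> powi (- e2 k)) ^ d) = (\<Prod>k=1..N div 2. inverse (sg N (int k) 0 \<tau> powi E k) ^ 2)"
    proof (intro prod.cong refl)
      fix k assume k: "k \<in> {1..N div 2}"
      have "(sg N (int k) 0 \<tau> powi (- e2 k)) ^ d = sg N (int k) 0 \<tau> powi (- e2 k * int d)" by (simp only: power_int_mult power_int_of_nat)
      also have "- e2 k * int d = - E k * int 2" using e2[OF k] by (simp add: mult.commute)
      finally show "(sg N (int k) 0 \<tau> powi (- e2 k)) ^ d = inverse (sg N (int k) 0 \<tau> powi E k) ^ 2" by (simp only: power_int_mult power_int_of_nat power_int_minus)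
    qed
    also have "\<dots> = inverse (\<Prod>k=1..N div 2. sg N (int k) 0 \<tau> powi E k) ^ 2"
      by (simp add: prod_power_distrib prod_inversef[symmetric] o_def power_inverse)
    also have "(f \<tau> ^ d) ^ 2 * \<dots> = C ^ 2"
    proof -
      have "(\<Prod>k=1..N div 2. sg N (int k) 0 \<tau> powi E k) \<noteq> 0" using snz \<tau> by (auto simp: prod_zero_iff)
      thus ?thesis unfolding d(3)[OF \<tau>] by (simp add: power_mult_distrib power_inverse)
    qed
    finally show "(f \<tau> ^ 2 * (\<Prod>k=1..N div 2. sg N (int k) 0 \<tau> powi (- e2 k))) ^ d = C ^ 2" .
  qed blast
  have inv: "f (SL2_act A \<tau>) = f \<tau>" if "A \<in> Gamma_up_1 N" "Im \<tau> > 0" for A \<tau> using f that unfolding weak_modular_def by blast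
  have solve: "f \<tau> ^ j = K * (\<Prod>k=1..N div 2. sg N (int k) 0 \<tau> powi x k)"
    if "f \<tau> ^ j * (\<Prod>k=1..N div 2. sg N (int k) 0 \<tau> powi (- x k)) = K" "Im \<tau> > 0" for j x K \<tau>
  proof -
    define p where "p = (\<Prod>k=1..N div 2. sg N (int k) 0 \<tau> powi x k)"
    have p: "p \<noteq> 0" unfolding p_def using snz that(2) by (auto simp: prod_zero_iff)
    define r where "r = (\<Prod>k=1..N div 2. sg N (int k) 0 \<tau> powi (- x k))"
    have "r = inverse p"
      unfolding p_def r_def power_int_minus prod_inversef[symmetric] by (simp add: o_def)
    hence pr: "r * p = 1" using p by simp
    have "f \<tau> ^ j * (r * p) = K * p" using that(1) unfolding r_def[symmetric] by (simp only: mult.assoc[symmetric])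
    hence "f \<tau> ^ j = K * p" by (simp only: pr mult_1_right)
    thus ?thesis by (simp only: p_def)
  qed
  have f2: "f \<tau> ^ 2 = c2 * (\<Prod>k=1..N div 2. sg N (int k) 0 \<tau> powi e2 k)" if "Im \<tau> > 0" for \<tau>
    by (rule solve[OF c2 that]) (use that in simp)
  have "c2 \<noteq> 0" using f2[of \<i>] nz[of \<i>] by auto
  from siegel_product_congruences(1)[OF N this f2] inv have "12 dvd (\<Sum>k=1..N div 2. e2 k)" by simp
  hence "even (\<Sum>k=1..N div 2. e2 k)" by (rule dvd_trans[rotated]) simp
  have ev1: "even (e2 k)" if k: "k \<in> {1..N div 2}" "2 * k \<noteq> N" for k
  proof -
    obtain z where "E k = int d * z" using d(4)[OF k(1)] k(2) by auto
    hence "int d * e2 k = int d * (2 * z)" using e2[OF k(1)] by simp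
    thus ?thesis using d(1) by simp
  qed
  have ev: "even (e2 k)" if k: "k \<in> {1..N div 2}" for k
  proof (cases "2 * k = N")
    case True
    have "(\<Sum>k=1..N div 2. e2 k) = e2 k + (\<Sum>j\<in>{1..N div 2} - {k}. e2 j)" using k by (intro sum.remove) auto
    moreover have "even (\<Sum>j\<in>{1..N div 2} - {k}. e2 j)" by (intro dvd_sum ev1) (use True in auto)
    ultimately show ?thesis using \<open>even (\<Sum>k=1..N div 2. e2 k)\<close> by simp
  qed (rule ev1[OF k])
  define e where "e k = e2 k div 2" for k
  have ee: "e2 k = e k * int 2" if "k \<in> {1..N div 2}" for k using ev[OF that] by (simp add: e_def)
  obtain c where c: "\<And>\<tau>. \<tau> \<in> upper_half_plane \<Longrightarrow> f \<tau> ^ 1 * (\<Prod>k=1..N div 2. sg N (int k) 0 \<tau> powi (- e k)) = c"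
  proof (rule constant_power[OF connected_upper_half_plane hol[of 1 "\<lambda>k. - e k"], of 2 c2])
    fix \<tau> assume \<tau>: "\<tau> \<in> upper_half_plane"
    have "(f \<tau> ^ 1 * (\<Prod>k=1..N div 2. sg N (int k) 0 \<tau> powi (- e k))) ^ 2 = f \<tau> ^ 2 * (\<Prod>k=1..N div 2. (sg N (int k) 0 \<tau> powi (- e k)) ^ 2)"
      by (simp add: power_mult_distrib prod_power_distrib)
    also have "(\<Prod>k=1..N div 2. (sg N (int k) 0 \<tau> powi (- e k)) ^ 2) = (\<Prod>k=1..N div 2. sg N (int k) 0 \<tau> powi (- e2 k))"
    proof (intro prod.cong refl)
      fix k assume k: "k \<in> {1..N div 2}"
      have "- e2 k = - e k * int 2" using ee[OF k] by simp
      thus "(sg N (int k) 0 \<tau> powi (- e k)) ^ 2 = sg N (int k) 0 \<tau> powi (- e2 k)" by (simp only: power_int_mult power_int_of_nat)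
    qed
    also have "f \<tau> ^ 2 * \<dots> = c2" by (rule c2[OF \<tau>])
    finally show "(f \<tau> ^ 1 * (\<Prod>k=1..N div 2. sg N (int k) 0 \<tau> powi (- e k))) ^ 2 = c2" .
  qed (simp, blast)
  have fe: "f \<tau> = c * (\<Prod>k=1..N div 2. sg N (int k) 0 \<tau> powi e k)" if "Im \<tau> > 0" for \<tau>
  proof -
    have "f \<tau> ^ 1 = c * (\<Prod>k=1..N div 2. sg N (int k) 0 \<tau> powi e k)" by (rule solve[OF c that]) (use that in simp)
    thus ?thesis by simp
  qed
  have c0: "c \<noteq> 0" using fe[of \<i>] nz[of \<i>] by auto
  have cg: "12 dvd (\<Sum>k=1..N div 2. e k)" "12 * int N dvd (\<Sum>k=1..N div 2. e k * siegel_order N (int k))"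
    using siegel_product_congruences[OF N c0 fe] inv by blast+
  show ?thesis
    by (rule that[OF c0 fe cg(1)]) (use siegel_congruences_iff[OF N0 cg(1)] cg(2) in auto)
qed

section \<open>Products of Siegel functions are modular units\<close>

definition siegel_prod :: "nat \<Rightarrow> (nat \<Rightarrow> int) \<Rightarrow> complex \<Rightarrow> complex" where
  "siegel_prod N e \<tau> = (\<Prod>k=1..N div 2. sg N (int k) 0 \<tau> powi e k)"

definition siegel_exponents :: "nat \<Rightarrow> (nat \<Rightarrow> int) set" where
  "siegel_exponents N = {e. 12 dvd (\<Sum>k=1..N div 2. e k) \<and> int (gcd N 2 * N) dvd (\<Sum>k=1..N div 2. int k ^ 2 * e k)}"

lemma sg_half_nonzero: "k \<in> {1..N div 2} \<Longrightarrow> Im \<tau> > 0 \<Longrightarrow> sg N (int k) 0 \<tau> \<noteq> 0"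
  using sg_nonzero[of N \<tau> "int k" 0] not_dvd_half[of N k] by (cases "N > 1") auto

lemma siegel_prod_nonzero: "Im \<tau> > 0 \<Longrightarrow> siegel_prod N e \<tau> \<noteq> 0"
  unfolding siegel_prod_def using sg_half_nonzero by (auto simp: prod_zero_iff)

lemma siegel_prod_holomorphic: "siegel_prod N e holomorphic_on upper_half_plane"
  unfolding siegel_prod_def[abs_def] using sg_half_nonzero by (intro holomorphic_intros holomorphic_powi sg_holomorphic) auto

lemma siegel_prod_add: "Im \<tau> > 0 \<Longrightarrow> siegel_prod N (\<lambda>k. e k + e' k) \<tau> = siegel_prod N e \<tau> * siegel_prod N e' \<tau>"
  unfolding siegel_prod_def prod.distrib[symmetric] using sg_half_nonzero by (intro prod.cong refl power_int_add) auto

lemma siegel_prod_0: "siegel_prod N (\<lambda>_. 0) \<tau> = 1"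
  by (simp add: siegel_prod_def)

section \<open>Invariance of the products\<close>

lemma sieg_add_left_int: "Im \<tau> > 0 \<Longrightarrow> sieg (a + of_int m) b \<tau> = (- exp (- of_real pi * \<i> * b)) powi m * sieg a b \<tau>"
proof -
  assume \<tau>: "Im \<tau> > 0"
  let ?c = "- exp (- of_real pi * \<i> * b)"
  have c: "?c \<noteq> 0" by simp
  show ?thesis
  proof (induction m rule: int_induct[of _ 0])
    case (step1 i)
    have "sieg (a + of_int (i + 1)) b \<tau> = ?c * sieg (a + of_int i) b \<tau>" using sieg_add_left[OF \<tau>, of "a + of_int i" b] by (simp add: add.assoc)
    thus ?case using step1 c by (simp add: power_int_add)
  next
    case (step2 i)
    have "sieg (a + of_int i) b \<tau> = ?c * sieg (a + of_int (i - 1)) b \<tau>" using sieg_add_left[OF \<tau>, of "a + of_int (i - 1)" b] by (simp add: add.assoc)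
    thus ?case using step2 c by (simp add: power_int_diff field_simps)
  qed simp
qed

lemma sieg_add_right_int: "Im \<tau> > 0 \<Longrightarrow> sieg a (b + of_int m) \<tau> = (- exp (of_real pi * \<i> * a)) powi m * sieg a b \<tau>"
proof -
  assume \<tau>: "Im \<tau> > 0"
  let ?c = "- exp (of_real pi * \<i> * a)"
  have c: "?c \<noteq> 0" by simp
  show ?thesis
  proof (induction m rule: int_induct[of _ 0])
    case (step1 i)
    have "sieg a (b + of_int (i + 1)) \<tau> = ?c * sieg a (b + of_int i) \<tau>" using sieg_add_right[OF \<tau>, of a "b + of_int i"] by (simp add: add.assoc)
    thus ?case using step1 c by (simp add: power_int_add)
  next
    case (step2 i)
    have "sieg a (b + of_int i) \<tau> = ?c * sieg a (b + of_int (i - 1)) \<tau>" using sieg_add_right[OF \<tau>, of a "b + of_int (i - 1)"] by (simp add: add.assoc)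
    thus ?case using step2 c by (simp add: power_int_diff field_simps)
  qed simp
qed

lemma minus_exp_ex: "- exp (of_real pi * \<i> * a) = ex ((1 + a) / 2)"
proof -
  have "ex ((1 + a) / 2) = ex (1 / 2) * ex (a / 2)" by (simp add: add_divide_distrib ex_add)
  also have "ex (a / 2) = exp (of_real pi * \<i> * a)" by (simp add: ex_def mult_ac)
  finally show ?thesis by (simp add: ex_half)
qed

lemma sg_Gamma_shift:
  assumes N: "N > 0" and \<tau>: "Im \<tau> > 0"
  shows "sg N (k + int N * (k * \<alpha>)) (int N * (k * \<beta>)) \<tau> =
     ex (of_int (k * \<alpha>) / 2 + of_int (k * \<beta>) * (1 + of_int k / of_nat N + of_int (k * \<alpha>)) / 2) * sg N k 0 \<tau>"
proof -
  have "sg N (k + int N * (k * \<alpha>)) (int N * (k * \<beta>)) \<tau> = sieg (of_int k / of_nat N + of_int (k * \<alpha>)) (0 + of_int (k * \<beta>)) \<tau>"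
    using N by (simp add: sg_def add_divide_distrib)
  also have "\<dots> = ex ((1 + (of_int k / of_nat N + of_int (k * \<alpha>))) / 2) powi (k * \<beta>) * (ex ((1 + 0) / 2) powi (k * \<alpha>) * sieg (of_int k / of_nat N) 0 \<tau>)"
    unfolding sieg_add_right_int[OF \<tau>] sieg_add_left_int[OF \<tau>] minus_exp_ex[symmetric] by simp
  also have "\<dots> = ex (of_int (k * \<beta>) * ((1 + (of_int k / of_nat N + of_int (k * \<alpha>))) / 2)) * ex (of_int (k * \<alpha>) * ((1 + 0) / 2)) * sg N k 0 \<tau>"
    unfolding ex_powi by (simp add: sg_def)
  also have "ex (of_int (k * \<beta>) * ((1 + (of_int k / of_nat N + of_int (k * \<alpha>))) / 2)) * ex (of_int (k * \<alpha>) * ((1 + 0) / 2)) =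
     ex (of_int (k * \<alpha>) / 2 + of_int (k * \<beta>) * (1 + of_int k / of_nat N + of_int (k * \<alpha>)) / 2)"
    unfolding ex_add[symmetric] by (simp add: algebra_simps)
  finally show ?thesis .
qed

text \<open>The expression is twice the exponent of the multiplier in
  \<open>siegel_prod_invariant\<close>. For even N both u and B are even. For odd N it is congruent
  to \<alpha> (1 + \<beta>) u modulo 2, and \<alpha> odd with \<beta> even would make the
  determinant even.\<close>

lemma Gamma_parity:
  fixes \<alpha> \<beta> u B :: int
  assumes u: "int (gcd N 2 * N) dvd int N * u" "N > 0" and B: "even (int N * u) \<longleftrightarrow> even B"
    and det: "(1 + int N * \<alpha>) * d - int N * \<beta> * c = 1"
  shows "even ((\<alpha> + \<beta>) * B + \<beta> * u + \<alpha> * \<beta> * (int N * u))"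
proof (cases "even N")
  case True
  hence "gcd N 2 = 2" by (simp add: gcd_nat.absorb2)
  hence "int N * 2 dvd int N * u" using u(1) by (simp add: mult.commute)
  hence "even u" using u(2) by simp
  thus ?thesis using B by simp
next
  case False
  have "even B \<longleftrightarrow> even u" using B False by simp
  moreover have "odd \<alpha> \<Longrightarrow> odd \<beta>"
  proof (rule ccontr)
    assume "odd \<alpha>" "\<not> odd \<beta>"
    hence "even ((1 + int N * \<alpha>) * d - int N * \<beta> * c)" using False by simp
    thus False using det by simp
  qed
  ultimately show ?thesis using False by (cases "even \<alpha>"; cases "even \<beta>"; cases "even u") auto
qed

text \<open>The common multiplier \<epsilon> disappears because 12 divides the sum of the exponents.
  The remaining exponents are quadratic in k, so their sum is expressed by the sums of k e(k) and
  k^2 e(k), and \<open>Gamma_parity\<close> makes it integral.\<close>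

lemma siegel_prod_invariant:
  fixes A :: "int ^ 2 ^ 2"
  assumes N: "N > 0" and e: "e \<in> siegel_exponents N" and A: "A \<in> Gamma_up_1 N" and \<tau>: "Im \<tau> > 0"
  shows "siegel_prod N e (SL2_act A \<tau>) = siegel_prod N e \<tau>"
proof -
  have SA: "A \<in> SL2Z" using A by (simp add: Gamma_up_1_def)
  obtain \<alpha> where \<alpha>: "A $ 1 $ 1 = 1 + int N * \<alpha>"
    using A cong_iff_lin[of 1 "A $ 1 $ 1" "int N"] by (auto simp: Gamma_up_1_def cong_sym_eq)
  obtain \<beta> where \<beta>: "A $ 1 $ 2 = int N * \<beta>" using A by (auto simp: Gamma_up_1_def cong_0_iff)
  obtain \<epsilon> where \<epsilon>: "\<epsilon> ^ 12 = 1" "\<And>M k l \<tau>. Im \<tau> > 0 \<Longrightarrow> sg M k l (SL2_act A \<tau>) =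
     \<epsilon> * sg M (k * A $ 1 $ 1 + l * A $ 2 $ 1) (k * A $ 1 $ 2 + l * A $ 2 $ 2) \<tau>" using sg_SL2[OF SA] by blast
  have \<epsilon>0: "\<epsilon> \<noteq> 0" using \<epsilon>(1) by auto
  define x where "x k = of_int (int k * \<alpha>) / 2 + of_int (int k * \<beta>) * (1 + of_int (int k) / of_nat N + of_int (int k * \<alpha>)) / (2 :: complex)" for k
  have s: "sg N (int k) 0 (SL2_act A \<tau>) = \<epsilon> * ex (x k) * sg N (int k) 0 \<tau>" for k
  proof -
    have "sg N (int k) 0 (SL2_act A \<tau>) = \<epsilon> * sg N (int k + int N * (int k * \<alpha>)) (int N * (int k * \<beta>)) \<tau>"
      using \<epsilon>(2)[OF \<tau>, of N "int k" 0] by (simp add: \<alpha> \<beta> algebra_simps)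
    thus ?thesis using sg_Gamma_shift[OF N \<tau>, of "int k" \<alpha> \<beta>] by (simp add: x_def)
  qed
  have "siegel_prod N e (SL2_act A \<tau>) = (\<Prod>k=1..N div 2. \<epsilon> powi e k * ex (of_int (e k) * x k) * sg N (int k) 0 \<tau> powi e k)"
    unfolding siegel_prod_def s power_int_mult_distrib ex_powi ..
  also have "\<dots> = \<epsilon> powi (\<Sum>k=1..N div 2. e k) * ex (\<Sum>k=1..N div 2. of_int (e k) * x k) * siegel_prod N e \<tau>"
    unfolding prod.distrib prod_powi[OF \<epsilon>0] ex_sum siegel_prod_def ..
  also have "\<epsilon> powi (\<Sum>k=1..N div 2. e k) = 1"
  proof -
    obtain z where "(\<Sum>k=1..N div 2. e k) = int 12 * z" using e by (auto simp: siegel_exponents_def)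
    thus ?thesis using \<epsilon>(1) by (simp only: power_int_mult power_int_of_nat power_int_1_left)
  qed
  also have "ex (\<Sum>k=1..N div 2. of_int (e k) * x k) = 1"
  proof -
    define S where "S = (\<Sum>k=1..N div 2. int k ^ 2 * e k)"
    define B where "B = (\<Sum>k=1..N div 2. int k * e k)"
    have dS: "int (gcd N 2 * N) dvd S" using e by (simp add: siegel_exponents_def S_def)
    then obtain u where u: "S = int N * u" by (metis dvd_def mult.assoc mult.commute of_nat_mult)
    have "S - B = (\<Sum>k=1..N div 2. int k * (int k - 1) * e k)"
      unfolding S_def B_def sum_subtractf[symmetric] by (intro sum.cong) (auto simp: algebra_simps power2_eq_square)
    also have "2 dvd \<dots>" by (intro dvd_sum) auto
    finally have par: "even (int N * u) \<longleftrightarrow> even B" unfolding u by simp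
    have det: "(1 + int N * \<alpha>) * A $ 2 $ 2 - int N * \<beta> * A $ 2 $ 1 = 1" using SA by (simp add: SL2Z_iff \<alpha> \<beta>)
    have "even ((\<alpha> + \<beta>) * B + \<beta> * u + \<alpha> * \<beta> * (int N * u))"
      by (rule Gamma_parity[OF dS[unfolded u] N par det])
    then obtain z where z: "(\<alpha> + \<beta>) * B + \<beta> * u + \<alpha> * \<beta> * S = 2 * z" unfolding u by blast
    have "of_int (e k) * x k = (of_int (\<alpha> + \<beta>) * of_int (int k * e k) + of_int \<beta> * (of_int (int k ^ 2 * e k) / of_nat N) + of_int (\<alpha> * \<beta>) * of_int (int k ^ 2 * e k)) / 2" for k
      by (simp add: x_def field_simps power2_eq_square)
    hence "(\<Sum>k=1..N div 2. of_int (e k) * x k) = (\<Sum>k=1..N div 2. (of_int (\<alpha> + \<beta>) * of_int (int k * e k) + of_int \<beta> * (of_int (int k ^ 2 * e k) / of_nat N) + of_int (\<alpha> * \<beta>) * of_int (int k ^ 2 * e k)) / 2)"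
      by (simp only:)
    also have "\<dots> = (of_int (\<alpha> + \<beta>) * of_int B + of_int \<beta> * (of_int S / of_nat N) + of_int (\<alpha> * \<beta>) * of_int S) / 2"
      unfolding B_def S_def of_int_sum sum_distrib_left sum_divide_distrib sum.distrib[symmetric] ..
    also have "of_int S / of_nat N = (of_int u :: complex)" using N by (simp add: u)
    also have "(of_int (\<alpha> + \<beta>) * of_int B + of_int \<beta> * of_int u + of_int (\<alpha> * \<beta>) * of_int S) / 2 = (of_int z :: complex)"
      using arg_cong[OF z, of "of_int :: int \<Rightarrow> complex"] by simp
    finally show ?thesis by simp
  qed
  finally show ?thesis by simp
qed

text \<open>Single Siegel functions are of this kind, for all characteristics of level N, and the
  class is closed under products and integer powers. Only the periodicity of the whole product makes
  \<rho> a multiple of 1/N.\<close>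

definition fractional_exp :: "nat \<Rightarrow> (complex \<Rightarrow> complex) \<Rightarrow> bool" where
  "fractional_exp N f \<longleftrightarrow> (\<exists>\<rho> g G. (\<forall>\<tau>. Im \<tau> > 0 \<longrightarrow> f \<tau> = ex (\<rho> * \<tau>) * g (ex (\<tau> / of_nat N))) \<and> g has_laurent_expansion G)"

lemma fractional_exp_const: "fractional_exp N (\<lambda>_. c)"
  unfolding fractional_exp_def by (rule exI[of _ 0], rule exI[of _ "\<lambda>_. c"], rule exI[of _ "fls_const c"]) (auto intro: has_laurent_expansion_const)

lemma fractional_exp_mult: assumes "fractional_exp N f" "fractional_exp N f'" shows "fractional_exp N (\<lambda>\<tau>. f \<tau> * f' \<tau>)"
proof -
  obtain \<rho> g G \<rho>' g' G' where *: "\<And>\<tau>. Im \<tau> > 0 \<Longrightarrow> f \<tau> = ex (\<rho> * \<tau>) * g (ex (\<tau> / of_nat N))" "g has_laurent_expansion G"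
    "\<And>\<tau>. Im \<tau> > 0 \<Longrightarrow> f' \<tau> = ex (\<rho>' * \<tau>) * g' (ex (\<tau> / of_nat N))" "g' has_laurent_expansion G'"
    using assms unfolding fractional_exp_def by blast
  show ?thesis unfolding fractional_exp_def
    by (rule exI[of _ "\<rho> + \<rho>'"], rule exI[of _ "\<lambda>z. g z * g' z"], rule exI[of _ "G * G'"])
       (use *(1,3) has_laurent_expansion_mult[OF *(2,4)] in \<open>simp add: distrib_right ex_add\<close>)
qed

lemma fractional_exp_powi: assumes "fractional_exp N f" shows "fractional_exp N (\<lambda>\<tau>. f \<tau> powi n)"
proof -
  obtain \<rho> g G where *: "\<And>\<tau>. Im \<tau> > 0 \<Longrightarrow> f \<tau> = ex (\<rho> * \<tau>) * g (ex (\<tau> / of_nat N))" "g has_laurent_expansion G"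
    using assms unfolding fractional_exp_def by blast
  show ?thesis unfolding fractional_exp_def
    by (rule exI[of _ "of_int n * \<rho>"], rule exI[of _ "\<lambda>z. g z powi n"], rule exI[of _ "G powi n"])
       (use *(1) has_laurent_expansion_power_int[OF *(2)] in \<open>simp add: power_int_mult_distrib ex_powi mult.assoc\<close>)
qed

lemma fractional_exp_prod: "(\<And>i. i \<in> I \<Longrightarrow> fractional_exp N (f i)) \<Longrightarrow> fractional_exp N (\<lambda>\<tau>. \<Prod>i\<in>I. f i \<tau>)"
  by (induction I rule: infinite_finite_induct) (auto intro: fractional_exp_mult fractional_exp_const)

lemma fractional_exp_cong: "(\<And>\<tau>. Im \<tau> > 0 \<Longrightarrow> f \<tau> = g \<tau>) \<Longrightarrow> fractional_exp N f \<Longrightarrow> fractional_exp N g"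
  unfolding fractional_exp_def by metis

lemma fractional_exp_sg: assumes N: "N > 0" shows "fractional_exp N (sg N k l)"
proof -
  define k' where "k' = nat (k mod int N)"
  have k': "k' < N" "k = int k' + int N * (k div int N)" using N by (auto simp: k'_def nat_less_iff)
  define c where "c = (- exp (- of_real pi * \<i> * (of_int l / of_nat N))) powi (k div int N)"
  have c: "sg N k l \<tau> = c * sieg (of_nat k' / of_nat N) (of_int l / of_nat N) \<tau>" if "Im \<tau> > 0" for \<tau>
  proof -
    have "of_int k / of_nat N = of_nat k' / of_nat N + (of_int (k div int N) :: complex)"
      by (subst k'(2)) (use N in \<open>simp add: add_divide_distrib\<close>)
    thus ?thesis unfolding sg_def c_def using sieg_add_left_int[OF that] by simp
  qed
  obtain C g where g: "g has_fps_expansion siegel_series N k' (ex (of_int l / of_nat N))" "\<And>\<tau>. Im \<tau> > 0 \<Longrightarrow> sieg (of_nat k' / of_nat N) (of_int l / of_nat N) \<tau> =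
         C * ex (of_int (siegel_order N (int k')) / (12 * of_nat N ^ 2) * \<tau>) * g (ex (\<tau> / of_nat N))"
    using sieg_q_expansion[OF N k'(1) refl, of l] by blast
  have L: "(\<lambda>z. (c * C) * g z) has_laurent_expansion fls_const (c * C) * fps_to_fls (siegel_series N k' (ex (of_int l / of_nat N)))"
    by (intro has_laurent_expansion_mult has_laurent_expansion_const has_laurent_expansion_fps g)
  show ?thesis unfolding fractional_exp_def
    by (rule exI[of _ "of_int (siegel_order N (int k')) / (12 * of_nat N ^ 2)"], rule exI[of _ "\<lambda>z. (c * C) * g z"],
        rule exI[of _ "fls_const (c * C) * fps_to_fls (siegel_series N k' (ex (of_int l / of_nat N)))"])
       (use L c g(2) in \<open>simp add: mult_ac\<close>)
qed

text \<open>The values at i and i + N differ by the factor ex(\<rho> N); so periodicity at this one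
  point, where f does not vanish, makes \<rho> N an integer.\<close>

lemma fractional_exp_periodic:
  assumes N: "N > 0" and f: "fractional_exp N f" and per: "f (\<i> + of_nat N) = f \<i>" "f \<i> \<noteq> 0"
  obtains F where "has_q_expansion N f F"
proof -
  obtain \<rho> g G where *: "\<And>\<tau>. Im \<tau> > 0 \<Longrightarrow> f \<tau> = ex (\<rho> * \<tau>) * g (ex (\<tau> / of_nat N))" "g has_laurent_expansion G"
    using f unfolding fractional_exp_def by blast
  have e: "ex ((\<i> + of_nat N) / of_nat N) = ex (\<i> / of_nat N)" using N by (simp add: add_divide_distrib ex_add)
  have "f (\<i> + of_nat N) = ex (\<rho> * of_nat N) * f \<i>"
    using *(1)[of \<i>] *(1)[of "\<i> + of_nat N"] unfolding e by (simp add: distrib_left ex_add)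
  hence "ex (\<rho> * of_nat N) = 1" using per by simp
  then obtain j where j: "\<rho> * of_nat N = of_int j" using ex_eq_1_iff by blast
  hence \<rho>: "\<rho> = of_int j / of_nat N" using N by (simp add: field_simps)
  have "has_q_expansion N (\<lambda>\<tau>. g (ex (\<tau> / of_nat N))) G" by (rule has_q_expansionI[OF N *(2)]) simp
  from has_q_expansion_mult[OF N has_q_expansion_ex[OF N, of j] this]
  have "has_q_expansion N f (fls_X_intpow j * G)"
    by (rule has_q_expansion_cong'[rotated]) (simp add: *(1) \<rho>)
  thus ?thesis using that by blast
qed

lemma siegel_prod_cusp:
  fixes A :: "int ^ 2 ^ 2"
  assumes N: "N > 0" and e: "e \<in> siegel_exponents N" and A: "A \<in> SL2Z"
  obtains F where "has_q_expansion N (\<lambda>\<tau>. siegel_prod N e (SL2_act A \<tau>)) F"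
proof (rule fractional_exp_periodic[OF N])
  obtain \<epsilon> where \<epsilon>: "\<epsilon> ^ 12 = 1" "\<And>M k l \<tau>. Im \<tau> > 0 \<Longrightarrow> sg M k l (SL2_act A \<tau>) =
     \<epsilon> * sg M (k * A $ 1 $ 1 + l * A $ 2 $ 1) (k * A $ 1 $ 2 + l * A $ 2 $ 2) \<tau>" using sg_SL2[OF A] by blast
  have "fractional_exp N (\<lambda>\<tau>. \<Prod>k=1..N div 2. (\<epsilon> * sg N (int k * A $ 1 $ 1) (int k * A $ 1 $ 2) \<tau>) powi e k)"
    by (intro fractional_exp_prod fractional_exp_powi fractional_exp_mult fractional_exp_const fractional_exp_sg N)
  thus "fractional_exp N (\<lambda>\<tau>. siegel_prod N e (SL2_act A \<tau>))"
    by (rule fractional_exp_cong[rotated]) (simp add: siegel_prod_def \<epsilon>(2))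
  have i: "Im \<i> > 0" by simp
  define B where "B = A ** mat2 1 (int N) 0 1"
  have B: "B \<in> SL2Z" unfolding B_def by (intro SL2Z_mult A translation_SL2Z)
  have "B ** inv2 A \<in> Gamma_up_1 N"
    by (rule Gamma_up_1_quotient[OF B A]) (auto simp: B_def mat_mult_nth cong_def)
  hence "siegel_prod N e (SL2_act (B ** inv2 A) (SL2_act A \<i>)) = siegel_prod N e (SL2_act A \<i>)" by (rule siegel_prod_invariant[OF N e _ Im_SL2_act[OF A i]])
  moreover have "SL2_act (B ** inv2 A) (SL2_act A \<i>) = SL2_act B \<i>"
    using SL2_act_mult[OF B inv2_SL2Z[OF A] Im_SL2_act[OF A i]] SL2_act_inv[OF A i] by simp
  moreover have "SL2_act B \<i> = SL2_act A (\<i> + of_nat N)"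
    unfolding B_def using SL2_act_mult[OF A translation_SL2Z i, of "int N"] by (simp add: SL2_act_translation)
  ultimately show "siegel_prod N e (SL2_act A (\<i> + of_nat N)) = siegel_prod N e (SL2_act A \<i>)" by simp
  show "siegel_prod N e (SL2_act A \<i>) \<noteq> 0" by (rule siegel_prod_nonzero[OF Im_SL2_act[OF A i]])
qed (rule that)

text \<open>Since 12 divides the sum of the exponents, the constants i of the Siegel functions
  cancel, which leaves a power of the parameter times a principal unit with integral
  coefficients.\<close>

lemma siegel_prod_q_expansion:
  assumes N: "N > 0" and e: "e \<in> siegel_exponents N"
  obtains t where "has_q_expansion N (siegel_prod N e) (fls_X_intpow t * (\<Prod>k=1..N div 2. sser N k powi e k))"
proof -
  have 12: "12 dvd (\<Sum>k=1..N div 2. e k)" using e by (simp add: siegel_exponents_def)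
  have "12 * int N dvd (\<Sum>k=1..N div 2. e k * siegel_order N (int k))"
    using siegel_congruences_iff[OF N 12] e by (simp add: siegel_exponents_def)
  then obtain t where t: "(\<Sum>k=1..N div 2. e k * siegel_order N (int k)) = 12 * int N * t" by blast
  have "\<exists>g. g has_fps_expansion siegel_series N k 1 \<and> (\<forall>\<tau>. Im \<tau> > 0 \<longrightarrow> sg N (int k) 0 \<tau> =
     \<i> * ex (of_int (siegel_order N (int k)) / (12 * of_nat N ^ 2) * \<tau>) * g (ex (\<tau> / of_nat N)))" if "k \<in> {1..N div 2}" for k
  proof -
    have k: "k < N" using that by auto
    show ?thesis using sieg_q_expansion[OF N k refl, of 0] by (auto simp: sg_def)
  qed
  then obtain g where g: "\<And>k. k \<in> {1..N div 2} \<Longrightarrow> g k has_fps_expansion siegel_series N k 1"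
    "\<And>k \<tau>. k \<in> {1..N div 2} \<Longrightarrow> Im \<tau> > 0 \<Longrightarrow> sg N (int k) 0 \<tau> = \<i> * ex (of_int (siegel_order N (int k)) / (12 * of_nat N ^ 2) * \<tau>) * g k (ex (\<tau> / of_nat N))"
    by metis
  have qe: "has_q_expansion N (\<lambda>\<tau>. ex (of_int t * \<tau> / of_nat N) * (\<Prod>k=1..N div 2. g k (ex (\<tau> / of_nat N)) powi e k))
     (fls_X_intpow t * (\<Prod>k=1..N div 2. sser N k powi e k))"
  proof (intro has_q_expansion_mult has_q_expansion_prod has_q_expansion_power_int has_q_expansion_ex N)
    fix k assume "k \<in> {1..N div 2}"
    from has_laurent_expansion_fps[OF g(1)[OF this]] show "has_q_expansion N (\<lambda>\<tau>. g k (ex (\<tau> / of_nat N))) (sser N k)"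
      unfolding sser_def by (rule has_q_expansionI[OF N]) simp
  qed
  have eq: "ex (of_int t * \<tau> / of_nat N) * (\<Prod>k=1..N div 2. g k (ex (\<tau> / of_nat N)) powi e k) = siegel_prod N e \<tau>" if \<tau>: "Im \<tau> > 0" for \<tau>
  proof -
    have "siegel_prod N e \<tau> = (\<Prod>k=1..N div 2. \<i> powi e k * ex (of_int (e k) * (of_int (siegel_order N (int k)) / (12 * of_nat N ^ 2) * \<tau>)) * g k (ex (\<tau> / of_nat N)) powi e k)"
      unfolding siegel_prod_def by (intro prod.cong refl) (simp only: g(2)[OF _ \<tau>] power_int_mult_distrib ex_powi)
    also have "\<dots> = \<i> powi (\<Sum>k=1..N div 2. e k) * ex (\<Sum>k=1..N div 2. of_int (e k) * (of_int (siegel_order N (int k)) / (12 * of_nat N ^ 2) * \<tau>)) * (\<Prod>k=1..N div 2. g k (ex (\<tau> / of_nat N)) powi e k)"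
      unfolding prod.distrib ex_sum by (subst prod_powi) auto
    also have "\<i> powi (\<Sum>k=1..N div 2. e k) = 1"
    proof -
      obtain z where "(\<Sum>k=1..N div 2. e k) = int 12 * z" using 12 by auto
      moreover have "\<i> ^ 12 = 1" by (simp add: eval_nat_numeral)
      ultimately show ?thesis by (simp only: power_int_mult power_int_of_nat power_int_1_left)
    qed
    also have "(\<Sum>k=1..N div 2. of_int (e k) * (of_int (siegel_order N (int k)) / (12 * of_nat N ^ 2) * \<tau>)) =
       of_int (\<Sum>k=1..N div 2. e k * siegel_order N (int k)) * (\<tau> / (12 * of_nat N ^ 2))"
      unfolding of_int_sum sum_distrib_right by (intro sum.cong) auto
    also have "\<dots> = of_int t * \<tau> / of_nat N" unfolding t using N by (simp add: field_simps power2_eq_square)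
    finally show ?thesis by simp
  qed
  show ?thesis by (rule that[OF has_q_expansion_cong'[OF eq qe]])
qed

text \<open>Dividing one expansion by the other leaves a constant, a power of the parameter and a
  principal unit; \<open>unit_lead_const\<close> separates them, and \<open>sser_independent\<close>
  compares the exponents.\<close>

lemma siegel_prod_unique:
  assumes N: "N > 0" and e: "e \<in> siegel_exponents N" "e' \<in> siegel_exponents N" and c: "c \<noteq> 0"
    and eq: "\<And>\<tau>. Im \<tau> > 0 \<Longrightarrow> c * siegel_prod N e \<tau> = c' * siegel_prod N e' \<tau>"
  shows "c = c'" "\<And>k. k \<in> {1..N div 2} \<Longrightarrow> e k = e' k"
proof -
  obtain t where t: "has_q_expansion N (siegel_prod N e) (fls_X_intpow t * (\<Prod>k=1..N div 2. sser N k powi e k))" using siegel_prod_q_expansion[OF N e(1)] by blast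
  obtain t' where t': "has_q_expansion N (siegel_prod N e') (fls_X_intpow t' * (\<Prod>k=1..N div 2. sser N k powi e' k))" using siegel_prod_q_expansion[OF N e(2)] by blast
  have S: "integral_unit (sser N k)" "sser N k \<noteq> 0" "unit_lead k (- of_int (if 2 * k = N then 2 else 1)) (sser N k)" if "k \<in> {1..N div 2}" for k
  proof -
    have k: "0 < k" "k < N" "2 * k \<le> N" using that by auto
    show "integral_unit (sser N k)" by (rule sser_integral_unit[OF N k(1,2)])
    thus "sser N k \<noteq> 0" by (auto simp: integral_unit_def)
    show "unit_lead k (- of_int (if 2 * k = N then 2 else 1)) (sser N k)" by (rule sser_unit_lead[OF k(1,3)])
  qed
  define U where "U x = (\<Prod>k=1..N div 2. sser N k powi x k)" for x
  have U0: "U x \<noteq> 0" for x unfolding U_def using S(2) by (auto simp: prod_zero_iff)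
  \<comment> \<open>The coefficient of x in the k-th series, nonzero only for k = 1.\<close>
  define a where "a k = (if k = 1 then - of_int (if 2 * k = N then 2 else 1) else 0 :: complex)" for k
  have l1: "unit_lead 1 (a k) (sser N k)" if "k \<in> {1..N div 2}" for k
    using S(3)[OF that] unit_lead_weaken[OF S(3)[OF that], of 1] that by (cases "k = 1") (auto simp: a_def)
  have "has_q_expansion N (\<lambda>\<tau>. c * siegel_prod N e \<tau>) (fls_const c' * (fls_X_intpow t' * U e'))"
    by (rule has_q_expansion_cong'[OF _ has_q_expansion_mult[OF N has_q_expansion_const[OF N] t'[folded U_def]]]) (simp add: eq)
  hence "fls_const c * (fls_X_intpow t * U e) = fls_const c' * (fls_X_intpow t' * U e')"
    using has_q_expansion_mult[OF N has_q_expansion_const[OF N, of c] t[folded U_def]] has_q_expansion_unique[OF N] by blast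
  hence "fls_X powi (- t') * (fls_const c * (fls_X powi t * U e)) * inverse (U e') = fls_X powi (- t') * (fls_const c' * (fls_X powi t' * U e')) * inverse (U e')"
    by (simp only: fls_X_power_int)
  also have "\<dots> = fls_const c' * (fls_X powi (- t') * fls_X powi t') * (U e' * inverse (U e'))" by (simp only: mult_ac)
  also have "\<dots> = fls_const c'" using U0[of e'] by (simp add: power_int_minus del: fls_X_power_int)
  also have "fls_X powi (- t') * (fls_const c * (fls_X powi t * U e)) * inverse (U e') = fls_const c * (fls_X powi (- t') * fls_X powi t) * (U e * inverse (U e'))"
    by (simp only: mult_ac)
  also have "fls_X powi (- t') * fls_X powi t = (fls_X_intpow (- t' + t) :: complex fls)"
    by (simp only: fls_X_power_int fls_X_intpow_times_fls_X_intpow)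
  finally have rel: "fls_const c * fls_X_intpow (- t' + t) * (U e * inverse (U e')) = fls_const c'" .
  have Ue: "U e * inverse (U e') = U (\<lambda>k. e k - e' k)"
    unfolding U_def prod_inversef[symmetric] o_def prod.distrib[symmetric] using S(2) by (intro prod.cong refl) (auto simp: power_int_diff divide_inverse)
  have lU: "unit_lead 1 (\<Sum>k=1..N div 2. of_int (e k - e' k) * a k) (U (\<lambda>k. e k - e' k))"
    unfolding U_def by (intro unit_lead_prod unit_lead_powi l1) auto
  show "c = c'" by (rule unit_lead_const(2)[OF lU c rel[unfolded Ue]])
  have "U (\<lambda>k. e k - e' k) = 1" by (rule unit_lead_const(1)[OF lU c rel[unfolded Ue]])
  thus "e k = e' k" if "k \<in> {1..N div 2}" for k
    using sser_independent[of 1 N "\<lambda>k. e k - e' k" k] that by (simp add: U_def)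
qed

section \<open>The group of modular units\<close>

lemma fls_over_subset: "fls_over \<int> F \<Longrightarrow> fls_over \<rat> F"
  unfolding fls_over_def using Ints_subset_Rats' by blast

definition sunit :: "nat \<Rightarrow> rat \<Rightarrow> (nat \<Rightarrow> int) \<Rightarrow> complex \<Rightarrow> complex" where
  "sunit N c e = (\<lambda>\<tau>\<in>upper_half_plane. of_rat c * siegel_prod N e \<tau>)"

text \<open>Poles have negative order and isolated zeros positive order; a zero that is not isolated
  makes f vanish on all of the connected set S.\<close>

lemma nicely_meromorphic_unit:
  assumes S: "open S" "connected S" and f: "f nicely_meromorphic_on S" and ord: "\<And>z. z \<in> S \<Longrightarrow> zorder f z = 0" and nz: "\<exists>z\<in>S. f z \<noteq> 0"
  shows "f holomorphic_on S" "\<And>z. z \<in> S \<Longrightarrow> f z \<noteq> 0"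
proof -
  have np: "\<not> is_pole f z" if z: "z \<in> S" for z
  proof
    assume "is_pole f z"
    moreover have "isolated_singularity_at f z" using f z unfolding nicely_meromorphic_on_def by (simp add: meromorphic_on_altdef)
    ultimately have "zorder f z < 0" using isolated_pole_imp_neg_zorder by blast
    thus False using ord[OF z] by simp
  qed
  have an: "f analytic_on {z}" if "z \<in> S" for z using nicely_meromorphic_on_imp_analytic_at[OF f that np[OF that]] .
  have "f analytic_on S" using an analytic_on_analytic_at by blast
  thus hol: "f holomorphic_on S" by (rule analytic_imp_holomorphic)
  show "f z \<noteq> 0" if z: "z \<in> S" for z
  proof
    assume fz: "f z = 0"
    show False
    proof (cases "frequently (\<lambda>w. f w \<noteq> 0) (at z)")
      case True
      thus False using zorder_pos_iff[OF hol S(1) z] fz ord[OF z] by simp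
    next
      case False
      hence "\<forall>\<^sub>F w in at z. f w = 0" by (simp add: frequently_def)
      then obtain T where T: "open T" "z \<in> T" "\<And>w. w \<in> T \<Longrightarrow> w \<noteq> z \<Longrightarrow> f w = 0" unfolding eventually_at_topological by blast
      have "f w = 0" if "w \<in> S" for w
      proof (rule analytic_continuation_open[of "T \<inter> S" S f "\<lambda>_. 0"])
        fix w assume "w \<in> T \<inter> S" thus "f w = 0" using T(3) fz by (cases "w = z") auto
      qed (use S T z that hol in auto)
      thus False using nz by blast
    qed
  qed
qed

text \<open>Level 1 is separate because the characteristic (1, 0) is then integral and
  \<open>phi\<close> vanishes identically. There is only one cusp, so f or 1/f is regular at it,
  hence constant.\<close>

lemma weak_modular_level_one:
  assumes f: "weak_modular 1 f" and nz: "\<And>\<tau>. Im \<tau> > 0 \<Longrightarrow> f \<tau> \<noteq> 0"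
  obtains c where "\<And>\<tau>. Im \<tau> > 0 \<Longrightarrow> f \<tau> = c"
proof -
  have inv: "g (SL2_act A \<tau>) = g \<tau>" if "weak_modular 1 g" "A \<in> SL2Z" "Im \<tau> > 0" for g A \<tau>
    using that by (auto simp: weak_modular_def Gamma_up_1_def)
  have const: "\<exists>c. \<forall>\<tau>. Im \<tau> > 0 \<longrightarrow> g \<tau> = c" if g: "weak_modular 1 g" and F: "has_q_expansion 2 g F" "fls_subdegree F \<ge> 0" for g F
  proof -
    have reg: "fls_subdegree F' \<ge> 0" if A: "A \<in> SL2Z" and F': "has_q_expansion (2 * 1) (\<lambda>\<tau>. g (SL2_act A \<tau>)) F'" for A F'
    proof -
      have "has_q_expansion 2 g F'" using has_q_expansion_cong'[OF _ F', of g] inv[OF g A] by simp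
      hence "F' = F" using F(1) has_q_expansion_unique[of 2] by simp
      thus ?thesis using F(2) by simp
    qed
    show ?thesis by (rule weak_modular_regular_constant[OF zero_less_one g reg]) blast+
  qed
  obtain F where "has_q_expansion (2 * 1) (\<lambda>\<tau>. f (SL2_act (mat 1) \<tau>)) F" using f mat_1_SL2Z unfolding weak_modular_def by blast
  hence F: "has_q_expansion 2 f F" by (simp only: SL2_act_1 mult_1_right)
  show ?thesis
  proof (cases "fls_subdegree F \<ge> 0")
    case True thus ?thesis using const[OF f F] that by blast
  next
    case False
    have "has_q_expansion 2 (\<lambda>\<tau>. f \<tau> powi (- 1)) (F powi (- 1))" by (rule has_q_expansion_power_int[OF _ F]) simp
    moreover have "fls_subdegree (F powi (- 1)) \<ge> 0" using False by (simp only: fls_subdegree_power_int)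
    ultimately obtain c where c: "\<And>\<tau>. Im \<tau> > 0 \<Longrightarrow> f \<tau> powi (- 1) = c"
      using const[OF weak_modular_powi[OF zero_less_one f nz, of "- 1"]] by blast
    have "f \<tau> = inverse c" if "Im \<tau> > 0" for \<tau> using c[OF that] by (auto simp: power_int_minus)
    thus ?thesis using that by blast
  qed
qed

lemma siegel_prod_q_expansion_rat:
  assumes N: "N > 0" and e: "e \<in> siegel_exponents N"
  obtains t H where "has_q_expansion N (siegel_prod N e) H" "fls_over \<rat> H" "fls_nth H t = 1"
proof -
  obtain t where t: "has_q_expansion N (siegel_prod N e) (fls_X_intpow t * (\<Prod>k=1..N div 2. sser N k powi e k))" using siegel_prod_q_expansion[OF N e] by blast
  have "integral_unit (\<Prod>k=1..N div 2. sser N k powi e k)" by (intro integral_unit_prod integral_unit_powi sser_integral_unit N) auto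
  then obtain P where P: "fps_over \<int> P" "fps_nth P 0 = 1" "(\<Prod>k=1..N div 2. sser N k powi e k) = fps_to_fls P" by (auto simp: integral_unit_def)
  show ?thesis
  proof (rule that[OF t])
    show "fls_over \<rat> (fls_X_intpow t * (\<Prod>k=1..N div 2. sser N k powi e k))"
      unfolding P(3) fls_X_intpow_times_conv_shift using P(1) by (auto intro!: fls_over_subset fls_over_fps_to_fls)
    show "fls_nth (fls_X_intpow t * (\<Prod>k=1..N div 2. sser N k powi e k)) t = 1"
      unfolding P(3) fls_X_intpow_times_conv_shift using P(2) by simp
  qed
qed

lemma sunit_in_modular_units:
  assumes N: "N > 0" and c: "c \<noteq> 0" and e: "e \<in> siegel_exponents N"
  shows "sunit N c e \<in> carrier (modular_units N)"
proof -
  let ?f = "sunit N c e"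
  have ev: "?f \<tau> = of_rat c * siegel_prod N e \<tau>" if "Im \<tau> > 0" for \<tau> using that by (simp add: sunit_def)
  have hol: "?f holomorphic_on upper_half_plane"
    by (rule holomorphic_transform[OF holomorphic_on_mult[OF holomorphic_on_const[of "of_rat c"] siegel_prod_holomorphic[of N e]]]) (simp add: ev)
  have an: "?f analytic_on upper_half_plane" using hol analytic_on_open[OF open_upper_half_plane] by blast
  have nz: "?f \<tau> \<noteq> 0" if "Im \<tau> > 0" for \<tau> using ev[OF that] siegel_prod_nonzero[OF that] c by simp
  have "?f \<in> modular_functions N"
    unfolding modular_functions_def
  proof (intro CollectI conjI ballI)
    show "?f \<in> extensional upper_half_plane" by (simp add: sunit_def)
    show "?f nicely_meromorphic_on upper_half_plane" by (rule analytic_on_imp_nicely_meromorphic_on[OF an])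
    show "?f (SL2_act \<gamma> \<tau>) = ?f \<tau>" if "\<gamma> \<in> Gamma_up_1 N" "\<tau> \<in> upper_half_plane" for \<gamma> \<tau>
      using that siegel_prod_invariant[OF N e that(1)] Im_SL2_act[of \<gamma> \<tau>] by (simp add: ev Gamma_up_1_def)
    show "\<exists>F. has_q_expansion N (\<lambda>\<tau>. ?f (SL2_act \<gamma> \<tau>)) F" if \<gamma>: "\<gamma> \<in> SL2Z" for \<gamma>
    proof -
      obtain F where F: "has_q_expansion N (\<lambda>\<tau>. siegel_prod N e (SL2_act \<gamma> \<tau>)) F" using siegel_prod_cusp[OF N e \<gamma>] by blast
      have "has_q_expansion N (\<lambda>\<tau>. ?f (SL2_act \<gamma> \<tau>)) (fls_const (of_rat c) * F)"
        by (rule has_q_expansion_cong'[OF _ has_q_expansion_mult[OF N has_q_expansion_const[OF N] F]]) (simp add: ev Im_SL2_act[OF \<gamma>])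
      thus ?thesis by blast
    qed
  qed
  moreover have "\<exists>\<tau>\<in>upper_half_plane. ?f \<tau> \<noteq> 0" by (rule bexI[of _ \<i>]) (use nz[of \<i>] in auto)
  moreover have "\<forall>\<tau>\<in>upper_half_plane. zorder ?f \<tau> = 0"
    using an nz zorder_eq_0I analytic_on_analytic_at by (metis mem_Collect_eq)
  moreover have "\<exists>F. has_q_expansion N ?f F \<and> (\<forall>n. fls_nth F n \<in> \<rat>)"
  proof -
    obtain t H where H: "has_q_expansion N (siegel_prod N e) H" "fls_over \<rat> H" "fls_nth H t = 1" using siegel_prod_q_expansion_rat[OF N e] by blast
    have "has_q_expansion N ?f (fls_const (of_rat c) * H)"
      by (rule has_q_expansion_cong'[OF _ has_q_expansion_mult[OF N has_q_expansion_const[OF N] H(1)]]) (simp add: ev)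
    moreover have "fls_nth (fls_const (of_rat c) * H) n \<in> \<rat>" for n using H(2) by (simp add: fls_over_def)
    ultimately show ?thesis by blast
  qed
  ultimately show ?thesis unfolding modular_units_def by simp
qed

text \<open>The complex constant is rational because the expansion of the product has a coefficient
  equal to 1, and the corresponding coefficient of f is the constant itself.\<close>

lemma modular_unit_is_sunit:
  assumes N: "N > 0" and f: "f \<in> carrier (modular_units N)"
  obtains c e where "c \<noteq> 0" "e \<in> siegel_exponents N" "f = sunit N c e"
proof -
  have mf: "f \<in> extensional upper_half_plane" "f nicely_meromorphic_on upper_half_plane"
    "\<And>\<gamma> \<tau>. \<gamma> \<in> Gamma_up_1 N \<Longrightarrow> Im \<tau> > 0 \<Longrightarrow> f (SL2_act \<gamma> \<tau>) = f \<tau>"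
    "\<And>\<gamma>. \<gamma> \<in> SL2Z \<Longrightarrow> \<exists>F. has_q_expansion N (\<lambda>\<tau>. f (SL2_act \<gamma> \<tau>)) F"
    "\<exists>\<tau>\<in>upper_half_plane. f \<tau> \<noteq> 0" "\<And>\<tau>. \<tau> \<in> upper_half_plane \<Longrightarrow> zorder f \<tau> = 0"
    using f unfolding modular_units_def modular_functions_def by auto
  obtain F where F: "has_q_expansion N f F" "\<And>n. fls_nth F n \<in> \<rat>" using f unfolding modular_units_def by auto
  note hn = nicely_meromorphic_unit[OF open_upper_half_plane connected_upper_half_plane mf(2,6,5)]
  have nz: "f \<tau> \<noteq> 0" if "Im \<tau> > 0" for \<tau> using hn(2) that by simp
  have hm: "weak_modular N f" unfolding weak_modular_def
  proof (intro conjI ballI allI impI)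
    fix A assume "A \<in> SL2Z"
    then obtain G where "has_q_expansion N (\<lambda>\<tau>. f (SL2_act A \<tau>)) G" using mf(4) by blast
    from has_q_expansion_refine[OF N _ this, of 2] show "\<exists>F. has_q_expansion (2 * N) (\<lambda>\<tau>. f (SL2_act A \<tau>)) F" by auto
  qed (use hn(1) mf(3) in auto)
  have q2: "has_q_expansion (2 * N) f (fls_compose_power F 2)" by (rule has_q_expansion_refine[OF N _ F(1)]) simp
  have r2: "fls_over \<rat> (fls_compose_power F 2)" using F(2) by (intro fls_over_compose_power) (auto simp: fls_over_def)
  have "\<exists>c e. c \<noteq> 0 \<and> e \<in> siegel_exponents N \<and> (\<forall>\<tau>. Im \<tau> > 0 \<longrightarrow> f \<tau> = c * siegel_prod N e \<tau>)"
  proof (cases "N > 1")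
    case True
    show ?thesis
    proof (rule unit_product[OF True hm nz q2 r2])
      fix c and e :: "nat \<Rightarrow> int"
      assume "c \<noteq> 0" "\<And>\<tau>. Im \<tau> > 0 \<Longrightarrow> f \<tau> = c * (\<Prod>k=1..N div 2. sg N (int k) 0 \<tau> powi e k)"
        "12 dvd (\<Sum>k=1..N div 2. e k)" "int (gcd N 2 * N) dvd (\<Sum>k=1..N div 2. int k ^ 2 * e k)"
      thus ?thesis unfolding siegel_prod_def siegel_exponents_def by blast
    qed
  next
    case False
    hence N1: "N = 1" using N by simp
    obtain c where c: "\<And>\<tau>. Im \<tau> > 0 \<Longrightarrow> f \<tau> = c" using weak_modular_level_one[OF hm[unfolded N1] nz] by blast
    have "c \<noteq> 0" using c[of \<i>] nz[of \<i>] by simp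
    thus ?thesis using c by (intro exI[of _ c] exI[of _ "\<lambda>_. 0"]) (auto simp: siegel_prod_0 siegel_exponents_def)
  qed
  then obtain c e where ce: "c \<noteq> 0" "e \<in> siegel_exponents N" "\<And>\<tau>. Im \<tau> > 0 \<Longrightarrow> f \<tau> = c * siegel_prod N e \<tau>" by blast
  obtain t H where H: "has_q_expansion N (siegel_prod N e) H" "fls_over \<rat> H" "fls_nth H t = 1" using siegel_prod_q_expansion_rat[OF N ce(2)] by blast
  have "has_q_expansion N f (fls_const c * H)"
    by (rule has_q_expansion_cong'[OF _ has_q_expansion_mult[OF N has_q_expansion_const[OF N] H(1)]]) (simp add: ce(3))
  hence "F = fls_const c * H" using F(1) has_q_expansion_unique[OF N] by blast
  hence "fls_nth F t = c" using H(3) by simp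
  hence "c \<in> \<rat>" using F(2)[of t] by simp
  then obtain r where r: "c = of_rat r" by (rule Rats_cases)
  have "f = sunit N r e"
  proof
    fix \<tau> show "f \<tau> = sunit N r e \<tau>"
      using ce(3) mf(1) by (cases "Im \<tau> > 0") (auto simp: sunit_def r extensional_def)
  qed
  thus ?thesis using that[of r e] ce r by auto
qed

lemma siegel_products_eq: "N > 0 \<Longrightarrow> siegel_products N = sunit N 1 ` siegel_exponents N"
proof -
  assume N: "N > 0"
  have "siegel_function (of_nat k / of_nat N, 0) \<tau> = sg N (int k) 0 \<tau>" if "Im \<tau> > 0" "k \<in> {1..N div 2}" for k \<tau>
  proof -
    have r: "(of_nat k / of_nat N, 0 :: rat) = (of_nat k / of_nat N, 0)" ..
    interpret upper_lattice \<tau> by unfold_locales (rule that)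
    show ?thesis using siegel_function_eq[of "of_nat k / of_nat N" 0] by (simp add: sg_def of_rat_divide)
  qed
  hence "(\<lambda>\<tau>\<in>upper_half_plane. \<Prod>k=1..N div 2. siegel_function (of_nat k / of_nat N, 0) \<tau> powi e k) = sunit N 1 e" for e
    unfolding sunit_def siegel_prod_def by (intro restrict_ext) simp
  thus ?thesis unfolding siegel_products_def siegel_exponents_def by auto
qed

section \<open>The group structure\<close>

lemma sunit_mult: "(\<lambda>\<tau>\<in>upper_half_plane. sunit N c e \<tau> * sunit N c' e' \<tau>) = sunit N (c * c') (\<lambda>k. e k + e' k)"
  unfolding sunit_def by (intro restrict_ext) (simp add: siegel_prod_add of_rat_mult)

lemma sunit_one: "(\<lambda>\<tau>\<in>upper_half_plane. 1) = sunit N 1 (\<lambda>_. 0)"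
  unfolding sunit_def by (simp add: siegel_prod_0)

lemma sunit_eqD:
  assumes "N > 0" "e \<in> siegel_exponents N" "e' \<in> siegel_exponents N" "c \<noteq> 0" "sunit N c e = sunit N c' e'"
  shows "c = c'" "\<And>k. k \<in> {1..N div 2} \<Longrightarrow> e k = e' k"
proof -
  have eq: "of_rat c * siegel_prod N e \<tau> = of_rat c' * siegel_prod N e' \<tau>" if "Im \<tau> > 0" for \<tau>
    using fun_cong[OF assms(5), of \<tau>] that by (simp add: sunit_def)
  have c: "(of_rat c :: complex) \<noteq> 0" using assms(4) by simp
  show "c = c'" using siegel_prod_unique(1)[OF assms(1-3) c eq] by simp
  show "\<And>k. k \<in> {1..N div 2} \<Longrightarrow> e k = e' k" by (rule siegel_prod_unique(2)[OF assms(1-3) c eq])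
qed

lemma sunit_cong: "(\<And>k. k \<in> {1..N div 2} \<Longrightarrow> e k = e' k) \<Longrightarrow> sunit N c e = sunit N c e'"
  unfolding sunit_def siegel_prod_def by (intro restrict_ext) simp

lemma siegel_exponents_0: "(\<lambda>_. 0) \<in> siegel_exponents N" by (simp add: siegel_exponents_def)
lemma siegel_exponents_add: "e \<in> siegel_exponents N \<Longrightarrow> e' \<in> siegel_exponents N \<Longrightarrow> (\<lambda>k. e k + e' k) \<in> siegel_exponents N"
  by (simp add: siegel_exponents_def sum.distrib distrib_left dvd_add)
lemma siegel_exponents_diff: "e \<in> siegel_exponents N \<Longrightarrow> e' \<in> siegel_exponents N \<Longrightarrow> (\<lambda>k. e k - e' k) \<in> siegel_exponents N"
  by (simp add: siegel_exponents_def sum_subtractf right_diff_distrib dvd_diff)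
lemma siegel_exponents_uminus: "e \<in> siegel_exponents N \<Longrightarrow> (\<lambda>k. - e k) \<in> siegel_exponents N"
  using siegel_exponents_diff[OF siegel_exponents_0, of e] by simp

lemma modular_units_carrier: "N > 0 \<Longrightarrow> f \<in> carrier (modular_units N) \<longleftrightarrow> (\<exists>c e. c \<noteq> 0 \<and> e \<in> siegel_exponents N \<and> f = sunit N c e)"
  using sunit_in_modular_units modular_unit_is_sunit by metis

lemma modular_units_ops:
  "f \<otimes>\<^bsub>modular_units N\<^esub> g = (\<lambda>\<tau>\<in>upper_half_plane. f \<tau> * g \<tau>)" "\<one>\<^bsub>modular_units N\<^esub> = (\<lambda>\<tau>\<in>upper_half_plane. 1)"
  by (simp_all add: modular_units_def)

lemma comm_group_modular_units: assumes N: "N > 0" shows "comm_group (modular_units N)"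
proof (rule comm_groupI)
  fix x y z assume xyz: "x \<in> carrier (modular_units N)" "y \<in> carrier (modular_units N)"
  from xyz obtain c e c' e' where x: "c \<noteq> 0" "e \<in> siegel_exponents N" "x = sunit N c e" and y: "c' \<noteq> 0" "e' \<in> siegel_exponents N" "y = sunit N c' e'"
    unfolding modular_units_carrier[OF N] by blast
  show "x \<otimes>\<^bsub>modular_units N\<^esub> y \<in> carrier (modular_units N)"
    unfolding modular_units_carrier[OF N] modular_units_ops x(3) y(3) sunit_mult
    by (intro exI[of _ "c * c'"] exI[of _ "\<lambda>k. e k + e' k"]) (use x y siegel_exponents_add in auto)
  show "x \<otimes>\<^bsub>modular_units N\<^esub> y = y \<otimes>\<^bsub>modular_units N\<^esub> x" by (simp add: modular_units_ops mult.commute)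
  show "\<one>\<^bsub>modular_units N\<^esub> \<otimes>\<^bsub>modular_units N\<^esub> x = x"
    unfolding modular_units_ops x(3) by (subst sunit_one[of N], subst sunit_mult) simp
  have "sunit N (inverse c) (\<lambda>k. - e k) \<otimes>\<^bsub>modular_units N\<^esub> x = \<one>\<^bsub>modular_units N\<^esub>"
    unfolding modular_units_ops x(3) sunit_mult sunit_one[of N] using x(1) by simp
  moreover have "sunit N (inverse c) (\<lambda>k. - e k) \<in> carrier (modular_units N)"
    by (rule sunit_in_modular_units[OF N _ siegel_exponents_uminus[OF x(2)]]) (use x in simp)
  ultimately show "\<exists>y\<in>carrier (modular_units N). y \<otimes>\<^bsub>modular_units N\<^esub> x = \<one>\<^bsub>modular_units N\<^esub>" by blast
next
  show "\<one>\<^bsub>modular_units N\<^esub> \<in> carrier (modular_units N)"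
    unfolding modular_units_ops sunit_one[of N] by (rule sunit_in_modular_units[OF N _ siegel_exponents_0]) simp
qed (auto simp: modular_units_ops fun_eq_iff restrict_def mult.assoc)

lemma subgroup_siegel_products: assumes N: "N > 0" shows "subgroup (siegel_products N) (modular_units N)"
proof -
  interpret comm_group "modular_units N" by (rule comm_group_modular_units[OF N])
  show ?thesis unfolding siegel_products_eq[OF N]
  proof (rule subgroupI)
    show "sunit N 1 ` siegel_exponents N \<subseteq> carrier (modular_units N)" using sunit_in_modular_units[OF N] by auto
    show "sunit N 1 ` siegel_exponents N \<noteq> {}" using siegel_exponents_0 by blast
  next
    fix a assume "a \<in> sunit N 1 ` siegel_exponents N"
    then obtain e where e: "e \<in> siegel_exponents N" "a = sunit N 1 e" by blast
    have "sunit N 1 (\<lambda>k. - e k) \<otimes>\<^bsub>modular_units N\<^esub> a = \<one>\<^bsub>modular_units N\<^esub>"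
      unfolding modular_units_ops e(2) sunit_mult sunit_one[of N] by simp
    hence "inv\<^bsub>modular_units N\<^esub> a = sunit N 1 (\<lambda>k. - e k)"
      by (rule inv_equality) (use e siegel_exponents_uminus sunit_in_modular_units[OF N] in auto)
    thus "inv\<^bsub>modular_units N\<^esub> a \<in> sunit N 1 ` siegel_exponents N" using siegel_exponents_uminus[OF e(1)] by blast
  next
    fix a b assume "a \<in> sunit N 1 ` siegel_exponents N" "b \<in> sunit N 1 ` siegel_exponents N"
    then obtain e e' where "e \<in> siegel_exponents N" "a = sunit N 1 e" "e' \<in> siegel_exponents N" "b = sunit N 1 e'" by blast
    thus "a \<otimes>\<^bsub>modular_units N\<^esub> b \<in> sunit N 1 ` siegel_exponents N" by (auto simp: modular_units_ops sunit_mult intro!: imageI siegel_exponents_add)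
  qed
qed

lemma modular_units_product_iso:
  assumes N: "N > 0"
  shows "(\<lambda>(c, s). \<lambda>\<tau>\<in>upper_half_plane. of_rat c * s \<tau>)
           \<in> iso (rat_units \<times>\<times> (modular_units N)\<lparr>carrier := siegel_products N\<rparr>) (modular_units N)"
proof -
  let ?h = "\<lambda>(c, s). \<lambda>\<tau>\<in>upper_half_plane. of_rat c * s \<tau>"
  have h: "?h (c, sunit N 1 e) = sunit N c e" for c e
    by (simp add: sunit_def restrict_def fun_eq_iff)
  have car: "carrier (rat_units \<times>\<times> (modular_units N)\<lparr>carrier := siegel_products N\<rparr>) = {c. c \<noteq> 0} \<times> sunit N 1 ` siegel_exponents N"
    by (simp add: rat_units_def siegel_products_eq[OF N])
  show ?thesis
    unfolding iso_def bij_betw_def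
  proof (intro CollectI conjI homI inj_onI)
    fix x assume "x \<in> carrier (rat_units \<times>\<times> (modular_units N)\<lparr>carrier := siegel_products N\<rparr>)"
    then obtain c e where "c \<noteq> 0" "e \<in> siegel_exponents N" "x = (c, sunit N 1 e)" unfolding car by blast
    thus "?h x \<in> carrier (modular_units N)" using sunit_in_modular_units[OF N] h by simp
  next
    fix x y assume "x \<in> carrier (rat_units \<times>\<times> (modular_units N)\<lparr>carrier := siegel_products N\<rparr>)"
      "y \<in> carrier (rat_units \<times>\<times> (modular_units N)\<lparr>carrier := siegel_products N\<rparr>)"
    then obtain c e c' e' where x: "c \<noteq> 0" "e \<in> siegel_exponents N" "x = (c, sunit N 1 e)" and y: "c' \<noteq> 0" "e' \<in> siegel_exponents N" "y = (c', sunit N 1 e')" unfolding car by blast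
    have "x \<otimes>\<^bsub>rat_units \<times>\<times> (modular_units N)\<lparr>carrier := siegel_products N\<rparr>\<^esub> y = (c * c', sunit N 1 (\<lambda>k. e k + e' k))"
      unfolding x(3) y(3) mult_DirProd by (simp add: rat_units_def modular_units_ops sunit_mult)
    thus "?h (x \<otimes>\<^bsub>rat_units \<times>\<times> (modular_units N)\<lparr>carrier := siegel_products N\<rparr>\<^esub> y) = ?h x \<otimes>\<^bsub>modular_units N\<^esub> ?h y"
      by (simp only: h x(3) y(3) modular_units_ops sunit_mult)
    assume "?h x = ?h y"
    hence eq: "sunit N c e = sunit N c' e'" by (simp only: h x(3) y(3))
    show "x = y" using sunit_eqD[OF N x(2) y(2) x(1) eq] sunit_cong[of N e e' 1] by (simp add: x(3) y(3))
  next
    show "?h ` carrier (rat_units \<times>\<times> (modular_units N)\<lparr>carrier := siegel_products N\<rparr>) = carrier (modular_units N)"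
    proof (intro equalityI subsetI)
      fix f assume "f \<in> ?h ` carrier (rat_units \<times>\<times> (modular_units N)\<lparr>carrier := siegel_products N\<rparr>)"
      then obtain c e where "c \<noteq> 0" "e \<in> siegel_exponents N" "f = ?h (c, sunit N 1 e)" unfolding car by blast
      thus "f \<in> carrier (modular_units N)" using sunit_in_modular_units[OF N] h by simp
    next
      fix f assume "f \<in> carrier (modular_units N)"
      then obtain c e where ce: "c \<noteq> 0" "e \<in> siegel_exponents N" "f = sunit N c e" unfolding modular_units_carrier[OF N] by blast
      show "f \<in> ?h ` carrier (rat_units \<times>\<times> (modular_units N)\<lparr>carrier := siegel_products N\<rparr>)"
        unfolding car
      proof (rule image_eqI)
        show "f = ?h (c, sunit N 1 e)" unfolding h by (rule ce(3))
      qed (use ce in blast)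
    qed
  qed
qed

text \<open>The usual proof that a subgroup of finite index in \<int>^n is free of rank n. The last
  coordinates of L form an ideal, nonzero because of D, whose generator g is attained by a vector
  \<open>b0\<close>; the vectors with last coordinate 0 are handled by induction.\<close>

lemma triangular_basis:
  fixes L :: "(nat \<Rightarrow> int) set"
  assumes "(\<lambda>_. 0) \<in> L" "\<And>e e'. e \<in> L \<Longrightarrow> e' \<in> L \<Longrightarrow> (\<lambda>k. e k - e' k) \<in> L" "D > 0"
    "\<And>j. j \<in> {1..n} \<Longrightarrow> (\<lambda>k. if k = j then D else 0) \<in> L" "\<And>e k. e \<in> L \<Longrightarrow> k \<notin> {1..n} \<Longrightarrow> e k = 0"
  shows "\<exists>b. (\<forall>i\<in>{1..n}. b i \<in> L) \<and> (\<forall>e\<in>L. \<exists>c. \<forall>k. e k = (\<Sum>i=1..n. c i * b i k)) \<and>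
     (\<forall>c. (\<forall>k. (\<Sum>i=1..n. c i * b i k) = 0) \<longrightarrow> (\<forall>i\<in>{1..n}. c i = (0::int)))"
  using assms
proof (induction n arbitrary: L)
  case 0
  have "e k = 0" if "e \<in> L" for e k using 0(5)[OF that] by simp
  thus ?case by auto
next
  case (Suc n)
  note L = Suc.prems
  have neg: "(\<lambda>k. - e k) \<in> L" if "e \<in> L" for e using L(2)[OF L(1) that] by simp
  have add: "(\<lambda>k. e k + e' k) \<in> L" if "e \<in> L" "e' \<in> L" for e e' using L(2)[OF that(1) neg[OF that(2)]] by simp
  have mult: "(\<lambda>k. z * e k) \<in> L" if "e \<in> L" for e z
  proof (induction z rule: int_induct[of _ 0])
    case (step1 i) thus ?case using add[OF step1(2) that] by (simp add: distrib_right)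
  next
    case (step2 i) thus ?case using L(2)[OF step2(2) that] by (simp add: left_diff_distrib)
  qed (use L(1) in simp)
  define P where "P g \<longleftrightarrow> g > 0 \<and> (\<exists>e\<in>L. e (Suc n) = int g)" for g
  have "P (nat D)" unfolding P_def using L(3) L(4)[of "Suc n"] by (auto intro!: bexI[of _ "\<lambda>k. if k = Suc n then D else 0"])
  define g where "g = (LEAST g. P g)"
  have "P g" unfolding g_def by (rule LeastI) fact
  then obtain b0 where g: "g > 0" and b0: "b0 \<in> L" "b0 (Suc n) = int g" by (auto simp: P_def)
  have gmin: "g \<le> g'" if "P g'" for g' unfolding g_def by (rule Least_le) fact
  have dvd: "int g dvd e (Suc n)" if e: "e \<in> L" for e
  proof (rule ccontr)
    assume "\<not> int g dvd e (Suc n)"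
    hence m: "e (Suc n) mod int g > 0" using g by (metis dvd_eq_mod_eq_0 less_le pos_mod_sign of_nat_0_less_iff)
    have "(\<lambda>k. e k - (e (Suc n) div int g) * b0 k) \<in> L" by (intro L(2) e mult b0)
    hence "P (nat (e (Suc n) mod int g))" unfolding P_def using m
      by (auto intro!: bexI[of _ "\<lambda>k. e k - (e (Suc n) div int g) * b0 k"] simp: b0 minus_div_mult_eq_mod)
    from gmin[OF this] show False using m g pos_mod_bound[of "int g" "e (Suc n)"] by linarith
  qed
  define L' where "L' = {e \<in> L. e (Suc n) = 0}"
  have "\<exists>b. (\<forall>i\<in>{1..n}. b i \<in> L') \<and> (\<forall>e\<in>L'. \<exists>c. \<forall>k. e k = (\<Sum>i=1..n. c i * b i k)) \<and>
     (\<forall>c. (\<forall>k. (\<Sum>i=1..n. c i * b i k) = 0) \<longrightarrow> (\<forall>i\<in>{1..n}. c i = 0))"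
  proof (rule Suc.IH)
    show "e k = 0" if "e \<in> L'" "k \<notin> {1..n}" for e k
      using that L(5)[of e k] by (cases "k = Suc n") (auto simp: L'_def)
  qed (use L in \<open>auto simp: L'_def\<close>)
  then obtain b where b': "\<forall>i\<in>{1..n}. b i \<in> L'" "\<forall>e\<in>L'. \<exists>c. \<forall>k. e k = (\<Sum>i=1..n. c i * b i k)"
    "\<forall>c. (\<forall>k. (\<Sum>i=1..n. c i * b i k) = 0) \<longrightarrow> (\<forall>i\<in>{1..n}. c i = 0)" by (elim exE conjE) (rule that)
  note b = bspec[OF b'(1)] bspec[OF b'(2)] mp[OF spec[OF b'(3)]]
  define bs where "bs = b(Suc n := b0)"
  have sum: "(\<Sum>i=1..Suc n. c i * bs i k) = (\<Sum>i=1..n. c i * b i k) + c (Suc n) * b0 k" for c k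
    by (simp add: bs_def)
  show ?case
  proof (intro exI[of _ bs] conjI ballI allI impI)
    show "bs i \<in> L" if "i \<in> {1..Suc n}" for i using b(1)[of i] b0 that by (auto simp: bs_def L'_def)
  next
    fix e assume e: "e \<in> L"
    define q where "q = e (Suc n) div int g"
    have "(\<lambda>k. e k - q * b0 k) \<in> L'" unfolding L'_def using dvd[OF e] by (auto intro!: L(2) e mult b0 simp: b0 q_def)
    then obtain c where c: "\<And>k. e k - q * b0 k = (\<Sum>i=1..n. c i * b i k)" using b(2) by blast
    have "e k = (\<Sum>i=1..Suc n. (c(Suc n := q)) i * bs i k)" for k
    proof -
      have "(\<Sum>i=1..n. (c(Suc n := q)) i * b i k) = (\<Sum>i=1..n. c i * b i k)" by (intro sum.cong) auto
      thus ?thesis unfolding sum using c[of k] by simp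
    qed
    thus "\<exists>c. \<forall>k. e k = (\<Sum>i=1..Suc n. c i * bs i k)" by blast
  next
    fix c i assume c: "\<forall>k. (\<Sum>i=1..Suc n. c i * bs i k) = 0" and i: "i \<in> {1..Suc n}"
    have "(\<Sum>i=1..n. c i * b i (Suc n)) = 0" by (intro sum.neutral) (use b(1) in \<open>auto simp: L'_def\<close>)
    hence "c (Suc n) = 0" using c[rule_format, of "Suc n"] g unfolding sum by (simp add: b0)
    moreover have "\<forall>i\<in>{1..n}. c i = 0" by (rule b(3)) (use c[unfolded sum] \<open>c (Suc n) = 0\<close> in simp)
    ultimately show "c i = 0" using i by (cases "i = Suc n") auto
  qed
qed

lemma siegel_products_free:
  assumes N: "N > 0"
  shows "free_Abelian_group {1..N div 2} \<cong> (modular_units N)\<lparr>carrier := siegel_products N\<rparr>"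
proof -
  define n where "n = N div 2"
  \<comment> \<open>Values of the exponents outside 1..n leave the product unchanged; fixing them to
    be 0 makes the exponent function unique.\<close>
  define L where "L = {e \<in> siegel_exponents N. \<forall>k. k \<notin> {1..n} \<longrightarrow> e k = 0}"
  have "\<exists>b. (\<forall>i\<in>{1..n}. b i \<in> L) \<and> (\<forall>e\<in>L. \<exists>c. \<forall>k. e k = (\<Sum>i=1..n. c i * b i k)) \<and>
     (\<forall>c. (\<forall>k. (\<Sum>i=1..n. c i * b i k) = 0) \<longrightarrow> (\<forall>i\<in>{1..n}. c i = (0::int)))"
  \<comment> \<open>This multiple of each unit vector satisfies both congruences, so L has full rank
    n.\<close>
  proof (rule triangular_basis[of L "12 * int (gcd N 2 * N)"])
    fix j assume j: "j \<in> {1..n}"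
    have "(\<Sum>k=1..n. f k * (if k = j then D else 0)) = f j * D" for f :: "nat \<Rightarrow> int" and D
      using j by (subst sum.remove[of _ j]) (auto intro!: sum.neutral)
    from this[of "\<lambda>_. 1"] this[of "\<lambda>k. int k ^ 2"]
    show "(\<lambda>k. if k = j then 12 * int (gcd N 2 * N) else 0) \<in> L" using j by (simp add: L_def siegel_exponents_def n_def)
  qed (use N siegel_exponents_0 siegel_exponents_diff in \<open>auto simp: L_def\<close>)
  then obtain b :: "nat \<Rightarrow> nat \<Rightarrow> int" where b': "\<forall>i\<in>{1..n}. b i \<in> L" "\<forall>e\<in>L. \<exists>c. \<forall>k. e k = (\<Sum>i=1..n. c i * b i k)"
    "\<forall>c. (\<forall>k. (\<Sum>i=1..n. c i * b i k) = 0) \<longrightarrow> (\<forall>i\<in>{1..n}. c i = 0)" by (elim exE conjE) (rule that)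
  note b = bspec[OF b'(1)] bspec[OF b'(2)] mp[OF spec[OF b'(3)]]
  define v where "v x k = (\<Sum>i=1..n. Poly_Mapping.lookup x i * b i k)" for x :: "nat \<Rightarrow>\<^sub>0 int" and k
  have vL: "v x \<in> siegel_exponents N" for x
  proof -
    have m: "(\<lambda>k. z * e k) \<in> siegel_exponents N" if "e \<in> siegel_exponents N" for e z
      using that by (auto simp: siegel_exponents_def mult.left_commute[of _ z] sum_distrib_left[symmetric])
    have "(\<lambda>k. \<Sum>i\<in>I. Poly_Mapping.lookup x i * b i k) \<in> siegel_exponents N" if "finite I" "I \<subseteq> {1..n}" for I
      using that
    proof (induction I rule: finite_induct)
      case (insert i I)
      have "b i \<in> siegel_exponents N" using b(1)[of i] insert by (simp add: L_def)
      thus ?case using insert siegel_exponents_add[OF m[of "b i" "Poly_Mapping.lookup x i"]] by simp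
    qed (simp add: siegel_exponents_0)
    thus ?thesis unfolding v_def[abs_def] by simp
  qed
  let ?G = "free_Abelian_group {1..n}" and ?H = "(modular_units N)\<lparr>carrier := siegel_products N\<rparr>"
  have "(\<lambda>x. sunit N 1 (v x)) \<in> iso ?G ?H"
    unfolding iso_def bij_betw_def
  proof (intro CollectI conjI homI inj_onI)
    fix x assume "x \<in> carrier ?G"
    show "sunit N 1 (v x) \<in> carrier ?H" using vL by (simp add: siegel_products_eq[OF N])
  next
    fix x y assume xy: "x \<in> carrier ?G" "y \<in> carrier ?G"
    have "v (x + y) = (\<lambda>k. v x k + v y k)" by (simp add: v_def[abs_def] lookup_add distrib_right sum.distrib)
    thus "sunit N 1 (v (x \<otimes>\<^bsub>?G\<^esub> y)) = sunit N 1 (v x) \<otimes>\<^bsub>?H\<^esub> sunit N 1 (v y)"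
      by (simp add: free_Abelian_group_def modular_units_ops sunit_mult)
    assume eq: "sunit N 1 (v x) = sunit N 1 (v y)"
    have on: "v x k = v y k" if "k \<in> {1..n}" for k
      using sunit_eqD(2)[OF N vL vL _ eq, of k] that by (simp add: n_def)
    have off: "v z k = 0" if "k \<notin> {1..n}" for z k
      unfolding v_def by (intro sum.neutral) (use b(1) that in \<open>auto simp: L_def\<close>)
    have "(\<Sum>i=1..n. (Poly_Mapping.lookup x i - Poly_Mapping.lookup y i) * b i k) = 0" for k
      using on[of k] off[of k x] off[of k y] unfolding left_diff_distrib sum_subtractf v_def by (cases "k \<in> {1..n}") auto
    hence "\<forall>i\<in>{1..n}. Poly_Mapping.lookup x i - Poly_Mapping.lookup y i = 0" by (intro b(3)) simp
    moreover have "Poly_Mapping.lookup z i = 0" if "z \<in> carrier ?G" "i \<notin> {1..n}" for z i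
      using that by (auto simp: in_keys_iff)
    ultimately show "x = y" using xy by (intro poly_mapping_eqI) (metis eq_iff_diff_eq_0)
  next
    show "(\<lambda>x. sunit N 1 (v x)) ` carrier ?G = carrier ?H"
    proof (intro equalityI subsetI)
      fix f assume "f \<in> (\<lambda>x. sunit N 1 (v x)) ` carrier ?G"
      thus "f \<in> carrier ?H" using vL by (auto simp: siegel_products_eq[OF N])
    next
      fix f assume "f \<in> carrier ?H"
      then obtain e where e: "e \<in> siegel_exponents N" "f = sunit N 1 e" by (auto simp: siegel_products_eq[OF N])
      define e' where "e' k = (if k \<in> {1..n} then e k else 0)" for k
      have "(\<Sum>k=1..n. f k * e' k) = (\<Sum>k=1..n. f k * e k)" for f by (intro sum.cong) (auto simp: e'_def)
      from this[of "\<lambda>_. 1"] this[of "\<lambda>k. int k ^ 2"]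
      have "e' \<in> L" using e(1) by (simp add: L_def siegel_exponents_def n_def[symmetric]) (simp add: e'_def)
      then obtain c where c: "\<And>k. e' k = (\<Sum>i=1..n. c i * b i k)" using b(2) by blast
      define x where "x = Abs_poly_mapping (\<lambda>i. if i \<in> {1..n} then c i else 0)"
      have "finite {i. (if i \<in> {1..n} then c i else 0) \<noteq> 0}" by (rule finite_subset[of _ "{1..n}"]) auto
      hence x: "Poly_Mapping.lookup x = (\<lambda>i. if i \<in> {1..n} then c i else 0)" unfolding x_def by (rule lookup_Abs_poly_mapping)
      have "x \<in> carrier ?G" by (auto simp: in_keys_iff x split: if_splits)
      moreover have "sunit N 1 (v x) = f" unfolding e(2)
      proof (rule sunit_cong)
        fix k assume "k \<in> {1..N div 2}"
        hence "e' k = e k" by (simp add: e'_def n_def)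
        thus "v x k = e k" using c[of k] by (simp add: v_def x)
      qed
      ultimately show "f \<in> (\<lambda>x. sunit N 1 (v x)) ` carrier ?G" by blast
    qed
  qed
  thus ?thesis unfolding n_def is_iso_def by blast
qed

theorem theorem1p3:
  fixes N :: nat
  assumes "N \<ge> 1"
  shows "comm_group (modular_units N) \<and>
         subgroup (siegel_products N) (modular_units N) \<and>
         (modular_units N)\<lparr>carrier := siegel_products N\<rparr> \<cong> free_Abelian_group {1..N div 2} \<and>
         (\<lambda>(c, s). \<lambda>\<tau>\<in>upper_half_plane. of_rat c * s \<tau>)
           \<in> iso (rat_units \<times>\<times> (modular_units N)\<lparr>carrier := siegel_products N\<rparr>) (modular_units N)"
proof -
  have N: "N > 0" using assms by simp
  show ?thesis
    using comm_group_modular_units[OF N] subgroup_siegel_products[OF N] modular_units_product_iso[OF N]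
      group.iso_sym[OF group_free_Abelian_group siegel_products_free[OF N]] by blast
qed

end
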